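(* Let $n\in\mathbb N$, $1<p_1,p_2<\infty$, $\frac1p=\frac1{p_1}+\frac1{p_2}$, $1<u<\infty$ with $\frac1u+\frac1{u'}=1$, and $0<s<\infty$; let $p'$ satisfy $\frac1p+\frac1{p'}=1$. Suppose that $$\|T_m(f_1,f_2)\|_{L^p(\mathbb R^n)}\lesssim\mathcal A^u_s[m]\,\|f_1\|_{L^{p_1}(\mathbb R^n)}\|f_2\|_{L^{p_2}(\mathbb R^n)}$$ for all $m$ with $\mathcal A^u_s[m]<\infty$ and all Schwartz $f_1,f_2$. Then necessarily $$\frac sn>\max\Big\{\frac2u,\frac1p-\frac1{u'}\Big\}\quad\text{and}\quad\frac sn\ge\max\Big\{\frac12-\frac1{p'},0\Big\}+\sum_{i=1}^2\max\Big\{\frac12-\frac1{p_i},0\Big\}.$$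
   Context: For bounded $m$ on $\mathbb R^{2n}$: $T_m(f_1,f_2)(x)=\int_{(\mathbb R^n)^2}\widehat{f_1}(\xi_1)\widehat{f_2}(\xi_2)m(\xi_1,\xi_2)e^{2\pi i\langle x,\xi_1+\xi_2\rangle}d\xi_1d\xi_2$, $\widehat f(\xi)=\int f(x)e^{-2\pi i\langle x,\xi\rangle}dx$. $\Theta$ is a fixed Schwartz function on $\mathbb R^{2n}$ with $\widehat\Theta$ supported in $\{1/2\le|\vec\xi|\le2\}$; $\|F\|_{L^u_s(\mathbb R^{2n})}=\|[(1+4\pi^2|\cdot|^2)^{s/2}\widehat F]^\vee\|_{L^u}$; $\mathcal A^u_s[m]=\sup_{k\in\mathbb Z}\|m(2^k\cdot)\widehat\Theta\|_{L^u_s(\mathbb R^{2n})}$. *)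

theory Defs
  imports "HOL-Analysis.Analysis"
begin

definition fourier :: "('a::euclidean_space \<Rightarrow> complex) \<Rightarrow> 'a \<Rightarrow> complex" where
  "fourier f \<xi> = (LINT x|lborel. f x * cis (- 2 * pi * (x \<bullet> \<xi>)))"

fun dderiv :: "'a::euclidean_space list \<Rightarrow> ('a \<Rightarrow> complex) \<Rightarrow> 'a \<Rightarrow> complex" where
  "dderiv [] f = f"
| "dderiv (v # vs) f = (\<lambda>x. frechet_derivative (dderiv vs f) (at x) v)"

definition schwartz :: "('a::euclidean_space \<Rightarrow> complex) \<Rightarrow> bool" where
  "schwartz f \<longleftrightarrow>
     (\<forall>vs x. dderiv vs f differentiable (at x)) \<and>
     (\<forall>vs (N::nat). \<exists>C. \<forall>x. (1 + norm x) ^ N * norm (dderiv vs f x) \<le> C)"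

definition Lp_norm :: "real \<Rightarrow> ('a::euclidean_space \<Rightarrow> complex) \<Rightarrow> ennreal" where
  "Lp_norm p f =
     (let I = (\<integral>\<^sup>+ x. ennreal (norm (f x) powr p) \<partial>lborel)
      in if I = \<infinity> then \<infinity> else ennreal (enn2real I powr (1 / p)))"

definition in_Lp :: "real \<Rightarrow> ('a::euclidean_space \<Rightarrow> complex) \<Rightarrow> bool" where
  "in_Lp p f \<longleftrightarrow> f \<in> borel_measurable lborel \<and> Lp_norm p f < \<infinity>"

(* Bessel potential (Sobolev) norm ||F||_{L^u_s} = ||[(1+4\<pi>^2|.|^2)^{s/2} \<hat>F]^\<or>||_{L^u},
   for integrable F; the inverse Fourier transform is taken in the sense of tempered
   distributions: G is the function with \<hat>G = (1+4\<pi>^2|.|^2)^{s/2}\<hat>F, i.e.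
   \<integral> G \<hat>\<phi> = \<integral> (1+4\<pi>^2|\<xi>|^2)^{s/2} \<hat>F(\<xi>) \<phi>(\<xi>) d\<xi> for all Schwartz \<phi>.
   If no such G in L^u exists, the norm is \<infinity>. *)
definition bessel_norm :: "real \<Rightarrow> real \<Rightarrow> ('a::euclidean_space \<Rightarrow> complex) \<Rightarrow> ennreal" where
  "bessel_norm u s F =
     (if integrable lborel F then
        (INF G \<in> {G. in_Lp u G \<and>
                     (\<forall>\<phi>. schwartz \<phi> \<longrightarrow>
                        (LINT x|lborel. G x * fourier \<phi> x) =
                        (LINT \<xi>|lborel. complex_of_real ((1 + 4 * pi\<^sup>2 * (norm \<xi>)\<^sup>2) powr (s / 2))
                                          * fourier F \<xi> * \<phi> \<xi>))}.
           Lp_norm u G)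
      else \<infinity>)"

definition Tm :: "((real^'n) \<times> (real^'n) \<Rightarrow> complex) \<Rightarrow> ((real^'n) \<Rightarrow> complex) \<Rightarrow> ((real^'n) \<Rightarrow> complex)
                   \<Rightarrow> (real^'n) \<Rightarrow> complex" where
  "Tm m f1 f2 x = (LINT \<xi>|lborel. fourier f1 (fst \<xi>) * fourier f2 (snd \<xi>) * m \<xi>
                      * cis (2 * pi * (x \<bullet> (fst \<xi> + snd \<xi>))))"

definition Aus :: "((real^'n) \<times> (real^'n) \<Rightarrow> complex) \<Rightarrow> real \<Rightarrow> real
                    \<Rightarrow> ((real^'n) \<times> (real^'n) \<Rightarrow> complex) \<Rightarrow> ennreal" where
  "Aus \<Theta> u s m = (SUP k::int. bessel_norm u s (\<lambda>\<xi>. m ((2::real) powr (real_of_int k) *\<^sub>R \<xi>) * fourier \<Theta> \<xi>))"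

end

theory Submission
  imports Defs "HOL-Probability.Probability" "HOL-Complex_Analysis.Complex_Analysis"
begin

text \<open>Every multiplier \<open>F * fourier \<Theta>\<close> is admissible: multiplication by the Schwartz functions
  \<open>fourier \<Theta> (2 powr k \<xi>) * fourier \<Theta> \<xi>\<close>, only boundedly many of which do not vanish, costs at most a
  constant in the Bessel norm of \<open>F\<close>. Three choices of \<open>F\<close>, centred at a point \<open>\<zeta>\<close> with
  \<open>fourier \<Theta> \<zeta> \<noteq> 0\<close>, give the three conditions.

  First, \<open>F\<close> is a Bessel potential of a truncation of \<open>|\<xi>| powr (- 2 n / u)\<close> at radius \<open>\<epsilon>\<close>, with norm of order
  \<open>(log (1 / \<epsilon>)) powr (1 / u)\<close>. If \<open>s \<le> 2 n / u\<close>, its value at the centre is at least of order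
  \<open>log (1 / \<epsilon>)\<close>, whereas the operator bound, tested on Gaussians concentrating in frequency at \<open>\<zeta>\<close>, bounds
  this value by the norm.

  Secondly, \<open>F\<close> is singular along \<open>\<xi>\<^sub>1 + \<xi>\<^sub>2 = 0\<close> only, with a kernel decaying on the diagonal like
  \<open>|x| powr (- s - n + n / u)\<close> up to \<open>|x| = 1 / \<epsilon>\<close> and norm of order \<open>log (1 / \<epsilon>)\<close>. If the second strict
  inequality fails then \<open>p < 1\<close> by the first one, and the \<open>L\<^sup>p\<close> norm of the output is at least of order
  \<open>(log (1 / \<epsilon>)) powr (1 / p)\<close>.

  Thirdly, \<open>F\<close> is the chirp \<open>exp (\<pi> i N (c1 |\<xi>\<^sub>1|\<^sup>2 + c2 |\<xi>\<^sub>2|\<^sup>2 - c0 |\<xi>\<^sub>1 + \<xi>\<^sub>2|\<^sup>2))\<close> with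
  \<open>c0, c1, c2 \<in> {0, 1}\<close>, of norm \<open>N powr s\<close>. It cancels the opposite chirps of two Gaussian inputs and makes
  the output a Gaussian that is spread over \<open>|x| \<le> N\<close> when \<open>c0 = 1\<close>; comparing powers of \<open>N\<close> gives the sum
  condition.\<close>


section \<open>Integration on Euclidean spaces\<close>

text \<open>For fractional \<open>s\<close> there is no exact Leibniz rule, so products are treated
  on the Fourier side. A modulation by \<open>y\<close> replaces \<open>jap x\<close> by
  \<open>jap (x + y)\<close>, and everything hinges on
  \<open>(jap (x + y) / jap x) powr (s / 2)\<close> being a constant plus the transform of an
  integrable kernel whose mass is polynomial in \<open>y\<close>. For exponents below one this comes
  from the formula for \<open>r powr \<beta>\<close> as an average of
  \<open>r / (r + \<tau>)\<close>, which is explicit for quotients of quadratic polynomials; larger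
  exponents are powers. A parameter \<open>b\<close> in the denominator also covers dilations and
  the scale \<open>1 / N\<close> of the chirps. As \<open>p\<close> may be below 1, lower bounds use
  neither duality nor a triangle inequality in L^p: outputs on Gaussian inputs are computed
  pointwise, and limits are taken by Fatou. The strict inequalities are endpoint statements, so
  their tests sum \<open>N\<close> dyadic shells of equal mass; the contradictions are
  \<open>N\<close> against \<open>N powr (1 / u)\<close> with \<open>u > 1\<close>, and
  \<open>N\<close> against \<open>N powr p\<close> with \<open>p < 1\<close>.\<close>

lemma nn_integral_lborel_affine:
  fixes f :: "'a::euclidean_space \<Rightarrow> ennreal"
  assumes [measurable]: "f \<in> borel_measurable borel" and c: "c \<noteq> 0"
  shows "(\<integral>\<^sup>+x. f x \<partial>lborel) = ennreal (\<bar>c\<bar> ^ DIM('a)) * (\<integral>\<^sup>+x. f (t + c *\<^sub>R x) \<partial>lborel)"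
  by (subst lborel_affine[OF c, of t])
     (simp add: nn_integral_density nn_integral_distr nn_integral_cmult)

lemma nn_integral_lborel_translate:
  fixes f :: "'a::euclidean_space \<Rightarrow> ennreal"
  assumes [measurable]: "f \<in> borel_measurable borel"
  shows "(\<integral>\<^sup>+x. f (x + t) \<partial>lborel) = (\<integral>\<^sup>+x. f x \<partial>lborel)"
    "(\<integral>\<^sup>+x. f (x - t) \<partial>lborel) = (\<integral>\<^sup>+x. f x \<partial>lborel)"
    "(\<integral>\<^sup>+x. f (t - x) \<partial>lborel) = (\<integral>\<^sup>+x. f x \<partial>lborel)"
  using nn_integral_lborel_affine[OF assms, of 1 t] nn_integral_lborel_affine[OF assms, of 1 "-t"]
    nn_integral_lborel_affine[OF assms, of "-1" t] by (simp_all add: add.commute)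

lemma integrable_lborel_affine:
  fixes f :: "'a::euclidean_space \<Rightarrow> 'b :: {banach, second_countable_topology}"
  assumes f: "integrable lborel f" and c: "c \<noteq> 0"
  shows "integrable lborel (\<lambda>x. f (t + c *\<^sub>R x))"
proof -
  have [measurable]: "f \<in> borel_measurable borel" using f by auto
  show ?thesis
    using f c unfolding integrable_iff_bounded
    by (subst (asm) nn_integral_lborel_affine[where c=c and t=t])
       (auto simp: ennreal_mult_less_top)
qed

lemma integrable_lborel_translate:
  fixes f :: "'a::euclidean_space \<Rightarrow> 'b :: {banach, second_countable_topology}"
  assumes f: "integrable lborel f"
  shows "integrable lborel (\<lambda>x. f (x + t))" "integrable lborel (\<lambda>x. f (x - t))"
    "integrable lborel (\<lambda>x. f (t - x))"
  using integrable_lborel_affine[OF f, of 1 t] integrable_lborel_affine[OF f, of 1 "-t"]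
    integrable_lborel_affine[OF f, of "-1" t] by (simp_all add: add.commute)

lemma integral_lborel_affine:
  fixes f :: "'a::euclidean_space \<Rightarrow> 'b :: {banach, second_countable_topology}"
  assumes c: "c \<noteq> 0"
  shows "(LINT x|lborel. f x) = (\<bar>c\<bar> ^ DIM('a)) *\<^sub>R (LINT x|lborel. f (t + c *\<^sub>R x))"
proof cases
  assume f: "integrable lborel f"
  then have [measurable]: "f \<in> borel_measurable borel" by auto
  show ?thesis
    by (subst lborel_affine[OF c, of t]) (simp add: integral_density integral_distr)
next
  assume nf: "\<not> integrable lborel f"
  have "\<not> integrable lborel (\<lambda>x. f (t + c *\<^sub>R x))"
  proof
    assume "integrable lborel (\<lambda>x. f (t + c *\<^sub>R x))"
    from integrable_lborel_affine[OF this, of "1/c" "- (1/c) *\<^sub>R t"] c nf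
    show False by (simp add: algebra_simps)
  qed
  with nf show ?thesis by (simp add: not_integrable_integral_eq)
qed

lemma integral_lborel_translate:
  fixes f :: "'a::euclidean_space \<Rightarrow> 'b :: {banach, second_countable_topology}"
  shows "(LINT x|lborel. f (x + t)) = (LINT x|lborel. f x)"
    "(LINT x|lborel. f (x - t)) = (LINT x|lborel. f x)"
    "(LINT x|lborel. f (t - x)) = (LINT x|lborel. f x)"
  using integral_lborel_affine[of 1 f t] integral_lborel_affine[of 1 f "-t"]
    integral_lborel_affine[of "-1" f t] by (simp_all add: add.commute)

lemma integrable_lborel_pairI:
  fixes f :: "'a::euclidean_space \<Rightarrow> 'b::euclidean_space \<Rightarrow> complex"
  assumes [measurable]: "case_prod f \<in> borel_measurable (borel \<Otimes>\<^sub>M borel)"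
    and "(\<integral>\<^sup>+x. \<integral>\<^sup>+y. norm (f x y) \<partial>lborel \<partial>lborel) < \<infinity>"
  shows "integrable (lborel \<Otimes>\<^sub>M lborel) (case_prod f)"
proof (rule integrableI_bounded)
  show "case_prod f \<in> borel_measurable (lborel \<Otimes>\<^sub>M lborel)" by measurable
  have "(\<integral>\<^sup>+z. norm (case_prod f z) \<partial>(lborel \<Otimes>\<^sub>M lborel)) = (\<integral>\<^sup>+x. \<integral>\<^sup>+y. norm (f x y) \<partial>lborel \<partial>lborel)"
    by (subst lborel.nn_integral_fst[symmetric]) auto
  then show "(\<integral>\<^sup>+z. norm (case_prod f z) \<partial>(lborel \<Otimes>\<^sub>M lborel)) < \<infinity>" using assms(2) by simp
qed

lemma fubini_lborel:
  fixes f :: "'a::euclidean_space \<Rightarrow> 'b::euclidean_space \<Rightarrow> complex"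
  assumes m: "case_prod f \<in> borel_measurable (borel \<Otimes>\<^sub>M borel)"
    and b: "(\<integral>\<^sup>+x. \<integral>\<^sup>+y. norm (f x y) \<partial>lborel \<partial>lborel) < \<infinity>"
  shows "(LINT x|lborel. LINT y|lborel. f x y) = (LINT y|lborel. LINT x|lborel. f x y)"
    and "integrable lborel (\<lambda>x. LINT y|lborel. f x y)"
    and "integrable lborel (\<lambda>y. LINT x|lborel. f x y)"
    and "AE y in lborel. integrable lborel (\<lambda>x. f x y)"
    and "AE x in lborel. integrable lborel (\<lambda>y. f x y)"
proof -
  note i = integrable_lborel_pairI[OF m b]
  show "(LINT x|lborel. LINT y|lborel. f x y) = (LINT y|lborel. LINT x|lborel. f x y)"
    using lborel_pair.Fubini_integral[OF i] by simp
  show "integrable lborel (\<lambda>x. LINT y|lborel. f x y)" by (rule lborel_pair.integrable_fst[OF i])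
  show "integrable lborel (\<lambda>y. LINT x|lborel. f x y)" by (rule lborel_pair.integrable_snd[OF i])
  show "AE y in lborel. integrable lborel (\<lambda>x. f x y)" by (rule lborel_pair.AE_integrable_snd[OF i])
  show "AE x in lborel. integrable lborel (\<lambda>y. f x y)" by (rule lborel_pair.AE_integrable_fst[OF i])
qed

lemma lborel_prod_integral:
  fixes f :: "'a::euclidean_space \<times> 'b::euclidean_space \<Rightarrow> complex"
  assumes "integrable lborel f"
  shows "(LINT z|lborel. f z) = (LINT x|lborel. LINT y|lborel. f (x, y))"
  using assms lborel_pair.integral_fst'[of f] by (simp add: lborel_prod)

lemma nn_integral_lborel_fst:
  fixes f :: "'a::euclidean_space \<times> 'b::euclidean_space \<Rightarrow> ennreal"
  assumes "f \<in> borel_measurable borel"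
  shows "(\<integral>\<^sup>+z. f z \<partial>lborel) = (\<integral>\<^sup>+x. \<integral>\<^sup>+y. f (x, y) \<partial>lborel \<partial>lborel)"
  using assms lborel.nn_integral_fst[of f lborel] by (simp add: lborel_prod)

lemma nn_integral_lborel_swap:
  fixes f :: "'a::euclidean_space \<Rightarrow> 'b::euclidean_space \<Rightarrow> ennreal"
  assumes [measurable]: "case_prod f \<in> borel_measurable (borel \<Otimes>\<^sub>M borel)"
  shows "(\<integral>\<^sup>+x. \<integral>\<^sup>+y. f x y \<partial>lborel \<partial>lborel) = (\<integral>\<^sup>+y. \<integral>\<^sup>+x. f x y \<partial>lborel \<partial>lborel)"
  by (rule lborel_pair.Fubini'[symmetric]) simp

section \<open>Triangle, Jensen and Minkowski inequalities for integrals\<close>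

lemma norm_integral_le_nn_integral:
  fixes f :: "'a \<Rightarrow> 'b :: {banach, second_countable_topology}"
  shows "ennreal (norm (LINT x|M. f x)) \<le> (\<integral>\<^sup>+x. norm (f x) \<partial>M)"
proof cases
  assume "integrable M f" then show ?thesis by (rule integral_norm_bound_ennreal)
qed (simp add: not_integrable_integral_eq)

text \<open>Convexity of \<open>x powr u\<close>: the graph lies above its tangent at
  \<open>a\<close>. The inequality is Young's inequality for \<open>x\<close> and
  \<open>a powr (u - 1)\<close>, multiplied by \<open>u\<close>.\<close>

lemma tangent_powr:
  fixes u a x :: real
  assumes "1 < u" "0 < a" "0 \<le> x"
  shows "u * a powr (u - 1) * x \<le> x powr u + (u - 1) * a powr u"
proof -
  define q where "q = u / (u - 1)"
  have q: "1 < q" "1/u + 1/q = 1" using assms by (auto simp: q_def field_simps)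
  have "(a powr (u-1)) powr q = a powr u" using assms by (simp add: powr_powr q_def)
  then have "x * a powr (u - 1) \<le> x powr u / u + a powr u / q"
    using Youngs_inequality[of u q x "a powr (u-1)"] assms q by simp
  from mult_left_mono[OF this, of u]
  have "u * (x * a powr (u - 1)) \<le> u * (x powr u / u) + u * (a powr u / q)"
    using assms by (simp add: distrib_left)
  also have "u * (x powr u / u) = x powr u" using assms by simp
  also have "u * (a powr u / q) = (u - 1) * a powr u" using assms by (simp add: q_def)
  finally show ?thesis by (simp add: mult_ac)
qed

text \<open>Jensen's inequality, by integrating the tangent line of \<open>x powr u\<close> at the mean value.\<close>

lemma jensen_powr_integral:
  fixes f :: "'b \<Rightarrow> complex" and \<rho> g :: "'b \<Rightarrow> real"
  assumes u: "1 < u" and [measurable]: "\<rho> \<in> borel_measurable M" "g \<in> borel_measurable M"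
    and nn: "\<And>y. 0 \<le> \<rho> y" "\<And>y. 0 \<le> g y" and f: "\<And>y. norm (f y) \<le> \<rho> y * g y"
    and D: "0 \<le> D" "(\<integral>\<^sup>+y. \<rho> y \<partial>M) \<le> ennreal D"
  shows "ennreal (norm (LINT y|M. f y) powr u) \<le> ennreal (D powr (u - 1)) * (\<integral>\<^sup>+y. \<rho> y * g y powr u \<partial>M)"
proof -
  define X where "X = norm (LINT y|M. f y)"
  \<comment> \<open>For fixed \<open>a\<close> the tangent inequality is affine in \<open>g\<close>,
    so it survives integration against \<open>\<rho>\<close>; the choice of \<open>a\<close> is
    postponed until the right-hand side is known to be finite.\<close>
  have tang: "ennreal (u * a powr (u-1) * X) \<le> (\<integral>\<^sup>+y. \<rho> y * g y powr u \<partial>M) + ennreal ((u-1) * a powr u * D)"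
    if a: "0 < a" for a
  proof -
    have "ennreal (u * a powr (u-1) * X) \<le> ennreal (u * a powr (u-1)) * (\<integral>\<^sup>+y. norm (f y) \<partial>M)"
      unfolding X_def using u by (subst ennreal_mult) (auto intro!: mult_left_mono norm_integral_le_nn_integral)
    also have "\<dots> \<le> ennreal (u * a powr (u-1)) * (\<integral>\<^sup>+y. \<rho> y * g y \<partial>M)"
      by (intro mult_left_mono nn_integral_mono ennreal_leI f) auto
    also have "\<dots> = (\<integral>\<^sup>+y. ennreal (\<rho> y * (u * a powr (u-1) * g y)) \<partial>M)"
      using u nn by (subst nn_integral_cmult[symmetric]) (auto simp: ennreal_mult[symmetric] mult_ac)
    also have "\<dots> \<le> (\<integral>\<^sup>+y. ennreal (\<rho> y * g y powr u) + ennreal ((u - 1) * a powr u) * ennreal (\<rho> y) \<partial>M)"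
    proof (rule nn_integral_mono)
      fix y
      have "\<rho> y * (u * a powr (u-1) * g y) \<le> \<rho> y * (g y powr u + (u - 1) * a powr u)"
        by (intro mult_left_mono tangent_powr u a nn)
      then have "ennreal (\<rho> y * (u * a powr (u-1) * g y)) \<le> ennreal (\<rho> y * g y powr u + ((u - 1) * a powr u) * \<rho> y)"
        by (intro ennreal_leI) (simp add: distrib_left mult_ac)
      also have "\<dots> = ennreal (\<rho> y * g y powr u) + ennreal ((u - 1) * a powr u) * ennreal (\<rho> y)"
        using nn u by (subst ennreal_plus) (auto intro!: ennreal_mult)
      finally show "ennreal (\<rho> y * (u * a powr (u-1) * g y)) \<le> ennreal (\<rho> y * g y powr u) + ennreal ((u - 1) * a powr u) * ennreal (\<rho> y)" .
    qed
    also have "\<dots> = (\<integral>\<^sup>+y. \<rho> y * g y powr u \<partial>M) + ennreal ((u - 1) * a powr u) * (\<integral>\<^sup>+y. \<rho> y \<partial>M)"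
      by (simp add: nn_integral_add nn_integral_cmult)
    also have "\<dots> \<le> (\<integral>\<^sup>+y. \<rho> y * g y powr u \<partial>M) + ennreal ((u-1) * a powr u * D)"
      using u D by (subst ennreal_mult) (auto intro!: add_left_mono mult_left_mono)
    finally show ?thesis .
  qed
  show ?thesis
  proof (cases "X = 0")
    case True then show ?thesis unfolding X_def by simp
  next
    case False
    then have X: "X > 0" unfolding X_def by simp
    have D0: "D > 0"
    proof (rule ccontr)
      assume "\<not> D > 0"
      then have "(\<integral>\<^sup>+y. \<rho> y \<partial>M) = 0" using D by simp
      then have "AE y in M. \<rho> y = 0" using nn by (subst (asm) nn_integral_0_iff_AE) (auto simp: ennreal_eq_0_iff antisym)
      then have "AE y in M. f y = 0"
      proof eventually_elim
        case (elim y) then show ?case using f[of y] by simp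
      qed
      then have "(LINT y|M. f y) = 0" by (rule integral_eq_zero_AE)
      then show False using X unfolding X_def by simp
    qed
    show ?thesis
    proof (cases "(\<integral>\<^sup>+y. \<rho> y * g y powr u \<partial>M)")
      case top
      then show ?thesis using D0 by (simp add: ennreal_mult_top)
    next
      case (real J)
      \<comment> \<open>For this \<open>a\<close> the term \<open>(u - 1) * a powr u * D\<close>
        equals \<open>(u - 1) * (a powr (u - 1) * X)\<close>, so it absorbs all but one of the
        \<open>u\<close> copies on the left.\<close>
      define a where "a = X / D"
      have a: "a > 0" using X D0 by (simp add: a_def)
      from tang[OF a] real have "ennreal (u * a powr (u-1) * X) \<le> ennreal (J + (u-1) * a powr u * D)"
        using u D by (subst ennreal_plus) auto
      then have *: "u * a powr (u-1) * X \<le> J + (u-1) * a powr u * D"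
        using u D real by (subst (asm) ennreal_le_iff) auto
      have e1: "a powr u = a powr (u-1) * a" using a by (simp add: powr_diff)
      have e2: "a powr (u-1) * X = X powr u / D powr (u-1)"
        using X D0 by (simp add: a_def powr_divide powr_diff)
      have e3: "a powr u * D = a powr (u-1) * X" unfolding e1 using D0 by (simp add: a_def)
      have "u * (a powr (u-1) * X) \<le> J + (u-1) * (a powr (u-1) * X)" using * e3 by (simp add: mult.assoc)
      then have "a powr (u-1) * X \<le> J" by (simp add: algebra_simps)
      then have "X powr u \<le> D powr (u-1) * J" unfolding e2 using D0 by (simp add: field_simps)
      then show ?thesis using real unfolding X_def by (simp add: ennreal_mult[symmetric])
    qed
  qed
qed

text \<open>Minkowski's inequality for a superposition over \<open>y\<close>. Jensen's inequality is
  applied with density \<open>\<rho> y * b y\<close> to the normalised functions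
  \<open>g y \<xi> / b y\<close>, whose \<open>u\<close>-th powers have integral at most 1; Tonelli
  does the rest.\<close>

lemma minkowski_powr_integral:
  fixes F :: "'b::euclidean_space \<Rightarrow> 'a::euclidean_space \<Rightarrow> complex" and \<rho> b :: "'b \<Rightarrow> real"
    and g :: "'b \<Rightarrow> 'a \<Rightarrow> real"
  assumes u: "1 < u" and [measurable]: "\<rho> \<in> borel_measurable borel" "b \<in> borel_measurable borel"
      "case_prod g \<in> borel_measurable (borel \<Otimes>\<^sub>M borel)"
    and nn: "\<And>y. 0 \<le> \<rho> y" "\<And>y \<xi>. 0 \<le> g y \<xi>" "\<And>y. 0 < b y"
    and F: "\<And>y \<xi>. norm (F y \<xi>) \<le> \<rho> y * g y \<xi>"
    and gb: "\<And>y. (\<integral>\<^sup>+\<xi>. g y \<xi> powr u \<partial>lborel) \<le> ennreal (b y powr u)"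
    and D: "0 \<le> D" "(\<integral>\<^sup>+y. \<rho> y * b y \<partial>lborel) \<le> ennreal D"
  shows "(\<integral>\<^sup>+\<xi>. norm (LINT y|lborel. F y \<xi>) powr u \<partial>lborel) \<le> ennreal (D powr u)"
proof -
  have "(\<integral>\<^sup>+\<xi>. norm (LINT y|lborel. F y \<xi>) powr u \<partial>lborel)
     \<le> (\<integral>\<^sup>+\<xi>. ennreal (D powr (u-1)) * (\<integral>\<^sup>+y. (\<rho> y * b y) * (g y \<xi> / b y) powr u \<partial>lborel) \<partial>lborel)"
  proof (rule nn_integral_mono, rule jensen_powr_integral[OF u])
    show "norm (F y \<xi>) \<le> \<rho> y * b y * (g y \<xi> / b y)" for y \<xi> using F[of y \<xi>] nn(3)[of y] by simp
  qed (use D nn in \<open>auto intro!: mult_nonneg_nonneg divide_nonneg_pos intro: less_imp_le\<close>)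
  also have "\<dots> = ennreal (D powr (u-1)) * (\<integral>\<^sup>+\<xi>. (\<integral>\<^sup>+y. (\<rho> y * b y) * (g y \<xi> / b y) powr u \<partial>lborel) \<partial>lborel)"
    by (rule nn_integral_cmult) simp
  also have "(\<integral>\<^sup>+\<xi>. (\<integral>\<^sup>+y. (\<rho> y * b y) * (g y \<xi> / b y) powr u \<partial>lborel) \<partial>lborel)
     = (\<integral>\<^sup>+y. (\<integral>\<^sup>+\<xi>. (\<rho> y * b y) * (g y \<xi> / b y) powr u \<partial>lborel) \<partial>lborel)"
    by (rule nn_integral_lborel_swap) simp
  also have "\<dots> \<le> (\<integral>\<^sup>+y. \<rho> y * b y \<partial>lborel)"
  proof (rule nn_integral_mono)
    fix y
    have "(\<integral>\<^sup>+\<xi>. (\<rho> y * b y) * (g y \<xi> / b y) powr u \<partial>lborel)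
      = (\<integral>\<^sup>+\<xi>. ennreal (\<rho> y * b y / b y powr u) * ennreal (g y \<xi> powr u) \<partial>lborel)"
      using nn by (intro nn_integral_cong) (auto simp: ennreal_mult[symmetric] powr_divide less_imp_le)
    also have "\<dots> = ennreal (\<rho> y * b y / b y powr u) * (\<integral>\<^sup>+\<xi>. ennreal (g y \<xi> powr u) \<partial>lborel)"
      by (rule nn_integral_cmult) simp
    also have "\<dots> \<le> ennreal (\<rho> y * b y / b y powr u) * ennreal (b y powr u)"
      by (intro mult_left_mono gb) simp
    also have "\<dots> = ennreal (\<rho> y * b y)" using nn(3)[of y] nn(1)[of y] by (subst ennreal_mult[symmetric]) auto
    finally show "(\<integral>\<^sup>+\<xi>. (\<rho> y * b y) * (g y \<xi> / b y) powr u \<partial>lborel) \<le> ennreal (\<rho> y * b y)" .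
  qed
  also have "ennreal (D powr (u - 1)) * \<dots> \<le> ennreal (D powr (u-1)) * ennreal D"
    by (intro mult_left_mono D) simp
  also have "\<dots> = ennreal (D powr u)"
    using D by (cases "D = 0") (auto simp: ennreal_mult[symmetric] powr_diff)
  finally show ?thesis by (simp add: mult_left_mono)
qed

section \<open>\<open>L\<^sup>p\<close> norms\<close>

lemma Lp_norm_le_iff:
  assumes "0 < p" "0 \<le> K"
  shows "Lp_norm p f \<le> ennreal K \<longleftrightarrow> (\<integral>\<^sup>+x. norm (f x) powr p \<partial>lborel) \<le> ennreal (K powr p)"
proof (cases "(\<integral>\<^sup>+x. norm (f x) powr p \<partial>lborel)")
  case top then show ?thesis by (simp add: Lp_norm_def Let_def top_unique)
next
  case (real r)
  have "r powr (1/p) \<le> K \<longleftrightarrow> r \<le> K powr p"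
  proof
    assume "r powr (1/p) \<le> K"
    then have "(r powr (1/p)) powr p \<le> K powr p" using assms by (intro powr_mono2) auto
    then show "r \<le> K powr p" using assms real by (simp add: powr_powr)
  next
    assume "r \<le> K powr p"
    then have "r powr (1/p) \<le> (K powr p) powr (1/p)" using assms real by (intro powr_mono2) auto
    then show "r powr (1/p) \<le> K" using assms real by (simp add: powr_powr)
  qed
  then show ?thesis using real assms by (simp add: Lp_norm_def Let_def)
qed

section \<open>Fourier transforms of integrable functions\<close>

lemma borel_measurable_cis [measurable]: "cis \<in> borel_measurable borel"
  by (intro borel_measurable_continuous_onI continuous_intros)

lemma borel_measurable_fourier [measurable]:
  assumes [measurable]: "f \<in> borel_measurable borel"
  shows "fourier f \<in> borel_measurable borel"
  unfolding fourier_def[abs_def] by measurable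

lemma integrable_cis_mult:
  fixes f :: "'a \<Rightarrow> complex"
  assumes "integrable M f" and [measurable]: "g \<in> borel_measurable M"
  shows "integrable M (\<lambda>x. f x * cis (g x))"
  by (rule Bochner_Integration.integrable_bound[OF assms(1)])
     (use borel_measurable_integrable[OF assms(1)] in \<open>auto simp: norm_mult\<close>)

lemma integrable_fourier_integrand:
  "integrable lborel f \<Longrightarrow> integrable lborel (\<lambda>x. f x * cis (- 2 * pi * (x \<bullet> \<xi>)))"
  by (rule integrable_cis_mult) auto

lemma norm_fourier_le: "norm (fourier f \<xi>) \<le> (LINT x|lborel. norm (f x))"
  unfolding fourier_def
  using integral_norm_bound[of lborel "\<lambda>x. f x * cis (- 2 * pi * (x \<bullet> \<xi>))"] by (simp add: norm_mult)

lemma fourier_cmult: "fourier (\<lambda>x. c * f x) \<xi> = c * fourier f \<xi>"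
  unfolding fourier_def by (simp add: mult.assoc)

lemma fourier_add:
  assumes "integrable lborel f" "integrable lborel g"
  shows "fourier (\<lambda>x. f x + g x) \<xi> = fourier f \<xi> + fourier g \<xi>"
  unfolding fourier_def using integrable_fourier_integrand[OF assms(1)] integrable_fourier_integrand[OF assms(2)]
  by (simp add: distrib_right)

lemma fourier_modulate: "fourier (\<lambda>x. cis (2 * pi * (y \<bullet> x)) * f x) \<xi> = fourier f (\<xi> - y)"
proof -
  have "cis (2 * pi * (y \<bullet> x)) * f x * cis (- 2 * pi * (x \<bullet> \<xi>)) = f x * cis (- 2 * pi * (x \<bullet> (\<xi> - y)))" for x
  proof -
    have "- 2 * pi * (x \<bullet> (\<xi> - y)) = 2 * pi * (y \<bullet> x) + - 2 * pi * (x \<bullet> \<xi>)"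
      by (simp add: inner_diff_right inner_commute[of x y] right_diff_distrib)
    then show ?thesis by (simp only: cis_mult[symmetric] mult_ac)
  qed
  then show ?thesis by (simp only: fourier_def)
qed

lemma fourier_translate: "fourier (\<lambda>x. f (x - y)) \<xi> = cis (- 2 * pi * (y \<bullet> \<xi>)) * fourier f \<xi>"
proof -
  have "fourier (\<lambda>x. f (x - y)) \<xi> = (LINT x|lborel. f x * cis (- 2 * pi * ((x + y) \<bullet> \<xi>)))"
    unfolding fourier_def
    using integral_lborel_translate(2)[where t=y and f="\<lambda>x. f x * cis (- 2 * pi * ((x + y) \<bullet> \<xi>))"] by simp
  also have "\<dots> = (LINT x|lborel. cis (- 2 * pi * (y \<bullet> \<xi>)) * (f x * cis (- 2 * pi * (x \<bullet> \<xi>))))"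
  proof (intro Bochner_Integration.integral_cong refl)
    fix x
    have "- 2 * pi * ((x + y) \<bullet> \<xi>) = - 2 * pi * (y \<bullet> \<xi>) + - 2 * pi * (x \<bullet> \<xi>)"
      by (simp add: inner_add_left distrib_left)
    then show "f x * cis (- 2 * pi * ((x + y) \<bullet> \<xi>)) = cis (- 2 * pi * (y \<bullet> \<xi>)) * (f x * cis (- 2 * pi * (x \<bullet> \<xi>)))"
      by (simp only: cis_mult[symmetric] mult_ac)
  qed
  finally show ?thesis by (simp add: fourier_def)
qed

lemma fourier_dilate:
  fixes f :: "'a::euclidean_space \<Rightarrow> complex"
  assumes "c > 0"
  shows "fourier (\<lambda>x. f (c *\<^sub>R x)) \<xi> = of_real (1 / c ^ DIM('a)) * fourier f (\<xi> /\<^sub>R c)"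
proof -
  have "fourier f (\<xi> /\<^sub>R c) = (c ^ DIM('a)) *\<^sub>R (LINT x|lborel. f (c *\<^sub>R x) * cis (- 2 * pi * ((c *\<^sub>R x) \<bullet> (\<xi> /\<^sub>R c))))"
    unfolding fourier_def using assms
    by (subst integral_lborel_affine[of c _ 0]) auto
  also have "\<dots> = (c ^ DIM('a)) *\<^sub>R fourier (\<lambda>x. f (c *\<^sub>R x)) \<xi>"
  proof -
    have "(c *\<^sub>R x) \<bullet> (\<xi> /\<^sub>R c) = x \<bullet> \<xi>" for x using assms by simp
    then show ?thesis by (simp only: fourier_def)
  qed
  finally show ?thesis using assms by (simp add: scaleR_conv_of_real)
qed

lemma continuous_fourier:
  assumes "integrable lborel f"
  shows "continuous (at \<xi>) (fourier f)"
  unfolding continuous_at_sequentially o_def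
proof (intro allI impI)
  fix X assume X: "X \<longlonglongrightarrow> \<xi>"
  show "(\<lambda>n. fourier f (X n)) \<longlonglongrightarrow> fourier f \<xi>"
    unfolding fourier_def
  proof (rule integral_dominated_convergence[where w="\<lambda>x. norm (f x)"])
    show "AE x in lborel. (\<lambda>n. f x * cis (- 2 * pi * (x \<bullet> X n))) \<longlonglongrightarrow> f x * cis (- 2 * pi * (x \<bullet> \<xi>))"
      by (auto intro!: tendsto_intros X)
  qed (use assms borel_measurable_integrable[OF assms] in \<open>auto simp: norm_mult\<close>)
qed

lemma fourier_multiplication_formula:
  fixes f g :: "'a::euclidean_space \<Rightarrow> complex"
  assumes f: "integrable lborel f" and g: "integrable lborel g"
  shows "(LINT x|lborel. f x * fourier g x) = (LINT x|lborel. fourier f x * g x)"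
proof -
  have [measurable]: "f \<in> borel_measurable borel" "g \<in> borel_measurable borel" using f g by auto
  have "(\<integral>\<^sup>+x. \<integral>\<^sup>+y. norm (f x * (g y * cis (- 2 * pi * (y \<bullet> x)))) \<partial>lborel \<partial>lborel)
     = (\<integral>\<^sup>+x. norm (f x) \<partial>lborel) * (\<integral>\<^sup>+y. norm (g y) \<partial>lborel)"
    by (simp add: norm_mult ennreal_mult nn_integral_cmult nn_integral_multc)
  also have "\<dots> < \<infinity>" using f g by (simp add: integrable_iff_bounded ennreal_mult_less_top)
  finally have b: "(\<integral>\<^sup>+x. \<integral>\<^sup>+y. norm (f x * (g y * cis (- 2 * pi * (y \<bullet> x)))) \<partial>lborel \<partial>lborel) < \<infinity>" .
  have "(LINT x|lborel. LINT y|lborel. f x * (g y * cis (- 2 * pi * (y \<bullet> x))))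
      = (LINT y|lborel. LINT x|lborel. f x * (g y * cis (- 2 * pi * (y \<bullet> x))))"
    by (rule fubini_lborel(1)[OF _ b]) simp
  also have "\<dots> = (LINT y|lborel. LINT x|lborel. (f x * cis (- 2 * pi * (x \<bullet> y))) * g y)"
    by (intro Bochner_Integration.integral_cong) (auto simp: inner_commute mult_ac)
  finally show ?thesis unfolding fourier_def by simp
qed

text \<open>Every kernel built below is a superposition over a parameter \<open>t\<close> of
  functions with known transforms. One bound on the iterated integral of the norms yields
  integrability of the superposition, its L^1 bound, and the exchange of \<open>fourier\<close> with
  the parameter integral.\<close>

lemma fourier_mix:
  fixes k :: "'t::euclidean_space \<Rightarrow> 'a::euclidean_space \<Rightarrow> complex"
  assumes [measurable]: "case_prod k \<in> borel_measurable (borel \<Otimes>\<^sub>M borel)"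
    and b: "(\<integral>\<^sup>+t. \<integral>\<^sup>+\<xi>. norm (k t \<xi>) \<partial>lborel \<partial>lborel) \<le> ennreal B"
  shows "integrable lborel (\<lambda>\<xi>. LINT t|lborel. k t \<xi>)"
    and "(\<integral>\<^sup>+\<xi>. norm (LINT t|lborel. k t \<xi>) \<partial>lborel) \<le> ennreal B"
    and "fourier (\<lambda>\<xi>. LINT t|lborel. k t \<xi>) x = (LINT t|lborel. fourier (k t) x)"
    and "integrable lborel (\<lambda>t. fourier (k t) x)"
proof -
  have b': "(\<integral>\<^sup>+t. \<integral>\<^sup>+\<xi>. norm (k t \<xi>) \<partial>lborel \<partial>lborel) < \<infinity>"
    using b by (auto intro: le_less_trans)
  have b2: "(\<integral>\<^sup>+t. \<integral>\<^sup>+\<xi>. norm (k t \<xi> * cis (- 2 * pi * (\<xi> \<bullet> x))) \<partial>lborel \<partial>lborel) < \<infinity>"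
    using b' by (simp add: norm_mult)
  show "integrable lborel (\<lambda>\<xi>. LINT t|lborel. k t \<xi>)" by (rule fubini_lborel(3)[OF _ b']) simp
  have "(\<integral>\<^sup>+\<xi>. norm (LINT t|lborel. k t \<xi>) \<partial>lborel) \<le> (\<integral>\<^sup>+\<xi>. \<integral>\<^sup>+t. norm (k t \<xi>) \<partial>lborel \<partial>lborel)"
    by (intro nn_integral_mono norm_integral_le_nn_integral)
  also have "\<dots> \<le> ennreal B" using b by (subst nn_integral_lborel_swap) simp_all
  finally show "(\<integral>\<^sup>+\<xi>. norm (LINT t|lborel. k t \<xi>) \<partial>lborel) \<le> ennreal B" .
  have "fourier (\<lambda>\<xi>. LINT t|lborel. k t \<xi>) x = (LINT \<xi>|lborel. LINT t|lborel. k t \<xi> * cis (- 2 * pi * (\<xi> \<bullet> x)))"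
    unfolding fourier_def by simp
  also have "\<dots> = (LINT t|lborel. fourier (k t) x)"
    unfolding fourier_def by (rule fubini_lborel(1)[OF _ b2, symmetric]) simp
  finally show "fourier (\<lambda>\<xi>. LINT t|lborel. k t \<xi>) x = (LINT t|lborel. fourier (k t) x)" .
  show "integrable lborel (\<lambda>t. fourier (k t) x)"
    unfolding fourier_def by (rule fubini_lborel(2)[OF _ b2]) simp
qed

definition convol :: "('a::euclidean_space \<Rightarrow> complex) \<Rightarrow> ('a \<Rightarrow> complex) \<Rightarrow> 'a \<Rightarrow> complex" where
  "convol k G \<xi> = (LINT \<eta>|lborel. k \<eta> * G (\<xi> - \<eta>))"

lemma
  fixes k G :: "'a::euclidean_space \<Rightarrow> complex"
  assumes k: "integrable lborel k" and G: "integrable lborel G"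
  shows integrable_convol: "integrable lborel (convol k G)"
    and fourier_convol: "fourier (convol k G) x = fourier k x * fourier G x"
proof -
  have [measurable]: "k \<in> borel_measurable borel" "G \<in> borel_measurable borel" using k G by auto
  have "(\<integral>\<^sup>+\<eta>. \<integral>\<^sup>+\<xi>. norm (k \<eta> * G (\<xi> - \<eta>)) \<partial>lborel \<partial>lborel)
     = (\<integral>\<^sup>+\<eta>. norm (k \<eta>) * (\<integral>\<^sup>+\<xi>. norm (G (\<xi> - \<eta>)) \<partial>lborel) \<partial>lborel)"
    by (simp add: norm_mult ennreal_mult nn_integral_cmult)
  also have "\<dots> = (\<integral>\<^sup>+\<eta>. norm (k \<eta>) \<partial>lborel) * (\<integral>\<^sup>+\<xi>. norm (G \<xi>) \<partial>lborel)"
    using nn_integral_lborel_translate(2)[of "\<lambda>\<xi>. norm (G \<xi>)"] by (simp add: nn_integral_multc)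
  also have "\<dots> < \<infinity>" using k G by (simp add: integrable_iff_bounded ennreal_mult_less_top)
  finally have B: "(\<integral>\<^sup>+\<eta>. \<integral>\<^sup>+\<xi>. norm (k \<eta> * G (\<xi> - \<eta>)) \<partial>lborel \<partial>lborel)
      \<le> ennreal (enn2real (\<integral>\<^sup>+\<eta>. \<integral>\<^sup>+\<xi>. norm (k \<eta> * G (\<xi> - \<eta>)) \<partial>lborel \<partial>lborel))"
    by (subst ennreal_enn2real) auto
  have m: "(\<lambda>(\<eta>, \<xi>). k \<eta> * G (\<xi> - \<eta>)) \<in> borel_measurable (borel \<Otimes>\<^sub>M borel)" by measurable
  show "integrable lborel (convol k G)"
    unfolding convol_def[abs_def] by (rule fourier_mix(1)[OF m B])
  have "fourier (convol k G) x = (LINT \<eta>|lborel. k \<eta> * (cis (- 2 * pi * (\<eta> \<bullet> x)) * fourier G x))"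
    unfolding convol_def[abs_def] by (subst fourier_mix(3)[OF m B]) (simp add: fourier_cmult fourier_translate)
  also have "\<dots> = (LINT \<eta>|lborel. (k \<eta> * cis (- 2 * pi * (\<eta> \<bullet> x))) * fourier G x)" by (simp only: mult.assoc)
  also have "\<dots> = fourier k x * fourier G x" by (simp add: fourier_def[of k])
  finally show "fourier (convol k G) x = fourier k x * fourier G x" .
qed

section \<open>Gaussians\<close>

lemma norm_exp_minus_1_le:
  fixes z :: complex
  shows "norm (exp z - 1) \<le> norm z * exp (norm z)"
proof -
  have "norm (exp z - exp 0) \<le> exp (norm z) * norm (z - 0)"
  proof (rule field_differentiable_bound[of "cball 0 (norm z)" exp exp])
    show "norm (exp w) \<le> exp (norm z)" if "w \<in> cball 0 (norm z)" for w :: complex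
      using that complex_Re_le_cmod[of w] by simp
  qed (auto intro!: derivative_eq_intros)
  then show ?thesis by (simp add: mult.commute)
qed

text \<open>The difference quotients are dominated by the integrand at the two points
  \<open>a0 + 2 * r\<close> and \<open>a0 - 2 * r\<close> only: one factor
  \<open>exp (r * \<bar>h x\<bar>)\<close> absorbs the linear factor \<open>\<bar>h x\<bar>\<close>,
  and \<open>exp (2 * r * \<bar>h x\<bar>)\<close> is at most the sum of the exponentials with both
  signs.\<close>

lemma exp_integral_DERIV:
  fixes h :: "'a \<Rightarrow> real" and g :: "'a \<Rightarrow> complex"
  assumes S: "open S" "a0 \<in> S" and [measurable]: "h \<in> borel_measurable M" "g \<in> borel_measurable M"
    and int: "\<And>a. a \<in> S \<Longrightarrow> integrable M (\<lambda>x. exp (of_real (h x) * a) * g x)"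
  shows "((\<lambda>a. LINT x|M. exp (of_real (h x) * a) * g x) has_field_derivative
            (LINT x|M. of_real (h x) * exp (of_real (h x) * a0) * g x)) (at a0)"
proof -
  obtain r where r: "r > 0" "cball a0 (2 * r) \<subseteq> S"
  proof -
    obtain e where "e > 0" "cball a0 e \<subseteq> S" using S open_contains_cball by blast
    then show ?thesis using that[of "e/2"] by simp
  qed
  have inS: "a \<in> S" if "norm (a - a0) \<le> 2 * r" for a
    using r that by (auto simp: dist_norm norm_minus_commute)
  define W where "W x = (1/r) * (norm (exp (of_real (h x) * (a0 + of_real (2 * r))) * g x)
       + norm (exp (of_real (h x) * (a0 - of_real (2 * r))) * g x))" for x
  have W: "integrable M W"
    unfolding W_def[abs_def] using r
    by (intro integrable_mult_right Bochner_Integration.integrable_add integrable_norm int inS) auto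
  have quot: "norm ((exp (of_real (h x) * (a0 + d)) - exp (of_real (h x) * a0)) / d * g x) \<le> W x"
    if d: "norm d \<le> r" "d \<noteq> 0" for x d
  proof -
    let ?h = "\<bar>h x\<bar>"
    have "exp (of_real (h x) * (a0 + d)) - exp (of_real (h x) * a0)
        = exp (of_real (h x) * a0) * (exp (of_real (h x) * d) - 1)"
      by (simp add: ring_distribs exp_add)
    then have "norm ((exp (of_real (h x) * (a0 + d)) - exp (of_real (h x) * a0)) / d * g x)
       = exp (h x * Re a0) * (norm (exp (of_real (h x) * d) - 1) / norm d) * norm (g x)"
      by (simp add: norm_mult norm_divide)
    also have "norm (exp (of_real (h x) * d) - 1) / norm d \<le> (1/r) * exp (2 * r * ?h)"
    proof -
      have "norm (exp (of_real (h x) * d) - 1) \<le> (?h * norm d) * exp (?h * norm d)"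
        using norm_exp_minus_1_le[of "of_real (h x) * d"] by (simp add: norm_mult)
      also have "\<dots> \<le> (?h * norm d) * exp (?h * r)"
        using d by (intro mult_left_mono) (auto intro: mult_left_mono)
      finally have "norm (exp (of_real (h x) * d) - 1) / norm d \<le> ?h * exp (?h * r)"
        using d by (simp add: field_simps)
      also have "?h * r \<le> exp (?h * r)" using exp_ge_add_one_self[of "?h * r"] by linarith
      then have "?h * exp (?h * r) \<le> (1/r) * (exp (?h * r) * exp (?h * r))"
        using r by (simp add: field_simps)
      also have "exp (?h * r) * exp (?h * r) = exp (2 * r * ?h)" by (simp add: mult_exp_exp)
      finally show ?thesis .
    qed
    also have "exp (h x * Re a0) * ((1/r) * exp (2 * r * ?h)) * norm (g x) \<le> W x"
    proof -
      have "exp (h x * Re a0) * exp (2 * r * ?h) \<le> exp (h x * (Re a0 + 2 * r)) + exp (h x * (Re a0 - 2 * r))"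
        by (cases "h x \<ge> 0") (auto simp: mult_exp_exp algebra_simps)
      then have "(exp (h x * Re a0) * exp (2 * r * ?h)) * norm (g x) / r
         \<le> (exp (h x * (Re a0 + 2 * r)) + exp (h x * (Re a0 - 2 * r))) * norm (g x) / r"
        using r by (intro divide_right_mono mult_right_mono) auto
      then show ?thesis unfolding W_def by (simp add: norm_mult algebra_simps add_divide_distrib)
    qed
    finally show ?thesis by (simp add: mult_left_mono mult_right_mono)
  qed
  show ?thesis
    unfolding DERIV_def tendsto_at_iff_sequentially o_def
  proof (intro allI impI)
    fix X :: "nat \<Rightarrow> complex" assume X0: "\<forall>i. X i \<in> UNIV - {0}" and X: "X \<longlonglongrightarrow> 0"
    from X r(1) obtain N where N: "\<And>n. n \<ge> N \<Longrightarrow> norm (X n) \<le> r"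
      unfolding lim_sequentially by (metis dist_0_norm dist_commute less_imp_le)
    have inX: "norm (X (n + N)) \<le> r" for n by (rule N) simp
    have XN: "(\<lambda>n. X (n + N)) \<longlonglongrightarrow> 0" using X by (rule LIMSEQ_ignore_initial_segment)
    have "(\<lambda>n. LINT x|M. (exp (of_real (h x) * (a0 + X (n + N))) - exp (of_real (h x) * a0)) / X (n + N) * g x)
        \<longlonglongrightarrow> (LINT x|M. of_real (h x) * exp (of_real (h x) * a0) * g x)"
    proof (rule integral_dominated_convergence[where w=W])
      show "AE x in M. (\<lambda>n. (exp (of_real (h x) * (a0 + X (n + N))) - exp (of_real (h x) * a0)) / X (n + N) * g x)
         \<longlonglongrightarrow> of_real (h x) * exp (of_real (h x) * a0) * g x"
      proof (rule AE_I2, rule tendsto_mult_right)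
        fix x
        have "((\<lambda>a. exp (of_real (h x) * a)) has_field_derivative of_real (h x) * exp (of_real (h x) * a0)) (at a0)"
          by (auto intro!: derivative_eq_intros)
        then have "(\<lambda>n. (exp (of_real (h x) * (a0 + X n)) - exp (of_real (h x) * a0)) / X n)
          \<longlonglongrightarrow> of_real (h x) * exp (of_real (h x) * a0)"
          unfolding DERIV_def tendsto_at_iff_sequentially o_def using X0 X by blast
        then show "(\<lambda>n. (exp (of_real (h x) * (a0 + X (n + N))) - exp (of_real (h x) * a0)) / X (n + N))
          \<longlonglongrightarrow> of_real (h x) * exp (of_real (h x) * a0)"
          by (rule LIMSEQ_ignore_initial_segment)
      qed
      show "AE x in M. norm ((exp (of_real (h x) * (a0 + X (n + N))) - exp (of_real (h x) * a0)) / X (n + N) * g x) \<le> W x" for n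
        using inX X0 by (intro AE_I2 quot) auto
    qed (use W in auto)
    moreover have eq: "(LINT x|M. (exp (of_real (h x) * (a0 + X (n + N))) - exp (of_real (h x) * a0)) / X (n + N) * g x)
      = ((LINT x|M. exp (of_real (h x) * (a0 + X (n + N))) * g x) - (LINT x|M. exp (of_real (h x) * a0) * g x)) / X (n + N)" for n
    proof -
      have "norm (a0 + X (n + N) - a0) \<le> 2 * r" using inX[of n] r by simp
      then have i: "integrable M (\<lambda>x. exp (of_real (h x) * (a0 + X (n + N))) * g x)"
        "integrable M (\<lambda>x. exp (of_real (h x) * a0) * g x)"
        using r by (auto intro!: int inS)
      have "(LINT x|M. (exp (of_real (h x) * (a0 + X (n + N))) - exp (of_real (h x) * a0)) / X (n + N) * g x)
         = (LINT x|M. (exp (of_real (h x) * (a0 + X (n + N))) * g x - exp (of_real (h x) * a0) * g x) / X (n + N))"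
        by (intro Bochner_Integration.integral_cong refl) (simp add: algebra_simps diff_divide_distrib)
      then show ?thesis using i by simp
    qed
    ultimately have "(\<lambda>n. ((LINT x|M. exp (of_real (h x) * (a0 + X (n + N))) * g x) - (LINT x|M. exp (of_real (h x) * a0) * g x)) / X (n + N))
       \<longlonglongrightarrow> (LINT x|M. of_real (h x) * exp (of_real (h x) * a0) * g x)" by (simp only: eq)
    then show "(\<lambda>n. ((LINT x|M. exp (of_real (h x) * (a0 + X n)) * g x) - (LINT x|M. exp (of_real (h x) * a0) * g x)) / X n)
       \<longlonglongrightarrow> (LINT x|M. of_real (h x) * exp (of_real (h x) * a0) * g x)"
      by (rule LIMSEQ_offset)
  qed
qed

lemma exp_integral_holomorphic:
  fixes h :: "'a \<Rightarrow> real" and g :: "'a \<Rightarrow> complex"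
  assumes "open S" and "h \<in> borel_measurable M" "g \<in> borel_measurable M"
    and "\<And>a. a \<in> S \<Longrightarrow> integrable M (\<lambda>x. exp (of_real (h x) * a) * g x)"
  shows "(\<lambda>a. LINT x|M. exp (of_real (h x) * a) * g x) holomorphic_on S"
  unfolding holomorphic_on_open[OF assms(1)] using exp_integral_DERIV[OF assms(1) _ assms(2-4)] by blast

section \<open>Gaussian integrals and the transform of complex Gaussians\<close>

lemma nn_integral_gaussian_1:
  assumes "a > 0"
  shows "(\<integral>\<^sup>+x. ennreal (exp (- (pi * a * x\<^sup>2))) \<partial>lborel) = ennreal (a powr (-1/2))"
proof -
  define \<sigma> where "\<sigma> = 1 / sqrt (2 * pi * a)"
  have s: "\<sigma> > 0" using assms by (simp add: \<sigma>_def)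
  have s2: "\<sigma>\<^sup>2 = 1 / (2 * pi * a)" using assms by (simp add: \<sigma>_def power_divide)
  have e: "exp (- (pi * a * x\<^sup>2)) = a powr (-1/2) * normal_density 0 \<sigma> x" for x
  proof -
    have "sqrt (2 * pi * \<sigma>\<^sup>2) = a powr (-1/2)"
      using assms by (simp add: s2 real_sqrt_divide powr_minus powr_half_sqrt field_simps)
    moreover have "(x - 0)\<^sup>2 / (2 * \<sigma>\<^sup>2) = pi * a * x\<^sup>2" using assms by (simp add: s2 field_simps)
    ultimately show ?thesis using assms by (simp add: normal_density_def)
  qed
  have "(\<integral>\<^sup>+x. normal_density 0 \<sigma> x \<partial>lborel) = 1"
    using s by (subst nn_integral_eq_integral) auto
  then show ?thesis unfolding e by (subst ennreal_mult) (auto simp: nn_integral_cmult)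
qed

lemma nn_integral_gaussian:
  assumes "a > 0"
  shows "(\<integral>\<^sup>+x. ennreal (exp (- (pi * a * (norm x)\<^sup>2))) \<partial>(lborel :: 'a::euclidean_space measure))
    = ennreal (a powr (- real DIM('a) / 2))"
proof -
  have e: "ennreal (exp (- (pi * a * (norm x)\<^sup>2))) = (\<Prod>b\<in>Basis. ennreal (exp (- (pi * a * (x \<bullet> b)\<^sup>2))))" for x :: 'a
  proof -
    have "(norm x)\<^sup>2 = (\<Sum>b\<in>Basis. (x \<bullet> b)\<^sup>2)"
      unfolding power2_norm_eq_inner by (subst euclidean_inner) (simp add: power2_eq_square)
    then have "exp (- (pi * a * (norm x)\<^sup>2)) = (\<Prod>b\<in>Basis. exp (- (pi * a * (x \<bullet> b)\<^sup>2)))"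
      by (simp add: exp_sum[symmetric] sum_distrib_left sum_negf)
    then show ?thesis by (simp add: prod_ennreal)
  qed
  have "(\<integral>\<^sup>+x. ennreal (exp (- (pi * a * (norm x)\<^sup>2))) \<partial>(lborel :: 'a measure)) = (\<Prod>b\<in>(Basis::'a set). ennreal (a powr (-1/2)))"
    unfolding e by (subst nn_integral_lborel_prod) (simp_all add: nn_integral_gaussian_1[OF assms])
  also have "\<dots> = ennreal (a powr (- real DIM('a) / 2))"
    using assms by (simp add: ennreal_power powr_power)
  finally show ?thesis .
qed

text \<open>Normalised so that the Gaussian with parameter 1 is its own Fourier transform. The
  parameter is complex: its real part gives the decay and its imaginary part a quadratic phase, so
  Gaussians and chirps obey one formula.\<close>

definition cgauss :: "complex \<Rightarrow> 'a::real_normed_vector \<Rightarrow> complex" where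
  "cgauss a x = exp (- (of_real (pi * (norm x)\<^sup>2) * a))"

lemma norm_cgauss: "norm (cgauss a x) = exp (- (pi * Re a * (norm x)\<^sup>2))"
  by (simp add: cgauss_def mult_ac)

lemma norm_cgauss_le_1: "0 \<le> Re a \<Longrightarrow> norm (cgauss a x) \<le> 1"
  by (simp add: norm_cgauss)

lemma cgauss_of_real: "cgauss (of_real a) x = of_real (exp (- (pi * a * (norm x)\<^sup>2)))"
  by (simp add: cgauss_def exp_of_real[symmetric] mult_ac)

lemma borel_measurable_cgauss [measurable]:
  fixes f :: "'b \<Rightarrow> 'a::euclidean_space"
  assumes [measurable]: "a \<in> borel_measurable M" "f \<in> borel_measurable M"
  shows "(\<lambda>x. cgauss (a x) (f x)) \<in> borel_measurable M"
  unfolding cgauss_def by measurable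

lemma cgauss_add: "cgauss (a + b) x = cgauss a x * cgauss b x"
  by (simp add: cgauss_def ring_distribs exp_add[symmetric])

lemma nn_integral_cgauss:
  assumes "Re a > 0"
  shows "(\<integral>\<^sup>+x. norm (cgauss a x) \<partial>(lborel :: 'a::euclidean_space measure))
    = ennreal (Re a powr (- real DIM('a) / 2))"
  unfolding norm_cgauss by (rule nn_integral_gaussian[OF assms])

lemma integrable_cgauss:
  assumes "Re a > 0"
  shows "integrable lborel (cgauss a :: 'a::euclidean_space \<Rightarrow> complex)"
  by (rule integrableI_bounded) (use nn_integral_cgauss[OF assms, where 'a='a] in auto)

lemma integral_cgauss_of_real:
  assumes "a > 0"
  shows "(LINT x|(lborel :: 'a::euclidean_space measure). cgauss (of_real a) x)
    = of_real (a powr (- real DIM('a) / 2))"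
proof -
  have "(LINT x|(lborel :: 'a measure). exp (- (pi * a * (norm x)\<^sup>2))) = a powr (- real DIM('a) / 2)"
    by (rule integral_eq_nn_integral[THEN trans]) (use nn_integral_gaussian[OF assms, where 'a='a] in auto)
  then show ?thesis unfolding cgauss_of_real by simp
qed

lemma integrable_exp_cgauss:
  fixes w :: "'a::euclidean_space"
  assumes "a > 0"
  shows "integrable lborel (\<lambda>x. exp (of_real (w \<bullet> x) * z) * cgauss (of_real a) x)"
proof (rule Bochner_Integration.integrable_bound)
  \<comment> \<open>The square of \<open>pi * a * X - Y\<close> bounds the exponent by half of the
    quadratic decay plus a constant, and \<open>C\<close> is the exponential of that
    constant.\<close>
  define C where "C = exp ((norm w)\<^sup>2 * (norm z)\<^sup>2 / (2 * pi * a))"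
  show "integrable lborel (\<lambda>x::'a. of_real C * cgauss (of_real (a / 2)) x)"
    using assms by (intro integrable_mult_right integrable_cgauss) auto
  show "AE x in lborel. norm (exp (of_real (w \<bullet> x) * z) * cgauss (of_real a) x) \<le> norm (of_real C * cgauss (of_real (a / 2)) x)"
  proof (rule AE_I2)
    fix x :: 'a
    define X where "X = norm x" define Y where "Y = norm w * norm z"
    have "(w \<bullet> x) * Re z \<le> \<bar>w \<bullet> x\<bar> * \<bar>Re z\<bar>" by (metis abs_ge_self abs_mult)
    also have "\<dots> \<le> (norm w * norm x) * norm z"
      by (intro mult_mono Cauchy_Schwarz_ineq2 abs_Re_le_cmod) auto
    also have "\<dots> = X * Y" by (simp add: X_def Y_def)
    also have "X * Y \<le> pi * a * X\<^sup>2 / 2 + Y\<^sup>2 / (2 * pi * a)"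
    proof -
      have "0 \<le> (pi * a * X - Y)\<^sup>2 / (2 * pi * a)" using assms by simp
      also have "\<dots> = pi * a * X\<^sup>2 / 2 + Y\<^sup>2 / (2 * pi * a) - X * Y"
        using assms by (simp add: field_simps power2_eq_square)
      finally show ?thesis by simp
    qed
    finally have "(w \<bullet> x) * Re z - pi * a * X\<^sup>2 \<le> Y\<^sup>2 / (2 * pi * a) - pi * (a/2) * X\<^sup>2"
      by (simp add: field_simps)
    then have "exp ((w \<bullet> x) * Re z) * exp (- (pi * a * X\<^sup>2)) \<le> exp (Y\<^sup>2 / (2 * pi * a)) * exp (- (pi * (a/2) * X\<^sup>2))"
      by (simp add: mult_exp_exp)
    then show "norm (exp (of_real (w \<bullet> x) * z) * cgauss (of_real a) x) \<le> norm (of_real C * cgauss (of_real (a / 2)) x)"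
      by (simp add: norm_mult norm_cgauss C_def X_def Y_def power_mult_distrib)
  qed
qed measurable

lemma islimpt_of_real_pos: "(1::complex) islimpt (of_real ` {0<..})"
  unfolding islimpt_approachable
proof (intro allI impI)
  fix e :: real assume "e > 0"
  then have "complex_of_real (1 + e/2) \<in> of_real ` {0<..}" by (intro imageI) simp
  moreover have "complex_of_real (1 + e/2) \<noteq> 1 \<and> dist (complex_of_real (1 + e/2)) 1 < e"
    using \<open>e > 0\<close> by (auto simp: dist_norm norm_divide)
  ultimately show "\<exists>x'\<in>of_real ` {0<..}. x' \<noteq> 1 \<and> dist x' (1::complex) < e" by blast
qed

text \<open>For real \<open>z\<close> this is completion of the square and a translation of the
  integral. Both sides are entire in \<open>z\<close>, so equality on the positive reals, which
  accumulate at 1, extends to all complex \<open>z\<close>.\<close>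

lemma integral_exp_cgauss:
  fixes w :: "'a::euclidean_space"
  assumes a: "a > 0"
  shows "(LINT x|lborel. exp (of_real (w \<bullet> x) * z) * cgauss (of_real a) x)
     = of_real (a powr (- real DIM('a) / 2)) * exp (z\<^sup>2 * of_real ((norm w)\<^sup>2 / (4 * pi * a)))"
proof -
  define f where "f z = (LINT x|lborel. exp (of_real (w \<bullet> x) * z) * cgauss (of_real a) x)
     - of_real (a powr (- real DIM('a) / 2)) * exp (z\<^sup>2 * of_real ((norm w)\<^sup>2 / (4 * pi * a)))" for z
  have real: "f (of_real t) = 0" for t :: real
  proof -
    define K where "K = t / (2 * pi * a)"
    have t: "t = 2 * pi * a * K" using a by (simp add: K_def)
    define v where "v = K *\<^sub>R w"
    have e: "exp (of_real (w \<bullet> x) * of_real t) * cgauss (of_real a) x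
      = exp ((of_real t)\<^sup>2 * of_real ((norm w)\<^sup>2 / (4 * pi * a))) * cgauss (of_real a) (x - v)" for x
    proof -
      have nrm: "(norm (x - v))\<^sup>2 = (norm x)\<^sup>2 - 2 * K * (w \<bullet> x) + K\<^sup>2 * (norm w)\<^sup>2"
        unfolding v_def power2_norm_eq_inner
        by (simp add: inner_diff_left inner_diff_right inner_commute power2_eq_square algebra_simps)
      have tsq: "t\<^sup>2 * ((norm w)\<^sup>2 / (4 * pi * a)) = pi * a * K\<^sup>2 * (norm w)\<^sup>2"
        unfolding t using a by (simp add: power2_eq_square)
      have "(w \<bullet> x) * t - pi * (norm x)\<^sup>2 * a = t\<^sup>2 * ((norm w)\<^sup>2 / (4 * pi * a)) - pi * (norm (x - v))\<^sup>2 * a"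
        unfolding nrm tsq by (simp add: t algebra_simps)
      then have "exp (of_real ((w \<bullet> x) * t - pi * (norm x)\<^sup>2 * a) :: complex)
          = exp (of_real (t\<^sup>2 * ((norm w)\<^sup>2 / (4 * pi * a)) - pi * (norm (x - v))\<^sup>2 * a))" by simp
      then show ?thesis by (simp add: cgauss_def mult_exp_exp)
    qed
    show ?thesis unfolding f_def e
      using integral_lborel_translate(2)[of "cgauss (of_real a)" v] integral_cgauss_of_real[OF a, where 'a='a] by simp
  qed
  have "f z = 0"
  proof (rule analytic_continuation[of f UNIV "of_real ` {0<..}" 1])
    show "f holomorphic_on UNIV"
      unfolding f_def[abs_def] using integrable_exp_cgauss[OF a]
      by (intro holomorphic_intros exp_integral_holomorphic) auto
  qed (use real islimpt_of_real_pos in auto)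
  then show ?thesis by (simp add: f_def)
qed

lemma exp_eq_cis: "exp (of_real t * (of_real s * \<i>)) = cis (t * s)"
  by (simp add: cis_conv_exp mult_ac)

text \<open>For positive real \<open>a\<close> this is the preceding integral at an imaginary
  argument. Both sides are holomorphic in the half plane \<open>Re a > 0\<close>, which the branch
  cut of \<open>powr\<close> does not meet, so analytic continuation applies again.\<close>

theorem fourier_cgauss:
  fixes \<xi> :: "'a::euclidean_space"
  assumes a: "Re a > 0"
  shows "fourier (cgauss a) \<xi> = a powr (of_real (- real DIM('a) / 2)) * cgauss (1 / a) \<xi>"
proof -
  let ?S = "{a. 0 < Re a}"
  define F where "F a = (LINT x|lborel. exp (of_real (- (pi * (norm x)\<^sup>2)) * a) * cis (- 2 * pi * (x \<bullet> \<xi>)))" for a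
  have F: "fourier (cgauss a) \<xi> = F a" for a
    unfolding fourier_def F_def cgauss_def by simp
  define f where "f a = F a - a powr (of_real (- real DIM('a) / 2)) * cgauss (1 / a) \<xi>" for a
  have real: "f (of_real t) = 0" if t: "t > 0" for t :: real
  proof -
    have "F (of_real t) = (LINT x|lborel. exp (of_real (\<xi> \<bullet> x) * (of_real (- 2 * pi) * \<i>)) * cgauss (of_real t) x)"
      unfolding F_def exp_eq_cis cgauss_def by (intro Bochner_Integration.integral_cong) (auto simp: inner_commute mult_ac)
    also have "\<dots> = of_real (t powr (- real DIM('a) / 2)) * exp ((of_real (- 2 * pi) * \<i>)\<^sup>2 * of_real ((norm \<xi>)\<^sup>2 / (4 * pi * t)))"
      by (rule integral_exp_cgauss[OF t])
    also have "(of_real (- 2 * pi) * \<i>)\<^sup>2 * of_real ((norm \<xi>)\<^sup>2 / (4 * pi * t)) = - (of_real (pi * (norm \<xi>)\<^sup>2) * (1 / of_real t))"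
      using t by (simp add: power_mult_distrib field_simps power2_eq_square)
    finally have "F (of_real t) = of_real (t powr (- real DIM('a) / 2)) * exp (- (of_real (pi * (norm \<xi>)\<^sup>2) * (1 / of_real t)))" .
    moreover have "complex_of_real t powr (of_real (- real DIM('a) / 2)) = of_real (t powr (- real DIM('a) / 2))"
      by (rule powr_of_real) (use t in simp)
    ultimately show ?thesis by (simp only: f_def cgauss_def diff_self)
  qed
  have "f a = 0"
  proof (rule analytic_continuation[of f ?S "of_real ` {0<..}" 1])
    show "open ?S" by (rule open_halfspace_Re_gt)
    show "connected ?S" by (intro convex_connected convex_halfspace_Re_gt)
    have "integrable lborel (\<lambda>x::'a. exp (of_real (- (pi * (norm x)\<^sup>2)) * a) * cis (- 2 * pi * (x \<bullet> \<xi>)))"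
      if "a \<in> ?S" for a
      using integrable_fourier_integrand[OF integrable_cgauss[of a], of \<xi>] that by (simp add: cgauss_def[abs_def])
    then have "F holomorphic_on ?S"
      unfolding F_def[abs_def] by (intro exp_integral_holomorphic open_halfspace_Re_gt) auto
    then show "f holomorphic_on ?S"
      unfolding f_def[abs_def] cgauss_def
      by (intro holomorphic_intros) (auto simp: complex_nonpos_Reals_iff)
  qed (use real islimpt_of_real_pos a in auto)
  then show ?thesis by (simp add: f_def F)
qed

lemma fourier_cgauss_of_real:
  fixes \<xi> :: "'a::euclidean_space"
  assumes "a > 0"
  shows "fourier (cgauss (of_real a)) \<xi> = of_real (a powr (- real DIM('a) / 2)) * cgauss (of_real (1 / a)) \<xi>"
proof -
  have "complex_of_real a powr (of_real (- real DIM('a) / 2)) = of_real (a powr (- real DIM('a) / 2))"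
    by (rule powr_of_real) (use assms in simp)
  then show ?thesis using fourier_cgauss[of "of_real a" \<xi>] assms by (simp only: of_real_divide of_real_1 Re_complex_of_real)
qed

section \<open>Gamma integrals and the heat kernel\<close>

text \<open>The weight of the Gamma integral, extended by zero to \<open>t \<le> 0\<close> so that
  parameter integrals run over \<open>lborel\<close> on the whole line.\<close>

definition gker :: "real \<Rightarrow> real \<Rightarrow> real" where
  "gker \<sigma> t = (if 0 < t then t powr (\<sigma> - 1) else 0)"

lemma gker_nonneg [simp]: "0 \<le> gker \<sigma> t" by (simp add: gker_def)

lemma borel_measurable_gker [measurable]: "gker \<sigma> \<in> borel_measurable borel"
  unfolding gker_def[abs_def] by measurable

lemma gker_mult: "0 < r \<Longrightarrow> gker \<sigma> (r * t) = r powr (\<sigma> - 1) * gker \<sigma> t"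
  by (simp add: gker_def powr_mult zero_less_mult_iff)

lemma nn_integral_gker_exp:
  assumes s: "\<sigma> > 0" and A: "A > 0"
  shows "(\<integral>\<^sup>+t. ennreal (gker \<sigma> t * exp (- (t * A))) \<partial>lborel) = ennreal (Gamma \<sigma> * A powr (- \<sigma>))"
proof -
  have "(\<integral>\<^sup>+t. ennreal (gker \<sigma> t * exp (- t)) \<partial>lborel)
     = (\<integral>\<^sup>+t. ennreal (indicator {0..} t * t powr (\<sigma> - 1) / exp t) \<partial>lborel)"
    by (intro nn_integral_cong_AE AE_I[where N="{0}"])
       (auto simp: gker_def exp_minus field_simps split: split_indicator)
  also have "\<dots> = ennreal (Gamma \<sigma>)"
    using Gamma_conv_nn_integral_real[OF s] by simp
  finally have G: "(\<integral>\<^sup>+t. ennreal (gker \<sigma> t * exp (- t)) \<partial>lborel) = ennreal (Gamma \<sigma>)" .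
  have "(\<integral>\<^sup>+t. ennreal (gker \<sigma> t * exp (- (t * A))) \<partial>lborel)
     = ennreal (1/A) * (\<integral>\<^sup>+t. ennreal (gker \<sigma> (1/A * t) * exp (- (1/A * t * A))) \<partial>lborel)"
    using A by (subst nn_integral_real_affine[where c="1/A" and t=0]) auto
  also have "\<dots> = ennreal (1/A) * (\<integral>\<^sup>+t. ennreal ((1/A) powr (\<sigma> - 1)) * ennreal (gker \<sigma> t * exp (- t)) \<partial>lborel)"
    using A by (subst gker_mult) (auto simp: ennreal_mult[symmetric] mult.assoc)
  also have "\<dots> = ennreal (1/A) * (ennreal ((1/A) powr (\<sigma> - 1)) * ennreal (Gamma \<sigma>))"
    by (simp add: nn_integral_cmult G)
  also have "\<dots> = ennreal (Gamma \<sigma> * A powr (- \<sigma>))"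
  proof -
    have "(1/A) * (1/A) powr (\<sigma> - 1) = A powr (- \<sigma>)"
      using A by (simp add: powr_divide powr_diff powr_minus field_simps)
    moreover have "ennreal (1/A) * (ennreal ((1/A) powr (\<sigma> - 1)) * ennreal (Gamma \<sigma>))
       = ennreal (Gamma \<sigma> * ((1/A) * (1/A) powr (\<sigma> - 1)))"
      using A s by (simp add: ennreal_mult[symmetric] mult_ac)
    ultimately show ?thesis by (simp only:)
  qed
  finally show ?thesis .
qed

lemma
  assumes s: "\<sigma> > 0" and A: "A > 0"
  shows integrable_gker_exp: "integrable lborel (\<lambda>t. gker \<sigma> t * exp (- (t * A)))"
    and integral_gker_exp: "(LINT t|lborel. gker \<sigma> t * exp (- (t * A))) = Gamma \<sigma> * A powr (- \<sigma>)"
proof -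
  have b: "has_bochner_integral lborel (\<lambda>t. gker \<sigma> t * exp (- (t * A))) (Gamma \<sigma> * A powr (- \<sigma>))"
    using assms nn_integral_gker_exp[OF assms] by (intro has_bochner_integral_nn_integral) auto
  then show "integrable lborel (\<lambda>t. gker \<sigma> t * exp (- (t * A)))"
    "(LINT t|lborel. gker \<sigma> t * exp (- (t * A))) = Gamma \<sigma> * A powr (- \<sigma>)"
    by (auto simp: has_bochner_integral_iff)
qed

text \<open>Write \<open>1 / (r + t)\<close> as the Laplace integral of
  \<open>exp (- (s * (r + t)))\<close> over \<open>s > 0\<close> and exchange the integrals: two
  Gamma integrals of orders \<open>\<beta>\<close> and \<open>1 - \<beta>\<close> remain. The second
  one is the reason for \<open>\<beta> < 1\<close>. Read backwards, this represents
  \<open>r powr \<beta>\<close> as an average of resolvents.\<close>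

lemma nn_integral_gker_resolvent:
  assumes b: "0 < \<beta>" "\<beta> < 1" and r: "r > 0"
  shows "(\<integral>\<^sup>+t. ennreal (gker \<beta> t * (r / (r + t))) \<partial>lborel) = ennreal (Gamma \<beta> * Gamma (1 - \<beta>) * r powr \<beta>)"
proof -
  have "(\<integral>\<^sup>+t. ennreal (gker \<beta> t * (r / (r + t))) \<partial>lborel)
    = (\<integral>\<^sup>+t. \<integral>\<^sup>+s. ennreal r * ennreal (gker \<beta> t * (gker 1 s * exp (- (s * (r + t))))) \<partial>lborel \<partial>lborel)"
  proof (rule nn_integral_cong)
    fix t
    show "ennreal (gker \<beta> t * (r / (r + t))) = (\<integral>\<^sup>+s. ennreal r * ennreal (gker \<beta> t * (gker 1 s * exp (- (s * (r + t))))) \<partial>lborel)"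
    proof (cases "t > 0")
      case True
      have "(\<integral>\<^sup>+s. ennreal (r * gker \<beta> t) * ennreal (gker 1 s * exp (- (s * (r + t)))) \<partial>lborel) = ennreal (r * gker \<beta> t) * ennreal (1 / (r + t))"
        using True r by (subst nn_integral_cmult) (auto simp: nn_integral_gker_exp powr_minus_divide)
      then show ?thesis using True r by (simp add: ennreal_mult[symmetric] mult_ac)
    qed (simp add: gker_def)
  qed
  also have "\<dots> = (\<integral>\<^sup>+s. \<integral>\<^sup>+t. ennreal r * ennreal (gker \<beta> t * (gker 1 s * exp (- (s * (r + t))))) \<partial>lborel \<partial>lborel)"
    by (rule nn_integral_lborel_swap) measurable
  also have "\<dots> = (\<integral>\<^sup>+s. ennreal (r * Gamma \<beta>) * ennreal (gker (1 - \<beta>) s * exp (- (s * r))) \<partial>lborel)"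
  proof (rule nn_integral_cong)
    fix s
    show "(\<integral>\<^sup>+t. ennreal r * ennreal (gker \<beta> t * (gker 1 s * exp (- (s * (r + t))))) \<partial>lborel) = ennreal (r * Gamma \<beta>) * ennreal (gker (1 - \<beta>) s * exp (- (s * r)))"
    proof (cases "s > 0")
      case True
      have "(\<integral>\<^sup>+t. ennreal r * ennreal (gker \<beta> t * (gker 1 s * exp (- (s * (r + t))))) \<partial>lborel)
         = (\<integral>\<^sup>+t. ennreal (r * exp (- (s * r))) * ennreal (gker \<beta> t * exp (- (t * s))) \<partial>lborel)"
        using True r by (intro nn_integral_cong) (simp add: gker_def ennreal_mult[symmetric] mult_exp_exp algebra_simps)
      also have "\<dots> = ennreal (r * exp (- (s * r))) * ennreal (Gamma \<beta> * s powr (- \<beta>))"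
        using True b by (subst nn_integral_cmult) (auto simp: nn_integral_gker_exp)
      finally show ?thesis using True r b by (simp add: gker_def ennreal_mult[symmetric] mult_ac)
    qed (simp add: gker_def)
  qed
  also have "\<dots> = ennreal (r * Gamma \<beta>) * ennreal (Gamma (1 - \<beta>) * r powr (- (1 - \<beta>)))"
    using b r by (subst nn_integral_cmult) (auto simp: nn_integral_gker_exp)
  also have "\<dots> = ennreal (Gamma \<beta> * Gamma (1 - \<beta>) * r powr \<beta>)"
    using b r by (simp add: ennreal_mult[symmetric] powr_diff powr_minus field_simps)
  finally show ?thesis .
qed

lemma
  assumes b: "0 < \<beta>" "\<beta> < 1" and r: "r > 0"
  shows integrable_gker_resolvent: "integrable lborel (\<lambda>t. gker \<beta> t * (r / (r + t)))"
    and integral_gker_resolvent: "(LINT t|lborel. gker \<beta> t * (r / (r + t))) = Gamma \<beta> * Gamma (1 - \<beta>) * r powr \<beta>"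
proof -
  have nn: "0 \<le> gker \<beta> t * (r / (r + t))" for t using r by (cases "t > 0") (auto simp: gker_def)
  have "has_bochner_integral lborel (\<lambda>t. gker \<beta> t * (r / (r + t))) (Gamma \<beta> * Gamma (1 - \<beta>) * r powr \<beta>)"
    using assms nn_integral_gker_resolvent[OF assms] nn by (intro has_bochner_integral_nn_integral) auto
  then show "integrable lborel (\<lambda>t. gker \<beta> t * (r / (r + t)))"
    "(LINT t|lborel. gker \<beta> t * (r / (r + t))) = Gamma \<beta> * Gamma (1 - \<beta>) * r powr \<beta>"
    by (auto simp: has_bochner_integral_iff)
qed

section \<open>The heat kernel and its first moments\<close>

definition heat :: "real \<Rightarrow> 'a::euclidean_space \<Rightarrow> real" where
  "heat t \<xi> = (4 * pi * t) powr (- real DIM('a) / 2) * exp (- ((norm \<xi>)\<^sup>2 / (4 * t)))"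

lemma heat_nonneg [simp]: "0 \<le> heat t \<xi>" by (simp add: heat_def)

lemma borel_measurable_heat [measurable]:
  assumes [measurable]: "f \<in> borel_measurable M" "g \<in> borel_measurable M"
  shows "(\<lambda>x. heat (f x) (g x :: 'a::euclidean_space)) \<in> borel_measurable M"
  unfolding heat_def by measurable

lemma heat_eq_cgauss:
  assumes "t > 0"
  shows "of_real (heat t \<xi>) = of_real ((4 * pi * t) powr (- real DIM('a) / 2)) * cgauss (of_real (1 / (4 * pi * t))) (\<xi>::'a::euclidean_space)"
  using assms by (simp only: heat_def cgauss_of_real of_real_mult) (simp add: field_simps)

lemma powr_mult_inverse: "0 < (c::real) \<Longrightarrow> c powr r * (1 / c) powr r = 1"
  by (simp add: powr_divide)

lemma nn_integral_heat:
  assumes "t > 0"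
  shows "(\<integral>\<^sup>+\<xi>. heat t \<xi> \<partial>(lborel :: 'a::euclidean_space measure)) = 1"
proof -
  have "(\<integral>\<^sup>+\<xi>. heat t \<xi> \<partial>(lborel :: 'a measure)) = (\<integral>\<^sup>+\<xi>. ennreal ((4 * pi * t) powr (- real DIM('a) / 2)) * ennreal (exp (- (pi * (1 / (4 * pi * t)) * (norm \<xi>)\<^sup>2))) \<partial>(lborel :: 'a measure))"
    using assms by (intro nn_integral_cong) (simp add: heat_def ennreal_mult[symmetric] field_simps)
  also have "\<dots> = ennreal ((4 * pi * t) powr (- real DIM('a) / 2)) * ennreal ((1 / (4 * pi * t)) powr (- real DIM('a) / 2))"
    using assms by (subst nn_integral_cmult, simp, subst nn_integral_gaussian) auto
  also have "\<dots> = 1"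
    using assms powr_mult_inverse[of "4 * pi * t"] by (simp only: ennreal_mult[symmetric] powr_ge_zero) simp
  finally show ?thesis .
qed

lemma integrable_heat: "t > 0 \<Longrightarrow> integrable lborel (heat t :: 'a::euclidean_space \<Rightarrow> real)"
  using nn_integral_heat[where 'a='a] by (intro integrableI_bounded) auto

lemma fourier_heat:
  fixes x :: "'a::euclidean_space"
  assumes "t > 0"
  shows "fourier (\<lambda>\<xi>. of_real (heat t \<xi>)) x = of_real (exp (- (t * (4 * pi\<^sup>2 * (norm x)\<^sup>2))))"
proof -
  have "fourier (\<lambda>\<xi>. of_real (heat t \<xi>)) x = of_real ((4 * pi * t) powr (- real DIM('a) / 2)) * fourier (cgauss (of_real (1 / (4 * pi * t)))) x"
    by (simp only: heat_eq_cgauss[OF assms] fourier_cmult)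
  also have "\<dots> = of_real ((4 * pi * t) powr (- real DIM('a) / 2) * (1 / (4 * pi * t)) powr (- real DIM('a) / 2)) * cgauss (of_real (4 * pi * t)) x"
    using fourier_cgauss_of_real[of "1 / (4 * pi * t)" x] assms by simp
  also have "(4 * pi * t) powr (- real DIM('a) / 2) * (1 / (4 * pi * t)) powr (- real DIM('a) / 2) = 1"
    using assms by (intro powr_mult_inverse) simp
  finally show ?thesis by (simp only: cgauss_of_real of_real_1 mult_1) (simp add: power2_eq_square mult_ac)
qed

text \<open>The order \<open>sqrt t\<close> compensates half of the factor \<open>1 / t\<close> in
  front of the gradient term of \<open>res_kernel\<close>. Replacing
  \<open>z * exp (- z\<^sup>2)\<close> by \<open>exp (- (z\<^sup>2 / 2))\<close> doubles the
  variance of the Gaussian, whence \<open>2 powr (real DIM('a) / 2)\<close>.\<close>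

lemma heat_moment:
  fixes y :: "'a::euclidean_space"
  assumes t: "t > 0"
  shows "(\<integral>\<^sup>+\<xi>. ennreal (\<bar>y \<bullet> \<xi>\<bar> * heat t \<xi>) \<partial>lborel) \<le> ennreal (norm y * (2 * sqrt t * 2 powr (real DIM('a) / 2)))"
proof -
  define c where "c = norm y * (2 * sqrt t) * (4 * pi * t) powr (- real DIM('a) / 2)"
  have c: "c \<ge> 0" using t by (simp add: c_def)
  have "(\<integral>\<^sup>+\<xi>. ennreal (\<bar>y \<bullet> \<xi>\<bar> * heat t \<xi>) \<partial>lborel)
     \<le> (\<integral>\<^sup>+\<xi>. ennreal c * ennreal (exp (- (pi * (1 / (8 * pi * t)) * (norm \<xi>)\<^sup>2))) \<partial>(lborel :: 'a measure))"
  proof (rule nn_integral_mono)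
    fix \<xi> :: 'a
    define z where "z = norm \<xi> / (2 * sqrt t)"
    have z: "z \<ge> 0" "norm \<xi> = 2 * sqrt t * z" using t by (auto simp: z_def)
    have z2: "(norm \<xi>)\<^sup>2 = 4 * t * z\<^sup>2" using t by (simp add: z power_mult_distrib)
    have "0 \<le> (z - 1)\<^sup>2" by simp
    then have "z \<le> 1 + z\<^sup>2 / 2" by (simp add: power2_diff)
    also have "\<dots> \<le> exp (z\<^sup>2 / 2)" by (rule exp_ge_add_one_self)
    finally have "z * exp (- z\<^sup>2) \<le> exp (z\<^sup>2 / 2) * exp (- z\<^sup>2)" by (rule mult_right_mono) simp
    also have "\<dots> = exp (- (z\<^sup>2 / 2))" by (simp add: mult_exp_exp)
    finally have zz: "z * exp (- z\<^sup>2) \<le> exp (- (z\<^sup>2 / 2))" .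
    have "\<bar>y \<bullet> \<xi>\<bar> * heat t \<xi> \<le> (norm y * norm \<xi>) * heat t \<xi>"
      by (intro mult_right_mono Cauchy_Schwarz_ineq2) simp
    also have "\<dots> = c * (z * exp (- z\<^sup>2))" using t by (simp add: heat_def z c_def power_mult_distrib)
    also have "\<dots> \<le> c * exp (- (z\<^sup>2 / 2))" by (intro mult_left_mono zz c)
    also have "z\<^sup>2 / 2 = pi * (1 / (8 * pi * t)) * (norm \<xi>)\<^sup>2" using t unfolding z2 by simp
    finally show "ennreal (\<bar>y \<bullet> \<xi>\<bar> * heat t \<xi>) \<le> ennreal c * ennreal (exp (- (pi * (1 / (8 * pi * t)) * (norm \<xi>)\<^sup>2)))"
      using c by (simp add: ennreal_mult[symmetric])
  qed
  also have "\<dots> = ennreal c * ennreal ((1 / (8 * pi * t)) powr (- real DIM('a) / 2))"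
    using t by (subst nn_integral_cmult, simp, subst nn_integral_gaussian) auto
  also have "\<dots> = ennreal (norm y * (2 * sqrt t * 2 powr (real DIM('a) / 2)))"
  proof -
    have "(4 * pi * t) powr (- real DIM('a) / 2) * (1 / (8 * pi * t)) powr (- real DIM('a) / 2) = 2 powr (real DIM('a) / 2)"
    proof -
      define c where "c = 4 * pi * t"
      have c: "c > 0" "8 * pi * t = 2 * c" using t by (auto simp: c_def)
      have "c powr (- r) * (1 / (2 * c)) powr (- r) = 2 powr r" for r
        using c by (simp add: powr_divide powr_mult powr_minus field_simps)
      from this[of "real DIM('a) / 2"] show ?thesis unfolding c(2) c_def[symmetric] by simp
    qed
    then have "(4 * pi * t) powr (- real DIM('a) / 2) * (1 / (8 * pi * t)) powr (- real DIM('a) / 2) = 2 powr (real DIM('a) / 2)" .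
    then show ?thesis using c unfolding c_def by (simp only: ennreal_mult[symmetric] powr_ge_zero mult.assoc)
  qed
  finally show ?thesis .
qed

text \<open>Inserting \<open>exp (of_real (y \<bullet> \<xi>) * a)\<close> with
  \<open>a = - 2 * pi * \<i> * \<tau>\<close> translates the transform of the heat kernel to
  \<open>x + \<tau> *\<^sub>R y\<close>. Comparing the derivatives of both expressions at
  \<open>\<tau> = 0\<close> gives the transform of the first moment.\<close>

lemma fourier_heat_gradient:
  fixes x y :: "'a::euclidean_space"
  assumes t: "t > 0"
  shows "fourier (\<lambda>\<xi>. of_real ((y \<bullet> \<xi>) * heat t \<xi>)) x
     = - (4 * pi * t * \<i>) * of_real ((x \<bullet> y) * exp (- (t * (4 * pi\<^sup>2 * (norm x)\<^sup>2))))"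
proof -
  define g where "g \<xi> = of_real (heat t \<xi>) * cis (- 2 * pi * (\<xi> \<bullet> x))" for \<xi> :: 'a
  define E where "E a = (LINT \<xi>|lborel. exp (of_real (y \<bullet> \<xi>) * a) * g \<xi>)" for a
  define m where "m = (\<lambda>\<tau>. exp (- (t * (4 * pi\<^sup>2 * (norm (x + \<tau> *\<^sub>R y))\<^sup>2))))"
  have [measurable]: "g \<in> borel_measurable borel" unfolding g_def[abs_def] by measurable
  have int: "integrable lborel (\<lambda>\<xi>. exp (of_real (y \<bullet> \<xi>) * a) * g \<xi>)" for a
  proof -
    have "integrable lborel (\<lambda>\<xi>. of_real ((4 * pi * t) powr (- real DIM('a) / 2)) *
        (exp (of_real (y \<bullet> \<xi>) * a) * cgauss (of_real (1 / (4 * pi * t))) \<xi>) * cis (- 2 * pi * (\<xi> \<bullet> x)))"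
      by (intro integrable_cis_mult integrable_mult_right integrable_exp_cgauss) (use t in auto)
    then show ?thesis unfolding g_def by (simp only: heat_eq_cgauss[OF t] mult_ac)
  qed
  have "(E has_field_derivative (LINT \<xi>|lborel. of_real (y \<bullet> \<xi>) * exp (of_real (y \<bullet> \<xi>) * 0) * g \<xi>)) (at 0)"
    unfolding E_def by (rule exp_integral_DERIV[where S=UNIV]) (use int in auto)
  moreover have "(LINT \<xi>|lborel. of_real (y \<bullet> \<xi>) * exp (of_real (y \<bullet> \<xi>) * 0) * g \<xi>) = fourier (\<lambda>\<xi>. of_real ((y \<bullet> \<xi>) * heat t \<xi>)) x"
    unfolding fourier_def g_def by (simp add: mult_ac)
  ultimately have dE: "(E has_field_derivative (fourier (\<lambda>\<xi>. of_real ((y \<bullet> \<xi>) * heat t \<xi>)) x)) (at (of_real 0 * (- 2 * pi * \<i>)))"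
    by simp
  have "((\<lambda>\<tau>::real. of_real \<tau> * (- 2 * pi * \<i>)) has_vector_derivative (- 2 * pi * \<i>)) (at 0)"
    unfolding has_vector_derivative_def scaleR_conv_of_real
    by (rule bounded_linear_imp_has_derivative, rule bounded_linear_mult_left[THEN bounded_linear_compose, OF bounded_linear_of_real])
  from field_vector_diff_chain_at[OF this dE]
  have d1: "((\<lambda>\<tau>. E (of_real \<tau> * (- 2 * pi * \<i>))) has_vector_derivative
      (- 2 * pi * \<i>) * fourier (\<lambda>\<xi>. of_real ((y \<bullet> \<xi>) * heat t \<xi>)) x) (at 0)" by (simp add: o_def)
  have Em: "E (of_real \<tau> * (- 2 * pi * \<i>)) = of_real (m \<tau>)" for \<tau>
  proof -
    have "exp (of_real (y \<bullet> \<xi>) * (of_real \<tau> * (- 2 * pi * \<i>))) * g \<xi> = of_real (heat t \<xi>) * cis (- 2 * pi * (\<xi> \<bullet> (x + \<tau> *\<^sub>R y)))" for \<xi>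
    proof -
      have e1: "exp (of_real (y \<bullet> \<xi>) * (of_real \<tau> * (- 2 * pi * \<i>))) = cis ((y \<bullet> \<xi>) * (\<tau> * (- 2 * pi)))"
        by (simp add: cis_conv_exp mult_ac)
      have e2: "(y \<bullet> \<xi>) * (\<tau> * (- 2 * pi)) + - 2 * pi * (\<xi> \<bullet> x) = - 2 * pi * (\<xi> \<bullet> (x + \<tau> *\<^sub>R y))"
        by (simp add: inner_add_right inner_commute[of \<xi> y] algebra_simps)
      show ?thesis unfolding g_def e1 by (subst mult.left_commute) (simp only: cis_mult e2)
    qed
    then have "E (of_real \<tau> * (- 2 * pi * \<i>)) = fourier (\<lambda>\<xi>. of_real (heat t \<xi>)) (x + \<tau> *\<^sub>R y)"
      unfolding E_def fourier_def by simp
    then show ?thesis unfolding m_def by (simp add: fourier_heat[OF t])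
  qed
  have nrm: "(norm (x + \<tau> *\<^sub>R y))\<^sup>2 = (norm x)\<^sup>2 + 2 * \<tau> * (x \<bullet> y) + \<tau>\<^sup>2 * (norm y)\<^sup>2" for \<tau>
    unfolding power2_norm_eq_inner by (simp add: inner_add_left inner_add_right inner_commute[of y x] power2_eq_square algebra_simps)
  have "(m has_real_derivative (- (t * (4 * pi\<^sup>2 * (2 * (x \<bullet> y))))) * exp (- (t * (4 * pi\<^sup>2 * (norm x)\<^sup>2)))) (at 0)"
    unfolding m_def nrm by (auto intro!: derivative_eq_intros)
  then have "(m has_vector_derivative (- (t * (4 * pi\<^sup>2 * (2 * (x \<bullet> y))))) * exp (- (t * (4 * pi\<^sup>2 * (norm x)\<^sup>2)))) (at 0)"
    by (simp add: has_real_derivative_iff_has_vector_derivative)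
  from bounded_linear.has_vector_derivative[OF bounded_linear_of_real this]
  have d2: "((\<lambda>\<tau>. complex_of_real (m \<tau>)) has_vector_derivative
      of_real ((- (t * (4 * pi\<^sup>2 * (2 * (x \<bullet> y))))) * exp (- (t * (4 * pi\<^sup>2 * (norm x)\<^sup>2))))) (at 0)" .
  have eq: "(- 2 * pi * \<i>) * fourier (\<lambda>\<xi>. of_real ((y \<bullet> \<xi>) * heat t \<xi>)) x
      = of_real ((- (t * (4 * pi\<^sup>2 * (2 * (x \<bullet> y))))) * exp (- (t * (4 * pi\<^sup>2 * (norm x)\<^sup>2))))"
    using vector_derivative_unique_at[OF d1[unfolded Em] d2] .
  define G where "G = exp (- (t * (4 * pi\<^sup>2 * (norm x)\<^sup>2)))"
  define X where "X = fourier (\<lambda>\<xi>. of_real ((y \<bullet> \<xi>) * heat t \<xi>)) x"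
  have "X = (of_real (- 2 * pi) * \<i>) * X / (of_real (- 2 * pi) * \<i>)" by simp
  also have "\<dots> = of_real ((- (t * (4 * pi\<^sup>2 * (2 * (x \<bullet> y))))) * G) / (of_real (- 2 * pi) * \<i>)"
    unfolding X_def G_def eq ..
  also have "\<dots> = - (4 * pi * t * \<i>) * of_real ((x \<bullet> y) * G)"
    by (simp add: divide_simps power2_eq_square)
  finally show ?thesis unfolding X_def G_def .
qed

section \<open>Fractional powers of quotients of brackets as Fourier multipliers\<close>

text \<open>The square of the usual bracket, with the \<open>2 * pi\<close> of this Fourier
  transform; the Bessel weight of order \<open>s\<close> is
  \<open>jap x powr (s / 2)\<close>.\<close>

definition jap :: "'a::real_normed_vector \<Rightarrow> real" where
  "jap x = 1 + 4 * pi\<^sup>2 * (norm x)\<^sup>2"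

lemma jap_ge_1: "1 \<le> jap x" and jap_pos [simp]: "0 < jap x" and jap_nonneg [simp]: "0 \<le> jap x"
proof -
  have "0 \<le> 4 * pi\<^sup>2 * (norm x)\<^sup>2" by simp
  then show "1 \<le> jap x" "0 < jap x" "0 \<le> jap x" unfolding jap_def by linarith+
qed

lemma borel_measurable_jap [measurable]:
  assumes [measurable]: "f \<in> borel_measurable M"
  shows "(\<lambda>x. jap (f x :: 'a::euclidean_space)) \<in> borel_measurable M"
  unfolding jap_def by measurable

text \<open>Completing the square in the denominator of
  \<open>A / (\<tau> B + A)\<close>, where \<open>A = jap (x + y)\<close> and \<open>B = 1 + b * (4 * pi\<^sup>2 * (norm x)\<^sup>2)\<close>.\<close>

definition res_den :: "real \<Rightarrow> real \<Rightarrow> 'a::euclidean_space \<Rightarrow> real" where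
  "res_den b \<tau> y = (1 + \<tau>) / (1 + \<tau> * b) + 4 * pi\<^sup>2 * (\<tau> * b / (1 + \<tau> * b)\<^sup>2) * (norm y)\<^sup>2"

definition res_num :: "real \<Rightarrow> real \<Rightarrow> 'a::euclidean_space \<Rightarrow> real" where
  "res_num b \<tau> y = 1 - res_den b \<tau> y + 4 * pi\<^sup>2 * (\<tau> * b / (1 + \<tau> * b))\<^sup>2 * (norm y)\<^sup>2"

lemma res_den_ge:
  assumes "b > 0" "\<tau> > 0"
  shows "(1 + \<tau>) / (1 + \<tau> * b) \<le> res_den b \<tau> y" "0 < res_den b \<tau> y"
proof -
  have "0 < 1 + \<tau> * b" using assms by (simp add: add_pos_pos)
  then have "0 < (1 + \<tau>) / (1 + \<tau> * b)" "0 \<le> 4 * pi\<^sup>2 * (\<tau> * b / (1 + \<tau> * b)\<^sup>2) * (norm y)\<^sup>2"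
    using assms by auto
  then show "(1 + \<tau>) / (1 + \<tau> * b) \<le> res_den b \<tau> y" "0 < res_den b \<tau> y" by (auto simp: res_den_def)
qed

text \<open>The denominator \<open>\<tau> * B + jap (x + y)\<close> is \<open>e\<close> times a
  quadratic centred at \<open>X = 0\<close>, and the numerator is that same quadratic plus
  \<open>res_num\<close> plus a term linear in \<open>X\<close>. Division leaves the constant
  \<open>1 / e\<close> and a constant-plus-linear numerator over a resolvent in \<open>X\<close>,
  that is, transforms of heat kernels and of their first moments integrated over time.\<close>

lemma res_identity:
  fixes x y :: "'a::euclidean_space"
  assumes "b > 0" "\<tau> > 0"
  defines "e \<equiv> 1 + \<tau> * b" and "X \<equiv> x + (1 / (1 + \<tau> * b)) *\<^sub>R y"
    and "B \<equiv> 1 + b * (4 * pi\<^sup>2 * (norm x)\<^sup>2)"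
  shows "1 / e + (1 / e) * (res_num b \<tau> y + 8 * pi\<^sup>2 * (\<tau> * b / e) * (X \<bullet> y)) / (res_den b \<tau> y + 4 * pi\<^sup>2 * (norm X)\<^sup>2)
     = (jap (x + y) / B) / (jap (x + y) / B + \<tau>)"
proof -
  have e: "e > 0" using assms(1,2) by (simp add: e_def add_pos_pos)
  define q where "q = \<tau> * b / e"
  have q: "1 - 1 / e = q" "\<tau> * b = e * q" "1/e + q = 1" using e by (auto simp: q_def e_def field_simps)
  have x: "x = X - (1/e) *\<^sub>R y" by (simp add: X_def e_def)
  have xy: "x + y = X + q *\<^sub>R y"
    using q(3) by (simp add: x scaleR_left_diff_distrib q(1)[symmetric])
  have n1: "(norm (x + y))\<^sup>2 = (norm X)\<^sup>2 + 2 * q * (X \<bullet> y) + q\<^sup>2 * (norm y)\<^sup>2"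
    unfolding xy power2_norm_eq_inner by (simp add: inner_add_left inner_add_right inner_commute[of y X] power2_eq_square algebra_simps)
  have n2: "(norm x)\<^sup>2 = (norm X)\<^sup>2 - 2 * (1/e) * (X \<bullet> y) + (1/e)\<^sup>2 * (norm y)\<^sup>2"
    unfolding x power2_norm_eq_inner by (simp add: inner_diff_left inner_diff_right inner_commute[of y X] power2_eq_square algebra_simps)
  have d: "res_den b \<tau> y = (1 + \<tau>) / e + 4 * pi\<^sup>2 * (q / e) * (norm y)\<^sup>2"
    by (simp add: res_den_def e_def[symmetric] q_def power2_eq_square)
  define DD where "DD = res_den b \<tau> y + 4 * pi\<^sup>2 * (norm X)\<^sup>2"
  have DD: "DD > 0" using res_den_ge(2)[OF assms(1,2), of y] by (simp add: DD_def add_pos_nonneg)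
  have A: "jap (x + y) = DD + (res_num b \<tau> y + 8 * pi\<^sup>2 * q * (X \<bullet> y))"
    unfolding jap_def n1 DD_def res_num_def e_def[symmetric] q_def[symmetric] by (simp add: algebra_simps)
  \<comment> \<open>The cross terms in \<open>X \<bullet> y\<close> cancel because
    \<open>X = 0\<close> is the minimum point of the quadratic form
    \<open>(\<tau> * b) * (norm x)\<^sup>2 + (norm (x + y))\<^sup>2\<close>.\<close>
  have TB: "\<tau> * B + jap (x + y) = e * DD"
  proof -
    have "\<tau> * B + jap (x + y) = 1 + \<tau> + 4 * pi\<^sup>2 * ((\<tau> * b) * (norm x)\<^sup>2 + (norm (x + y))\<^sup>2)"
      by (simp add: B_def jap_def algebra_simps)
    also have "(\<tau> * b) * (norm x)\<^sup>2 + (norm (x + y))\<^sup>2 = e * (norm X)\<^sup>2 + q * (norm y)\<^sup>2"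
    proof -
      have "(\<tau> * b) * (norm x)\<^sup>2 + (norm (x + y))\<^sup>2 = (e * q + 1) * (norm X)\<^sup>2
         + (2 * q - 2 * (e * (1/e)) * q) * (X \<bullet> y) + (q * (e * (1/e)) * (1/e) + q * q) * (norm y)\<^sup>2"
        unfolding n1 n2 q(2) by (simp add: algebra_simps power2_eq_square)
      also have "e * (1/e) = 1" using e by simp
      also have "q * 1 * (1/e) + q * q = q" using q(3) by (metis distrib_left mult.right_neutral)
      also have "e * q + 1 = e" using q(2) by (simp add: e_def)
      finally show ?thesis by simp
    qed
    also have "1 + \<tau> + 4 * pi\<^sup>2 * (e * (norm X)\<^sup>2 + q * (norm y)\<^sup>2) = e * DD"
    proof -
      define u v where "u = (1 + \<tau>) / e" and "v = q / e"
      have uv: "1 + \<tau> = e * u" "q = e * v" using e by (auto simp: u_def v_def)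
      have "1 + \<tau> + 4 * pi\<^sup>2 * (e * (norm X)\<^sup>2 + q * (norm y)\<^sup>2) = e * u + 4 * pi\<^sup>2 * (e * (norm X)\<^sup>2 + (e * v) * (norm y)\<^sup>2)"
        by (simp only: uv)
      also have "\<dots> = e * DD" unfolding DD_def d u_def[symmetric] v_def[symmetric] by (simp add: algebra_simps)
      finally show ?thesis .
    qed
    finally show ?thesis .
  qed
  have B: "B > 0" using assms(1) by (simp add: B_def add_pos_nonneg)
  have "(jap (x + y) / B) / (jap (x + y) / B + \<tau>) = jap (x + y) / (\<tau> * B + jap (x + y))"
    using B by (simp add: field_simps)
  also have "\<dots> = 1 / e + (1 / e) * (res_num b \<tau> y + 8 * pi\<^sup>2 * q * (X \<bullet> y)) / DD"
    unfolding TB unfolding A using e DD by (simp add: field_simps)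
  finally show ?thesis by (simp add: DD_def q_def)
qed

text \<open>The left side is the mass of the kernel at fixed \<open>\<tau>\<close>. The aim is a
  bound by the two resolvents \<open>1 / (1 + \<tau> * b)\<close> and
  \<open>1 / (1 + \<tau>)\<close>, both integrable against \<open>gker \<beta>\<close>; they become
  \<open>b powr (- \<beta>)\<close> and 1. The number 64 comes from
  \<open>4 * pi\<^sup>2 \<le> 64\<close>, which needs only \<open>pi < 4\<close>.\<close>

lemma res_norm_bound:
  fixes y :: "'a::euclidean_space"
  assumes b: "b > 0" "\<tau> > 0" and K: "K \<ge> 0"
  defines "e \<equiv> 1 + \<tau> * b" and "D \<equiv> res_den b \<tau> y"
  shows "(1 / e) * (\<bar>res_num b \<tau> y\<bar> / D + K * norm y / sqrt D)
    \<le> (64 + K) * (1 + norm y)\<^sup>2 * (1 / e + 1 / (1 + \<tau>))"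
proof -
  have e: "e > 0" using b by (simp add: e_def add_pos_pos)
  have D: "D > 0" "(1 + \<tau>) / e \<le> D" using res_den_ge[OF b, of y] by (auto simp: D_def e_def)
  have inv: "1 / D \<le> e / (1 + \<tau>)"
    using D e b by (simp add: field_simps)
  define Y where "Y = norm y"
  have Y: "Y \<ge> 0" by (simp add: Y_def)
  have pi64: "4 * pi\<^sup>2 \<le> 64"
  proof -
    have "pi\<^sup>2 \<le> 4\<^sup>2" using pi_less_4 by (intro power_mono) auto
    then show ?thesis by simp
  qed
  have q: "0 \<le> \<tau> * b / e" "\<tau> * b / e \<le> 1" using b e by (auto simp: e_def)
  then have "(\<tau> * b / e)\<^sup>2 \<le> 1" by (simp add: power_le_one)
  then have "4 * pi\<^sup>2 * (\<tau> * b / e)\<^sup>2 * Y\<^sup>2 \<le> 64 * 1 * Y\<^sup>2"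
    by (intro mult_right_mono mult_mono pi64) auto
  moreover have "0 \<le> 4 * pi\<^sup>2 * (\<tau> * b / e)\<^sup>2 * Y\<^sup>2" by simp
  moreover have "res_num b \<tau> y = 1 - D + 4 * pi\<^sup>2 * (\<tau> * b / e)\<^sup>2 * Y\<^sup>2"
    by (simp add: res_num_def D_def Y_def e_def)
  ultimately have N: "\<bar>res_num b \<tau> y\<bar> \<le> D + (1 + 64 * Y\<^sup>2)"
    using D(1) by (intro abs_leI) linarith+
  have "\<bar>res_num b \<tau> y\<bar> / D \<le> (D + (1 + 64 * Y\<^sup>2)) / D" using N D by (intro divide_right_mono) auto
  also have "\<dots> = 1 + (1 + 64 * Y\<^sup>2) * (1 / D)" using D by (simp add: field_simps)
  also have "\<dots> \<le> 1 + (1 + 64 * Y\<^sup>2) * (e / (1 + \<tau>))" by (intro add_left_mono mult_left_mono inv) auto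
  finally have 1: "\<bar>res_num b \<tau> y\<bar> / D \<le> 1 + (1 + 64 * Y\<^sup>2) * (e / (1 + \<tau>))" .
  have "1 / sqrt D \<le> 1 + 1 / D"
  proof (cases "D \<ge> 1")
    case True
    then have "1 \<le> sqrt D" by simp
    then have "1 / sqrt D \<le> 1" by simp
    then show ?thesis using D by (simp add: add_increasing2)
  next
    case False
    then have "D * 1 \<le> sqrt D" using D real_le_rsqrt[of D D] by (simp add: power2_eq_square mult_left_le)
    then have "1 / sqrt D \<le> 1 / D" using D by (simp add: frac_le)
    then show ?thesis by simp
  qed
  also have "\<dots> \<le> 1 + e / (1 + \<tau>)" using inv by simp
  finally have 2: "K * Y * (1 / sqrt D) \<le> K * Y * (1 + e / (1 + \<tau>))"
    using K Y by (intro mult_left_mono) auto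
  have "(1 / e) * (\<bar>res_num b \<tau> y\<bar> / D + K * Y / sqrt D)
     \<le> (1 / e) * ((1 + (1 + 64 * Y\<^sup>2) * (e / (1 + \<tau>))) + K * Y * (1 + e / (1 + \<tau>)))"
    using 1 2 e by (intro mult_left_mono add_mono) auto
  also have "\<dots> = (1 / e) * (1 + K * Y) + (1 / (1 + \<tau>)) * (1 + 64 * Y\<^sup>2 + K * Y)"
  proof -
    define v where "v = 1 + \<tau>"
    have "v > 0" using b by (simp add: v_def)
    then show ?thesis unfolding v_def[symmetric] using e by (simp add: field_simps)
  qed
  also have "\<dots> \<le> (1 / e) * ((64 + K) * (1 + Y)\<^sup>2) + (1 / (1 + \<tau>)) * ((64 + K) * (1 + Y)\<^sup>2)"
  proof (intro add_mono mult_left_mono)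
    have "0 \<le> K * Y" "0 \<le> K * Y\<^sup>2" using K Y by auto
    moreover have "(64 + K) * (1 + Y)\<^sup>2 = 64 + 128 * Y + 64 * Y\<^sup>2 + K + 2 * (K * Y) + K * Y\<^sup>2"
      by (simp add: power2_eq_square algebra_simps)
    ultimately show "1 + K * Y \<le> (64 + K) * (1 + Y)\<^sup>2" "1 + 64 * Y\<^sup>2 + K * Y \<le> (64 + K) * (1 + Y)\<^sup>2"
      using K Y by auto
  qed (use e b in auto)
  finally show ?thesis unfolding Y_def by (simp add: algebra_simps)
qed

text \<open>The pair \<open>p\<close> is \<open>(\<tau>, t)\<close>: \<open>\<tau>\<close> averages
  the resolvents to a fractional power, and \<open>t\<close> is the heat time that writes
  \<open>1 / (res_den b \<tau> y + 4 * pi\<^sup>2 * (norm X)\<^sup>2)\<close> as a Laplace integral.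
  The modulation moves \<open>x\<close> to the centre \<open>X\<close>, and the imaginary
  coefficient cancels the factor \<open>- 4 * pi * t * \<i>\<close> in the transform of the first
  moment.\<close>

definition res_kernel :: "real \<Rightarrow> real \<Rightarrow> 'a::euclidean_space \<Rightarrow> real \<times> real \<Rightarrow> 'a \<Rightarrow> complex" where
  "res_kernel \<beta> b y p \<xi> = of_real (gker \<beta> (fst p) / (Gamma \<beta> * Gamma (1 - \<beta>) * (1 + fst p * b))
       * (gker 1 (snd p) * exp (- (snd p * res_den b (fst p) y))))
     * (cis (2 * pi * ((- (1 / (1 + fst p * b)) *\<^sub>R y) \<bullet> \<xi>))
     * (of_real (res_num b (fst p) y) * of_real (heat (snd p) \<xi>)
        + (of_real (8 * pi\<^sup>2 * (fst p * b / (1 + fst p * b)) / (4 * pi * snd p)) * \<i>) * of_real ((y \<bullet> \<xi>) * heat (snd p) \<xi>)))"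

lemma borel_measurable_res_kernel [measurable]:
  assumes [measurable]: "f \<in> borel_measurable M" "p \<in> borel_measurable M" "g \<in> borel_measurable M"
  shows "(\<lambda>x. res_kernel \<beta> b (f x :: 'a::euclidean_space) (p x) (g x)) \<in> borel_measurable M"
proof -
  have [measurable]: "(\<lambda>x. fst (p x)) \<in> borel_measurable M" "(\<lambda>x. snd (p x)) \<in> borel_measurable M"
    using assms(2) unfolding borel_prod[symmetric] by measurable
  show ?thesis unfolding res_kernel_def res_num_def res_den_def by measurable
qed

context
  fixes \<beta> b :: real and y :: "'a::euclidean_space"
  assumes \<beta>: "0 < \<beta>" "\<beta> < 1" and b: "b > 0"
begin

lemma fourier_res_kernel:
  fixes x :: 'a
  defines "X \<equiv> \<lambda>\<tau>. x + (1 / (1 + \<tau> * b)) *\<^sub>R y"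
  shows "fourier (res_kernel \<beta> b y (\<tau>, t)) x
    = of_real (gker \<beta> \<tau> / (Gamma \<beta> * Gamma (1 - \<beta>) * (1 + \<tau> * b))
        * (res_num b \<tau> y + 8 * pi\<^sup>2 * (\<tau> * b / (1 + \<tau> * b)) * (X \<tau> \<bullet> y))
        * (gker 1 t * exp (- (t * (res_den b \<tau> y + 4 * pi\<^sup>2 * (norm (X \<tau>))\<^sup>2)))))"
proof (cases "0 < t")
  case False
  then have "gker 1 t = 0" by (simp add: gker_def)
  then show ?thesis by (simp add: res_kernel_def fourier_def)
next
  case t: True
  have g: "integrable lborel (\<lambda>\<xi>. complex_of_real ((y \<bullet> \<xi>) * heat t \<xi>))"
  proof (rule integrableI_bounded)
    have "(\<integral>\<^sup>+\<xi>. ennreal (norm (complex_of_real ((y \<bullet> \<xi>) * heat t \<xi>))) \<partial>lborel) = (\<integral>\<^sup>+\<xi>. ennreal (\<bar>y \<bullet> \<xi>\<bar> * heat t \<xi>) \<partial>lborel)"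
      by (simp add: norm_mult)
    also have "\<dots> < \<infinity>" using heat_moment[OF t, of y] by (rule le_less_trans) simp
    finally show "(\<integral>\<^sup>+\<xi>. ennreal (norm (complex_of_real ((y \<bullet> \<xi>) * heat t \<xi>))) \<partial>lborel) < \<infinity>" .
  qed measurable
  have h: "integrable lborel (\<lambda>\<xi>. complex_of_real (heat t (\<xi>::'a)))"
    using integrable_heat[OF t, where 'a='a] by simp
  define e where "e = 1 + \<tau> * b"
    define q where "q = \<tau> * b / e"
  have XX: "x - (- (1 / e) *\<^sub>R y) = X \<tau>" by (simp add: X_def e_def)
  have cc: "of_real (8 * pi\<^sup>2 * q / (4 * pi * t)) * \<i> * (- (4 * pi * t * \<i>) * of_real w)
      = complex_of_real (8 * pi\<^sup>2 * q * w)" for w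
    using t by (simp add: field_simps)
  define G where "G = exp (- (t * (4 * pi\<^sup>2 * (norm (X \<tau>))\<^sup>2)))"
  have "fourier (res_kernel \<beta> b y (\<tau>, t)) x
    = of_real (gker \<beta> \<tau> / (Gamma \<beta> * Gamma (1 - \<beta>) * e) * (gker 1 t * exp (- (t * res_den b \<tau> y))))
     * (of_real (res_num b \<tau> y) * fourier (\<lambda>\<xi>. of_real (heat t \<xi>)) (X \<tau>)
        + of_real (8 * pi\<^sup>2 * q / (4 * pi * t)) * \<i> * fourier (\<lambda>\<xi>. of_real ((y \<bullet> \<xi>) * heat t \<xi>)) (X \<tau>))"
    unfolding res_kernel_def fst_conv snd_conv fourier_cmult fourier_modulate e_def[symmetric] q_def[symmetric] XX
    by (subst fourier_add) (use g h in \<open>auto simp only: fourier_cmult intro!: integrable_mult_right\<close>)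
  also have "\<dots> = of_real (gker \<beta> \<tau> / (Gamma \<beta> * Gamma (1 - \<beta>) * e) * (gker 1 t * exp (- (t * res_den b \<tau> y))))
     * (of_real (res_num b \<tau> y) * of_real G + of_real (8 * pi\<^sup>2 * q * ((X \<tau> \<bullet> y) * G)))"
    unfolding fourier_heat[OF t] fourier_heat_gradient[OF t] cc G_def ..
  also have "\<dots> = of_real (gker \<beta> \<tau> / (Gamma \<beta> * Gamma (1 - \<beta>) * e) * (res_num b \<tau> y + 8 * pi\<^sup>2 * q * (X \<tau> \<bullet> y))
        * (gker 1 t * (exp (- (t * res_den b \<tau> y)) * G)))"
    unfolding of_real_mult[symmetric] of_real_add[symmetric] of_real_eq_iff by (simp only: ring_distribs mult_ac)
  also have "exp (- (t * res_den b \<tau> y)) * G = exp (- (t * (res_den b \<tau> y + 4 * pi\<^sup>2 * (norm (X \<tau>))\<^sup>2)))"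
    by (simp add: G_def mult_exp_exp algebra_simps)
  finally show ?thesis by (simp only: e_def q_def)
qed

text \<open>The integrations are done in the order \<open>\<xi>\<close>, \<open>t\<close>,
  \<open>\<tau>\<close>: mass and first moment of the heat kernel, then Gamma integrals of orders 1
  and \<open>1/2\<close> producing \<open>1 / D\<close> and \<open>sqrt pi / sqrt D\<close>, then
  the resolvent averages.\<close>

lemma nn_integral_res_kernel:
  fixes K :: real
  defines "K \<equiv> 4 * pi * 2 powr (real DIM('a) / 2) * sqrt pi"
  shows "(\<integral>\<^sup>+p. \<integral>\<^sup>+\<xi>. norm (res_kernel \<beta> b y p \<xi>) \<partial>lborel \<partial>lborel)
     \<le> ennreal ((64 + K) * (1 + norm y)\<^sup>2 * (1 + b powr (- \<beta>)))"
proof -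
  define c where "c = Gamma \<beta> * Gamma (1 - \<beta>)"
  have c: "c > 0" using \<beta> by (simp add: c_def)
  define K0 where "K0 = 4 * pi * 2 powr (real DIM('a) / 2)"
  have K0: "K0 \<ge> 0" "K = K0 * sqrt pi" by (auto simp: K0_def K_def)
  have K: "K \<ge> 0" by (simp add: K_def)
  define Y where "Y = (64 + K) * (1 + norm y)\<^sup>2"
  have Y: "Y \<ge> 0" using K by (simp add: Y_def)
  have inner: "(\<integral>\<^sup>+\<xi>. norm (res_kernel \<beta> b y (\<tau>, t) \<xi>) \<partial>lborel)
     \<le> ennreal (gker \<beta> \<tau> / (c * (1 + \<tau> * b)) * \<bar>res_num b \<tau> y\<bar>) * ennreal (gker 1 t * exp (- (t * res_den b \<tau> y)))
      + ennreal (gker \<beta> \<tau> / (c * (1 + \<tau> * b)) * (K0 * norm y)) * ennreal (gker (1/2) t * exp (- (t * res_den b \<tau> y)))"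
    for \<tau> t
  proof (cases "\<tau> > 0 \<and> t > 0")
    case False
    then have "gker \<beta> \<tau> = 0 \<or> gker 1 t = 0" by (auto simp: gker_def)
    then show ?thesis by (auto simp: res_kernel_def)
  next
    case True
    then have \<tau>: "\<tau> > 0" and t: "t > 0" by auto
    define e where "e = 1 + \<tau> * b"
    define q where "q = \<tau> * b / e"
    have e: "e > 0" using \<tau> b by (simp add: e_def add_pos_pos)
    have q: "0 \<le> q" "q \<le> 1" using \<tau> b e by (auto simp: q_def e_def)
    define G where "G = gker \<beta> \<tau> / (c * e) * (gker 1 t * exp (- (t * res_den b \<tau> y)))"
    have G: "G \<ge> 0" using c e by (simp add: G_def)
    define Q where "Q = 8 * pi\<^sup>2 * q / (4 * pi * t)"
    have Q: "Q \<ge> 0" using t q by (simp add: Q_def)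
    have "(\<integral>\<^sup>+\<xi>. norm (res_kernel \<beta> b y (\<tau>, t) \<xi>) \<partial>lborel)
      \<le> (\<integral>\<^sup>+\<xi>. ennreal (G * \<bar>res_num b \<tau> y\<bar>) * ennreal (heat t \<xi>) + ennreal (G * Q) * ennreal (\<bar>y \<bullet> \<xi>\<bar> * heat t \<xi>) \<partial>lborel)"
    proof (rule nn_integral_mono)
      fix \<xi> :: 'a
      have "norm (res_kernel \<beta> b y (\<tau>, t) \<xi>)
         = G * norm (of_real (res_num b \<tau> y) * of_real (heat t \<xi>) + (of_real Q * \<i>) * of_real ((y \<bullet> \<xi>) * heat t \<xi>))"
        unfolding res_kernel_def fst_conv snd_conv norm_mult[of "of_real _" "cis _ * _"] norm_mult[of "cis _" "_"]
          c_def[symmetric] e_def[symmetric] q_def[symmetric] G_def[symmetric] Q_def[symmetric]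
        using G by simp
      also have "\<dots> \<le> G * (\<bar>res_num b \<tau> y\<bar> * heat t \<xi> + Q * (\<bar>y \<bullet> \<xi>\<bar> * heat t \<xi>))"
        by (intro mult_left_mono G order_trans[OF norm_triangle_ineq]) (use Q in \<open>simp add: norm_mult abs_mult\<close>)
      finally show "ennreal (norm (res_kernel \<beta> b y (\<tau>, t) \<xi>))
         \<le> ennreal (G * \<bar>res_num b \<tau> y\<bar>) * ennreal (heat t \<xi>) + ennreal (G * Q) * ennreal (\<bar>y \<bullet> \<xi>\<bar> * heat t \<xi>)"
        using G Q by (simp add: ennreal_mult[symmetric] ennreal_plus[symmetric] distrib_left mult.assoc del: ennreal_plus)
    qed
    also have "\<dots> = ennreal (G * \<bar>res_num b \<tau> y\<bar>) + ennreal (G * Q) * (\<integral>\<^sup>+\<xi>. ennreal (\<bar>y \<bullet> \<xi>\<bar> * heat t \<xi>) \<partial>lborel)"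
      by (simp add: nn_integral_add nn_integral_cmult nn_integral_heat[OF t])
    also have "\<dots> \<le> ennreal (G * \<bar>res_num b \<tau> y\<bar>) + ennreal (G * Q) * ennreal (norm y * (2 * sqrt t * 2 powr (real DIM('a) / 2)))"
      by (intro add_left_mono mult_left_mono heat_moment[OF t]) simp
    also have "\<dots> \<le> ennreal (gker \<beta> \<tau> / (c * e) * \<bar>res_num b \<tau> y\<bar>) * ennreal (gker 1 t * exp (- (t * res_den b \<tau> y)))
      + ennreal (gker \<beta> \<tau> / (c * e) * (K0 * norm y)) * ennreal (gker (1/2) t * exp (- (t * res_den b \<tau> y)))"
    proof (rule add_mono)
      show "ennreal (G * \<bar>res_num b \<tau> y\<bar>) \<le> ennreal (gker \<beta> \<tau> / (c * e) * \<bar>res_num b \<tau> y\<bar>) * ennreal (gker 1 t * exp (- (t * res_den b \<tau> y)))"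
        using c e by (simp add: G_def ennreal_mult[symmetric] mult_ac)
      \<comment> \<open>The factor \<open>1 / t\<close> of the gradient term against a moment of
        order \<open>sqrt t\<close> leaves \<open>gker (1/2)\<close>, whose Gamma integral
        contributes the \<open>sqrt pi\<close> in \<open>K\<close>.\<close>
      have g: "gker (1/2) t = sqrt t / t" using t by (simp add: gker_def powr_minus_divide powr_half_sqrt real_div_sqrt field_simps)
      have g1: "gker 1 t = 1" using t by (simp add: gker_def)
      have "Q * (norm y * (2 * sqrt t * 2 powr (real DIM('a) / 2))) = q * ((K0 * norm y) * gker (1/2) t)"
        using t by (simp add: Q_def K0_def g field_simps power2_eq_square)
      also have "\<dots> \<le> 1 * ((K0 * norm y) * gker (1/2) t)"
        using q K0 by (intro mult_right_mono) auto
      finally have le: "Q * (norm y * (2 * sqrt t * 2 powr (real DIM('a) / 2))) \<le> (K0 * norm y) * gker (1/2) t" by simp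
      have "ennreal (G * Q) * ennreal (norm y * (2 * sqrt t * 2 powr (real DIM('a) / 2))) = ennreal (G * (Q * (norm y * (2 * sqrt t * 2 powr (real DIM('a) / 2)))))"
        using G Q t by (simp add: ennreal_mult[symmetric] mult.assoc)
      also have "\<dots> \<le> ennreal (G * ((K0 * norm y) * gker (1/2) t))"
        by (intro ennreal_leI mult_left_mono le G)
      also have "\<dots> = ennreal (gker \<beta> \<tau> / (c * e) * (K0 * norm y)) * ennreal (gker (1/2) t * exp (- (t * res_den b \<tau> y)))"
        using c e K0 by (simp add: G_def g1 ennreal_mult[symmetric] mult_ac)
      finally show "ennreal (G * Q) * ennreal (norm y * (2 * sqrt t * 2 powr (real DIM('a) / 2)))
        \<le> ennreal (gker \<beta> \<tau> / (c * e) * (K0 * norm y)) * ennreal (gker (1/2) t * exp (- (t * res_den b \<tau> y)))" .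
    qed
    finally show ?thesis unfolding e_def .
  qed
  have mid: "(\<integral>\<^sup>+t. \<integral>\<^sup>+\<xi>. norm (res_kernel \<beta> b y (\<tau>, t) \<xi>) \<partial>lborel \<partial>lborel)
     \<le> ennreal (Y / c) * (ennreal (gker \<beta> \<tau> * ((1/b) / (1/b + \<tau>))) + ennreal (gker \<beta> \<tau> * (1 / (1 + \<tau>))))" for \<tau>
  proof (cases "\<tau> > 0")
    case False
    then have "res_kernel \<beta> b y (\<tau>, t) \<xi> = 0" for t \<xi> by (simp add: res_kernel_def gker_def)
    then show ?thesis by simp
  next
    case \<tau>: True
    define e D where "e = 1 + \<tau> * b" and "D = res_den b \<tau> y"
    have e: "e > 0" using \<tau> b by (simp add: e_def add_pos_pos)
    have D: "D > 0" using res_den_ge(2)[OF b \<tau>] by (simp add: D_def)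
    define g where "g = gker \<beta> \<tau> / c"
    have g: "g \<ge> 0" using c by (simp add: g_def)
    have ge: "gker \<beta> \<tau> / (c * e) = g / e" by (simp add: g_def)
    have "(\<integral>\<^sup>+t. \<integral>\<^sup>+\<xi>. norm (res_kernel \<beta> b y (\<tau>, t) \<xi>) \<partial>lborel \<partial>lborel)
      \<le> (\<integral>\<^sup>+t. ennreal (g / e * \<bar>res_num b \<tau> y\<bar>) * ennreal (gker 1 t * exp (- (t * D)))
      + ennreal (g / e * (K0 * norm y)) * ennreal (gker (1/2) t * exp (- (t * D))) \<partial>lborel)"
      using inner[of \<tau>] by (intro nn_integral_mono) (simp only: e_def[symmetric] D_def[symmetric] ge)
    also have "\<dots> = ennreal (g / e * \<bar>res_num b \<tau> y\<bar>) * ennreal (1 / D)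
      + ennreal (g / e * (K0 * norm y)) * ennreal (sqrt pi / sqrt D)"
      using D by (simp add: nn_integral_add nn_integral_cmult nn_integral_gker_exp Gamma_one_half_real powr_minus_divide powr_half_sqrt)
    also have "\<dots> = ennreal (g * ((1 / e) * (\<bar>res_num b \<tau> y\<bar> / D + K * norm y / sqrt D)))"
      using g e D K0 by (simp add: ennreal_mult[symmetric] ennreal_plus[symmetric] ring_distribs mult_ac del: ennreal_plus)
    also have "\<dots> \<le> ennreal (g * (Y * (1 / e + 1 / (1 + \<tau>))))"
      unfolding Y_def e_def D_def by (intro ennreal_leI mult_left_mono res_norm_bound b \<tau> K g)
    also have "g * (Y * (1 / e + 1 / (1 + \<tau>))) = (Y / c) * (gker \<beta> \<tau> * ((1/b) / (1/b + \<tau>)) + gker \<beta> \<tau> * (1 / (1 + \<tau>)))"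
    proof -
      have "(1/b) / (1/b + \<tau>) = 1 / e" using b \<tau> by (simp add: e_def field_simps)
      then show ?thesis by (simp only: g_def) (simp add: field_simps)
    qed
    also have "ennreal \<dots> = ennreal (Y / c) * (ennreal (gker \<beta> \<tau> * ((1/b) / (1/b + \<tau>))) + ennreal (gker \<beta> \<tau> * (1 / (1 + \<tau>))))"
      using Y c b \<tau> by (subst ennreal_mult) (auto intro!: add_nonneg_nonneg mult_nonneg_nonneg)
    finally show ?thesis .
  qed
  have "(\<integral>\<^sup>+p. \<integral>\<^sup>+\<xi>. norm (res_kernel \<beta> b y p \<xi>) \<partial>lborel \<partial>lborel)
     = (\<integral>\<^sup>+\<tau>. \<integral>\<^sup>+t. \<integral>\<^sup>+\<xi>. norm (res_kernel \<beta> b y (\<tau>, t) \<xi>) \<partial>lborel \<partial>lborel \<partial>lborel)"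
    by (subst nn_integral_lborel_fst) simp_all
  also have "\<dots> \<le> (\<integral>\<^sup>+\<tau>. ennreal (Y / c) * (ennreal (gker \<beta> \<tau> * ((1/b) / (1/b + \<tau>))) + ennreal (gker \<beta> \<tau> * (1 / (1 + \<tau>)))) \<partial>lborel)"
    by (intro nn_integral_mono mid)
  also have "\<dots> = ennreal (Y / c) * (ennreal (c * (1/b) powr \<beta>) + ennreal (c * 1 powr \<beta>))"
    unfolding c_def using \<beta> b nn_integral_gker_resolvent[of \<beta> "1/b"] nn_integral_gker_resolvent[of \<beta> 1]
    by (simp add: nn_integral_cmult nn_integral_add del: times_divide_eq_right)
  also have "\<dots> = ennreal (Y * (1 + b powr (- \<beta>)))"
    using Y c b by (simp add: ennreal_mult[symmetric] ennreal_plus[symmetric] powr_divide powr_minus field_simps del: ennreal_plus)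
  finally show ?thesis by (simp add: Y_def)
qed

end

text \<open>Averaging the resolvent identity over \<open>\<tau>\<close> with weight
  \<open>gker \<beta>\<close> turns \<open>r / (r + \<tau>)\<close> into
  \<open>r powr \<beta>\<close> for the bracket quotient \<open>r\<close>. The quotient tends to
  \<open>1 / b\<close> at infinity, so its power is not the transform of an integrable function; the
  constant \<open>b powr (- \<beta>)\<close> is split off. Later uses take \<open>b = 1\<close> with
  varying \<open>y\<close> for modulations, and \<open>y = 0\<close> with other \<open>b\<close> for
  changes of scale.\<close>

theorem bracket_quotient_kernel:
  fixes \<beta> :: real
  assumes \<beta>: "0 < \<beta>" "\<beta> < 1"
  obtains K :: real where "K > 0"
    and "\<And>b. b > 0 \<Longrightarrow> \<exists>\<kappa> :: 'a::euclidean_space \<Rightarrow> 'a \<Rightarrow> complex.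
        case_prod \<kappa> \<in> borel_measurable (borel \<Otimes>\<^sub>M borel) \<and> (\<forall>y. integrable lborel (\<kappa> y)) \<and>
        (\<forall>y. (\<integral>\<^sup>+\<xi>. norm (\<kappa> y \<xi>) \<partial>lborel) \<le> ennreal (K * (1 + norm y)\<^sup>2 * (1 + b powr (- \<beta>)))) \<and>
        (\<forall>x y. of_real (b powr (- \<beta>)) + fourier (\<kappa> y) x
            = of_real ((jap (x + y) / (1 + b * (4 * pi\<^sup>2 * (norm x)\<^sup>2))) powr \<beta>))"
proof
  define K where "K = 64 + 4 * pi * 2 powr (real DIM('a) / 2) * sqrt pi"
  show "K > 0" unfolding K_def by (intro add_pos_nonneg) auto
  fix b :: real assume b: "b > 0"
  define \<kappa> where "\<kappa> y \<xi> = (LINT p|lborel. res_kernel \<beta> b y p \<xi>)" for y \<xi> :: 'a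
  have bd: "(\<integral>\<^sup>+p. \<integral>\<^sup>+\<xi>. norm (res_kernel \<beta> b y p \<xi>) \<partial>lborel \<partial>lborel)
     \<le> ennreal (K * (1 + norm y)\<^sup>2 * (1 + b powr (- \<beta>)))" for y :: 'a
    unfolding K_def by (rule nn_integral_res_kernel[OF \<beta> b])
  have m: "case_prod (res_kernel \<beta> b y) \<in> borel_measurable (borel \<Otimes>\<^sub>M borel)" for y :: 'a
    by measurable
  define c where "c = Gamma \<beta> * Gamma (1 - \<beta>)"
  have c: "c > 0" using \<beta> by (simp add: c_def)
  show "\<exists>\<kappa> :: 'a \<Rightarrow> 'a \<Rightarrow> complex. case_prod \<kappa> \<in> borel_measurable (borel \<Otimes>\<^sub>M borel) \<and> (\<forall>y. integrable lborel (\<kappa> y)) \<and>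
        (\<forall>y. (\<integral>\<^sup>+\<xi>. norm (\<kappa> y \<xi>) \<partial>lborel) \<le> ennreal (K * (1 + norm y)\<^sup>2 * (1 + b powr (- \<beta>)))) \<and>
        (\<forall>x y. of_real (b powr (- \<beta>)) + fourier (\<kappa> y) x
            = of_real ((jap (x + y) / (1 + b * (4 * pi\<^sup>2 * (norm x)\<^sup>2))) powr \<beta>))"
  proof (intro exI[of _ \<kappa>] conjI allI)
    show "case_prod \<kappa> \<in> borel_measurable (borel \<Otimes>\<^sub>M borel)" unfolding \<kappa>_def by measurable
    show "integrable lborel (\<kappa> y)" for y unfolding \<kappa>_def[abs_def] by (rule fourier_mix(1)[OF m bd])
    show "(\<integral>\<^sup>+\<xi>. norm (\<kappa> y \<xi>) \<partial>lborel) \<le> ennreal (K * (1 + norm y)\<^sup>2 * (1 + b powr (- \<beta>)))" for y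
      unfolding \<kappa>_def by (rule fourier_mix(2)[OF m bd])
    fix x y :: 'a
    define B where "B = 1 + b * (4 * pi\<^sup>2 * (norm x)\<^sup>2)"
    have B: "B > 0" using b by (simp add: B_def add_pos_nonneg)
    define r where "r = jap (x + y) / B"
    have r: "r > 0" using B by (simp add: r_def)
    have "fourier (\<kappa> y) x = (LINT p|lborel. fourier (res_kernel \<beta> b y p) x)"
      unfolding \<kappa>_def[abs_def] by (rule fourier_mix(3)[OF m bd])
    also have "\<dots> = (LINT \<tau>|lborel. LINT t|lborel. fourier (res_kernel \<beta> b y (\<tau>, t)) x)"
      by (rule lborel_prod_integral, rule fourier_mix(4)[OF m bd])
    also have "\<dots> = (LINT \<tau>|lborel. complex_of_real ((1 / c) * (gker \<beta> \<tau> * (r / (r + \<tau>)) - gker \<beta> \<tau> * ((1/b) / (1/b + \<tau>)))))"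
    proof (rule Bochner_Integration.integral_cong[OF refl])
      fix \<tau>
      show "(LINT t|lborel. fourier (res_kernel \<beta> b y (\<tau>, t)) x)
        = complex_of_real ((1 / c) * (gker \<beta> \<tau> * (r / (r + \<tau>)) - gker \<beta> \<tau> * ((1/b) / (1/b + \<tau>))))"
      proof (cases "\<tau> > 0")
        case False
        then show ?thesis by (simp add: res_kernel_def gker_def fourier_def)
      next
        case \<tau>: True
        define e where "e = 1 + \<tau> * b"
        define X where "X = x + (1 / (1 + \<tau> * b)) *\<^sub>R y"
        define DD where "DD = res_den b \<tau> y + 4 * pi\<^sup>2 * (norm X)\<^sup>2"
        define E where "E = res_num b \<tau> y + 8 * pi\<^sup>2 * (\<tau> * b / e) * (X \<bullet> y)"
        have e: "e > 0" using \<tau> b by (simp add: e_def add_pos_pos)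
        have DD: "DD > 0" using res_den_ge(2)[OF b \<tau>, of y] by (simp add: DD_def add_pos_nonneg)
        have "(LINT t|lborel. fourier (res_kernel \<beta> b y (\<tau>, t)) x)
          = (LINT t|lborel. complex_of_real (gker \<beta> \<tau> / (c * e) * E * (gker 1 t * exp (- (t * DD)))))"
          unfolding fourier_res_kernel[OF \<beta> b] c_def e_def E_def DD_def X_def ..
        also have "\<dots> = complex_of_real (gker \<beta> \<tau> / (c * e) * E * (1 / DD))"
          unfolding integral_complex_of_real using integral_gker_exp[of 1 DD] DD by (simp add: powr_minus_divide)
        also have "gker \<beta> \<tau> / (c * e) * E * (1 / DD) = (1 / c) * (gker \<beta> \<tau> * ((1 / e) * E / DD))"
          by simp
        \<comment> \<open>The part \<open>1 / e\<close>, which does not decay in \<open>x\<close>,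
          is itself the resolvent at \<open>1 / b\<close>; its average is the constant
          \<open>b powr (- \<beta>)\<close>.\<close>
        also have "(1 / e) * E / DD = r / (r + \<tau>) - (1/b) / (1/b + \<tau>)"
        proof -
          have "1 / e + (1 / e) * E / DD = r / (r + \<tau>)"
            using res_identity[OF b \<tau>, of y x] unfolding r_def B_def e_def E_def DD_def X_def .
          moreover have "(1/b) / (1/b + \<tau>) = 1 / e" using b \<tau> by (simp add: e_def field_simps)
          ultimately show ?thesis by simp
        qed
        finally show ?thesis by (simp only: right_diff_distrib)
      qed
    qed
    also have "\<dots> = complex_of_real ((1 / c) * (c * r powr \<beta> - c * (1/b) powr \<beta>))"
      using integrable_gker_resolvent[OF \<beta> r] integrable_gker_resolvent[OF \<beta>, of "1/b"]
        integral_gker_resolvent[OF \<beta> r] integral_gker_resolvent[OF \<beta>, of "1/b"] b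
      unfolding c_def[symmetric] integral_complex_of_real by (simp del: times_divide_eq_right)
    also have "\<dots> = complex_of_real (r powr \<beta> - b powr (- \<beta>))"
      using c b by (simp add: powr_divide powr_minus field_simps)
    finally show "of_real (b powr (- \<beta>)) + fourier (\<kappa> y) x
            = of_real ((jap (x + y) / (1 + b * (4 * pi\<^sup>2 * (norm x)\<^sup>2))) powr \<beta>)"
      by (simp add: r_def B_def)
  qed
qed

section \<open>Bracket quotients of arbitrary order acting on L^1 and L^u\<close>

lemma powr_add_superadditive:
  fixes a b u :: real
  assumes "0 \<le> a" "0 \<le> b" "1 \<le> u"
  shows "a powr u + b powr u \<le> (a + b) powr u"
proof (cases "a + b = 0")
  case True
  then have "a = 0" "b = 0" using assms by auto
  then show ?thesis by simp
next
  case False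
  then have ab: "a + b > 0" using assms by auto
  have *: "x powr u \<le> x * (a + b) powr (u - 1)" if "0 \<le> x" "x \<le> a + b" for x
  proof (cases "x = 0")
    case False
    then have "x powr u = x * x powr (u - 1)" using that by (simp add: powr_diff)
    also have "\<dots> \<le> x * (a + b) powr (u - 1)"
      using that assms by (intro mult_left_mono powr_mono2) auto
    finally show ?thesis .
  qed simp
  have "a powr u + b powr u \<le> a * (a + b) powr (u - 1) + b * (a + b) powr (u - 1)"
    using assms by (intro add_mono *) auto
  also have "\<dots> = (a + b) * (a + b) powr (u - 1)" by (simp add: distrib_right)
  also have "\<dots> = (a + b) powr u" using ab by (simp add: powr_diff)
  finally show ?thesis .
qed

lemma powr_add_le:
  fixes a b u :: real
  assumes "0 \<le> a" "0 \<le> b" "0 \<le> u"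
  shows "(a + b) powr u \<le> 2 powr u * (a powr u + b powr u)"
proof -
  have "(a + b) powr u \<le> (2 * max a b) powr u" using assms by (intro powr_mono2) auto
  also have "\<dots> = 2 powr u * (max a b) powr u" using assms by (simp add: powr_mult)
  also have "\<dots> \<le> 2 powr u * (a powr u + b powr u)"
    by (intro mult_left_mono) (auto simp: max_def)
  finally show ?thesis .
qed

text \<open>The parameter \<open>y\<close> is carried along so that the result can be integrated in \<open>y\<close> afterwards.\<close>

lemma multiplier_step:
  fixes G \<kappa> :: "'a::euclidean_space \<Rightarrow> 'a \<Rightarrow> complex" and B M L :: "'a \<Rightarrow> real"
  assumes u: "1 < u"
    and G: "case_prod G \<in> borel_measurable (borel \<Otimes>\<^sub>M borel)" "\<And>y. integrable lborel (G y)"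
      "\<And>y. (\<integral>\<^sup>+\<xi>. norm (G y \<xi>) powr u \<partial>lborel) \<le> ennreal (B y powr u)" "\<And>y. 0 < B y"
      "\<And>y. (\<integral>\<^sup>+\<xi>. norm (G y \<xi>) \<partial>lborel) \<le> ennreal (L y)" "\<And>y. 0 \<le> L y"
    and \<kappa>: "case_prod \<kappa> \<in> borel_measurable (borel \<Otimes>\<^sub>M borel)" "\<And>y. integrable lborel (\<kappa> y)"
      "\<And>y. (\<integral>\<^sup>+\<xi>. norm (\<kappa> y \<xi>) \<partial>lborel) \<le> ennreal (M y)" "\<And>y. 0 \<le> M y"
  shows "\<exists>G'. case_prod G' \<in> borel_measurable (borel \<Otimes>\<^sub>M borel) \<and> (\<forall>y. integrable lborel (G' y)) \<and>
      (\<forall>y. (\<integral>\<^sup>+\<xi>. norm (G' y \<xi>) powr u \<partial>lborel) \<le> ennreal ((2 * (norm c + M y) * B y) powr u)) \<and>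
      (\<forall>y. (\<integral>\<^sup>+\<xi>. norm (G' y \<xi>) \<partial>lborel) \<le> ennreal (2 * (norm c + M y) * L y)) \<and>
      (\<forall>y x. fourier (G' y) x = (c + fourier (\<kappa> y) x) * fourier (G y) x)"
proof (intro exI[of _ "\<lambda>y \<xi>. c * G y \<xi> + convol (\<kappa> y) (G y) \<xi>"] conjI allI)
  note [measurable] = G(1) \<kappa>(1)
  have [measurable]: "G y \<in> borel_measurable borel" "\<kappa> y \<in> borel_measurable borel" for y
    using G(2)[of y] \<kappa>(2)[of y] by auto
  show "(\<lambda>(y, \<xi>). c * G y \<xi> + convol (\<kappa> y) (G y) \<xi>) \<in> borel_measurable (borel \<Otimes>\<^sub>M borel)"
    unfolding convol_def by measurable
  have ic: "integrable lborel (convol (\<kappa> y) (G y))" for y by (rule integrable_convol[OF \<kappa>(2) G(2)])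
  show "integrable lborel (\<lambda>\<xi>. c * G y \<xi> + convol (\<kappa> y) (G y) \<xi>)" for y
    using ic G(2) by (intro Bochner_Integration.integrable_add integrable_mult_right) auto
  show "fourier (\<lambda>\<xi>. c * G y \<xi> + convol (\<kappa> y) (G y) \<xi>) x = (c + fourier (\<kappa> y) x) * fourier (G y) x" for x y
  proof -
    have "fourier (\<lambda>\<xi>. c * G y \<xi> + convol (\<kappa> y) (G y) \<xi>) x = c * fourier (G y) x + fourier (convol (\<kappa> y) (G y)) x"
      by (subst fourier_add) (use ic G(2) in \<open>auto simp: fourier_cmult\<close>)
    then show ?thesis by (simp add: fourier_convol[OF \<kappa>(2) G(2)] distrib_right)
  qed
  fix y
  have "(\<integral>\<^sup>+\<xi>. norm (c * G y \<xi> + convol (\<kappa> y) (G y) \<xi>) \<partial>lborel)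
      \<le> (\<integral>\<^sup>+\<xi>. ennreal (norm c) * ennreal (norm (G y \<xi>)) + (\<integral>\<^sup>+\<eta>. ennreal (norm (\<kappa> y \<eta>)) * ennreal (norm (G y (\<xi> - \<eta>))) \<partial>lborel) \<partial>lborel)"
  proof (rule nn_integral_mono)
    fix \<xi>
    have "ennreal (norm (convol (\<kappa> y) (G y) \<xi>)) \<le> (\<integral>\<^sup>+\<eta>. ennreal (norm (\<kappa> y \<eta>)) * ennreal (norm (G y (\<xi> - \<eta>))) \<partial>lborel)"
      using norm_integral_le_nn_integral[of lborel "\<lambda>\<eta>. \<kappa> y \<eta> * G y (\<xi> - \<eta>)"]
      by (simp add: convol_def norm_mult ennreal_mult)
    moreover have "ennreal (norm (c * G y \<xi> + convol (\<kappa> y) (G y) \<xi>)) \<le> ennreal (norm c) * ennreal (norm (G y \<xi>)) + ennreal (norm (convol (\<kappa> y) (G y) \<xi>))"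
      using norm_triangle_ineq[of "c * G y \<xi>" "convol (\<kappa> y) (G y) \<xi>"]
      by (simp add: norm_mult ennreal_mult[symmetric] ennreal_plus[symmetric] del: ennreal_plus)
    ultimately show "ennreal (norm (c * G y \<xi> + convol (\<kappa> y) (G y) \<xi>))
      \<le> ennreal (norm c) * ennreal (norm (G y \<xi>)) + (\<integral>\<^sup>+\<eta>. ennreal (norm (\<kappa> y \<eta>)) * ennreal (norm (G y (\<xi> - \<eta>))) \<partial>lborel)"
      by (meson add_left_mono order_trans)
  qed
  also have "\<dots> = ennreal (norm c) * (\<integral>\<^sup>+\<xi>. norm (G y \<xi>) \<partial>lborel)
      + (\<integral>\<^sup>+\<xi>. \<integral>\<^sup>+\<eta>. ennreal (norm (\<kappa> y \<eta>)) * ennreal (norm (G y (\<xi> - \<eta>))) \<partial>lborel \<partial>lborel)"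
    by (simp add: nn_integral_add nn_integral_cmult)
  also have "(\<integral>\<^sup>+\<xi>. \<integral>\<^sup>+\<eta>. ennreal (norm (\<kappa> y \<eta>)) * ennreal (norm (G y (\<xi> - \<eta>))) \<partial>lborel \<partial>lborel)
      = (\<integral>\<^sup>+\<eta>. \<integral>\<^sup>+\<xi>. ennreal (norm (\<kappa> y \<eta>)) * ennreal (norm (G y (\<xi> - \<eta>))) \<partial>lborel \<partial>lborel)"
    by (rule nn_integral_lborel_swap) simp
  also have "\<dots> = (\<integral>\<^sup>+\<eta>. ennreal (norm (\<kappa> y \<eta>)) * (\<integral>\<^sup>+\<xi>. ennreal (norm (G y (\<xi> - \<eta>))) \<partial>lborel) \<partial>lborel)"
    by (simp add: nn_integral_cmult)
  also have "\<dots> = (\<integral>\<^sup>+\<eta>. ennreal (norm (\<kappa> y \<eta>)) \<partial>lborel) * (\<integral>\<^sup>+\<xi>. norm (G y \<xi>) \<partial>lborel)"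
    using nn_integral_lborel_translate(2)[of "\<lambda>\<xi>. ennreal (norm (G y \<xi>))"] by (simp add: nn_integral_multc)
  also have "ennreal (norm c) * (\<integral>\<^sup>+\<xi>. norm (G y \<xi>) \<partial>lborel) + (\<integral>\<^sup>+\<eta>. ennreal (norm (\<kappa> y \<eta>)) \<partial>lborel) * (\<integral>\<^sup>+\<xi>. norm (G y \<xi>) \<partial>lborel)
      \<le> ennreal (norm c) * ennreal (L y) + ennreal (M y) * ennreal (L y)"
    by (intro add_mono mult_mono G(5) \<kappa>(3) order_refl) auto
  also have "\<dots> \<le> ennreal (2 * (norm c + M y) * L y)"
  proof -
    have "(norm c + M y) * L y \<ge> 0" using G(6)[of y] \<kappa>(4)[of y] by simp
    then have "(norm c + M y) * L y \<le> 2 * ((norm c + M y) * L y)" by linarith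
    then have "(norm c + M y) * L y \<le> 2 * (norm c + M y) * L y" by (simp only: mult.assoc)
    moreover have "ennreal (norm c) * ennreal (L y) + ennreal (M y) * ennreal (L y) = ennreal ((norm c + M y) * L y)"
      using G(6)[of y] \<kappa>(4)[of y]
      by (simp add: ennreal_mult[symmetric] ennreal_plus[symmetric] distrib_right[symmetric] del: ennreal_plus)
    ultimately show ?thesis by (simp only: ennreal_leI)
  qed
  finally show "(\<integral>\<^sup>+\<xi>. norm (c * G y \<xi> + convol (\<kappa> y) (G y) \<xi>) \<partial>lborel) \<le> ennreal (2 * (norm c + M y) * L y)" .
  \<comment> \<open>Young's inequality for the convolution of L^1 with L^u: a superposition of
    translates of \<open>G y\<close>, all with the same norm bound \<open>B y\<close>.\<close>
  have conv: "(\<integral>\<^sup>+\<xi>. norm (convol (\<kappa> y) (G y) \<xi>) powr u \<partial>lborel) \<le> ennreal ((M y * B y) powr u)"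
    unfolding convol_def
  proof (rule minkowski_powr_integral[OF u, where \<rho>="\<lambda>\<eta>. norm (\<kappa> y \<eta>)" and b="\<lambda>_. B y" and g="\<lambda>\<eta> \<xi>. norm (G y (\<xi> - \<eta>))"])
    show "(\<integral>\<^sup>+\<xi>. norm (G y (\<xi> - \<eta>)) powr u \<partial>lborel) \<le> ennreal (B y powr u)" for \<eta>
      using nn_integral_lborel_translate(2)[of "\<lambda>\<xi>. ennreal (norm (G y \<xi>) powr u)" \<eta>] G(3)[of y] by simp
    have "(\<integral>\<^sup>+\<eta>. norm (\<kappa> y \<eta>) * B y \<partial>lborel) = (\<integral>\<^sup>+\<eta>. norm (\<kappa> y \<eta>) \<partial>lborel) * ennreal (B y)"
      using G(4)[of y] by (simp add: ennreal_mult nn_integral_multc less_imp_le)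
    also have "\<dots> \<le> ennreal (M y) * ennreal (B y)" by (intro mult_right_mono \<kappa>(3)) simp
    finally show "(\<integral>\<^sup>+\<eta>. norm (\<kappa> y \<eta>) * B y \<partial>lborel) \<le> ennreal (M y * B y)"
      using G(4)[of y] \<kappa>(4)[of y] by (simp add: ennreal_mult less_imp_le)
  qed (use G(4)[of y] \<kappa>(4)[of y] in \<open>auto simp: norm_mult\<close>)
  have [measurable]: "convol (\<kappa> y) (G y) \<in> borel_measurable borel" using ic[of y] by auto
  have "(\<integral>\<^sup>+\<xi>. norm (c * G y \<xi> + convol (\<kappa> y) (G y) \<xi>) powr u \<partial>lborel)
    \<le> (\<integral>\<^sup>+\<xi>. ennreal (2 powr u) * (ennreal (norm c powr u) * ennreal (norm (G y \<xi>) powr u) + ennreal (norm (convol (\<kappa> y) (G y) \<xi>) powr u)) \<partial>lborel)"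
  proof (rule nn_integral_mono)
    fix \<xi>
    have "norm (c * G y \<xi> + convol (\<kappa> y) (G y) \<xi>) powr u \<le> (norm (c * G y \<xi>) + norm (convol (\<kappa> y) (G y) \<xi>)) powr u"
      using u by (intro powr_mono2 norm_triangle_ineq) auto
    also have "\<dots> \<le> 2 powr u * (norm (c * G y \<xi>) powr u + norm (convol (\<kappa> y) (G y) \<xi>) powr u)"
      using u by (intro powr_add_le) auto
    also have "norm (c * G y \<xi>) powr u = norm c powr u * norm (G y \<xi>) powr u" by (simp add: norm_mult powr_mult)
    finally show "ennreal (norm (c * G y \<xi> + convol (\<kappa> y) (G y) \<xi>) powr u)
      \<le> ennreal (2 powr u) * (ennreal (norm c powr u) * ennreal (norm (G y \<xi>) powr u) + ennreal (norm (convol (\<kappa> y) (G y) \<xi>) powr u))"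
      by (simp add: ennreal_mult[symmetric] ennreal_plus[symmetric] del: ennreal_plus)
  qed
  also have "\<dots> = ennreal (2 powr u) * (ennreal (norm c powr u) * (\<integral>\<^sup>+\<xi>. norm (G y \<xi>) powr u \<partial>lborel) + (\<integral>\<^sup>+\<xi>. norm (convol (\<kappa> y) (G y) \<xi>) powr u \<partial>lborel))"
    by (simp add: nn_integral_cmult nn_integral_add)
  also have "\<dots> \<le> ennreal (2 powr u) * (ennreal (norm c powr u) * ennreal (B y powr u) + ennreal ((M y * B y) powr u))"
    by (intro mult_left_mono add_mono G(3) conv) auto
  also have "\<dots> = ennreal (2 powr u * ((norm c * B y) powr u + (M y * B y) powr u))"
  proof -
    have "(norm c * B y) powr u = norm c powr u * B y powr u" by (rule powr_mult)
    then show ?thesis by (simp add: ennreal_mult[symmetric] ennreal_plus[symmetric] del: ennreal_plus)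
  qed
  \<comment> \<open>Superadditivity of the power turns the sum of \<open>u\<close>-th powers back
    into one \<open>u\<close>-th power, so that the total loss is the factor 2.\<close>
  also have "\<dots> \<le> ennreal (2 powr u * (norm c * B y + M y * B y) powr u)"
    using u G(4)[of y] \<kappa>(4)[of y] by (intro ennreal_leI mult_left_mono powr_add_superadditive) auto
  also have "2 powr u * (norm c * B y + M y * B y) powr u = (2 * (norm c + M y) * B y) powr u"
  proof -
    have "2 * (norm c + M y) * B y = 2 * (norm c * B y + M y * B y)" by (simp add: algebra_simps)
    then show ?thesis by (simp only: powr_mult)
  qed
  finally show "(\<integral>\<^sup>+\<xi>. norm (c * G y \<xi> + convol (\<kappa> y) (G y) \<xi>) powr u \<partial>lborel) \<le> ennreal ((2 * (norm c + M y) * B y) powr u)" .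
qed

text \<open>The kernel of the bracket quotient is available only for exponents
  \<open>\<beta> < 1\<close>; larger exponents are reached by applying the same multiplier
  \<open>k\<close> times. The L^1 bound is carried along because superpositions in \<open>y\<close>
  need it for Fubini.\<close>

lemma multiplier_iterate:
  fixes G \<kappa> :: "'a::euclidean_space \<Rightarrow> 'a \<Rightarrow> complex" and B M L :: "'a \<Rightarrow> real"
  assumes u: "1 < u"
    and G: "case_prod G \<in> borel_measurable (borel \<Otimes>\<^sub>M borel)" "\<And>y. integrable lborel (G y)"
      "\<And>y. (\<integral>\<^sup>+\<xi>. norm (G y \<xi>) powr u \<partial>lborel) \<le> ennreal (B y powr u)" "\<And>y. 0 < B y"
      "\<And>y. (\<integral>\<^sup>+\<xi>. norm (G y \<xi>) \<partial>lborel) \<le> ennreal (L y)" "\<And>y. 0 \<le> L y"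
    and \<kappa>: "case_prod \<kappa> \<in> borel_measurable (borel \<Otimes>\<^sub>M borel)" "\<And>y. integrable lborel (\<kappa> y)"
      "\<And>y. (\<integral>\<^sup>+\<xi>. norm (\<kappa> y \<xi>) \<partial>lborel) \<le> ennreal (M y)" "\<And>y. 0 < M y"
  shows "\<exists>G'. case_prod G' \<in> borel_measurable (borel \<Otimes>\<^sub>M borel) \<and> (\<forall>y. integrable lborel (G' y)) \<and>
      (\<forall>y. (\<integral>\<^sup>+\<xi>. norm (G' y \<xi>) powr u \<partial>lborel) \<le> ennreal (((2 * (norm c + M y)) ^ k * B y) powr u)) \<and>
      (\<forall>y. (\<integral>\<^sup>+\<xi>. norm (G' y \<xi>) \<partial>lborel) \<le> ennreal ((2 * (norm c + M y)) ^ k * L y)) \<and>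
      (\<forall>y x. fourier (G' y) x = (c + fourier (\<kappa> y) x) ^ k * fourier (G y) x)"
proof (induction k)
  case 0
  show ?case by (rule exI[of _ G]) (use G in auto)
next
  case (Suc k)
  then obtain H where H: "case_prod H \<in> borel_measurable (borel \<Otimes>\<^sub>M borel)" "\<And>y. integrable lborel (H y)"
      "\<And>y. (\<integral>\<^sup>+\<xi>. norm (H y \<xi>) powr u \<partial>lborel) \<le> ennreal (((2 * (norm c + M y)) ^ k * B y) powr u)"
      "\<And>y. (\<integral>\<^sup>+\<xi>. norm (H y \<xi>) \<partial>lborel) \<le> ennreal ((2 * (norm c + M y)) ^ k * L y)"
      "\<And>y x. fourier (H y) x = (c + fourier (\<kappa> y) x) ^ k * fourier (G y) x" by blast
  have pos: "0 < (2 * (norm c + M y)) ^ k * B y" for y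
    using G(4)[of y] \<kappa>(4)[of y] by (intro mult_pos_pos zero_less_power) (auto intro: add_nonneg_pos)
  have nn: "0 \<le> (2 * (norm c + M y)) ^ k * L y" for y
    using G(6)[of y] \<kappa>(4)[of y] by (intro mult_nonneg_nonneg zero_le_power) (auto intro: add_nonneg_nonneg)
  from multiplier_step[OF u H(1-3) pos H(4) nn \<kappa>(1-3) less_imp_le[OF \<kappa>(4)], of c] obtain G' where
    "case_prod G' \<in> borel_measurable (borel \<Otimes>\<^sub>M borel)" "\<forall>y. integrable lborel (G' y)"
     "\<forall>y. (\<integral>\<^sup>+\<xi>. norm (G' y \<xi>) powr u \<partial>lborel) \<le> ennreal ((2 * (norm c + M y) * ((2 * (norm c + M y)) ^ k * B y)) powr u)"
     "\<forall>y. (\<integral>\<^sup>+\<xi>. norm (G' y \<xi>) \<partial>lborel) \<le> ennreal (2 * (norm c + M y) * ((2 * (norm c + M y)) ^ k * L y))"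
      "\<forall>y x. fourier (G' y) x = (c + fourier (\<kappa> y) x) * fourier (H y) x" by blast
  then show ?case by (intro exI[of _ G']) (simp add: H(5) mult.assoc)
qed

text \<open>Packages a multiplier estimate for families \<open>G y\<close>. The whole family is
  transformed at once so that joint measurability in \<open>y\<close> and \<open>\<xi>\<close> is
  preserved; the growth in \<open>y\<close> is polynomial and the dependence on \<open>b\<close>
  explicit. The last argument only fixes the space on which the functions live.\<close>

definition bracket_bound :: "real \<Rightarrow> real \<Rightarrow> real \<Rightarrow> nat \<Rightarrow> 'a::euclidean_space itself \<Rightarrow> bool" where
  "bracket_bound s u C m T \<longleftrightarrow> (\<forall>b (G :: 'a \<Rightarrow> 'a \<Rightarrow> complex) B L. b > 0 \<longrightarrow>
      case_prod G \<in> borel_measurable (borel \<Otimes>\<^sub>M borel) \<longrightarrow> (\<forall>y. integrable lborel (G y)) \<longrightarrow>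
      (\<forall>y. (\<integral>\<^sup>+\<xi>. norm (G y \<xi>) powr u \<partial>lborel) \<le> ennreal (B powr u)) \<longrightarrow> 0 < B \<longrightarrow>
      (\<forall>y. (\<integral>\<^sup>+\<xi>. norm (G y \<xi>) \<partial>lborel) \<le> ennreal L) \<longrightarrow> 0 \<le> L \<longrightarrow>
      (\<exists>G'. case_prod G' \<in> borel_measurable (borel \<Otimes>\<^sub>M borel) \<and> (\<forall>y. integrable lborel (G' y)) \<and>
        (\<forall>y. (\<integral>\<^sup>+\<xi>. norm (G' y \<xi>) powr u \<partial>lborel)
            \<le> ennreal ((C * (1 + norm y) ^ m * (1 + b powr (- s / 2)) * B) powr u)) \<and>
        (\<forall>y. (\<integral>\<^sup>+\<xi>. norm (G' y \<xi>) \<partial>lborel) \<le> ennreal (C * (1 + norm y) ^ m * (1 + b powr (- s / 2)) * L)) \<and>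
        (\<forall>y x. fourier (G' y) x
           = of_real ((jap (x + y) / (1 + b * (4 * pi\<^sup>2 * (norm x)\<^sup>2))) powr (s / 2)) * fourier (G y) x)))"

lemma bracket_boundE:
  fixes G :: "'a::euclidean_space \<Rightarrow> 'a \<Rightarrow> complex"
  assumes "bracket_bound s u C m TYPE('a)" "b > 0"
    "case_prod G \<in> borel_measurable (borel \<Otimes>\<^sub>M borel)" "\<And>y. integrable lborel (G y)"
    "\<And>y. (\<integral>\<^sup>+\<xi>. norm (G y \<xi>) powr u \<partial>lborel) \<le> ennreal (B powr u)" "0 < B"
    "\<And>y. (\<integral>\<^sup>+\<xi>. norm (G y \<xi>) \<partial>lborel) \<le> ennreal L" "0 \<le> L"
  obtains G' where "case_prod G' \<in> borel_measurable (borel \<Otimes>\<^sub>M borel)" "\<And>y. integrable lborel (G' y)"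
    "\<And>y. (\<integral>\<^sup>+\<xi>. norm (G' y \<xi>) powr u \<partial>lborel)
            \<le> ennreal ((C * (1 + norm y) ^ m * (1 + b powr (- s / 2)) * B) powr u)"
    "\<And>y. (\<integral>\<^sup>+\<xi>. norm (G' y \<xi>) \<partial>lborel) \<le> ennreal (C * (1 + norm y) ^ m * (1 + b powr (- s / 2)) * L)"
    "\<And>y x. fourier (G' y) x
           = of_real ((jap (x + y) / (1 + b * (4 * pi\<^sup>2 * (norm x)\<^sup>2))) powr (s / 2)) * fourier (G y) x"
proof -
  have "\<forall>y. integrable lborel (G y)" "\<forall>y. (\<integral>\<^sup>+\<xi>. norm (G y \<xi>) powr u \<partial>lborel) \<le> ennreal (B powr u)"
    "\<forall>y. (\<integral>\<^sup>+\<xi>. norm (G y \<xi>) \<partial>lborel) \<le> ennreal L" using assms(4,5,7) by auto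
  from assms(1)[unfolded bracket_bound_def, rule_format, OF assms(2,3) this(1)[rule_format] this(2)[rule_format] assms(6) this(3)[rule_format] assms(8)]
  show thesis using that by blast
qed

text \<open>The exponent \<open>s / 2\<close> is split into \<open>k\<close> equal parts
  \<open>\<beta> = s / (2 * k)\<close>. Since \<open>k \<ge> s\<close>, each part is at most
  \<open>1/2\<close>, within the range of the kernel construction; each application contributes a
  quadratic factor in \<open>1 + norm y\<close>, hence the degree \<open>2 * k\<close>.\<close>

theorem bracket_multiplier:
  fixes s u :: real
  assumes s: "0 < s" and u: "1 < u"
  obtains C :: real and m :: nat where "C > 0" and "bracket_bound s u C m TYPE('a::euclidean_space)"
proof -
  define k where "k = nat \<lceil>s\<rceil> + 1"
  define \<beta> where "\<beta> = s / (2 * real k)"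
  have ks: "s \<le> real k" "k \<ge> 1" unfolding k_def by linarith+
  have \<beta>: "0 < \<beta>" "\<beta> < 1" using s ks by (auto simp: \<beta>_def field_simps)
  have \<beta>k: "\<beta> * real k = s / 2" using ks by (simp add: \<beta>_def)
  have powk: "(R powr \<beta>) ^ k = R powr (s / 2)" if "R > 0" for R :: real
    using that by (subst powr_realpow[symmetric]) (simp_all add: powr_powr \<beta>k)
  obtain K :: real where K: "K > 0"
    and ker: "\<And>b. b > 0 \<Longrightarrow> \<exists>\<kappa> :: 'a \<Rightarrow> 'a \<Rightarrow> complex.
        case_prod \<kappa> \<in> borel_measurable (borel \<Otimes>\<^sub>M borel) \<and> (\<forall>y. integrable lborel (\<kappa> y)) \<and>
        (\<forall>y. (\<integral>\<^sup>+\<xi>. norm (\<kappa> y \<xi>) \<partial>lborel) \<le> ennreal (K * (1 + norm y)\<^sup>2 * (1 + b powr (- \<beta>)))) \<and>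
        (\<forall>x y. of_real (b powr (- \<beta>)) + fourier (\<kappa> y) x
            = of_real ((jap (x + y) / (1 + b * (4 * pi\<^sup>2 * (norm x)\<^sup>2))) powr \<beta>))"
    by (rule bracket_quotient_kernel[OF \<beta>, where 'a='a]) (rule that)
  define C where "C = (2 * (K + 1)) ^ k * 2 ^ k"
  have C: "C > 0" using K by (simp add: C_def)
  show thesis
  proof (rule that[OF C, of "2 * k"], unfold bracket_bound_def, intro allI impI)
    fix b :: real and G :: "'a \<Rightarrow> 'a \<Rightarrow> complex" and B L :: real
    assume b: "b > 0" and G0: "case_prod G \<in> borel_measurable (borel \<Otimes>\<^sub>M borel)" "\<forall>y. integrable lborel (G y)"
      "\<forall>y. (\<integral>\<^sup>+\<xi>. norm (G y \<xi>) powr u \<partial>lborel) \<le> ennreal (B powr u)" "0 < B"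
      "\<forall>y. (\<integral>\<^sup>+\<xi>. norm (G y \<xi>) \<partial>lborel) \<le> ennreal L" "0 \<le> L"
    note G = G0(1) G0(2)[rule_format] G0(3)[rule_format] G0(4) G0(5)[rule_format] G0(6)
    from ker[OF b] obtain \<kappa> :: "'a \<Rightarrow> 'a \<Rightarrow> complex" where \<kappa>:
      "case_prod \<kappa> \<in> borel_measurable (borel \<Otimes>\<^sub>M borel)" "\<And>y. integrable lborel (\<kappa> y)"
      "\<And>y. (\<integral>\<^sup>+\<xi>. norm (\<kappa> y \<xi>) \<partial>lborel) \<le> ennreal (K * (1 + norm y)\<^sup>2 * (1 + b powr (- \<beta>)))"
      "\<And>x y. of_real (b powr (- \<beta>)) + fourier (\<kappa> y) x
            = of_real ((jap (x + y) / (1 + b * (4 * pi\<^sup>2 * (norm x)\<^sup>2))) powr \<beta>)" by blast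
    have Mpos: "0 < K * (1 + norm y)\<^sup>2 * (1 + b powr (- \<beta>))" for y :: 'a
      using K by (intro mult_pos_pos zero_less_power) (auto intro: add_pos_nonneg)
    from multiplier_iterate[OF u G(1-3) G(4) G(5,6) \<kappa>(1-3) Mpos, of "of_real (b powr (- \<beta>))" k]
    obtain G' where G': "case_prod G' \<in> borel_measurable (borel \<Otimes>\<^sub>M borel)" "\<And>y. integrable lborel (G' y)"
      "\<And>y. (\<integral>\<^sup>+\<xi>. norm (G' y \<xi>) powr u \<partial>lborel) \<le> ennreal (((2 * (norm (complex_of_real (b powr (- \<beta>))) + K * (1 + norm y)\<^sup>2 * (1 + b powr (- \<beta>)))) ^ k * B) powr u)"
      "\<And>y. (\<integral>\<^sup>+\<xi>. norm (G' y \<xi>) \<partial>lborel) \<le> ennreal ((2 * (norm (complex_of_real (b powr (- \<beta>))) + K * (1 + norm y)\<^sup>2 * (1 + b powr (- \<beta>)))) ^ k * L)"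
      "\<And>y x. fourier (G' y) x = (of_real (b powr (- \<beta>)) + fourier (\<kappa> y) x) ^ k * fourier (G y) x" by blast
    show "\<exists>G'. case_prod G' \<in> borel_measurable (borel \<Otimes>\<^sub>M borel) \<and> (\<forall>y. integrable lborel (G' y)) \<and>
        (\<forall>y. (\<integral>\<^sup>+\<xi>. norm (G' y \<xi>) powr u \<partial>lborel)
            \<le> ennreal ((C * (1 + norm y) ^ (2 * k) * (1 + b powr (- s / 2)) * B) powr u)) \<and>
        (\<forall>y. (\<integral>\<^sup>+\<xi>. norm (G' y \<xi>) \<partial>lborel) \<le> ennreal (C * (1 + norm y) ^ (2 * k) * (1 + b powr (- s / 2)) * L)) \<and>
        (\<forall>y x. fourier (G' y) x
           = of_real ((jap (x + y) / (1 + b * (4 * pi\<^sup>2 * (norm x)\<^sup>2))) powr (s / 2)) * fourier (G y) x)"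
    proof (intro exI[of _ G'] conjI allI G'(1,2))
      fix y x :: 'a
      have r: "jap (x + y) / (1 + b * (4 * pi\<^sup>2 * (norm x)\<^sup>2)) > 0"
        using b by (intro divide_pos_pos) (auto intro: add_pos_nonneg)
      have "((jap (x + y) / (1 + b * (4 * pi\<^sup>2 * (norm x)\<^sup>2))) powr \<beta>) ^ k = (jap (x + y) / (1 + b * (4 * pi\<^sup>2 * (norm x)\<^sup>2))) powr (s / 2)"
        by (rule powk[OF r])
      then show "fourier (G' y) x
           = of_real ((jap (x + y) / (1 + b * (4 * pi\<^sup>2 * (norm x)\<^sup>2))) powr (s / 2)) * fourier (G y) x"
        using G'(5)[of y x] \<kappa>(4)[of y x] by (metis of_real_power)
    next
      fix y :: 'a
      define z where "z = b powr (- \<beta>)"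
      have z: "z > 0" using b by (simp add: z_def)
      define Y where "Y = 1 + norm y"
      have Y: "Y \<ge> 1" by (simp add: Y_def)
      \<comment> \<open>The \<open>k\<close>-th power of \<open>1 + z\<close> is at most
        \<open>2 ^ k * (1 + z ^ k)\<close>, so the accumulated dependence on \<open>b\<close> is
        exactly the factor \<open>1 + b powr (- s / 2)\<close> of the claim.\<close>
      have zk: "z ^ k = b powr (- s / 2)"
        unfolding z_def using b by (subst powr_realpow[symmetric]) (simp_all add: powr_powr \<beta>k)
      define P where "P = z + K * Y\<^sup>2 * (1 + z)"
      have P: "P \<ge> 0" unfolding P_def using z K by simp
      have "P \<le> (K + 1) * Y\<^sup>2 * (1 + z)"
      proof -
        have "z * 1 \<le> (1 + z) * Y\<^sup>2" using z Y by (intro mult_mono) auto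
        then show ?thesis unfolding P_def by (simp add: algebra_simps)
      qed
      then have "(2 * P) ^ k \<le> (2 * ((K + 1) * Y\<^sup>2 * (1 + z))) ^ k"
        using P by (intro power_mono) auto
      also have "\<dots> = (2 * (K + 1)) ^ k * Y ^ (2 * k) * (1 + z) ^ k"
        by (simp only: power_mult_distrib power_mult mult.assoc)
      also have "\<dots> \<le> (2 * (K + 1)) ^ k * Y ^ (2 * k) * (2 ^ k * (1 + z ^ k))"
      proof (intro mult_left_mono)
        have "(1 + z) ^ k \<le> (2 * max 1 z) ^ k" using z by (intro power_mono) auto
        also have "\<dots> = 2 ^ k * (max 1 z) ^ k" by (simp add: power_mult_distrib)
        also have "\<dots> \<le> 2 ^ k * (1 + z ^ k)" using z by (intro mult_left_mono) (auto simp: max_def)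
        finally show "(1 + z) ^ k \<le> 2 ^ k * (1 + z ^ k)" .
      qed (use K Y in auto)
      finally have le: "(2 * P) ^ k \<le> C * Y ^ (2 * k) * (1 + b powr (- s / 2))"
        by (simp add: C_def zk mult_ac)
      have le2: "((2 * P) ^ k * B) powr u \<le> (C * Y ^ (2 * k) * (1 + b powr (- s / 2)) * B) powr u"
        using u G(4) P by (intro powr_mono2 mult_right_mono le) auto
      have abs_powr_eq_self: "\<bar>b powr (- \<beta>)\<bar> = b powr (- \<beta>)" by simp
      have "(2 * P) ^ k * L \<le> C * Y ^ (2 * k) * (1 + b powr (- s / 2)) * L"
        using G(6) by (intro mult_right_mono le)
      moreover have "(\<integral>\<^sup>+\<xi>. norm (G' y \<xi>) \<partial>lborel) \<le> ennreal ((2 * P) ^ k * L)"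
        using G'(4)[of y] unfolding P_def z_def Y_def norm_of_real abs_powr_eq_self .
      ultimately show "(\<integral>\<^sup>+\<xi>. norm (G' y \<xi>) \<partial>lborel) \<le> ennreal (C * (1 + norm y) ^ (2 * k) * (1 + b powr (- s / 2)) * L)"
        unfolding Y_def by (rule order_trans[rotated, OF ennreal_leI])
      have G3: "(\<integral>\<^sup>+\<xi>. norm (G' y \<xi>) powr u \<partial>lborel) \<le> ennreal (((2 * P) ^ k * B) powr u)"
        using G'(3)[of y] unfolding P_def z_def Y_def norm_of_real abs_powr_eq_self .
      show "(\<integral>\<^sup>+\<xi>. norm (G' y \<xi>) powr u \<partial>lborel)
            \<le> ennreal ((C * (1 + norm y) ^ (2 * k) * (1 + b powr (- s / 2)) * B) powr u)"
        using order_trans[OF G3 ennreal_leI[OF le2]] unfolding Y_def .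
    qed
  qed
qed

section \<open>Schwartz functions and the Bessel potential norm\<close>

lemma jap_neq_0 [simp]: "jap x \<noteq> 0"
  using jap_pos[of x] by linarith

text \<open>Writing \<open>jap x powr (- d)\<close> as a Gamma integral of Gaussians and integrating
  in \<open>x\<close> gives the factor \<open>(4 * pi * t) powr (- d / 2)\<close>, which lowers the
  order of the Gamma integral from \<open>d\<close> to \<open>d / 2\<close>. This avoids polar
  coordinates.\<close>

lemma nn_integral_jap_powr:
  "(\<integral>\<^sup>+x. ennreal (jap x powr (- real DIM('a))) \<partial>(lborel :: 'a::euclidean_space measure)) < \<infinity>"
proof -
  define d where "d = real DIM('a)"
  have d: "d \<ge> 1" using DIM_positive[where 'a='a] unfolding d_def by linarith
  have g: "Gamma d \<noteq> 0" using Gamma_real_pos[of d] d by linarith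
  define c where "c = (4 * pi) powr (- d / 2) / Gamma d"
  have c: "c \<ge> 0" using d by (simp add: c_def)
  have "(\<integral>\<^sup>+x. ennreal (jap x powr (- d)) \<partial>(lborel :: 'a measure))
     = (\<integral>\<^sup>+x. \<integral>\<^sup>+t. ennreal (1 / Gamma d * gker d t * exp (- t)) * ennreal (exp (- (pi * (4 * pi * t) * (norm x)\<^sup>2))) \<partial>lborel \<partial>(lborel :: 'a measure))"
  proof (rule nn_integral_cong)
    fix x :: 'a
    have "(\<integral>\<^sup>+t. ennreal (1 / Gamma d * gker d t * exp (- t)) * ennreal (exp (- (pi * (4 * pi * t) * (norm x)\<^sup>2))) \<partial>lborel)
       = (\<integral>\<^sup>+t. ennreal (1 / Gamma d) * ennreal (gker d t * exp (- (t * jap x))) \<partial>lborel)"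
      using d by (intro nn_integral_cong) (simp add: ennreal_mult[symmetric] mult_exp_exp jap_def algebra_simps power2_eq_square)
    also have "\<dots> = ennreal (jap x powr (- d))"
      using d g by (subst nn_integral_cmult) (auto simp: nn_integral_gker_exp ennreal_mult[symmetric])
    finally show "ennreal (jap x powr (- d)) = (\<integral>\<^sup>+t. ennreal (1 / Gamma d * gker d t * exp (- t)) * ennreal (exp (- (pi * (4 * pi * t) * (norm x)\<^sup>2))) \<partial>lborel)" ..
  qed
  also have "\<dots> = (\<integral>\<^sup>+t. \<integral>\<^sup>+x. ennreal (1 / Gamma d * gker d t * exp (- t)) * ennreal (exp (- (pi * (4 * pi * t) * (norm x)\<^sup>2))) \<partial>(lborel :: 'a measure) \<partial>lborel)"
    by (rule nn_integral_lborel_swap) measurable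
  also have "\<dots> = (\<integral>\<^sup>+t. ennreal c * ennreal (gker (d / 2) t * exp (- (t * 1))) \<partial>lborel)"
  proof (rule nn_integral_cong)
    fix t :: real
    show "(\<integral>\<^sup>+x. ennreal (1 / Gamma d * gker d t * exp (- t)) * ennreal (exp (- (pi * (4 * pi * t) * (norm x)\<^sup>2))) \<partial>(lborel :: 'a measure)) = ennreal c * ennreal (gker (d / 2) t * exp (- (t * 1)))"
    proof (cases "t > 0")
      case True
      have "gker d t * (4 * pi * t) powr (- d / 2) = (4 * pi) powr (- d / 2) * gker (d / 2) t"
        using True by (simp add: gker_def powr_mult powr_add[symmetric])
      then have *: "1 / Gamma d * gker d t * exp (- t) * (4 * pi * t) powr (- d / 2) = c * (gker (d / 2) t * exp (- (t * 1)))"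
        by (simp add: c_def)
      have "(\<integral>\<^sup>+x. ennreal (1 / Gamma d * gker d t * exp (- t)) * ennreal (exp (- (pi * (4 * pi * t) * (norm x)\<^sup>2))) \<partial>(lborel :: 'a measure))
        = ennreal (1 / Gamma d * gker d t * exp (- t)) * ennreal ((4 * pi * t) powr (- d / 2))"
        using True nn_integral_gaussian[of "4 * pi * t", where 'a='a] by (subst nn_integral_cmult) (simp_all add: d_def)
      also have "\<dots> = ennreal (c * (gker (d / 2) t * exp (- (t * 1))))"
        unfolding *[symmetric] using d by (intro ennreal_mult[symmetric]) auto
      finally show ?thesis using c by (simp add: ennreal_mult)
    qed (simp add: gker_def)
  qed
  also have "\<dots> = ennreal c * ennreal (Gamma (d / 2) * 1 powr (- (d / 2)))"
    using d by (subst nn_integral_cmult, simp, subst nn_integral_gker_exp) auto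
  also have "\<dots> < \<infinity>" by (simp add: ennreal_mult_less_top)
  finally show ?thesis by (simp add: d_def)
qed

lemma borel_measurable_schwartz:
  assumes "schwartz \<phi>"
  shows "\<phi> \<in> borel_measurable borel"
proof -
  have "dderiv [] \<phi> differentiable (at x)" for x
    using assms unfolding schwartz_def by blast
  then have "continuous_on UNIV \<phi>"
    by (intro continuous_at_imp_continuous_on ballI differentiable_imp_continuous_within) simp
  then show ?thesis by (rule borel_measurable_continuous_onI)
qed

lemma integrable_schwartz_weight:
  fixes \<phi> :: "'a::euclidean_space \<Rightarrow> complex"
  assumes "schwartz \<phi>"
  shows "integrable lborel (\<lambda>x. (1 + norm x) ^ m * norm (\<phi> x))"
proof -
  note [measurable] = borel_measurable_schwartz[OF assms]
  let ?d = "DIM('a)"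
  \<comment> \<open>The weight is raised by \<open>2 * DIM('a)\<close> powers, which pay for the
    integrable factor \<open>jap x powr (- real ?d)\<close>.\<close>
  obtain C where C: "\<And>x. (1 + norm x) ^ (m + 2 * ?d) * norm (dderiv [] \<phi> x) \<le> C"
    using assms unfolding schwartz_def by meson
  have C0: "C \<ge> 0" using C[of 0] by (simp add: order_trans[OF norm_ge_zero])
  have int: "integrable lborel (\<lambda>x::'a. jap x powr (- real ?d))"
    by (rule integrableI_bounded) (use nn_integral_jap_powr[where 'a='a] in auto)
  show ?thesis
  proof (rule Bochner_Integration.integrable_bound)
    show "integrable lborel (\<lambda>x::'a. C * 64 ^ ?d * jap x powr (- real ?d))" by (rule integrable_mult_right[OF int])
    show "AE x in lborel. norm ((1 + norm x) ^ m * norm (\<phi> x)) \<le> norm (C * 64 ^ ?d * jap x powr (- real ?d))"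
    proof (rule AE_I2)
      fix x :: 'a
      define Y where "Y = 1 + norm x"
      have Y: "Y \<ge> 1" by (simp add: Y_def)
      have "4 * pi\<^sup>2 \<le> 4 * 4\<^sup>2" using pi_less_4 by (intro mult_left_mono power_mono) auto
      then have "4 * pi\<^sup>2 * (norm x)\<^sup>2 \<le> 64 * (norm x)\<^sup>2" by (intro mult_right_mono) auto
      moreover have "64 * Y\<^sup>2 = 64 + 128 * norm x + 64 * (norm x)\<^sup>2"
        by (simp add: Y_def power2_eq_square algebra_simps)
      ultimately have "jap x \<le> 64 * Y\<^sup>2" unfolding jap_def using norm_ge_zero[of x] by linarith
      then have "jap x ^ ?d \<le> (64 * Y\<^sup>2) ^ ?d" by (intro power_mono) auto
      also have "\<dots> = 64 ^ ?d * Y ^ (2 * ?d)" by (simp add: power_mult_distrib power_mult)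
      finally have j: "1 \<le> 64 ^ ?d * Y ^ (2 * ?d) * jap x powr (- real ?d)"
        by (simp add: powr_minus powr_realpow field_simps)
      have "Y ^ m * norm (\<phi> x) \<le> Y ^ m * norm (\<phi> x) * (64 ^ ?d * Y ^ (2 * ?d) * jap x powr (- real ?d))"
        using Y mult_left_mono[OF j, of "Y ^ m * norm (\<phi> x)"] by simp
      also have "\<dots> = (Y ^ (m + 2 * ?d) * norm (\<phi> x)) * (64 ^ ?d * jap x powr (- real ?d))"
        by (simp add: power_add mult_ac)
      also have "\<dots> \<le> C * (64 ^ ?d * jap x powr (- real ?d))"
        using C[of x] by (intro mult_right_mono) (auto simp: Y_def)
      finally show "norm ((1 + norm x) ^ m * norm (\<phi> x)) \<le> norm (C * 64 ^ ?d * jap x powr (- real ?d))"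
        using C0 by (simp add: Y_def abs_mult mult.assoc)
    qed
  qed measurable
qed

lemma integrable_schwartz:
  fixes \<phi> :: "'a::euclidean_space \<Rightarrow> complex"
  assumes "schwartz \<phi>"
  shows "integrable lborel \<phi>"
  using integrable_schwartz_weight[OF assms, of 0] borel_measurable_schwartz[OF assms]
  by (simp add: integrable_norm_iff)

section \<open>Bessel representatives under translation, dilation and multiplication\<close>

text \<open>All functions here lie in \<open>L\<^sup>1\<close>, so the distributional identity in \<open>bessel_norm\<close> reduces to
  a pointwise identity of Fourier transforms.\<close>

definition bessel_rep :: "real \<Rightarrow> ('a::euclidean_space \<Rightarrow> complex) \<Rightarrow> ('a \<Rightarrow> complex) \<Rightarrow> bool" where
  "bessel_rep s F G \<longleftrightarrow> integrable lborel F \<and> integrable lborel G \<and>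
     (\<forall>x. fourier G x = of_real (jap x powr (s / 2)) * fourier F x)"

lemma bessel_norm_le:
  assumes rep: "bessel_rep s F G" and u: "0 < u" and B: "0 \<le> B"
    and G: "(\<integral>\<^sup>+\<xi>. norm (G \<xi>) powr u \<partial>lborel) \<le> ennreal (B powr u)"
  shows "bessel_norm u s F \<le> ennreal B"
proof -
  have i: "integrable lborel F" "integrable lborel G" using rep by (auto simp: bessel_rep_def)
  have le: "Lp_norm u G \<le> ennreal B" using Lp_norm_le_iff[OF u B, of G] G by simp
  have "in_Lp u G" using le i(2) unfolding in_Lp_def by (auto intro: le_less_trans)
  moreover have "(LINT x|lborel. G x * fourier \<phi> x) =
      (LINT \<xi>|lborel. complex_of_real ((1 + 4 * pi\<^sup>2 * (norm \<xi>)\<^sup>2) powr (s / 2)) * fourier F \<xi> * \<phi> \<xi>)"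
    if "schwartz \<phi>" for \<phi>
    using fourier_multiplication_formula[OF i(2) integrable_schwartz[OF that]] rep
    by (simp add: bessel_rep_def jap_def)
  ultimately have "bessel_norm u s F \<le> Lp_norm u G"
    unfolding bessel_norm_def using i(1) by (auto intro!: INF_lower)
  then show ?thesis using le by simp
qed

lemma bessel_rep_translate:
  assumes "bessel_rep s F G"
  shows "bessel_rep s (\<lambda>\<xi>. F (\<xi> - \<zeta>)) (\<lambda>\<xi>. G (\<xi> - \<zeta>))"
  using assms unfolding bessel_rep_def
  by (auto simp: fourier_translate integrable_lborel_translate)

text \<open>The bracket is not homogeneous, so dilating \<open>G\<close> alone does not give a
  representative of the dilated \<open>F\<close>. The discrepancy is the quotient of
  \<open>jap x\<close> and \<open>jap (x /\<^sub>R c)\<close>, a bracket multiplier with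
  \<open>y = 0\<close> and \<open>b = 1 / c\<^sup>2\<close>.\<close>

lemma bessel_rep_dilate:
  fixes s u c :: real
  assumes s: "0 < s" and u: "1 < u" and c: "0 < c"
  shows "\<exists>C>0. \<forall>(F :: 'a::euclidean_space \<Rightarrow> complex) G B. bessel_rep s F G \<longrightarrow> 0 < B \<longrightarrow>
     (\<integral>\<^sup>+\<xi>. norm (G \<xi>) powr u \<partial>lborel) \<le> ennreal (B powr u) \<longrightarrow>
     (\<exists>G'. bessel_rep s (\<lambda>\<xi>. F (c *\<^sub>R \<xi>)) G' \<and> (\<integral>\<^sup>+\<xi>. norm (G' \<xi>) powr u \<partial>lborel) \<le> ennreal ((C * B) powr u))"
proof -
  obtain C :: real and m :: nat where C: "C > 0"
    and mul: "bracket_bound s u C m TYPE('a)"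
    by (rule bracket_multiplier[OF s u, where 'a='a]) (rule that)
  \<comment> \<open>The multiplier norm times \<open>(1 / c ^ DIM('a)) powr (1 / u)\<close>, the
    effect of the dilation on L^u norms.\<close>
  define D where "D = C * (1 + (1 / c\<^sup>2) powr (- s / 2)) * (1 / c ^ DIM('a)) powr (1 / u)"
  have D: "D > 0" using C c unfolding D_def by (intro mult_pos_pos) (auto intro: add_pos_nonneg)
  show ?thesis
  proof (intro exI[of _ D] conjI D allI impI)
    fix F G :: "'a \<Rightarrow> complex" and B :: real
    assume rep: "bessel_rep s F G" and B: "0 < B" and G: "(\<integral>\<^sup>+\<xi>. norm (G \<xi>) powr u \<partial>lborel) \<le> ennreal (B powr u)"
    have iF: "integrable lborel F" and iG: "integrable lborel G"
      and fG: "\<And>x. fourier G x = of_real (jap x powr (s / 2)) * fourier F x"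
      using rep by (auto simp: bessel_rep_def)
    have [measurable]: "G \<in> borel_measurable borel" using iG by auto
    have icG: "integrable lborel (\<lambda>\<xi>. G (c *\<^sub>R \<xi>))" using integrable_lborel_affine[OF iG, of c 0] c by simp
    have icF: "integrable lborel (\<lambda>\<xi>. F (c *\<^sub>R \<xi>))" using integrable_lborel_affine[OF iF, of c 0] c by simp
    define B1 where "B1 = (1 / c ^ DIM('a)) powr (1 / u) * B"
    have B1: "B1 > 0" using B c by (simp add: B1_def)
    have bd: "(\<integral>\<^sup>+\<xi>. norm (G (c *\<^sub>R \<xi>)) powr u \<partial>lborel) \<le> ennreal (B1 powr u)"
    proof -
      have e1: "(\<integral>\<^sup>+\<xi>. norm (G \<xi>) powr u \<partial>lborel) = ennreal (c ^ DIM('a)) * (\<integral>\<^sup>+\<xi>. norm (G (c *\<^sub>R \<xi>)) powr u \<partial>lborel)"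
        using c nn_integral_lborel_affine[of "\<lambda>\<xi>. ennreal (norm (G \<xi>) powr u)" c 0] by simp
      have "(\<integral>\<^sup>+\<xi>. norm (G (c *\<^sub>R \<xi>)) powr u \<partial>lborel)
         = ennreal (1 / c ^ DIM('a)) * (ennreal (c ^ DIM('a)) * (\<integral>\<^sup>+\<xi>. norm (G (c *\<^sub>R \<xi>)) powr u \<partial>lborel))"
        using c by (simp add: mult.assoc[symmetric] ennreal_mult[symmetric])
      also have "\<dots> \<le> ennreal (1 / c ^ DIM('a)) * ennreal (B powr u)"
        unfolding e1[symmetric] by (intro mult_left_mono G) simp
      also have "\<dots> = ennreal (B1 powr u)"
        using c B u by (simp add: B1_def powr_mult powr_powr ennreal_mult[symmetric])
      finally show ?thesis .
    qed
    define L where "L = enn2real (\<integral>\<^sup>+\<xi>. norm (G (c *\<^sub>R \<xi>)) \<partial>lborel)"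
    have L: "(\<integral>\<^sup>+\<xi>. norm (G (c *\<^sub>R \<xi>)) \<partial>lborel) \<le> ennreal L" "0 \<le> L"
      using icG by (auto simp: L_def integrable_iff_bounded)
    have mm: "(\<lambda>(y::'a, \<xi>). G (c *\<^sub>R \<xi>)) \<in> borel_measurable (borel \<Otimes>\<^sub>M borel)" by measurable
    have c2: "1 / c\<^sup>2 > 0" using c by simp
    obtain H where
      H: "\<And>y. integrable lborel (H y)" "\<And>y. (\<integral>\<^sup>+\<xi>. norm (H y \<xi>) powr u \<partial>lborel)
            \<le> ennreal ((C * (1 + norm y) ^ m * (1 + (1 / c\<^sup>2) powr (- s / 2)) * B1) powr u)"
       "\<And>y x. fourier (H y) x = of_real ((jap (x + y) / (1 + (1 / c\<^sup>2) * (4 * pi\<^sup>2 * (norm x)\<^sup>2))) powr (s / 2)) * fourier (\<lambda>\<xi>. G (c *\<^sub>R \<xi>)) x"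
      by (rule bracket_boundE[OF mul c2 mm icG bd B1 L]) (rule that)
    show "\<exists>G'. bessel_rep s (\<lambda>\<xi>. F (c *\<^sub>R \<xi>)) G' \<and> (\<integral>\<^sup>+\<xi>. norm (G' \<xi>) powr u \<partial>lborel) \<le> ennreal ((D * B) powr u)"
    proof (intro exI[of _ "H 0"] conjI)
      show "(\<integral>\<^sup>+\<xi>. norm (H 0 \<xi>) powr u \<partial>lborel) \<le> ennreal ((D * B) powr u)"
        using H(2)[of 0] by (simp add: D_def B1_def mult_ac)
      have "fourier (H 0) x = of_real (jap x powr (s / 2)) * fourier (\<lambda>\<xi>. F (c *\<^sub>R \<xi>)) x" for x
      proof -
        have j: "1 + (1 / c\<^sup>2) * (4 * pi\<^sup>2 * (norm x)\<^sup>2) = jap (x /\<^sub>R c)"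
          using c by (simp add: jap_def power_mult_distrib power_divide field_simps)
        have "(jap x / jap (x /\<^sub>R c)) powr (s / 2) * jap (x /\<^sub>R c) powr (s / 2) = jap x powr (s / 2)"
          by (simp add: powr_divide)
        then show ?thesis
          unfolding H(3) j fourier_dilate[OF c] fG
          by (simp add: mult.left_commute[of "complex_of_real (1 / c ^ _)"] mult.assoc[symmetric] flip: of_real_mult)
      qed
      then show "bessel_rep s (\<lambda>\<xi>. F (c *\<^sub>R \<xi>)) (H 0)" using H(1) icF by (simp add: bessel_rep_def)
    qed
  qed
qed

text \<open>Multiplication by \<open>fourier W\<close> is a superposition of the modulations by the frequencies \<open>y\<close>,
  with weight \<open>W y\<close>; a modulation changes the Bessel norm at most polynomially in \<open>y\<close>.\<close>

lemma bessel_rep_times_fourier: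
  fixes s u :: real and W :: "'a::euclidean_space \<Rightarrow> complex"
  assumes s: "0 < s" and u: "1 < u" and [measurable]: "W \<in> borel_measurable borel"
    and W: "\<And>m. integrable lborel (\<lambda>y. (1 + norm y) ^ m * norm (W y))"
  shows "\<exists>C>0. \<forall>F G B. bessel_rep s F G \<longrightarrow> 0 < B \<longrightarrow>
     (\<integral>\<^sup>+\<xi>. norm (G \<xi>) powr u \<partial>lborel) \<le> ennreal (B powr u) \<longrightarrow>
     (\<exists>G'. bessel_rep s (\<lambda>\<xi>. F \<xi> * fourier W \<xi>) G' \<and> (\<integral>\<^sup>+\<xi>. norm (G' \<xi>) powr u \<partial>lborel) \<le> ennreal ((C * B) powr u))"
proof -
  obtain C :: real and m :: nat where C: "C > 0"
    and mul: "bracket_bound s u C m TYPE('a)"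
    by (rule bracket_multiplier[OF s u, where 'a='a]) (rule that)
  define I where "I = (LINT y|lborel. (1 + norm y) ^ m * norm (W y))"
  have I0: "I \<ge> 0" by (simp add: I_def)
  have I: "(\<integral>\<^sup>+y. ennreal ((1 + norm y) ^ m * norm (W y)) \<partial>lborel) = ennreal I"
    unfolding I_def by (rule nn_integral_eq_integral[OF W]) simp
  define D where "D = 2 * C * (I + 1)"
  have D: "D > 0" using C I0 by (simp add: D_def)
  show ?thesis
  proof (intro exI[of _ D] conjI D allI impI)
    fix F G :: "'a \<Rightarrow> complex" and B :: real
    assume rep: "bessel_rep s F G" and B: "0 < B" and G: "(\<integral>\<^sup>+\<xi>. norm (G \<xi>) powr u \<partial>lborel) \<le> ennreal (B powr u)"
    have iF: "integrable lborel F" and iG: "integrable lborel G"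
      and fG: "\<And>x. fourier G x = of_real (jap x powr (s / 2)) * fourier F x"
      using rep by (auto simp: bessel_rep_def)
    have [measurable]: "G \<in> borel_measurable borel" "F \<in> borel_measurable borel" using iG iF by auto
    define L where "L = enn2real (\<integral>\<^sup>+\<xi>. norm (G \<xi>) \<partial>lborel)"
    have L: "(\<integral>\<^sup>+\<xi>. norm (G \<xi>) \<partial>lborel) \<le> ennreal L" "0 \<le> L"
      using iG by (auto simp: L_def integrable_iff_bounded)
    have mm: "(\<lambda>(y::'a, \<xi>). G \<xi>) \<in> borel_measurable (borel \<Otimes>\<^sub>M borel)" by measurable
    obtain H where
      H[measurable]: "case_prod H \<in> borel_measurable (borel \<Otimes>\<^sub>M borel)"
       and H1: "\<And>y. (\<integral>\<^sup>+\<xi>. norm (H y \<xi>) powr u \<partial>lborel) \<le> ennreal ((C * (1 + norm y) ^ m * (1 + 1 powr (- s / 2)) * B) powr u)"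
       and H2: "\<And>y. (\<integral>\<^sup>+\<xi>. norm (H y \<xi>) \<partial>lborel) \<le> ennreal (C * (1 + norm y) ^ m * (1 + 1 powr (- s / 2)) * L)"
       and H3: "\<And>y x. fourier (H y) x = of_real ((jap (x + y) / (1 + 1 * (4 * pi\<^sup>2 * (norm x)\<^sup>2))) powr (s / 2)) * fourier G x"
      by (rule bracket_boundE[OF mul zero_less_one mm iG G B L]) (rule that)
    define Y where "Y y = C * (1 + norm y) ^ m * 2" for y :: 'a
    have Ypos: "Y y > 0" for y unfolding Y_def using C by (intro mult_pos_pos zero_less_power) (auto intro: add_pos_nonneg)
    have [measurable]: "Y \<in> borel_measurable borel" unfolding Y_def by measurable
    have WY: "(\<integral>\<^sup>+y. ennreal (norm (W y) * (Y y * M)) \<partial>lborel) = ennreal (2 * C * I * M)" if "M \<ge> 0" for M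
    proof -
      have "(\<integral>\<^sup>+y. ennreal (norm (W y) * (Y y * M)) \<partial>lborel) = (\<integral>\<^sup>+y. ennreal (2 * C * M) * ennreal ((1 + norm y) ^ m * norm (W y)) \<partial>lborel)"
        using that C by (intro nn_integral_cong) (simp add: Y_def ennreal_mult[symmetric] mult_ac)
      also have "\<dots> = ennreal (2 * C * I * M)"
        using that C I0 by (subst nn_integral_cmult, simp, subst I) (simp add: ennreal_mult[symmetric] mult_ac)
      finally show ?thesis .
    qed
    \<comment> \<open>The sign is dictated by \<open>fourier W\<close>, which superposes the
      characters with frequency \<open>- y\<close>. Such a modulation evaluates transforms at
      \<open>x + y\<close>, and there the corrected function \<open>H (- y)\<close> has exactly the
      weight \<open>jap x powr (s / 2)\<close> of the unshifted point.\<close>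
    define k where "k y \<xi> = W y * (cis (2 * pi * ((- y) \<bullet> \<xi>)) * H (- y) \<xi>)" for y \<xi>
    define f where "f y \<xi> = W y * (cis (2 * pi * ((- y) \<bullet> \<xi>)) * F \<xi>)" for y \<xi>
    have km: "case_prod k \<in> borel_measurable (borel \<Otimes>\<^sub>M borel)" unfolding k_def by measurable
    have fm: "case_prod f \<in> borel_measurable (borel \<Otimes>\<^sub>M borel)" unfolding f_def by measurable
    have kb: "(\<integral>\<^sup>+y. \<integral>\<^sup>+\<xi>. norm (k y \<xi>) \<partial>lborel \<partial>lborel) \<le> ennreal (2 * C * I * L)"
    proof -
      have "(\<integral>\<^sup>+y. \<integral>\<^sup>+\<xi>. norm (k y \<xi>) \<partial>lborel \<partial>lborel) = (\<integral>\<^sup>+y. ennreal (norm (W y)) * (\<integral>\<^sup>+\<xi>. norm (H (- y) \<xi>) \<partial>lborel) \<partial>lborel)"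
        by (simp add: k_def norm_mult ennreal_mult nn_integral_cmult)
      also have "\<dots> \<le> (\<integral>\<^sup>+y. ennreal (norm (W y)) * ennreal (Y y * L) \<partial>lborel)"
        by (intro nn_integral_mono mult_left_mono) (use H2[of "- _"] in \<open>auto simp: Y_def\<close>)
      also have "\<dots> = ennreal (2 * C * I * L)"
        using WY[OF L(2)] Ypos L(2) by (simp add: ennreal_mult less_imp_le)
      finally show ?thesis .
    qed
    have fb: "(\<integral>\<^sup>+y. \<integral>\<^sup>+\<xi>. norm (f y \<xi>) \<partial>lborel \<partial>lborel) < \<infinity>"
    proof -
      have "(\<integral>\<^sup>+y. \<integral>\<^sup>+\<xi>. norm (f y \<xi>) \<partial>lborel \<partial>lborel) = (\<integral>\<^sup>+y. norm (W y) \<partial>lborel) * (\<integral>\<^sup>+\<xi>. norm (F \<xi>) \<partial>lborel)"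
        by (simp add: f_def norm_mult ennreal_mult nn_integral_cmult nn_integral_multc)
      also have "\<dots> < \<infinity>" using iF W[of 0] by (simp add: integrable_iff_bounded ennreal_mult_less_top)
      finally show ?thesis .
    qed
    then have fb': "(\<integral>\<^sup>+y. \<integral>\<^sup>+\<xi>. norm (f y \<xi>) \<partial>lborel \<partial>lborel) \<le> ennreal (enn2real (\<integral>\<^sup>+y. \<integral>\<^sup>+\<xi>. norm (f y \<xi>) \<partial>lborel \<partial>lborel))"
      by (subst ennreal_enn2real) auto
    have fW: "(\<lambda>\<xi>. F \<xi> * fourier W \<xi>) = (\<lambda>\<xi>. LINT y|lborel. f y \<xi>)"
    proof
      fix \<xi>
      have "(LINT y|lborel. f y \<xi>) = (LINT y|lborel. F \<xi> * (W y * cis (- 2 * pi * (y \<bullet> \<xi>))))"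
        unfolding f_def by (intro Bochner_Integration.integral_cong refl) (simp add: mult_ac)
      then show "F \<xi> * fourier W \<xi> = (LINT y|lborel. f y \<xi>)" by (simp add: fourier_def)
    qed
    show "\<exists>G'. bessel_rep s (\<lambda>\<xi>. F \<xi> * fourier W \<xi>) G' \<and> (\<integral>\<^sup>+\<xi>. norm (G' \<xi>) powr u \<partial>lborel) \<le> ennreal ((D * B) powr u)"
    proof (intro exI[of _ "\<lambda>\<xi>. LINT y|lborel. k y \<xi>"] conjI)
      show "bessel_rep s (\<lambda>\<xi>. F \<xi> * fourier W \<xi>) (\<lambda>\<xi>. LINT y|lborel. k y \<xi>)"
        unfolding bessel_rep_def fW
      proof (intro conjI allI fourier_mix(1)[OF fm fb'] fourier_mix(1)[OF km kb])
        fix x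
        have "fourier (k y) x = of_real (jap x powr (s / 2)) * fourier (f y) x" for y
        proof -
          have "(jap x / jap (x + y)) powr (s / 2) * jap (x + y) powr (s / 2) = jap x powr (s / 2)"
            by (simp add: powr_divide)
          then have "fourier (H (- y)) (x + y) = of_real (jap x powr (s / 2)) * fourier F (x + y)"
            unfolding H3 fG by (simp add: jap_def[of "x + y", symmetric] mult.assoc[symmetric] flip: of_real_mult)
          then show ?thesis
            unfolding k_def[abs_def] f_def[abs_def] fourier_cmult fourier_modulate by simp
        qed
        then show "fourier (\<lambda>\<xi>. LINT y|lborel. k y \<xi>) x = of_real (jap x powr (s / 2)) * fourier (\<lambda>\<xi>. LINT y|lborel. f y \<xi>) x"
          unfolding fourier_mix(3)[OF fm fb'] fourier_mix(3)[OF km kb] by simp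
      qed
      show "(\<integral>\<^sup>+\<xi>. norm (LINT y|lborel. k y \<xi>) powr u \<partial>lborel) \<le> ennreal ((D * B) powr u)"
      proof (rule minkowski_powr_integral[OF u, where \<rho>="\<lambda>y. norm (W y)" and b="\<lambda>y. Y y * B" and g="\<lambda>y \<xi>. norm (H (- y) \<xi>)"])
        show "(\<integral>\<^sup>+\<xi>. norm (H (- y) \<xi>) powr u \<partial>lborel) \<le> ennreal ((Y y * B) powr u)" for y
          using H1[of "- y"] by (simp add: Y_def)
        have "2 * C * I * B \<le> D * B" using C B by (simp add: D_def)
        then show "(\<integral>\<^sup>+y. ennreal (norm (W y) * (Y y * B)) \<partial>lborel) \<le> ennreal (D * B)"
          using WY[of B] B by (simp add: ennreal_leI)
      qed (use Ypos B D in \<open>auto simp: k_def norm_mult\<close>)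
    qed
  qed
qed

section \<open>Modulated complex Gaussians\<close>

definition gmod :: "'a::real_inner \<Rightarrow> complex \<Rightarrow> 'a \<Rightarrow> complex" where
  "gmod \<zeta> \<beta> x = cis (2 * pi * (\<zeta> \<bullet> x)) * cgauss \<beta> x"

text \<open>The polynomial prefactors produced by differentiating a modulated Gaussian. Only closure
  under derivatives and polynomial growth are required of the class.\<close>

inductive poly_fun :: "('a::real_inner \<Rightarrow> complex) \<Rightarrow> bool" where
  const: "poly_fun (\<lambda>x. c)"
| inner: "poly_fun (\<lambda>x. of_real (x \<bullet> v))"
| add: "poly_fun P \<Longrightarrow> poly_fun Q \<Longrightarrow> poly_fun (\<lambda>x. P x + Q x)"
| mult: "poly_fun P \<Longrightarrow> poly_fun Q \<Longrightarrow> poly_fun (\<lambda>x. P x * Q x)"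

lemma poly_fun_derivative:
  "poly_fun P \<Longrightarrow> \<exists>D. (\<forall>x. (P has_derivative (\<lambda>h. D h x)) (at x)) \<and> (\<forall>h. poly_fun (D h))"
proof (induction rule: poly_fun.induct)
  case (const c)
  show ?case by (rule exI[of _ "\<lambda>h x. 0"]) (auto intro: poly_fun.const)
next
  case (inner v)
  show ?case
  proof (rule exI[of _ "\<lambda>h x. of_real (h \<bullet> v)"], intro conjI allI)
    show "((\<lambda>x. of_real (x \<bullet> v)) has_derivative (\<lambda>h. complex_of_real (h \<bullet> v))) (at x)" for x
      by (auto intro!: derivative_eq_intros)
  qed (rule poly_fun.const)
next
  case (add P Q)
  then obtain D E where "\<forall>x. (P has_derivative (\<lambda>h. D h x)) (at x)" "\<forall>h. poly_fun (D h)"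
    "\<forall>x. (Q has_derivative (\<lambda>h. E h x)) (at x)" "\<forall>h. poly_fun (E h)" by blast
  then show ?case
    by (intro exI[of _ "\<lambda>h x. D h x + E h x"]) (auto intro!: has_derivative_add poly_fun.add)
next
  case (mult P Q)
  then obtain D E where "\<forall>x. (P has_derivative (\<lambda>h. D h x)) (at x)" "\<forall>h. poly_fun (D h)"
    "\<forall>x. (Q has_derivative (\<lambda>h. E h x)) (at x)" "\<forall>h. poly_fun (E h)" by blast
  with mult show ?case
    by (intro exI[of _ "\<lambda>h x. P x * E h x + D h x * Q x"])
       (auto intro!: has_derivative_mult poly_fun.intros)
qed

lemma poly_fun_growth:
  "poly_fun (P :: 'a::real_inner \<Rightarrow> complex) \<Longrightarrow> \<exists>C m. \<forall>x. norm (P x) \<le> C * (1 + norm x) ^ m"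
proof (induction rule: poly_fun.induct)
  case (const c)
  show ?case by (rule exI[of _ "norm c"], rule exI[of _ 0]) simp
next
  case (inner v)
  show ?case
  proof (rule exI[of _ "norm v"], rule exI[of _ 1], intro allI)
    fix x :: 'a
    have "\<bar>x \<bullet> v\<bar> \<le> norm x * norm v" by (rule Cauchy_Schwarz_ineq2)
    then show "norm (complex_of_real (x \<bullet> v)) \<le> norm v * (1 + norm x) ^ 1"
      by (simp add: algebra_simps add_increasing)
  qed
next
  case (add P Q)
  then obtain C m D k where *: "\<And>x. norm (P x) \<le> C * (1 + norm x) ^ m" "\<And>x. norm (Q x) \<le> D * (1 + norm x) ^ k" by blast
  have CD: "0 \<le> C" "0 \<le> D" using *[of 0] by (auto intro: order_trans[OF norm_ge_zero])
  show ?case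
  proof (rule exI[of _ "C + D"], rule exI[of _ "m + k"], intro allI)
    fix x :: 'a
    have "C * (1 + norm x) ^ m \<le> C * (1 + norm x) ^ (m + k)" "D * (1 + norm x) ^ k \<le> D * (1 + norm x) ^ (m + k)"
      using CD by (intro mult_left_mono power_increasing; simp)+
    then show "norm (P x + Q x) \<le> (C + D) * (1 + norm x) ^ (m + k)"
      using norm_triangle_ineq[of "P x" "Q x"] *[of x] unfolding distrib_right by linarith
  qed
next
  case (mult P Q)
  then obtain C m D k where *: "\<And>x. norm (P x) \<le> C * (1 + norm x) ^ m" "\<And>x. norm (Q x) \<le> D * (1 + norm x) ^ k" by blast
  show ?case
  proof (rule exI[of _ "C * D"], rule exI[of _ "m + k"], intro allI)
    fix x :: 'a
    have "norm (P x) * norm (Q x) \<le> (C * (1 + norm x) ^ m) * (D * (1 + norm x) ^ k)"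
      by (intro mult_mono * order_trans[OF norm_ge_zero *(1)]) auto
    then show "norm (P x * Q x) \<le> C * D * (1 + norm x) ^ (m + k)" by (simp add: norm_mult power_add mult_ac)
  qed
qed

lemma gmod_has_derivative:
  "(gmod \<zeta> \<beta> has_derivative (\<lambda>h. (of_real (h \<bullet> (2 * pi) *\<^sub>R \<zeta>) * \<i> - of_real (x \<bullet> (2 * pi) *\<^sub>R h) * \<beta>) * gmod \<zeta> \<beta> x)) (at x)"
proof -
  have e: "gmod \<zeta> \<beta> = (\<lambda>x. exp (of_real (2 * pi * (\<zeta> \<bullet> x)) * \<i> - of_real (pi * (x \<bullet> x)) * \<beta>))"
    by (rule ext) (simp add: gmod_def cgauss_def cis_conv_exp exp_diff exp_minus power2_norm_eq_inner divide_inverse mult_ac)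
  have "((\<lambda>x. of_real (2 * pi * (\<zeta> \<bullet> x)) * \<i> - of_real (pi * (x \<bullet> x)) * \<beta>) has_derivative
      (\<lambda>h. of_real (2 * pi * (\<zeta> \<bullet> h)) * \<i> - of_real (pi * (x \<bullet> h + h \<bullet> x)) * \<beta>)) (at x)"
    by (intro has_derivative_diff has_derivative_mult_left has_derivative_of_real has_derivative_mult_right
        has_derivative_inner has_derivative_inner_right has_derivative_ident)
  from has_derivative_compose[OF this DERIV_exp[unfolded has_field_derivative_def]]
  show ?thesis unfolding e by (rule has_derivative_eq_rhs) (auto simp: inner_commute algebra_simps)
qed

lemma dderiv_gmod: "\<exists>P. poly_fun P \<and> dderiv vs (gmod \<zeta> \<beta>) = (\<lambda>x. P x * gmod \<zeta> \<beta> x)"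
proof (induction vs)
  case Nil
  show ?case by (rule exI[of _ "\<lambda>x. 1"]) (auto intro: poly_fun.const)
next
  case (Cons v vs)
  then obtain P where P: "poly_fun P" "dderiv vs (gmod \<zeta> \<beta>) = (\<lambda>x. P x * gmod \<zeta> \<beta> x)" by blast
  obtain D where D: "\<And>x. (P has_derivative (\<lambda>h. D h x)) (at x)" "\<And>h. poly_fun (D h)"
    using poly_fun_derivative[OF P(1)] by blast
  define Q where "Q x = P x * (of_real (v \<bullet> (2 * pi) *\<^sub>R \<zeta>) * \<i> + (- \<beta>) * of_real (x \<bullet> (2 * pi) *\<^sub>R v)) + D v x" for x
  have "frechet_derivative (\<lambda>x. P x * gmod \<zeta> \<beta> x) (at x) v = Q x * gmod \<zeta> \<beta> x" for x
  proof -
    have "((\<lambda>x. P x * gmod \<zeta> \<beta> x) has_derivative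
       (\<lambda>h. P x * ((of_real (h \<bullet> (2 * pi) *\<^sub>R \<zeta>) * \<i> - of_real (x \<bullet> (2 * pi) *\<^sub>R h) * \<beta>) * gmod \<zeta> \<beta> x) + D h x * gmod \<zeta> \<beta> x)) (at x)"
      by (intro has_derivative_mult D(1) gmod_has_derivative)
    from frechet_derivative_at[OF this, symmetric] show ?thesis
      by (simp add: Q_def algebra_simps)
  qed
  moreover have "poly_fun Q" unfolding Q_def[abs_def] by (intro poly_fun.intros P(1) D(2))
  ultimately show ?case using P(2) by (intro exI[of _ Q]) auto
qed

lemma poly_exp_bounded:
  fixes c :: real
  assumes "c > 0"
  shows "\<exists>K. \<forall>r\<ge>0. (1 + r) ^ m * exp (- (c * r\<^sup>2)) \<le> K"
proof (rule exI[of _ "fact m * exp (1 + 1 / (4 * c))"], intro allI impI)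
  fix r :: real assume r: "r \<ge> 0"
  have "(1 + r) ^ m / fact m \<le> exp (1 + r)"
  proof -
    have "(\<Sum>n\<in>{m}. (1 + r) ^ n /\<^sub>R fact n) \<le> (\<Sum>n. (1 + r) ^ n /\<^sub>R fact n)"
      using r by (intro sum_le_suminf summable_exp_generic) auto
    then show ?thesis by (simp add: exp_def divide_inverse mult.commute)
  qed
  then have "(1 + r) ^ m * exp (- (c * r\<^sup>2)) \<le> fact m * exp (1 + r) * exp (- (c * r\<^sup>2))"
    by (intro mult_right_mono) (auto simp: field_simps)
  also have "\<dots> = fact m * exp (1 + r - c * r\<^sup>2)" by (simp add: mult_exp_exp mult.assoc)
  also have "1 + r - c * r\<^sup>2 \<le> 1 + 1 / (4 * c)"
  proof -
    have "0 \<le> c * (r - 1 / (2 * c))\<^sup>2" using assms by simp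
    also have "\<dots> = c * r\<^sup>2 - r + 1 / (4 * c)" using assms by (simp add: power2_eq_square field_simps)
    finally show ?thesis by simp
  qed
  then have "fact m * exp (1 + r - c * r\<^sup>2) \<le> fact m * exp (1 + 1 / (4 * c))" by simp
  finally show "(1 + r) ^ m * exp (- (c * r\<^sup>2)) \<le> fact m * exp (1 + 1 / (4 * c))" .
qed

lemma norm_gmod: "norm (gmod \<zeta> \<beta> x) = exp (- (pi * Re \<beta> * (norm x)\<^sup>2))"
  by (simp add: gmod_def norm_mult norm_cgauss)

lemma schwartz_gmod:
  fixes \<zeta> :: "'a::euclidean_space"
  assumes "Re \<beta> > 0"
  shows "schwartz (gmod \<zeta> \<beta>)"
  unfolding schwartz_def
proof (intro conjI allI)
  fix vs :: "'a list" and x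
  obtain P where P: "poly_fun P" "dderiv vs (gmod \<zeta> \<beta>) = (\<lambda>x. P x * gmod \<zeta> \<beta> x)" using dderiv_gmod by blast
  obtain D where D: "\<And>x. (P has_derivative (\<lambda>h. D h x)) (at x)" using poly_fun_derivative[OF P(1)] by blast
  show "dderiv vs (gmod \<zeta> \<beta>) differentiable (at x)"
    unfolding P(2) differentiable_def using has_derivative_mult[OF D gmod_has_derivative] by blast
next
  fix vs :: "'a list" and N :: nat
  obtain P where P: "poly_fun P" "dderiv vs (gmod \<zeta> \<beta>) = (\<lambda>x. P x * gmod \<zeta> \<beta> x)" using dderiv_gmod by blast
  obtain C m where C: "\<And>x. norm (P x) \<le> C * (1 + norm x) ^ m" using poly_fun_growth[OF P(1)] by blast
  have C0: "C \<ge> 0" using C[of 0] by (auto intro: order_trans[OF norm_ge_zero])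
  obtain K where K: "\<And>r. r \<ge> 0 \<Longrightarrow> (1 + r) ^ (N + m) * exp (- ((pi * Re \<beta>) * r\<^sup>2)) \<le> K"
    using poly_exp_bounded[of "pi * Re \<beta>" "N + m"] assms by auto
  show "\<exists>C. \<forall>x. (1 + norm x) ^ N * norm (dderiv vs (gmod \<zeta> \<beta>) x) \<le> C"
  proof (rule exI[of _ "C * K"], intro allI)
    fix x :: 'a
    have "(1 + norm x) ^ N * norm (dderiv vs (gmod \<zeta> \<beta>) x) = (1 + norm x) ^ N * (norm (P x) * exp (- ((pi * Re \<beta>) * (norm x)\<^sup>2)))"
      by (simp add: P(2) norm_mult norm_gmod)
    also have "\<dots> \<le> (1 + norm x) ^ N * ((C * (1 + norm x) ^ m) * exp (- ((pi * Re \<beta>) * (norm x)\<^sup>2)))"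
      by (intro mult_left_mono mult_right_mono C) auto
    also have "\<dots> = C * ((1 + norm x) ^ (N + m) * exp (- ((pi * Re \<beta>) * (norm x)\<^sup>2)))"
      by (simp add: power_add mult_ac)
    also have "\<dots> \<le> C * K" by (intro mult_left_mono K C0) simp
    finally show "(1 + norm x) ^ N * norm (dderiv vs (gmod \<zeta> \<beta>) x) \<le> C * K" .
  qed
qed

lemma fourier_gmod:
  fixes \<xi> \<zeta> :: "'a::euclidean_space"
  assumes "Re \<beta> > 0"
  shows "fourier (gmod \<zeta> \<beta>) \<xi> = \<beta> powr (of_real (- real DIM('a) / 2)) * cgauss (1 / \<beta>) (\<xi> - \<zeta>)"
  unfolding gmod_def[abs_def] fourier_modulate by (rule fourier_cgauss[OF assms])

lemma Lp_norm_gmod: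
  fixes \<zeta> :: "'a::euclidean_space"
  assumes "Re \<beta> > 0" "q > 0"
  shows "Lp_norm q (gmod \<zeta> \<beta>) \<le> ennreal ((q * Re \<beta>) powr (- real DIM('a) / (2 * q)))"
proof -
  have "(\<integral>\<^sup>+x. norm (gmod \<zeta> \<beta> x) powr q \<partial>lborel) = (\<integral>\<^sup>+x. ennreal (exp (- (pi * (q * Re \<beta>) * (norm x)\<^sup>2))) \<partial>(lborel :: 'a measure))"
    by (intro nn_integral_cong) (simp add: norm_gmod powr_def mult_ac)
  also have "\<dots> = ennreal ((q * Re \<beta>) powr (- real DIM('a) / 2))"
    using assms by (intro nn_integral_gaussian) simp
  finally show ?thesis using assms by (simp add: Lp_norm_le_iff powr_powr)
qed

section \<open>The multiplier \<open>F * fourier \<Theta>\<close>\<close>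

definition Hoermander_bound ::
  "((real^'n) \<times> (real^'n) \<Rightarrow> complex) \<Rightarrow> real \<Rightarrow> real \<Rightarrow> real \<Rightarrow> real \<Rightarrow> real \<Rightarrow> bool" where
  "Hoermander_bound \<Theta> u s p p1 p2 \<longleftrightarrow>
     (\<exists>C::real. \<forall>m. m \<in> borel_measurable lborel \<and> bounded (range m) \<and> Aus \<Theta> u s m < \<infinity> \<longrightarrow>
                  (\<forall>f1 f2. schwartz f1 \<and> schwartz f2 \<longrightarrow>
                     Lp_norm p (Tm m f1 f2) \<le> ennreal C * Aus \<Theta> u s m * Lp_norm p1 f1 * Lp_norm p2 f2))"

lemma bessel_norm_zero:
  assumes "0 < u" "\<And>\<xi>. F \<xi> = 0" "0 \<le> B"
  shows "bessel_norm u s F \<le> ennreal B"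
proof -
  have F: "F = (\<lambda>_. 0)" using assms(2) by blast
  show ?thesis unfolding F
    by (rule bessel_norm_le[where G="\<lambda>_. 0"]) (use assms in \<open>auto simp: bessel_rep_def fourier_def\<close>)
qed

text \<open>The annulus that carries \<open>fourier \<Theta>\<close> meets its dilate by
  \<open>2 powr k\<close> only for \<open>\<bar>k\<bar> \<le> 2\<close>, so the supremum in
  \<open>Aus\<close> runs effectively over five scales. The result is phrased with upper bounds
  \<open>B\<close>, \<open>K1\<close>, \<open>K2\<close> for the three norms, so that each test only
  has to supply a representative \<open>G\<close> and two inputs.\<close>

theorem Tm_localized_bound:
  fixes \<Theta> :: "(real^'n) \<times> (real^'n) \<Rightarrow> complex"
  assumes Theta: "schwartz \<Theta>"
    and supp: "\<And>\<xi>. fourier \<Theta> \<xi> \<noteq> 0 \<Longrightarrow> 1/2 \<le> norm \<xi> \<and> norm \<xi> \<le> 2"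
    and s: "0 < s" and u: "1 < u" and p: "0 < p"
    and bound: "Hoermander_bound \<Theta> u s p p1 p2"
  obtains C where "C > 0"
    "\<And>F G B f1 f2 K1 K2. bessel_rep s F G \<Longrightarrow> 0 < B \<Longrightarrow>
       (\<integral>\<^sup>+\<xi>. norm (G \<xi>) powr u \<partial>lborel) \<le> ennreal (B powr u) \<Longrightarrow> bounded (range F) \<Longrightarrow>
       schwartz f1 \<Longrightarrow> schwartz f2 \<Longrightarrow> Lp_norm p1 f1 \<le> ennreal K1 \<Longrightarrow> Lp_norm p2 f2 \<le> ennreal K2 \<Longrightarrow>
       0 \<le> K1 \<Longrightarrow> 0 \<le> K2 \<Longrightarrow>
       (\<integral>\<^sup>+x. norm (Tm (\<lambda>\<xi>. F \<xi> * fourier \<Theta> \<xi>) f1 f2 x) powr p \<partial>lborel) \<le> ennreal ((C * B * K1 * K2) powr p)"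
proof -
  note [measurable] = borel_measurable_schwartz[OF Theta]
  note W = integrable_schwartz_weight[OF Theta]
  obtain C1 where C1: "C1 > 0" "\<And>F G B. bessel_rep s F G \<Longrightarrow> 0 < B \<Longrightarrow>
     (\<integral>\<^sup>+\<xi>. norm (G \<xi>) powr u \<partial>lborel) \<le> ennreal (B powr u) \<Longrightarrow>
     (\<exists>G'. bessel_rep s (\<lambda>\<xi>. F \<xi> * fourier \<Theta> \<xi>) G' \<and> (\<integral>\<^sup>+\<xi>. norm (G' \<xi>) powr u \<partial>lborel) \<le> ennreal ((C1 * B) powr u))"
    using bessel_rep_times_fourier[OF s u borel_measurable_schwartz[OF Theta] W] by blast
  have "\<forall>k::int. \<exists>C>0. \<forall>(F :: (real^'n) \<times> (real^'n) \<Rightarrow> complex) G B. bessel_rep s F G \<longrightarrow> 0 < B \<longrightarrow>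
     (\<integral>\<^sup>+\<xi>. norm (G \<xi>) powr u \<partial>lborel) \<le> ennreal (B powr u) \<longrightarrow>
     (\<exists>G'. bessel_rep s (\<lambda>\<xi>. F ((2 powr real_of_int k) *\<^sub>R \<xi>)) G' \<and> (\<integral>\<^sup>+\<xi>. norm (G' \<xi>) powr u \<partial>lborel) \<le> ennreal ((C * B) powr u))"
    by (intro allI bessel_rep_dilate[OF s u]) simp
  then obtain Ck where Ck: "\<And>k. Ck k > 0" "\<And>k (F :: (real^'n) \<times> (real^'n) \<Rightarrow> complex) G B. bessel_rep s F G \<Longrightarrow> 0 < B \<Longrightarrow>
     (\<integral>\<^sup>+\<xi>. norm (G \<xi>) powr u \<partial>lborel) \<le> ennreal (B powr u) \<Longrightarrow>
     (\<exists>G'. bessel_rep s (\<lambda>\<xi>. F ((2 powr real_of_int k) *\<^sub>R \<xi>)) G' \<and> (\<integral>\<^sup>+\<xi>. norm (G' \<xi>) powr u \<partial>lborel) \<le> ennreal ((Ck k * B) powr u))"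
    by metis
  \<comment> \<open>The dilation constants depend on \<open>k\<close>; only those with
    \<open>\<bar>k\<bar> \<le> 2\<close> matter, and their sum dominates each of them.\<close>
  define S where "S = (\<Sum>k\<in>{-2..2}. Ck k)"
  have Sk: "Ck k \<le> S" if "k \<in> {-2..2}" for k
    unfolding S_def using that Ck(1) by (intro member_le_sum) (auto intro: less_imp_le)
  have S: "S > 0" using Sk[of 0] Ck(1)[of 0] by simp
  define CA where "CA = C1 * S * C1"
  have CA: "CA > 0" using C1 S by (simp add: CA_def)
  have Aus: "Aus \<Theta> u s (\<lambda>\<xi>. F \<xi> * fourier \<Theta> \<xi>) \<le> ennreal (CA * B)"
    if rep: "bessel_rep s F G" and B: "0 < B" and G: "(\<integral>\<^sup>+\<xi>. norm (G \<xi>) powr u \<partial>lborel) \<le> ennreal (B powr u)" for F G B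
    unfolding Aus_def
  proof (rule SUP_least)
    fix k :: int
    let ?c = "2 powr real_of_int k"
    show "bessel_norm u s (\<lambda>\<xi>. F (?c *\<^sub>R \<xi>) * fourier \<Theta> (?c *\<^sub>R \<xi>) * fourier \<Theta> \<xi>) \<le> ennreal (CA * B)"
    proof (cases "k \<in> {-2..2}")
      case True
      \<comment> \<open>Three operations lead from \<open>F\<close> to the piece of the multiplier
        at scale \<open>k\<close>: multiplication by \<open>fourier \<Theta>\<close>, dilation by
        \<open>2 powr k\<close>, and a second multiplication by \<open>fourier \<Theta>\<close>.
        Hence the constant \<open>C1 * S * C1\<close>.\<close>
      obtain G1 where G1: "bessel_rep s (\<lambda>\<xi>. F \<xi> * fourier \<Theta> \<xi>) G1" "(\<integral>\<^sup>+\<xi>. norm (G1 \<xi>) powr u \<partial>lborel) \<le> ennreal ((C1 * B) powr u)"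
        using C1(2)[OF rep B G] by blast
      have B1: "0 < C1 * B" using C1(1) B by simp
      obtain G2 where G2: "bessel_rep s (\<lambda>\<xi>. F (?c *\<^sub>R \<xi>) * fourier \<Theta> (?c *\<^sub>R \<xi>)) G2" "(\<integral>\<^sup>+\<xi>. norm (G2 \<xi>) powr u \<partial>lborel) \<le> ennreal ((Ck k * (C1 * B)) powr u)"
        using Ck(2)[OF G1(1) B1 G1(2)] by blast
      have B2: "0 < Ck k * (C1 * B)" using Ck(1) B1 by simp
      obtain G3 where G3: "bessel_rep s (\<lambda>\<xi>. F (?c *\<^sub>R \<xi>) * fourier \<Theta> (?c *\<^sub>R \<xi>) * fourier \<Theta> \<xi>) G3" "(\<integral>\<^sup>+\<xi>. norm (G3 \<xi>) powr u \<partial>lborel) \<le> ennreal ((C1 * (Ck k * (C1 * B))) powr u)"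
        using C1(2)[OF G2(1) B2 G2(2)] by blast
      have "bessel_norm u s (\<lambda>\<xi>. F (?c *\<^sub>R \<xi>) * fourier \<Theta> (?c *\<^sub>R \<xi>) * fourier \<Theta> \<xi>) \<le> ennreal (C1 * (Ck k * (C1 * B)))"
        using u B2 C1(1) by (intro bessel_norm_le[OF G3(1) _ _ G3(2)]) auto
      also have "\<dots> \<le> ennreal (CA * B)"
      proof (rule ennreal_leI)
        have "C1 * (Ck k * (C1 * B)) = (C1 * C1 * B) * Ck k" by simp
        also have "\<dots> \<le> (C1 * C1 * B) * S" using Sk[OF True] C1 B by (intro mult_left_mono) auto
        finally show "C1 * (Ck k * (C1 * B)) \<le> CA * B" by (simp add: CA_def mult_ac)
      qed
      finally show ?thesis .
    next
      case False
      have "F (?c *\<^sub>R \<xi>) * fourier \<Theta> (?c *\<^sub>R \<xi>) * fourier \<Theta> \<xi> = 0" for \<xi>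
      proof (rule ccontr)
        assume "F (?c *\<^sub>R \<xi>) * fourier \<Theta> (?c *\<^sub>R \<xi>) * fourier \<Theta> \<xi> \<noteq> 0"
        then have a: "1/2 \<le> norm \<xi>" "norm \<xi> \<le> 2" "1/2 \<le> ?c * norm \<xi>" "?c * norm \<xi> \<le> 2"
          using supp[of \<xi>] supp[of "?c *\<^sub>R \<xi>"] by auto
        have "?c * (1/2) \<le> ?c * norm \<xi>" by (rule mult_left_mono[OF a(1)]) simp
        moreover have "?c * norm \<xi> \<le> ?c * 2" by (rule mult_left_mono[OF a(2)]) simp
        ultimately have "?c \<le> 4" "1/4 \<le> ?c" using a by linarith+
        then have "2 powr real_of_int k \<le> 2 powr 2" "2 powr (-2) \<le> 2 powr real_of_int k"
          by (auto simp: powr_minus)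
        then have "real_of_int k \<le> 2" "-2 \<le> real_of_int k" by (subst (asm) powr_le_cancel_iff; simp)+
        then show False using False by auto
      qed
      then show ?thesis using u CA B by (intro bessel_norm_zero) auto
    qed
  qed
  obtain C0 where C0: "\<And>m f1 f2. m \<in> borel_measurable lborel \<Longrightarrow> bounded (range m) \<Longrightarrow> Aus \<Theta> u s m < \<infinity> \<Longrightarrow>
      schwartz f1 \<Longrightarrow> schwartz f2 \<Longrightarrow> Lp_norm p (Tm m f1 f2) \<le> ennreal C0 * Aus \<Theta> u s m * Lp_norm p1 f1 * Lp_norm p2 f2"
    using bound unfolding Hoermander_bound_def by blast
  \<comment> \<open>The given \<open>C0\<close> may be negative, and \<open>ennreal\<close> sends
    negative numbers to 0; a positive majorant lets the product of all constants be formed in the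
    reals.\<close>
  define C' where "C' = \<bar>C0\<bar> + 1"
  have C': "C' > 0" "C0 \<le> C'" by (auto simp: C'_def)
  define C where "C = C' * CA"
  have C: "C > 0" using CA C' by (simp add: C_def)
  show thesis
  proof (rule that[OF C])
    fix F G :: "(real^'n) \<times> (real^'n) \<Rightarrow> complex" and B K1 K2 :: real and f1 f2 :: "real^'n \<Rightarrow> complex"
    assume rep: "bessel_rep s F G" and B: "0 < B" and G: "(\<integral>\<^sup>+\<xi>. norm (G \<xi>) powr u \<partial>lborel) \<le> ennreal (B powr u)"
      and bF: "bounded (range F)" and f: "schwartz f1" "schwartz f2"
      and K: "Lp_norm p1 f1 \<le> ennreal K1" "Lp_norm p2 f2 \<le> ennreal K2" "0 \<le> K1" "0 \<le> K2"
    have [measurable]: "F \<in> borel_measurable borel" using rep by (auto simp: bessel_rep_def)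
    note A = Aus[OF rep B G]
    have bm: "bounded (range (\<lambda>\<xi>. F \<xi> * fourier \<Theta> \<xi>))"
    proof -
      obtain b where b: "\<And>\<xi>. norm (F \<xi>) \<le> b" using bF unfolding bounded_iff by auto
      have "norm (F \<xi> * fourier \<Theta> \<xi>) \<le> b * (LINT x|lborel. norm (\<Theta> x))" for \<xi>
        unfolding norm_mult by (intro mult_mono b norm_fourier_le order_trans[OF norm_ge_zero b]) auto
      then show ?thesis unfolding bounded_iff by blast
    qed
    have "Lp_norm p (Tm (\<lambda>\<xi>. F \<xi> * fourier \<Theta> \<xi>) f1 f2)
       \<le> ennreal C0 * Aus \<Theta> u s (\<lambda>\<xi>. F \<xi> * fourier \<Theta> \<xi>) * Lp_norm p1 f1 * Lp_norm p2 f2"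
      by (rule C0[OF _ bm _ f]) (use A in \<open>auto intro: le_less_trans\<close>)
    also have "\<dots> \<le> ennreal C' * ennreal (CA * B) * ennreal K1 * ennreal K2"
      by (intro mult_mono A K ennreal_leI C') auto
    also have "\<dots> = ennreal (C * B * K1 * K2)"
      using CA B K C' by (simp add: C_def ennreal_mult[symmetric] mult_ac)
    finally show "(\<integral>\<^sup>+x. norm (Tm (\<lambda>\<xi>. F \<xi> * fourier \<Theta> \<xi>) f1 f2 x) powr p \<partial>lborel) \<le> ennreal ((C * B * K1 * K2) powr p)"
      using Lp_norm_le_iff[OF p, of "C * B * K1 * K2" "Tm (\<lambda>\<xi>. F \<xi> * fourier \<Theta> \<xi>) f1 f2"] C B K by simp
  qed
qed

lemma cgauss_Pair: "cgauss a (x, y) = cgauss a x * cgauss a y"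
  by (simp add: cgauss_def norm_Pair ring_distribs exp_add[symmetric])

text \<open>If \<open>fourier \<Theta>\<close> vanished identically, every multiplier would have
  norm 0, and the assumed bound would make the output for the constant multiplier 1 vanish. On two
  Gaussians that output is a nonzero Gaussian.\<close>

lemma fourier_Theta_nonzero:
  fixes \<Theta> :: "(real^'n) \<times> (real^'n) \<Rightarrow> complex"
  assumes p: "0 < p" "0 < p1" "0 < p2" and u: "0 < u" and bound: "Hoermander_bound \<Theta> u s p p1 p2"
  obtains \<zeta> where "fourier \<Theta> \<zeta> \<noteq> 0"
proof (rule ccontr)
  assume "\<not> thesis"
  with that have z: "fourier \<Theta> \<zeta> = 0" for \<zeta> by blast
  have A: "Aus \<Theta> u s (\<lambda>_. 1) = 0"
  proof -
    have "bessel_norm u s (\<lambda>\<xi>. 1 * fourier \<Theta> \<xi>) \<le> ennreal 0" by (rule bessel_norm_zero[OF u]) (auto simp: z)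
    then show ?thesis by (simp add: Aus_def)
  qed
  let ?g = "gmod 0 1 :: real^'n \<Rightarrow> complex"
  have sg: "schwartz ?g" by (rule schwartz_gmod) simp
  obtain C where C: "\<And>m f1 f2. m \<in> borel_measurable lborel \<Longrightarrow> bounded (range m) \<Longrightarrow> Aus \<Theta> u s m < \<infinity> \<Longrightarrow>
      schwartz f1 \<Longrightarrow> schwartz f2 \<Longrightarrow> Lp_norm p (Tm m f1 f2) \<le> ennreal C * Aus \<Theta> u s m * Lp_norm p1 f1 * Lp_norm p2 f2"
    using bound unfolding Hoermander_bound_def by blast
  have "Lp_norm p (Tm (\<lambda>_. 1) ?g ?g) \<le> ennreal C * Aus \<Theta> u s (\<lambda>_. 1) * Lp_norm p1 ?g * Lp_norm p2 ?g"
    by (rule C) (use sg A in auto)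
  then have "Lp_norm p (Tm (\<lambda>_. 1) ?g ?g) \<le> ennreal 0" by (simp add: A)
  then have le: "(\<integral>\<^sup>+x. norm (Tm (\<lambda>_. 1) ?g ?g x) powr p \<partial>lborel) \<le> 0"
    using Lp_norm_le_iff[OF p(1), of 0 "Tm (\<lambda>_. 1) ?g ?g"] by simp
  \<comment> \<open>For the constant multiplier the output is the product of the two inputs; here it
    appears as the transform of a Gaussian on the product space at a diagonal point.\<close>
  have T: "Tm (\<lambda>_. 1) ?g ?g x = cgauss 1 (- (x, x))" for x
  proof -
    have "Tm (\<lambda>_. 1) ?g ?g x = fourier (cgauss 1) (- (x, x))"
      unfolding Tm_def fourier_def[of "cgauss 1"]
    proof (intro Bochner_Integration.integral_cong refl)
      fix \<xi> :: "(real^'n) \<times> (real^'n)"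
      have "fourier ?g (fst \<xi>) * fourier ?g (snd \<xi>) = cgauss 1 \<xi>"
        using cgauss_Pair[of 1 "fst \<xi>" "snd \<xi>"] by (simp add: fourier_gmod)
      moreover have "- 2 * pi * (\<xi> \<bullet> - (x, x)) = 2 * pi * (x \<bullet> (fst \<xi> + snd \<xi>))"
        by (cases \<xi>) (simp add: inner_add_right inner_commute algebra_simps)
      ultimately show "fourier ?g (fst \<xi>) * fourier ?g (snd \<xi>) * 1 * cis (2 * pi * (x \<bullet> (fst \<xi> + snd \<xi>)))
         = cgauss 1 \<xi> * cis (- 2 * pi * (\<xi> \<bullet> - (x, x)))" by (simp only: mult_1_right)
    qed
    then show ?thesis by (simp add: fourier_cgauss)
  qed
  have "(\<integral>\<^sup>+x. norm (Tm (\<lambda>_. 1) ?g ?g x) powr p \<partial>lborel) = (\<integral>\<^sup>+x. ennreal (exp (- (pi * (2 * p) * (norm x)\<^sup>2))) \<partial>(lborel :: (real^'n) measure))"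
    unfolding T by (intro nn_integral_cong) (simp add: norm_cgauss powr_def norm_Pair mult_ac)
  also have "\<dots> = ennreal ((2 * p) powr (- real DIM(real^'n) / 2))" using p by (intro nn_integral_gaussian) simp
  finally show False using le p by (simp add: ennreal_eq_0_iff)
qed

section \<open>The Bessel kernel\<close>

text \<open>The convolution kernel that inverts the Bessel weight of order \<open>s\<close>, as a
  Gamma average of heat kernels. In this form positivity, total mass and transform follow from those
  of \<open>heat\<close>.\<close>

definition bessel_ker :: "real \<Rightarrow> 'a::euclidean_space \<Rightarrow> real" where
  "bessel_ker s \<xi> = (LINT t|lborel. (1 / Gamma (s / 2)) * (gker (s / 2) t * exp (- t)) * heat t \<xi>)"

context
  fixes s :: real
  assumes s: "0 < s"
begin

lemma bessel_ker_nonneg: "0 \<le> bessel_ker s \<xi>"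
  unfolding bessel_ker_def using s by (intro Bochner_Integration.integral_nonneg) (simp add: less_imp_le)

lemma borel_measurable_bessel_ker [measurable]: "bessel_ker s \<in> borel_measurable borel"
  unfolding bessel_ker_def[abs_def] by measurable

lemma bessel_ker_bound:
  "(\<integral>\<^sup>+t. \<integral>\<^sup>+\<xi>. norm (complex_of_real ((1 / Gamma (s / 2)) * (gker (s / 2) t * exp (- t)) * heat t (\<xi>::'a::euclidean_space))) \<partial>lborel \<partial>lborel) \<le> ennreal 1"
proof -
  have g: "Gamma (s/2) > 0" using s by simp
  have "(\<integral>\<^sup>+t. \<integral>\<^sup>+\<xi>. norm (complex_of_real ((1 / Gamma (s / 2)) * (gker (s / 2) t * exp (- t)) * heat t (\<xi>::'a))) \<partial>lborel \<partial>lborel)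
     = (\<integral>\<^sup>+t. ennreal (1 / Gamma (s/2)) * ennreal (gker (s / 2) t * exp (- (t * 1))) \<partial>lborel)"
  proof (rule nn_integral_cong)
    fix t :: real
    show "(\<integral>\<^sup>+\<xi>. norm (complex_of_real ((1 / Gamma (s / 2)) * (gker (s / 2) t * exp (- t)) * heat t (\<xi>::'a))) \<partial>lborel)
       = ennreal (1 / Gamma (s/2)) * ennreal (gker (s / 2) t * exp (- (t * 1)))"
    proof (cases "t > 0")
      case True
      have "(\<integral>\<^sup>+\<xi>. norm (complex_of_real ((1 / Gamma (s / 2)) * (gker (s / 2) t * exp (- t)) * heat t (\<xi>::'a))) \<partial>lborel)
         = (\<integral>\<^sup>+\<xi>. ennreal ((1 / Gamma (s / 2)) * (gker (s / 2) t * exp (- t))) * ennreal (heat t (\<xi>::'a)) \<partial>lborel)"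
      proof (rule nn_integral_cong)
        fix \<xi> :: 'a
        have "0 \<le> (1 / Gamma (s / 2)) * (gker (s / 2) t * exp (- t)) * heat t \<xi>" using g by simp
        then show "ennreal (norm (complex_of_real ((1 / Gamma (s / 2)) * (gker (s / 2) t * exp (- t)) * heat t \<xi>)))
          = ennreal ((1 / Gamma (s / 2)) * (gker (s / 2) t * exp (- t))) * ennreal (heat t \<xi>)"
          using g by (simp only: norm_of_real abs_of_nonneg) (intro ennreal_mult; simp)
      qed
      also have "\<dots> = ennreal ((1 / Gamma (s / 2)) * (gker (s / 2) t * exp (- t)))"
        by (simp add: nn_integral_cmult nn_integral_heat[OF True])
      finally show ?thesis using g by (simp add: ennreal_mult[symmetric] less_imp_le)
    qed (simp add: gker_def)
  qed
  also have "\<dots> = ennreal (1 / Gamma (s/2)) * ennreal (Gamma (s/2) * 1 powr (- (s/2)))"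
    using s by (subst nn_integral_cmult, simp, subst nn_integral_gker_exp) auto
  also have "\<dots> = 1" using g by (simp add: ennreal_mult[symmetric] less_imp_le)
  finally show ?thesis by simp
qed

lemma bessel_ker_of_real:
  "complex_of_real (bessel_ker s \<xi>) = (LINT t|lborel. complex_of_real ((1 / Gamma (s / 2)) * (gker (s / 2) t * exp (- t)) * heat t \<xi>))"
  unfolding bessel_ker_def integral_complex_of_real ..

lemma
  shows integrable_bessel_ker: "integrable lborel (\<lambda>\<xi>::'a::euclidean_space. complex_of_real (bessel_ker s \<xi>))"
    and nn_integral_bessel_ker: "(\<integral>\<^sup>+\<xi>. bessel_ker s (\<xi>::'a) \<partial>lborel) \<le> ennreal 1"
    and fourier_bessel_ker: "fourier (\<lambda>\<xi>::'a. complex_of_real (bessel_ker s \<xi>)) x = of_real (jap x powr (- s / 2))"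
proof -
  have m: "(\<lambda>(t, \<xi>). complex_of_real ((1 / Gamma (s / 2)) * (gker (s / 2) t * exp (- t)) * heat t (\<xi>::'a))) \<in> borel_measurable (borel \<Otimes>\<^sub>M borel)"
    by measurable
  note mix = fourier_mix[OF m bessel_ker_bound]
  have g: "Gamma (s/2) \<noteq> 0" using s Gamma_real_pos[of "s/2"] by linarith
  show "integrable lborel (\<lambda>\<xi>::'a. complex_of_real (bessel_ker s \<xi>))"
    unfolding bessel_ker_of_real by (rule mix(1))
  show "(\<integral>\<^sup>+\<xi>. bessel_ker s (\<xi>::'a) \<partial>lborel) \<le> ennreal 1"
    using mix(2) unfolding bessel_ker_of_real[symmetric] by (simp add: bessel_ker_nonneg)
  have "fourier (\<lambda>\<xi>::'a. complex_of_real (bessel_ker s \<xi>)) x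
     = (LINT t|lborel. fourier (\<lambda>\<xi>. complex_of_real ((1 / Gamma (s / 2)) * (gker (s / 2) t * exp (- t)) * heat t \<xi>)) x)"
    unfolding bessel_ker_of_real by (rule mix(3))
  also have "\<dots> = (LINT t|lborel. complex_of_real ((1 / Gamma (s/2)) * (gker (s/2) t * exp (- (t * jap x)))))"
  proof (rule Bochner_Integration.integral_cong[OF refl])
    fix t
    show "fourier (\<lambda>\<xi>. complex_of_real ((1 / Gamma (s / 2)) * (gker (s / 2) t * exp (- t)) * heat t \<xi>)) x
      = complex_of_real ((1 / Gamma (s/2)) * (gker (s/2) t * exp (- (t * jap x))))"
    proof (cases "t > 0")
      case True
      have "exp (- t) * exp (- (t * (4 * pi\<^sup>2 * (norm x)\<^sup>2))) = exp (- (t * jap x))"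
        by (simp add: mult_exp_exp jap_def algebra_simps)
      then show ?thesis
        unfolding of_real_mult[of _ "heat t _"] fourier_cmult fourier_heat[OF True]
        by (simp only: of_real_mult[symmetric] mult.assoc)
    qed (simp add: gker_def fourier_def)
  qed
  also have "\<dots> = of_real (jap x powr (- s / 2))"
    unfolding integral_complex_of_real using integral_gker_exp[of "s/2" "jap x"] s g by simp
  finally show "fourier (\<lambda>\<xi>::'a. complex_of_real (bessel_ker s \<xi>)) x = of_real (jap x powr (- s / 2))" .
qed

text \<open>For \<open>norm \<xi> = r \<le> 1\<close> only the heat times between
  \<open>r\<^sup>2 / 2\<close> and \<open>r\<^sup>2\<close> are kept: there the heat kernel has size
  \<open>r powr (- d)\<close>, the Gamma weight has size \<open>r powr (s - 2)\<close>, and the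
  interval has length \<open>r\<^sup>2 / 2\<close>. The bound is stated almost everywhere because
  integrability in \<open>t\<close> is taken from Fubini; it is only used under an integral.\<close>

lemma bessel_ker_lower:
  obtains c where "c > 0"
    "AE \<xi> in (lborel :: 'a::euclidean_space measure). norm \<xi> \<le> 1 \<longrightarrow> \<xi> \<noteq> 0 \<longrightarrow> c * norm \<xi> powr (s - real DIM('a)) \<le> bessel_ker s \<xi>"
proof -
  define d where "d = real DIM('a)"
  define \<alpha> where "\<alpha> = s / 2 - 1 - d / 2"
  \<comment> \<open>The factor \<open>exp (- 3/2)\<close> bounds the two exponentials from below, as
    \<open>t \<le> 1\<close> and \<open>r\<^sup>2 / (4 * t) \<le> 1/2\<close> on the chosen
    interval; the minimum covers both signs of \<open>\<alpha>\<close>, the power of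
    \<open>t\<close> in the integrand.\<close>
  define c0 where "c0 = (1 / Gamma (s/2)) * (4 * pi) powr (- d / 2) * exp (- 3/2) * min 1 ((1/2) powr \<alpha>)"
  have c0: "c0 > 0" using s by (simp add: c0_def)
  define c where "c = c0 / 2"
  have c: "c > 0" using c0 by (simp add: c_def)
  have m: "(\<lambda>(t, \<xi>). complex_of_real ((1 / Gamma (s / 2)) * (gker (s / 2) t * exp (- t)) * heat t (\<xi>::'a))) \<in> borel_measurable (borel \<Otimes>\<^sub>M borel)"
    by measurable
  have "AE \<xi> in (lborel :: 'a measure). integrable lborel (\<lambda>t. complex_of_real ((1 / Gamma (s / 2)) * (gker (s / 2) t * exp (- t)) * heat t \<xi>))"
    by (rule fubini_lborel(4)[OF m]) (rule le_less_trans[OF bessel_ker_bound], simp)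
  then have "AE \<xi> in (lborel :: 'a measure). norm \<xi> \<le> 1 \<longrightarrow> \<xi> \<noteq> 0 \<longrightarrow> c * norm \<xi> powr (s - d) \<le> bessel_ker s \<xi>"
  proof eventually_elim
    case (elim \<xi>)
    show ?case
    proof (intro impI)
      assume \<xi>: "norm \<xi> \<le> 1" "\<xi> \<noteq> 0"
      define r where "r = norm \<xi>"
      have r: "0 < r" "r \<le> 1" using \<xi> by (auto simp: r_def)
      let ?k = "\<lambda>t. (1 / Gamma (s / 2)) * (gker (s / 2) t * exp (- t)) * heat t \<xi>"
      have i: "integrable lborel ?k" using elim by (simp only: complex_of_real_integrable_eq)
      have low: "c0 * r powr (2 * \<alpha>) \<le> ?k t" if t: "t \<in> {r\<^sup>2/2..r\<^sup>2}" for t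
      proof -
        have t0: "0 < t" "t \<le> 1" "t \<le> r\<^sup>2" "r\<^sup>2 / 2 \<le> t"
          using t r by (auto intro: order_trans[OF _ power_le_one] less_le_trans[of 0 "r\<^sup>2/2"])
        have a: "min 1 ((1/2) powr \<alpha>) * r powr (2 * \<alpha>) \<le> t powr \<alpha>"
        proof (cases "\<alpha> \<ge> 0")
          case True
          have "min 1 ((1/2) powr \<alpha>) * r powr (2 * \<alpha>) \<le> (1/2) powr \<alpha> * r powr (2 * \<alpha>)"
            by (intro mult_right_mono) auto
          also have "\<dots> = (r\<^sup>2 / 2) powr \<alpha>"
            using r by (simp add: powr_divide powr_powr powr_numeral[symmetric] del: powr_numeral)
          also have "\<dots> \<le> t powr \<alpha>" using True t0 r by (intro powr_mono2) auto
          finally show ?thesis .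
        next
          case False
          have "min 1 ((1/2) powr \<alpha>) * r powr (2 * \<alpha>) \<le> 1 * r powr (2 * \<alpha>)"
            by (intro mult_right_mono) auto
          also have "\<dots> = (r\<^sup>2) powr \<alpha>"
            using r by (simp add: powr_powr powr_numeral[symmetric] del: powr_numeral)
          also have "\<dots> \<le> t powr \<alpha>" using False t0 r by (intro powr_mono2') auto
          finally show ?thesis .
        qed
        have "?k t = (1 / Gamma (s/2)) * (4 * pi) powr (- d / 2) * exp (- t - r\<^sup>2 / (4 * t)) * t powr \<alpha>"
        proof -
          have "t powr (s/2 - 1) * (4 * pi * t) powr (- d / 2) = (4 * pi) powr (- d / 2) * t powr \<alpha>"
            using t0 by (simp add: powr_mult powr_add[symmetric] \<alpha>_def)
          moreover have "exp (- t) * exp (- (r\<^sup>2 / (4 * t))) = exp (- t - r\<^sup>2 / (4 * t))" by (simp add: mult_exp_exp)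
          moreover have "?k t = (1 / Gamma (s/2)) * ((t powr (s/2 - 1) * (4 * pi * t) powr (- d / 2)) * (exp (- t) * exp (- (r\<^sup>2 / (4 * t)))))"
            using t0 by (simp add: gker_def heat_def d_def r_def)
          ultimately show ?thesis by (simp add: mult_ac)
        qed
        moreover have "exp (- 3/2) \<le> exp (- t - r\<^sup>2 / (4 * t))"
        proof -
          have "r\<^sup>2 / (4 * t) \<le> 1/2" using t0 by (simp add: field_simps)
          then have "- 3/2 \<le> - t - r\<^sup>2 / (4 * t)" using t0 by linarith
          then show ?thesis by (simp only: exp_le_cancel_iff)
        qed
        ultimately have "(1 / Gamma (s/2)) * (4 * pi) powr (- d / 2) * exp (- 3/2) * (min 1 ((1/2) powr \<alpha>) * r powr (2 * \<alpha>)) \<le> ?k t"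
          using a s by (simp only:) (intro mult_mono mult_left_mono mult_nonneg_nonneg; simp)
        then show ?thesis by (simp only: c0_def mult.assoc)
      qed
      have "c * r powr (s - d) = (LINT t|lborel. indicator {r\<^sup>2/2..r\<^sup>2} t * (c0 * r powr (2 * \<alpha>)))"
      proof -
        have "measure lborel {r\<^sup>2/2..r\<^sup>2} = r\<^sup>2 / 2" by (simp add: measure_def)
        moreover have "r powr (s - d) = r powr (2 * \<alpha>) * r\<^sup>2"
          using r by (simp add: \<alpha>_def powr_numeral[symmetric] powr_add[symmetric] algebra_simps del: powr_numeral)
        ultimately show ?thesis by (simp add: c_def)
      qed
      also have "\<dots> \<le> (LINT t|lborel. ?k t)"
      proof (rule integral_mono)
        show "integrable lborel (\<lambda>t. indicator {r\<^sup>2/2..r\<^sup>2} t * (c0 * r powr (2 * \<alpha>)))"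
          by (intro integrable_mult_left) simp
        show "indicator {r\<^sup>2/2..r\<^sup>2} t * (c0 * r powr (2 * \<alpha>)) \<le> ?k t" for t
          using low[of t] s by (auto split: split_indicator intro!: mult_nonneg_nonneg less_imp_le[OF Gamma_real_pos])
      qed (rule i)
      finally show "c * norm \<xi> powr (s - d) \<le> bessel_ker s \<xi>" by (simp add: bessel_ker_def r_def)
    qed
  qed
  then show thesis using that c unfolding d_def by blast
qed

text \<open>Any integrable \<open>G\<close> can be prescribed as the representative. Test
  multipliers are therefore designed through \<open>G\<close>, whose L^u norm is explicit, and
  obtained from it by convolution.\<close>

lemma bessel_rep_convol:
  fixes G :: "'a::euclidean_space \<Rightarrow> complex"
  assumes "integrable lborel G"
  shows "bessel_rep s (convol (\<lambda>\<xi>. of_real (bessel_ker s \<xi>)) G) G"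
proof -
  have "jap x powr (s / 2) * jap x powr (- s / 2) = 1" for x :: 'a by (simp add: powr_add[symmetric])
  then show ?thesis
    unfolding bessel_rep_def
    by (auto simp: integrable_convol fourier_convol integrable_bessel_ker assms fourier_bessel_ker
        mult.assoc[symmetric] simp flip: of_real_mult)
qed

lemma norm_convol_bessel_le:
  fixes G :: "'a::euclidean_space \<Rightarrow> complex"
  assumes "\<And>\<xi>. norm (G \<xi>) \<le> b"
  shows "norm (convol (\<lambda>\<xi>. of_real (bessel_ker s \<xi>)) G \<xi>) \<le> b"
proof -
  have b: "b \<ge> 0" using assms[of 0] by (auto intro: order_trans[OF norm_ge_zero])
  have "ennreal (norm (convol (\<lambda>\<xi>. of_real (bessel_ker s \<xi>)) G \<xi>)) \<le> (\<integral>\<^sup>+\<eta>. norm (of_real (bessel_ker s \<eta>) * G (\<xi> - \<eta>)) \<partial>lborel)"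
    unfolding convol_def by (rule norm_integral_le_nn_integral)
  also have "\<dots> \<le> (\<integral>\<^sup>+\<eta>. ennreal b * ennreal (bessel_ker s (\<eta>::'a)) \<partial>lborel)"
  proof (rule nn_integral_mono)
    fix \<eta> :: 'a
    have "norm (of_real (bessel_ker s \<eta>) * G (\<xi> - \<eta>)) = bessel_ker s \<eta> * norm (G (\<xi> - \<eta>))"
      by (simp add: norm_mult bessel_ker_nonneg)
    also have "\<dots> \<le> bessel_ker s \<eta> * b" by (intro mult_left_mono assms bessel_ker_nonneg)
    finally show "ennreal (norm (of_real (bessel_ker s \<eta>) * G (\<xi> - \<eta>))) \<le> ennreal b * ennreal (bessel_ker s \<eta>)"
      using b by (simp add: ennreal_mult[symmetric] bessel_ker_nonneg mult.commute)
  qed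
  also have "\<dots> \<le> ennreal b * ennreal 1"
    by (subst nn_integral_cmult, simp) (intro mult_left_mono nn_integral_bessel_ker, simp)
  finally show ?thesis using b by simp
qed

lemma isCont_convol_bessel:
  fixes G :: "'a::euclidean_space \<Rightarrow> complex"
  assumes b: "\<And>\<xi>. norm (G \<xi>) \<le> b" and c: "continuous_on UNIV G"
  shows "isCont (convol (\<lambda>\<xi>. of_real (bessel_ker s \<xi>)) G) \<xi>"
  unfolding continuous_at_sequentially o_def
proof (intro allI impI)
  fix X assume X: "X \<longlonglongrightarrow> \<xi>"
  have [measurable]: "G \<in> borel_measurable borel" by (rule borel_measurable_continuous_onI[OF c])
  have bn: "b \<ge> 0" using b[of 0] by (auto intro: order_trans[OF norm_ge_zero])
  show "(\<lambda>n. convol (\<lambda>\<xi>. of_real (bessel_ker s \<xi>)) G (X n)) \<longlonglongrightarrow> convol (\<lambda>\<xi>. of_real (bessel_ker s \<xi>)) G \<xi>"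
    unfolding convol_def
  proof (rule integral_dominated_convergence[where w="\<lambda>\<eta>. b * norm (complex_of_real (bessel_ker s \<eta>))"])
    show "integrable lborel (\<lambda>\<eta>::'a. b * norm (complex_of_real (bessel_ker s \<eta>)))"
      by (intro integrable_mult_right integrable_norm integrable_bessel_ker)
    have "isCont G y" for y using c by (simp add: continuous_on_eq_continuous_at)
    then show "AE \<eta> in lborel. (\<lambda>n. of_real (bessel_ker s \<eta>) * G (X n - \<eta>)) \<longlonglongrightarrow> of_real (bessel_ker s \<eta>) * G (\<xi> - \<eta>)"
      by (intro AE_I2 tendsto_mult_left isCont_tendsto_compose[of _ G] tendsto_diff X tendsto_const)
    show "AE \<eta> in lborel. norm (of_real (bessel_ker s \<eta>) * G (X n - \<eta>)) \<le> b * norm (complex_of_real (bessel_ker s \<eta>))" for n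
      using mult_left_mono[OF b abs_ge_zero] by (intro AE_I2) (simp add: norm_mult mult.commute[of b])
  qed auto
qed

end

section \<open>Tools for the lower bounds\<close>

text \<open>Each of the three necessary conditions ends here: two power laws in \<open>N\<close> are
  compared for all large \<open>N\<close>, and only their exponents matter.\<close>

lemma growth_exponent_le:
  fixes a b \<alpha> \<beta> :: real
  assumes a: "a > 0" and le: "\<And>N::nat. N \<ge> N0 \<Longrightarrow> a * real N powr \<beta> \<le> b * real N powr \<alpha>"
  shows "\<beta> \<le> \<alpha>"
proof (rule ccontr)
  assume "\<not> \<beta> \<le> \<alpha>"
  then have d: "\<beta> - \<alpha> > 0" by simp
  define M where "M = max 1 (b / a)"
  have "eventually (\<lambda>N. M powr (1 / (\<beta> - \<alpha>)) < real N) sequentially"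
    using filterlim_real_sequentially by (simp add: filterlim_at_top_dense)
  then have "eventually (\<lambda>N. b / a < real N powr (\<beta> - \<alpha>)) sequentially"
  proof eventually_elim
    case (elim N)
    then have "(M powr (1 / (\<beta> - \<alpha>))) powr (\<beta> - \<alpha>) < real N powr (\<beta> - \<alpha>)"
      using d by (intro powr_less_mono2) auto
    then show ?case using d by (simp add: powr_powr M_def)
  qed
  moreover have "eventually (\<lambda>N. N \<ge> max N0 1) sequentially" by (rule eventually_ge_at_top)
  ultimately have "eventually (\<lambda>N::nat. False) sequentially"
  proof eventually_elim
    case (elim N)
    then have N: "real N > 0" "N \<ge> N0" by auto
    have "a * (real N powr (\<beta> - \<alpha>) * real N powr \<alpha>) \<le> b * real N powr \<alpha>"
      using le[OF N(2)] by (simp add: powr_add[symmetric])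
    then have "(a * real N powr (\<beta> - \<alpha>)) * real N powr \<alpha> \<le> b * real N powr \<alpha>" by (simp only: mult.assoc)
    then have "a * real N powr (\<beta> - \<alpha>) \<le> b" using N by (subst (asm) mult_le_cancel_right) auto
    then have "real N powr (\<beta> - \<alpha>) \<le> b / a" using a by (simp add: field_simps)
    with elim show False by simp
  qed
  then show False by simp
qed

text \<open>Pointwise convergence of the outputs is all that is known, and \<open>p\<close> may be
  below 1; Fatou's lemma needs nothing else.\<close>

lemma fatou_powr:
  fixes T :: "nat \<Rightarrow> 'a::euclidean_space \<Rightarrow> real"
  assumes p: "p > 0" and [measurable]: "\<And>N. T N \<in> borel_measurable borel"
    and nn: "\<And>N x. 0 \<le> T N x" and lim: "\<And>x. (\<lambda>N. T N x) \<longlonglongrightarrow> h x"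
    and K: "\<And>N. (\<integral>\<^sup>+x. T N x powr p \<partial>lborel) \<le> K"
  shows "(\<integral>\<^sup>+x. h x powr p \<partial>lborel) \<le> K"
proof -
  have "ennreal (h x powr p) = liminf (\<lambda>N. ennreal (T N x powr p))" for x
  proof -
    have "(\<lambda>N. T N x powr p) \<longlonglongrightarrow> h x powr p"
      using p nn by (intro tendsto_powr' lim tendsto_const) auto
    then have "(\<lambda>N. ennreal (T N x powr p)) \<longlonglongrightarrow> ennreal (h x powr p)" by (rule tendsto_ennrealI)
    then show ?thesis by (intro lim_imp_Liminf[symmetric]) auto
  qed
  then have "(\<integral>\<^sup>+x. h x powr p \<partial>lborel) = (\<integral>\<^sup>+x. liminf (\<lambda>N. ennreal (T N x powr p)) \<partial>lborel)" by simp
  also have "\<dots> \<le> liminf (\<lambda>N. \<integral>\<^sup>+x. ennreal (T N x powr p) \<partial>lborel)" by (intro nn_integral_liminf) measurable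
  also have "\<dots> \<le> limsup (\<lambda>N. \<integral>\<^sup>+x. ennreal (T N x powr p) \<partial>lborel)" by (rule Liminf_le_Limsup) simp
  also have "\<dots> \<le> K" by (rule Limsup_bounded) (use K in simp)
  finally show ?thesis .
qed

text \<open>The measure \<open>norm x powr (- real DIM('a)) dx\<close> is invariant under dilations,
  so all dyadic shells have the same mass. Every logarithm in the endpoint arguments is a number of
  such shells. The type argument fixes the space.\<close>

definition annulus_mass :: "real \<Rightarrow> real \<Rightarrow> 'a::euclidean_space itself \<Rightarrow> ennreal" where
  "annulus_mass a b T = (\<integral>\<^sup>+x. ennreal (indicator {a<..b} (norm x) * norm x powr (- real DIM('a))) \<partial>(lborel :: 'a measure))"

lemma annulus_mass_scale:
  assumes "c > 0"
  shows "annulus_mass (c * a) (c * b) TYPE('a::euclidean_space) = annulus_mass a b TYPE('a)"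
proof -
  have "annulus_mass (c * a) (c * b) TYPE('a)
    = ennreal (c ^ DIM('a)) * (\<integral>\<^sup>+x. ennreal (indicator {c * a<..c * b} (norm (c *\<^sub>R x)) * norm (c *\<^sub>R x) powr (- real DIM('a))) \<partial>(lborel :: 'a measure))"
    unfolding annulus_mass_def using assms by (subst nn_integral_lborel_affine[of _ c 0]) auto
  also have "\<dots> = ennreal (c ^ DIM('a)) * (\<integral>\<^sup>+x. ennreal (c powr (- real DIM('a))) * ennreal (indicator {a<..b} (norm x) * norm x powr (- real DIM('a))) \<partial>(lborel :: 'a measure))"
  proof (intro arg_cong2[where f="(*)"] refl nn_integral_cong)
    fix x :: 'a
    have "indicator {c * a<..c * b} (norm (c *\<^sub>R x)) = (indicator {a<..b} (norm x) :: real)"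
      using assms by (auto split: split_indicator)
    then show "ennreal (indicator {c * a<..c * b} (norm (c *\<^sub>R x)) * norm (c *\<^sub>R x) powr (- real DIM('a)))
        = ennreal (c powr (- real DIM('a))) * ennreal (indicator {a<..b} (norm x) * norm x powr (- real DIM('a)))"
      using assms by (simp add: powr_mult ennreal_mult[symmetric] mult_ac)
  qed
  also have "\<dots> = (ennreal (c ^ DIM('a)) * ennreal (c powr (- real DIM('a)))) * annulus_mass a b TYPE('a)"
    by (simp add: nn_integral_cmult annulus_mass_def mult.assoc)
  also have "ennreal (c ^ DIM('a)) * ennreal (c powr (- real DIM('a))) = 1"
    using assms by (simp add: ennreal_mult[symmetric] powr_minus powr_realpow)
  finally show ?thesis by simp
qed

lemma annulus_mass_add:
  assumes "a \<le> b" "b \<le> c"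
  shows "annulus_mass a c TYPE('a::euclidean_space) = annulus_mass a b TYPE('a) + annulus_mass b c TYPE('a)"
proof -
  have "annulus_mass a c TYPE('a) = (\<integral>\<^sup>+x. ennreal (indicator {a<..b} (norm x) * norm x powr (- real DIM('a)))
      + ennreal (indicator {b<..c} (norm x) * norm x powr (- real DIM('a))) \<partial>(lborel :: 'a measure))"
    unfolding annulus_mass_def using assms by (intro nn_integral_cong) (auto split: split_indicator)
  then show ?thesis by (simp add: annulus_mass_def nn_integral_add)
qed

lemma annulus_mass_dyadic:
  obtains J where "J > 0"
    "\<And>N::nat. annulus_mass 1 (2 ^ N) TYPE('a::euclidean_space) = ennreal (real N * J)"
proof -
  have fin: "annulus_mass 1 2 TYPE('a) < \<infinity>"
  proof -
    have "annulus_mass 1 2 TYPE('a) \<le> (\<integral>\<^sup>+x. indicator (cball 0 2) x \<partial>(lborel :: 'a measure))"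
      unfolding annulus_mass_def
    proof (rule nn_integral_mono)
      fix x :: 'a
      have "norm x powr (- real DIM('a)) \<le> 1" if "1 < norm x"
        using that powr_mono[of "- real DIM('a)" 0 "norm x"] by (cases "x = 0") auto
      then show "ennreal (indicator {1<..2} (norm x) * norm x powr (- real DIM('a))) \<le> indicator (cball 0 2) x"
        by (auto split: split_indicator)
    qed
    also have "\<dots> < \<infinity>" using emeasure_lborel_cball_finite[of "0::'a" 2] by simp
    finally show ?thesis .
  qed
  \<comment> \<open>A vanishing mass would make an open annulus negligible; it is nonempty, as it
    contains a point of norm \<open>3/2\<close>.\<close>
  have pos: "annulus_mass 1 2 TYPE('a) \<noteq> 0"
  proof
    assume "annulus_mass 1 2 TYPE('a) = 0"
    then have "AE x in (lborel :: 'a measure). ennreal (indicator {1<..2} (norm x) * norm x powr (- real DIM('a))) = 0"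
      unfolding annulus_mass_def by (subst (asm) nn_integral_0_iff_AE) auto
    then have "AE x in (lborel :: 'a measure). x \<notin> {x. 1 < norm x \<and> norm x < 2}"
    proof eventually_elim
      case (elim x) then show ?case by (auto split: split_indicator_asm simp: ennreal_eq_0_iff)
    qed
    moreover have o: "open {x::'a. 1 < norm x \<and> norm x < 2}"
      by (intro open_Collect_conj open_Collect_less continuous_intros)
    ultimately have "emeasure lborel {x::'a. 1 < norm x \<and> norm x < 2} = 0"
      by (subst (asm) AE_iff_measurable[OF _ refl]) auto
    then have "negligible {x::'a. 1 < norm x \<and> norm x < 2}"
      using o by (intro negligible_iff_null_sets[THEN iffD2] null_sets_completionI) auto
    moreover have "(3/2) *\<^sub>R (SOME b. b \<in> Basis) \<in> {x::'a. 1 < norm x \<and> norm x < 2}"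
      by (simp add: norm_Basis SOME_Basis)
    ultimately show False using open_not_negligible[OF o] by blast
  qed
  obtain J where J: "annulus_mass 1 2 TYPE('a) = ennreal J" "J \<ge> 0"
    using fin by (cases "annulus_mass 1 2 TYPE('a)") auto
  have J0: "J > 0" using J pos by (cases "J = 0") auto
  have "annulus_mass 1 (2 ^ N) TYPE('a) = ennreal (real N * J)" for N :: nat
  proof (induction N)
    case 0
    have "indicator {1<..1::real} y = (0::real)" for y by simp
    then show ?case by (simp add: annulus_mass_def)
  next
    case (Suc N)
    have "annulus_mass 1 (2 ^ Suc N) TYPE('a) = annulus_mass 1 (2 ^ N) TYPE('a) + annulus_mass (2 ^ N) (2 ^ Suc N) TYPE('a)"
      by (intro annulus_mass_add) auto
    also have "annulus_mass (2 ^ N) (2 ^ Suc N) TYPE('a) = annulus_mass 1 2 TYPE('a)"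
      using annulus_mass_scale[of "2 ^ N" 1 2, where 'a='a] by (simp add: mult.commute)
    finally show ?case using J J0 Suc by (simp add: ennreal_plus[symmetric] distrib_right add.commute del: ennreal_plus)
  qed
  then show thesis using that J0 by blast
qed

section \<open>The condition \<open>s / n > 2 / u\<close>\<close>

lemma borel_measurable_fst_snd:
  "(fst :: 'a::euclidean_space \<times> 'b::euclidean_space \<Rightarrow> 'a) \<in> borel_measurable borel"
  "(snd :: 'a::euclidean_space \<times> 'b::euclidean_space \<Rightarrow> 'b) \<in> borel_measurable borel"
  by (intro borel_measurable_continuous_onI continuous_intros)+

lemma Tm_gmod_eq:
  fixes m :: "(real^'n) \<times> (real^'n) \<Rightarrow> complex"
  assumes \<beta>: "Re \<beta>1 > 0" "Re \<beta>2 > 0"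
  shows "Tm m (gmod \<zeta>1 \<beta>1) (gmod \<zeta>2 \<beta>2) x
    = (\<beta>1 powr (of_real (- real CARD('n) / 2)) * \<beta>2 powr (of_real (- real CARD('n) / 2)))
      * (LINT \<xi>|lborel. cgauss (1 / \<beta>1) (fst \<xi> - \<zeta>1) * cgauss (1 / \<beta>2) (snd \<xi> - \<zeta>2) * m \<xi> * cis (2 * pi * (x \<bullet> (fst \<xi> + snd \<xi>))))"
proof -
  define c1 where "c1 = \<beta>1 powr (of_real (- real CARD('n) / 2))"
  define c2 where "c2 = \<beta>2 powr (of_real (- real CARD('n) / 2))"
  have 1: "fourier (gmod \<zeta>1 \<beta>1) \<xi> = c1 * cgauss (1 / \<beta>1) (\<xi> - \<zeta>1)" for \<xi> :: "real^'n"
    using fourier_gmod[OF \<beta>(1), of \<zeta>1 \<xi>] by (simp add: c1_def)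
  have 2: "fourier (gmod \<zeta>2 \<beta>2) \<xi> = c2 * cgauss (1 / \<beta>2) (\<xi> - \<zeta>2)" for \<xi> :: "real^'n"
    using fourier_gmod[OF \<beta>(2), of \<zeta>2 \<xi>] by (simp add: c2_def)
  have "Tm m (gmod \<zeta>1 \<beta>1) (gmod \<zeta>2 \<beta>2) x = (LINT \<xi>|lborel. (c1 * c2) * (cgauss (1 / \<beta>1) (fst \<xi> - \<zeta>1) * cgauss (1 / \<beta>2) (snd \<xi> - \<zeta>2) * m \<xi> * cis (2 * pi * (x \<bullet> (fst \<xi> + snd \<xi>)))))"
    unfolding Tm_def 1 2 by (intro Bochner_Integration.integral_cong refl) (simp only: mult_ac)
  also have "\<dots> = (c1 * c2) * (LINT \<xi>|lborel. cgauss (1 / \<beta>1) (fst \<xi> - \<zeta>1) * cgauss (1 / \<beta>2) (snd \<xi> - \<zeta>2) * m \<xi> * cis (2 * pi * (x \<bullet> (fst \<xi> + snd \<xi>))))"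
    by (rule integral_mult_right_zero)
  finally show ?thesis by (simp only: c1_def c2_def)
qed

text \<open>Testing on Gaussians whose Fourier transforms concentrate at \<open>\<zeta>\<close> evaluates the multiplier at \<open>\<zeta>\<close>.\<close>

lemma Tm_point_evaluation:
  fixes m :: "(real^'n) \<times> (real^'n) \<Rightarrow> complex"
  assumes p: "p > 0" "p1 > 0" "p2 > 0" "1 / p = 1 / p1 + 1 / p2"
    and [measurable]: "m \<in> borel_measurable borel" and mb: "\<And>\<xi>. norm (m \<xi>) \<le> b"
    and cont: "isCont m \<zeta>" and A: "A \<ge> 0"
    and bd: "\<And>f1 f2 K1 K2. schwartz f1 \<Longrightarrow> schwartz f2 \<Longrightarrow> Lp_norm p1 f1 \<le> ennreal K1 \<Longrightarrow> Lp_norm p2 f2 \<le> ennreal K2 \<Longrightarrow>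
       0 \<le> K1 \<Longrightarrow> 0 \<le> K2 \<Longrightarrow> (\<integral>\<^sup>+x. norm (Tm m f1 f2 x) powr p \<partial>lborel) \<le> ennreal ((A * K1 * K2) powr p)"
  shows "norm (m \<zeta>) * (2 * p) powr (- real CARD('n) / (2 * p))
     \<le> A * p1 powr (- real CARD('n) / (2 * p1)) * p2 powr (- real CARD('n) / (2 * p2))"
proof -
  define n where "n = real CARD('n)"
  define K where "K = A * p1 powr (- n / (2 * p1)) * p2 powr (- n / (2 * p2))"
  have K: "K \<ge> 0" using A by (simp add: K_def)
  have b: "b \<ge> 0" using mb[of 0] by (auto intro: order_trans[OF norm_ge_zero])
  \<comment> \<open>The spatial width of the inputs: their transforms concentrate at scale
    \<open>1 / R N\<close>. The successor keeps the width positive for \<open>N = 0\<close>.\<close>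
  define R where "R N = real (Suc N)" for N
  have R: "R N > 0" for N by (simp add: R_def)
  have Rinv: "(\<lambda>N. 1 / R N) \<longlonglongrightarrow> 0" unfolding R_def by (rule lim_1_over_n[THEN LIMSEQ_Suc])
  define I where "I N z = (LINT \<eta>|lborel. cgauss 1 \<eta> * m (\<zeta> + (1 / R N) *\<^sub>R \<eta>) * cis (2 * pi * (z \<bullet> (fst \<eta> + snd \<eta>))))" for N and z :: "real^'n"
  define f where "f N \<zeta>' = gmod \<zeta>' (of_real (1 / (R N)\<^sup>2))" for N and \<zeta>' :: "real^'n"
  have Re: "Re (of_real (1 / (R N)\<^sup>2)) > 0" for N using R[of N] by simp
  \<comment> \<open>Space is rescaled by \<open>R N\<close> and frequency around
    \<open>\<zeta>\<close> by \<open>1 / R N\<close>. The normalising powers of the two transforms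
    cancel the Jacobian on the product space exactly, and the recentring at \<open>\<zeta>\<close>
    costs only a unimodular factor.\<close>
  have T: "norm (Tm m (f N (fst \<zeta>)) (f N (snd \<zeta>)) (R N *\<^sub>R z)) = norm (I N z)" for N z
  proof -
    have pw: "complex_of_real (1 / (R N)\<^sup>2) powr (of_real (- n / 2)) = of_real (R N powr n)"
    proof -
      have "complex_of_real (1 / (R N)\<^sup>2) powr (of_real (- n / 2)) = of_real ((1 / (R N)\<^sup>2) powr (- n / 2))"
        by (rule powr_of_real) simp
      also have "(1 / (R N)\<^sup>2) powr (- n / 2) = R N powr n"
        using R[of N] by (simp add: powr_divide powr_minus powr_powr powr_numeral[symmetric] del: powr_numeral)
      finally show ?thesis .
    qed
    have "Tm m (f N (fst \<zeta>)) (f N (snd \<zeta>)) (R N *\<^sub>R z)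
       = of_real (R N powr n * R N powr n) * (LINT \<xi>|lborel. cgauss (1 / of_real (1 / (R N)\<^sup>2)) (fst \<xi> - fst \<zeta>) * cgauss (1 / of_real (1 / (R N)\<^sup>2)) (snd \<xi> - snd \<zeta>) * m \<xi> * cis (2 * pi * ((R N *\<^sub>R z) \<bullet> (fst \<xi> + snd \<xi>))))"
      unfolding f_def Tm_gmod_eq[OF Re Re] using pw by (simp only: n_def of_real_mult)
    also have "(LINT \<xi>|lborel. cgauss (1 / of_real (1 / (R N)\<^sup>2)) (fst \<xi> - fst \<zeta>) * cgauss (1 / of_real (1 / (R N)\<^sup>2)) (snd \<xi> - snd \<zeta>) * m \<xi> * cis (2 * pi * ((R N *\<^sub>R z) \<bullet> (fst \<xi> + snd \<xi>))))
      = (1 / R N) ^ DIM((real^'n) \<times> (real^'n)) *\<^sub>R (LINT \<eta>|lborel. cis (2 * pi * ((R N *\<^sub>R z) \<bullet> (fst \<zeta> + snd \<zeta>))) * (cgauss 1 \<eta> * m (\<zeta> + (1 / R N) *\<^sub>R \<eta>) * cis (2 * pi * (z \<bullet> (fst \<eta> + snd \<eta>)))))"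
    proof (subst integral_lborel_affine[of "1 / R N" _ \<zeta>], use R[of N] in simp)
      have "cgauss (1 / of_real (1 / (R N)\<^sup>2)) (fst (\<zeta> + (1 / R N) *\<^sub>R \<eta>) - fst \<zeta>) * cgauss (1 / of_real (1 / (R N)\<^sup>2)) (snd (\<zeta> + (1 / R N) *\<^sub>R \<eta>) - snd \<zeta>) = cgauss 1 \<eta>" for \<eta> :: "(real^'n) \<times> (real^'n)"
      proof -
        have "cgauss (1 / of_real (1 / (R N)\<^sup>2)) ((1 / R N) *\<^sub>R v) = cgauss 1 v" for v :: "real^'n"
          using R[of N] by (simp add: cgauss_def power_divide)
        then show ?thesis using cgauss_Pair[of 1 "fst \<eta>" "snd \<eta>"] by simp
      qed
      moreover have "cis (2 * pi * ((R N *\<^sub>R z) \<bullet> (fst (\<zeta> + (1 / R N) *\<^sub>R \<eta>) + snd (\<zeta> + (1 / R N) *\<^sub>R \<eta>))))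
         = cis (2 * pi * ((R N *\<^sub>R z) \<bullet> (fst \<zeta> + snd \<zeta>))) * cis (2 * pi * (z \<bullet> (fst \<eta> + snd \<eta>)))" for \<eta> :: "(real^'n) \<times> (real^'n)"
      proof -
        have "2 * pi * ((R N *\<^sub>R z) \<bullet> (fst (\<zeta> + (1 / R N) *\<^sub>R \<eta>) + snd (\<zeta> + (1 / R N) *\<^sub>R \<eta>)))
           = 2 * pi * ((R N *\<^sub>R z) \<bullet> (fst \<zeta> + snd \<zeta>)) + 2 * pi * (z \<bullet> (fst \<eta> + snd \<eta>))"
          using R[of N] by (simp add: inner_add_right field_simps)
        then show ?thesis by (simp only: cis_mult)
      qed
      ultimately show "\<bar>1 / R N\<bar> ^ DIM((real^'n) \<times> (real^'n)) *\<^sub>R (LINT \<eta>|lborel. cgauss (1 / of_real (1 / (R N)\<^sup>2)) (fst (\<zeta> + (1 / R N) *\<^sub>R \<eta>) - fst \<zeta>) * cgauss (1 / of_real (1 / (R N)\<^sup>2)) (snd (\<zeta> + (1 / R N) *\<^sub>R \<eta>) - snd \<zeta>) * m (\<zeta> + (1 / R N) *\<^sub>R \<eta>) * cis (2 * pi * ((R N *\<^sub>R z) \<bullet> (fst (\<zeta> + (1 / R N) *\<^sub>R \<eta>) + snd (\<zeta> + (1 / R N) *\<^sub>R \<eta>)))))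
        = (1 / R N) ^ DIM((real^'n) \<times> (real^'n)) *\<^sub>R (LINT \<eta>|lborel. cis (2 * pi * ((R N *\<^sub>R z) \<bullet> (fst \<zeta> + snd \<zeta>))) * (cgauss 1 \<eta> * m (\<zeta> + (1 / R N) *\<^sub>R \<eta>) * cis (2 * pi * (z \<bullet> (fst \<eta> + snd \<eta>)))))"
        using R[of N] by (simp only: abs_of_pos zero_less_divide_iff zero_less_one simp_thms) (simp only: mult_ac)
    qed
    also have "of_real (R N powr n * R N powr n) * ((1 / R N) ^ DIM((real^'n) \<times> (real^'n)) *\<^sub>R (LINT \<eta>|lborel. cis (2 * pi * ((R N *\<^sub>R z) \<bullet> (fst \<zeta> + snd \<zeta>))) * (cgauss 1 \<eta> * m (\<zeta> + (1 / R N) *\<^sub>R \<eta>) * cis (2 * pi * (z \<bullet> (fst \<eta> + snd \<eta>))))))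
       = cis (2 * pi * ((R N *\<^sub>R z) \<bullet> (fst \<zeta> + snd \<zeta>))) * I N z"
    proof -
      have "R N powr n * R N powr n * (1 / R N) ^ DIM((real^'n) \<times> (real^'n)) = 1"
        using R[of N] by (simp add: n_def powr_realpow power_add power_divide)
      then have "of_real (R N powr n * R N powr n) * ((1 / R N) ^ DIM((real^'n) \<times> (real^'n)) *\<^sub>R Y) = Y" for Y :: complex
        unfolding scaleR_conv_of_real mult.assoc[symmetric] of_real_mult[symmetric] by simp
      then show ?thesis unfolding I_def integral_mult_right_zero .
    qed
    finally show ?thesis by (simp add: norm_mult)
  qed
  note [measurable] = borel_measurable_fst_snd
  have [measurable]: "I N \<in> borel_measurable borel" for N unfolding I_def[abs_def] by measurable
  have lim: "(\<lambda>N. norm (I N z)) \<longlonglongrightarrow> norm (m \<zeta>) * exp (- (pi * 2 * (norm z)\<^sup>2))" for z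
  proof -
    have "(\<lambda>N. I N z) \<longlonglongrightarrow> (LINT \<eta>|lborel. cgauss 1 \<eta> * m \<zeta> * cis (2 * pi * (z \<bullet> (fst \<eta> + snd \<eta>))))"
      unfolding I_def
    proof (rule integral_dominated_convergence[where w="\<lambda>\<eta>. b * norm (cgauss 1 \<eta>)"])
      show "integrable lborel (\<lambda>\<eta>::(real^'n) \<times> (real^'n). b * norm (cgauss 1 \<eta>))"
        by (intro integrable_mult_right integrable_norm integrable_cgauss) simp
      show "AE \<eta> in lborel. (\<lambda>N. cgauss 1 \<eta> * m (\<zeta> + (1 / R N) *\<^sub>R \<eta>) * cis (2 * pi * (z \<bullet> (fst \<eta> + snd \<eta>))))
         \<longlonglongrightarrow> cgauss 1 \<eta> * m \<zeta> * cis (2 * pi * (z \<bullet> (fst \<eta> + snd \<eta>)))"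
      proof (intro AE_I2 tendsto_intros isCont_tendsto_compose[OF cont])
        fix \<eta> :: "(real^'n) \<times> (real^'n)"
        have "(\<lambda>N. \<zeta> + (1 / R N) *\<^sub>R \<eta>) \<longlonglongrightarrow> \<zeta> + 0 *\<^sub>R \<eta>" by (intro tendsto_intros Rinv)
        then show "(\<lambda>N. \<zeta> + (1 / R N) *\<^sub>R \<eta>) \<longlonglongrightarrow> \<zeta>" by simp
      qed
      show "AE \<eta> in lborel. norm (cgauss 1 \<eta> * m (\<zeta> + (1 / R N) *\<^sub>R \<eta>) * cis (2 * pi * (z \<bullet> (fst \<eta> + snd \<eta>)))) \<le> b * norm (cgauss 1 \<eta>)" for N
        using mult_left_mono[OF mb norm_ge_zero] by (intro AE_I2) (simp add: norm_mult mult.commute[of b])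
    qed measurable
    moreover have "(LINT \<eta>|lborel. cgauss 1 \<eta> * m \<zeta> * cis (2 * pi * (z \<bullet> (fst \<eta> + snd \<eta>)))) = m \<zeta> * of_real (exp (- (pi * 2 * (norm z)\<^sup>2)))"
    proof -
      have "(LINT \<eta>|lborel. cgauss 1 \<eta> * m \<zeta> * cis (2 * pi * (z \<bullet> (fst \<eta> + snd \<eta>)))) = (LINT \<eta>|lborel. m \<zeta> * (cgauss 1 \<eta> * cis (- 2 * pi * (\<eta> \<bullet> (- z, - z)))))"
      proof (intro Bochner_Integration.integral_cong refl)
        fix \<eta> :: "(real^'n) \<times> (real^'n)"
        have "- 2 * pi * (\<eta> \<bullet> (- z, - z)) = 2 * pi * (z \<bullet> (fst \<eta> + snd \<eta>))"
          by (cases \<eta>) (simp add: inner_add_right inner_commute algebra_simps)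
        then show "cgauss 1 \<eta> * m \<zeta> * cis (2 * pi * (z \<bullet> (fst \<eta> + snd \<eta>))) = m \<zeta> * (cgauss 1 \<eta> * cis (- 2 * pi * (\<eta> \<bullet> (- z, - z))))"
          by (simp only: mult_ac)
      qed
      also have "\<dots> = m \<zeta> * fourier (cgauss 1) (- z, - z)" unfolding fourier_def by (rule integral_mult_right_zero)
      also have "fourier (cgauss 1) (- z, - z) = of_real (exp (- (pi * 2 * (norm z)\<^sup>2)))"
        using cgauss_of_real[of 1 "(- z, - z)"] by (simp add: fourier_cgauss norm_Pair)
      finally show ?thesis .
    qed
    ultimately have "(\<lambda>N. I N z) \<longlonglongrightarrow> m \<zeta> * of_real (exp (- (pi * 2 * (norm z)\<^sup>2)))" by simp
    from tendsto_norm[OF this] show ?thesis by (simp only: norm_mult norm_of_real abs_exp_cancel)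
  qed
  have bound: "(\<integral>\<^sup>+z. norm (I N z) powr p \<partial>lborel) \<le> ennreal (K powr p)" for N
  proof -
    let ?T = "Tm m (f N (fst \<zeta>)) (f N (snd \<zeta>))"
    define K1 where "K1 q = q powr (- n / (2 * q)) * R N powr (n / q)" for q
    have L: "Lp_norm q (f N \<zeta>') \<le> ennreal (K1 q)" if "q > 0" for q \<zeta>'
    proof -
      have "(q * Re (of_real (1 / (R N)\<^sup>2))) powr (- n / (2 * q)) = K1 q"
        using R[of N] that by (simp add: K1_def powr_divide powr_minus powr_powr powr_numeral[symmetric] field_simps del: powr_numeral)
      then show ?thesis using Lp_norm_gmod[OF Re[of N] that, of \<zeta>'] by (simp add: f_def n_def)
    qed
    have K1: "0 \<le> K1 q" for q by (simp add: K1_def)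
    have [measurable]: "?T \<in> borel_measurable borel"
    proof -
      have [measurable]: "f N (fst \<zeta>) \<in> borel_measurable borel" "f N (snd \<zeta>) \<in> borel_measurable borel"
        unfolding f_def using Re by (auto intro!: borel_measurable_schwartz schwartz_gmod simp del: of_real_divide)
      show ?thesis unfolding Tm_def[abs_def] by measurable
    qed
    have "(\<integral>\<^sup>+x. norm (?T x) powr p \<partial>lborel) \<le> ennreal ((A * K1 p1 * K1 p2) powr p)"
      using p by (intro bd L K1) (auto simp: f_def intro!: schwartz_gmod Re simp del: of_real_divide)
    \<comment> \<open>The relation between the three exponents enters here: the input norms together
      grow like the power of \<open>R N\<close> that rescaling the output integral produces.\<close>
    also have "A * K1 p1 * K1 p2 = K * R N powr (n / p)"
    proof -
      have "n / p1 + n / p2 = n / p" using p(4) by (simp add: divide_inverse distrib_left[symmetric])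
      then have "R N powr (n / p1) * R N powr (n / p2) = R N powr (n / p)" by (simp add: powr_add[symmetric])
      then show ?thesis by (simp add: K1_def K_def mult_ac)
    qed
    also have "(K * R N powr (n / p)) powr p = K powr p * R N ^ CARD('n)"
      using R[of N] p by (simp add: powr_mult powr_powr n_def powr_realpow)
    also have "(\<integral>\<^sup>+x. norm (?T x) powr p \<partial>lborel) = ennreal (R N ^ CARD('n)) * (\<integral>\<^sup>+z. norm (I N z) powr p \<partial>lborel)"
      using R[of N] by (subst nn_integral_lborel_affine[of _ "R N" 0]) (simp_all add: T)
    finally have le: "ennreal (R N ^ CARD('n)) * (\<integral>\<^sup>+z. norm (I N z) powr p \<partial>lborel) \<le> ennreal (K powr p * R N ^ CARD('n))" .
    have "(\<integral>\<^sup>+z. norm (I N z) powr p \<partial>lborel) = ennreal (1 / R N ^ CARD('n)) * (ennreal (R N ^ CARD('n)) * (\<integral>\<^sup>+z. norm (I N z) powr p \<partial>lborel))"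
      using R[of N] by (simp add: mult.assoc[symmetric] ennreal_mult[symmetric])
    also have "\<dots> \<le> ennreal (1 / R N ^ CARD('n)) * ennreal (K powr p * R N ^ CARD('n))"
      by (intro mult_left_mono le) simp
    also have "\<dots> = ennreal (K powr p)" using R[of N] by (simp add: ennreal_mult[symmetric])
    finally show ?thesis .
  qed
  have "(\<integral>\<^sup>+z. (norm (m \<zeta>) * exp (- (pi * 2 * (norm z)\<^sup>2))) powr p \<partial>(lborel :: (real^'n) measure)) \<le> ennreal (K powr p)"
    by (rule fatou_powr[where T="\<lambda>N z. norm (I N z)"]) (use p lim bound in auto)
  also have "(\<integral>\<^sup>+z. (norm (m \<zeta>) * exp (- (pi * 2 * (norm z)\<^sup>2))) powr p \<partial>(lborel :: (real^'n) measure))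
     = (\<integral>\<^sup>+z. ennreal (norm (m \<zeta>) powr p) * ennreal (exp (- (pi * (2 * p) * (norm z)\<^sup>2))) \<partial>(lborel :: (real^'n) measure))"
    by (intro nn_integral_cong) (simp add: powr_mult ennreal_mult[symmetric] powr_def[of "exp _"] mult_ac)
  also have "\<dots> = ennreal (norm (m \<zeta>) powr p) * ennreal ((2 * p) powr (- n / 2))"
    using p nn_integral_gaussian[of "2 * p", where 'a="real^'n"] by (subst nn_integral_cmult) (simp_all add: n_def)
  also have "\<dots> = ennreal ((norm (m \<zeta>) * (2 * p) powr (- n / (2 * p))) powr p)"
    using p by (simp add: powr_mult powr_powr ennreal_mult[symmetric])
  finally have "(norm (m \<zeta>) * (2 * p) powr (- n / (2 * p))) powr p \<le> K powr p" by simp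
  then have "norm (m \<zeta>) * (2 * p) powr (- n / (2 * p)) \<le> K"
    using p K powr_less_mono2[of p K "norm (m \<zeta>) * (2 * p) powr (- n / (2 * p))"] by (meson not_le)
  then show ?thesis by (simp only: K_def n_def)
qed

theorem Hoermander_bound_imp_s_gt_two_div_u:
  fixes \<Theta> :: "(real^'n) \<times> (real^'n) \<Rightarrow> complex"
  assumes Theta: "schwartz \<Theta>"
    and supp: "\<And>\<xi>. fourier \<Theta> \<xi> \<noteq> 0 \<Longrightarrow> 1/2 \<le> norm \<xi> \<and> norm \<xi> \<le> 2"
    and s: "0 < s" and u: "1 < u" and p: "0 < p" "0 < p1" "0 < p2" "1 / p = 1 / p1 + 1 / p2"
    and bound: "Hoermander_bound \<Theta> u s p p1 p2"
  shows "2 / u < s / real CARD('n)"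
proof (rule ccontr)
  assume "\<not> 2 / u < s / real CARD('n)"
  let ?T = "TYPE((real^'n) \<times> (real^'n))"
  define d where "d = real DIM((real^'n) \<times> (real^'n))"
  have d: "d = 2 * real CARD('n)" "d > 0" by (auto simp: d_def)
  have sd: "s \<le> d / u" using \<open>\<not> 2 / u < s / real CARD('n)\<close> u d by (simp add: field_simps not_less)
  obtain C where C: "C > 0" and TC:
    "\<And>F G B f1 f2 K1 K2. bessel_rep s F G \<Longrightarrow> 0 < B \<Longrightarrow>
       (\<integral>\<^sup>+\<xi>. norm (G \<xi>) powr u \<partial>lborel) \<le> ennreal (B powr u) \<Longrightarrow> bounded (range F) \<Longrightarrow>
       schwartz f1 \<Longrightarrow> schwartz f2 \<Longrightarrow> Lp_norm p1 f1 \<le> ennreal K1 \<Longrightarrow> Lp_norm p2 f2 \<le> ennreal K2 \<Longrightarrow>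
       0 \<le> K1 \<Longrightarrow> 0 \<le> K2 \<Longrightarrow>
       (\<integral>\<^sup>+x. norm (Tm (\<lambda>\<xi>. F \<xi> * fourier \<Theta> \<xi>) f1 f2 x) powr p \<partial>lborel) \<le> ennreal ((C * B * K1 * K2) powr p)"
    by (rule Tm_localized_bound[OF Theta supp s u p(1) bound]) (assumption, rule that)
  obtain \<zeta> where \<zeta>: "fourier \<Theta> \<zeta> \<noteq> 0"
    using fourier_Theta_nonzero[OF p(1-3) less_trans[OF zero_less_one u] bound] by blast
  obtain J where J: "J > 0" "\<And>N::nat. annulus_mass 1 (2 ^ N) ?T = ennreal (real N * J)"
    by (rule annulus_mass_dyadic) (rule that)
  obtain c where c: "c > 0" and low0:
    "AE \<xi> in (lborel :: ((real^'n) \<times> (real^'n)) measure). norm \<xi> \<le> 1 \<longrightarrow> \<xi> \<noteq> 0 \<longrightarrow> c * norm \<xi> powr (s - real DIM((real^'n) \<times> (real^'n))) \<le> bessel_ker s \<xi>"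
    by (rule bessel_ker_lower[OF s, where 'a="(real^'n) \<times> (real^'n)"]) (rule that)
  note low = low0[folded d_def]
  have [measurable]: "cball 0 r \<in> sets (borel :: ((real^'n) \<times> (real^'n)) measure)" for r
    by (intro borel_closed) auto
  define V where "V = measure lborel (cball (0::(real^'n) \<times> (real^'n)) 1)"
  have V: "V \<ge> 0" "emeasure lborel (cball (0::(real^'n) \<times> (real^'n)) 1) = ennreal V"
    using emeasure_lborel_cball_finite[of "0::(real^'n) \<times> (real^'n)" 1] by (auto simp: V_def emeasure_eq_ennreal_measure)
  define a where "a = (c / 2) * J * norm (fourier \<Theta> \<zeta>) * (2 * p) powr (- real CARD('n) / (2 * p))"
  have a: "a > 0" using c J \<zeta> p by (simp add: a_def)
  define b where "b = C * p1 powr (- real CARD('n) / (2 * p1)) * p2 powr (- real CARD('n) / (2 * p2))"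
  have b: "b > 0" using C p by (simp add: b_def)
  have main: "a * real N \<le> b * (V + real (Suc N) * J) powr (1/u)" if "N \<ge> 1" for N :: nat
  proof -
    \<comment> \<open>With exponent \<open>Suc N\<close> there are \<open>N + 1\<close> dyadic
      shells between \<open>\<epsilon>\<close> and 1, which enter the norm, and \<open>N\<close>
      shells between \<open>\<epsilon>\<close> and \<open>1/2\<close>, which enter the value at the
      centre.\<close>
    define \<epsilon> where "\<epsilon> = (1/2::real) ^ Suc N"
    have e: "0 < \<epsilon>" "\<epsilon> \<le> 1/2" using power_decreasing[of 0 N "1/2::real"] by (auto simp: \<epsilon>_def)
    have e2: "\<epsilon> * 2 ^ Suc N = 1" "\<epsilon> * 2 ^ N = 1/2" by (auto simp: \<epsilon>_def power_one_over field_simps)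
    \<comment> \<open>The power is critical: its \<open>u\<close>-th power is the dilation-invariant
      weight on the product space of dimension \<open>d\<close>. Freezing it below
      \<open>\<epsilon>\<close> and multiplying by a tent makes \<open>g\<close> bounded, continuous
      and supported in the unit ball.\<close>
    define g where "g \<xi> = (max \<epsilon> (norm \<xi>)) powr (- d / u) * max 0 (1 - norm \<xi>)" for \<xi> :: "(real^'n) \<times> (real^'n)"
    have g0: "g \<xi> \<ge> 0" for \<xi> by (simp add: g_def)
    have gb: "g \<xi> \<le> \<epsilon> powr (- d / u)" for \<xi>
    proof -
      have "(max \<epsilon> (norm \<xi>)) powr (- d / u) \<le> \<epsilon> powr (- d / u)" using e d u by (intro powr_mono2') auto
      moreover have "max 0 (1 - norm \<xi>) \<le> 1" by simp
      ultimately have "g \<xi> \<le> \<epsilon> powr (- d / u) * 1" unfolding g_def by (intro mult_mono) auto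
      then show ?thesis by simp
    qed
    have gc: "continuous_on UNIV g" unfolding g_def using e
      by (intro continuous_intros) (auto simp: max_def)
    have [measurable]: "g \<in> borel_measurable borel" by (rule borel_measurable_continuous_onI[OF gc])
    define G where "G \<xi> = complex_of_real (g \<xi>)" for \<xi>
    have Gb: "norm (G \<xi>) \<le> \<epsilon> powr (- d / u)" for \<xi> using gb[of \<xi>] g0[of \<xi>] by (simp add: G_def)
    have Gc: "continuous_on UNIV G" unfolding G_def by (intro continuous_on_of_real gc)
    have iG: "integrable lborel G"
    proof (rule Bochner_Integration.integrable_bound)
      show "integrable lborel (\<lambda>\<xi>::(real^'n) \<times> (real^'n). \<epsilon> powr (- d / u) * indicator (cball 0 1) \<xi> :: real)"
        by (intro integrable_mult_right) (use V in \<open>auto simp: integrable_indicator_iff\<close>)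
      show "AE \<xi> in lborel. norm (G \<xi>) \<le> norm (\<epsilon> powr (- d / u) * indicator (cball 0 1) \<xi> :: real)"
      proof (rule AE_I2)
        fix \<xi> :: "(real^'n) \<times> (real^'n)"
        show "norm (G \<xi>) \<le> norm (\<epsilon> powr (- d / u) * indicator (cball 0 1) \<xi> :: real)"
        proof (cases "norm \<xi> \<le> 1")
          case True then show ?thesis using Gb[of \<xi>] by simp
        next
          case False
          then have "G \<xi> = 0" by (simp add: G_def g_def)
          then show ?thesis by simp
        qed
      qed
      show "G \<in> borel_measurable lborel" unfolding G_def[abs_def] by measurable
    qed
    define F where "F = convol (\<lambda>\<xi>. of_real (bessel_ker s \<xi>)) G"
    have rep: "bessel_rep s (\<lambda>\<xi>. F (\<xi> - \<zeta>)) (\<lambda>\<xi>. G (\<xi> - \<zeta>))"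
      unfolding F_def by (intro bessel_rep_translate bessel_rep_convol s iG)
    have Fb: "norm (F \<xi>) \<le> \<epsilon> powr (- d / u)" for \<xi> unfolding F_def by (rule norm_convol_bessel_le[OF s Gb])
    have Fc: "isCont F \<xi>" for \<xi> unfolding F_def by (rule isCont_convol_bessel[OF s Gb Gc])
    define B where "B = (V + real (Suc N) * J) powr (1/u)"
    have VJ: "V + real (Suc N) * J > 0" using V J by (simp add: add_nonneg_pos)
    have B: "B > 0" using VJ by (simp add: B_def)
    have "(\<integral>\<^sup>+\<xi>. norm (G (\<xi> - \<zeta>)) powr u \<partial>lborel) = (\<integral>\<^sup>+\<xi>. norm (G \<xi>) powr u \<partial>lborel)"
      using nn_integral_lborel_translate(2)[of "\<lambda>\<xi>. ennreal (norm (G \<xi>) powr u)" \<zeta>] by (simp add: G_def)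
    also have "\<dots> \<le> (\<integral>\<^sup>+\<xi>. ennreal (\<epsilon> powr (- d)) * indicator (cball 0 \<epsilon>) \<xi> + ennreal (indicator {\<epsilon><..1} (norm \<xi>) * norm \<xi> powr (- d)) \<partial>(lborel :: ((real^'n) \<times> (real^'n)) measure))"
    proof (rule nn_integral_mono)
      fix \<xi> :: "(real^'n) \<times> (real^'n)"
      have "norm (G \<xi>) powr u = (max \<epsilon> (norm \<xi>)) powr (- d) * (max 0 (1 - norm \<xi>)) powr u"
        using u g0[of \<xi>] e by (simp add: G_def) (simp add: g_def powr_mult powr_powr)
      moreover have "(max 0 (1 - norm \<xi>)) powr u \<le> 1" using u powr_mono2[of u "max 0 (1 - norm \<xi>)" 1] by simp
      ultimately have le: "norm (G \<xi>) powr u \<le> (max \<epsilon> (norm \<xi>)) powr (- d)"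
        using mult_left_mono[of "(max 0 (1 - norm \<xi>)) powr u" 1 "(max \<epsilon> (norm \<xi>)) powr (- d)"] by simp
      consider "norm \<xi> \<le> \<epsilon>" | "\<epsilon> < norm \<xi>" "norm \<xi> \<le> 1" | "norm \<xi> > 1" by linarith
      then show "ennreal (norm (G \<xi>) powr u) \<le> ennreal (\<epsilon> powr (- d)) * indicator (cball 0 \<epsilon>) \<xi> + ennreal (indicator {\<epsilon><..1} (norm \<xi>) * norm \<xi> powr (- d))"
      proof cases
        case 1
        then show ?thesis using le by (simp add: max_def ennreal_leI)
      next
        case 2
        then show ?thesis using le by (simp add: max_def ennreal_leI)
      next
        case 3
        then have "G \<xi> = 0" by (simp add: G_def g_def)
        then show ?thesis by simp
      qed
    qed
    also have "\<dots> = ennreal (\<epsilon> powr (- d)) * emeasure lborel (cball (0::(real^'n) \<times> (real^'n)) \<epsilon>) + annulus_mass \<epsilon> 1 ?T"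
      unfolding annulus_mass_def d_def[symmetric]
      by (subst nn_integral_add) (simp_all add: nn_integral_cmult_indicator)
    also have "annulus_mass \<epsilon> 1 ?T = annulus_mass (\<epsilon> * 1) (\<epsilon> * 2 ^ Suc N) ?T"
      by (simp only: e2 mult_1_right)
    also have "\<dots> = ennreal (real (Suc N) * J)"
      by (simp only: annulus_mass_scale[OF e(1)] J(2))
    also have "emeasure lborel (cball (0::(real^'n) \<times> (real^'n)) \<epsilon>) = ennreal (\<epsilon> powr d) * ennreal V"
    proof -
      have "emeasure lborel (cball (0::(real^'n) \<times> (real^'n)) \<epsilon>) = (\<integral>\<^sup>+x. indicator (cball (0::(real^'n) \<times> (real^'n)) \<epsilon>) x \<partial>lborel)" by simp
      also have "\<dots> = ennreal (\<bar>\<epsilon>\<bar> ^ DIM((real^'n) \<times> (real^'n))) * (\<integral>\<^sup>+x. indicator (cball (0::(real^'n) \<times> (real^'n)) \<epsilon>) (0 + \<epsilon> *\<^sub>R x) \<partial>lborel)"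
      proof (rule nn_integral_lborel_affine)
        show "(\<lambda>x. indicator (cball (0::(real^'n) \<times> (real^'n)) \<epsilon>) x :: ennreal) \<in> borel_measurable borel"
          by (rule borel_measurable_indicator) (intro borel_closed closed_cball)
      qed (use e in simp)
      also have "(\<integral>\<^sup>+x. indicator (cball (0::(real^'n) \<times> (real^'n)) \<epsilon>) (0 + \<epsilon> *\<^sub>R x) \<partial>lborel) = (\<integral>\<^sup>+x. indicator (cball (0::(real^'n) \<times> (real^'n)) 1) x \<partial>lborel)"
        using e by (intro nn_integral_cong) (auto split: split_indicator)
      also have "\<dots> = ennreal V" using V by simp
      also have "\<bar>\<epsilon>\<bar> ^ DIM((real^'n) \<times> (real^'n)) = \<epsilon> powr d" using e by (simp add: d_def powr_realpow[symmetric])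
      finally show ?thesis .
    qed
    also have "ennreal (\<epsilon> powr (- d)) * (ennreal (\<epsilon> powr d) * ennreal V) = ennreal V"
      using e V by (simp add: ennreal_mult[symmetric] mult.assoc[symmetric] powr_add[symmetric])
    also have "ennreal V + ennreal (real (Suc N) * J) = ennreal (B powr u)"
      using V J u VJ by (simp add: B_def powr_powr ennreal_plus[symmetric] del: ennreal_plus)
    finally have LG: "(\<integral>\<^sup>+\<xi>. norm (G (\<xi> - \<zeta>)) powr u \<partial>lborel) \<le> ennreal (B powr u)" .
    have "norm (F (\<zeta> - \<zeta>) * fourier \<Theta> \<zeta>) * (2 * p) powr (- real CARD('n) / (2 * p))
       \<le> (C * B) * p1 powr (- real CARD('n) / (2 * p1)) * p2 powr (- real CARD('n) / (2 * p2))"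
    proof (rule Tm_point_evaluation[where m="\<lambda>\<xi>. F (\<xi> - \<zeta>) * fourier \<Theta> \<xi>", OF p])
      have [measurable]: "F \<in> borel_measurable borel" using bessel_rep_convol[OF s iG] by (auto simp: bessel_rep_def F_def)
      have [measurable]: "\<Theta> \<in> borel_measurable borel" by (rule borel_measurable_schwartz[OF Theta])
      show "(\<lambda>\<xi>. F (\<xi> - \<zeta>) * fourier \<Theta> \<xi>) \<in> borel_measurable borel" by measurable
      show "norm (F (\<xi> - \<zeta>) * fourier \<Theta> \<xi>) \<le> \<epsilon> powr (- d / u) * (LINT x|lborel. norm (\<Theta> x))" for \<xi>
        unfolding norm_mult by (intro mult_mono Fb norm_fourier_le) auto
      have "isCont (\<lambda>\<xi>. \<xi> - \<zeta>) \<zeta>" by (intro continuous_intros)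
      then have "isCont (\<lambda>\<xi>. F (\<xi> - \<zeta>)) \<zeta>" by (rule isCont_o2) (rule Fc)
      then show "isCont (\<lambda>\<xi>. F (\<xi> - \<zeta>) * fourier \<Theta> \<xi>) \<zeta>"
        by (intro continuous_mult continuous_fourier integrable_schwartz Theta)
      show "0 \<le> C * B" using C B by simp
      show "(\<integral>\<^sup>+x. norm (Tm (\<lambda>\<xi>. F (\<xi> - \<zeta>) * fourier \<Theta> \<xi>) f1 f2 x) powr p \<partial>lborel) \<le> ennreal ((C * B * K1 * K2) powr p)"
        if "schwartz f1" "schwartz f2" "Lp_norm p1 f1 \<le> ennreal K1" "Lp_norm p2 f2 \<le> ennreal K2" "0 \<le> K1" "0 \<le> K2" for f1 f2 K1 K2
        by (rule TC[OF rep B LG _ that]) (rule boundedI[of _ "\<epsilon> powr (- d / u)"], use Fb in blast)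
    qed
    then have up: "norm (F 0) * norm (fourier \<Theta> \<zeta>) * (2 * p) powr (- real CARD('n) / (2 * p)) \<le> b * B"
      by (simp add: b_def norm_mult mult_ac)
    \<comment> \<open>Lower bound for the value at the centre. On the shells up to radius
      \<open>1/2\<close> the tent is at least \<open>1/2\<close>, and kernel times power is at least
      \<open>c * r powr (s - d - d / u)\<close>; since \<open>s \<le> d / u\<close> and
      \<open>r \<le> 1\<close>, this dominates \<open>c * r powr (- d)\<close>.\<close>
    have "ennreal (c / 2 * (real N * J)) = ennreal (c / 2) * annulus_mass \<epsilon> (1/2) ?T"
    proof -
      have "annulus_mass \<epsilon> (1/2) ?T = annulus_mass (\<epsilon> * 1) (\<epsilon> * 2 ^ N) ?T"
        by (simp only: e2 mult_1_right)
      also have "\<dots> = ennreal (real N * J)"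
        by (simp only: annulus_mass_scale[OF e(1)] J(2))
      finally have "annulus_mass \<epsilon> (1/2) ?T = ennreal (real N * J)" .
      then show ?thesis using c J by (simp add: ennreal_mult[symmetric])
    qed
    also have "\<dots> = (\<integral>\<^sup>+\<eta>. ennreal (c / 2) * ennreal (indicator {\<epsilon><..1/2} (norm \<eta>) * norm \<eta> powr (- d)) \<partial>(lborel :: ((real^'n) \<times> (real^'n)) measure))"
      unfolding annulus_mass_def d_def by (rule nn_integral_cmult[symmetric]) measurable
    also have "\<dots> \<le> (\<integral>\<^sup>+\<eta>. ennreal (bessel_ker s \<eta> * g (0 - \<eta>)) \<partial>lborel)"
    proof (rule nn_integral_mono_AE)
      show "AE \<eta> in (lborel :: ((real^'n) \<times> (real^'n)) measure). ennreal (c / 2) * ennreal (indicator {\<epsilon><..1/2} (norm \<eta>) * norm \<eta> powr (- d)) \<le> ennreal (bessel_ker s \<eta> * g (0 - \<eta>))"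
        using low
      proof eventually_elim
        case (elim \<eta>)
        show ?case
        proof (cases "\<epsilon> < norm \<eta> \<and> norm \<eta> \<le> 1/2")
          case False
          then show ?thesis by auto
        next
          case True
          define r where "r = norm \<eta>"
          have r: "\<epsilon> < r" "r \<le> 1/2" "0 < r" using True e by (auto simp: r_def)
          have "r powr (- d) \<le> r powr (s - d + (- d / u))"
          proof -
            have "s - d + (- d / u) \<le> - d" using sd by simp
            then show ?thesis using r powr_mono'[of "s - d + (- d / u)" "- d" r] by simp
          qed
          then have "(c / 2) * r powr (- d) \<le> (c * r powr (s - d)) * (r powr (- d / u) * (1/2))"
            using c unfolding powr_add by simp
          also have "\<dots> \<le> bessel_ker s \<eta> * g (0 - \<eta>)"
          proof (intro mult_mono)
            show "c * r powr (s - d) \<le> bessel_ker s \<eta>" using elim r by (auto simp: r_def)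
            show "r powr (- d / u) * (1/2) \<le> g (0 - \<eta>)"
            proof -
              have "(1/2::real) \<le> max 0 (1 - r)" using r by simp
              then have "r powr (- d / u) * (1/2) \<le> r powr (- d / u) * max 0 (1 - r)" by (rule mult_left_mono) simp
              moreover have "g (0 - \<eta>) = r powr (- d / u) * max 0 (1 - r)"
                using r by (simp add: g_def r_def[symmetric] max_absorb2)
              ultimately show ?thesis by (simp only:)
            qed
          qed (use c bessel_ker_nonneg[OF s] in auto)
          finally have le: "(c / 2) * r powr (- d) \<le> bessel_ker s \<eta> * g (0 - \<eta>)" .
          have "ennreal (c / 2) * ennreal (indicator {\<epsilon><..1/2} (norm \<eta>) * norm \<eta> powr (- d)) = ennreal ((c / 2) * r powr (- d))"
            using c True by (subst ennreal_mult[symmetric]) (auto simp: r_def)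
          then show ?thesis using le by (simp only: ennreal_leI)
        qed
      qed
    qed
    also have "\<dots> = ennreal (norm (F 0))"
    proof -
      have i: "integrable lborel (\<lambda>\<eta>. bessel_ker s \<eta> * g (0 - \<eta>))"
      proof (rule Bochner_Integration.integrable_bound)
        show "integrable lborel (\<lambda>\<eta>::(real^'n) \<times> (real^'n). \<epsilon> powr (- d / u) * norm (complex_of_real (bessel_ker s \<eta>)))"
          by (intro integrable_mult_right integrable_norm integrable_bessel_ker s)
        show "AE \<eta> in lborel. norm (bessel_ker s \<eta> * g (0 - \<eta>)) \<le> norm (\<epsilon> powr (- d / u) * norm (complex_of_real (bessel_ker s \<eta>)))"
        proof (rule AE_I2)
          fix \<eta> :: "(real^'n) \<times> (real^'n)"
          show "norm (bessel_ker s \<eta> * g (0 - \<eta>)) \<le> norm (\<epsilon> powr (- d / u) * norm (complex_of_real (bessel_ker s \<eta>)))"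
            using mult_left_mono[OF gb[of "0 - \<eta>"] bessel_ker_nonneg[OF s, of \<eta>]] bessel_ker_nonneg[OF s, of \<eta>] g0[of "0 - \<eta>"]
            by (simp add: abs_mult mult.commute)
        qed
      qed (use borel_measurable_bessel_ker[OF s] in measurable)
      have "F 0 = complex_of_real (LINT \<eta>|lborel. bessel_ker s \<eta> * g (0 - \<eta>))"
        unfolding F_def convol_def G_def of_real_mult[symmetric] by (rule integral_complex_of_real)
      moreover have "0 \<le> (LINT \<eta>|lborel. bessel_ker s \<eta> * g (0 - \<eta>))"
        by (intro Bochner_Integration.integral_nonneg mult_nonneg_nonneg bessel_ker_nonneg s g0)
      ultimately have "norm (F 0) = (LINT \<eta>|lborel. bessel_ker s \<eta> * g (0 - \<eta>))" by simp
      then show ?thesis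
        by (subst nn_integral_eq_integral[OF i]) (auto intro!: AE_I2 mult_nonneg_nonneg bessel_ker_nonneg s g0)
    qed
    finally have lo: "c / 2 * (real N * J) \<le> norm (F 0)" by simp
    have "a * real N = (c / 2 * (real N * J)) * (norm (fourier \<Theta> \<zeta>) * (2 * p) powr (- real CARD('n) / (2 * p)))"
      by (simp add: a_def)
    also have "\<dots> \<le> norm (F 0) * (norm (fourier \<Theta> \<zeta>) * (2 * p) powr (- real CARD('n) / (2 * p)))"
      by (intro mult_right_mono lo) auto
    also have "\<dots> \<le> b * B" using up by (simp add: mult.assoc)
    finally show ?thesis by (simp add: B_def)
  qed
  \<comment> \<open>The value at the centre grows linearly in \<open>N\<close>, its upper bound only
    like the \<open>1 / u\<close>-th power of a linear function; the comparison contradicts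
    \<open>u > 1\<close>.\<close>
  have "1 \<le> 1 / u"
  proof (rule growth_exponent_le[OF a, of 1 1 "b * (V + 2 * J) powr (1/u)"])
    fix N :: nat assume N: "N \<ge> 1"
    have "V * 1 \<le> V * real N" using V N by (intro mult_left_mono) auto
    moreover have "J * 1 \<le> J * real N" using J(1) N by (intro mult_left_mono) auto
    ultimately have "V + real (Suc N) * J \<le> (V + 2 * J) * real N" by (simp add: algebra_simps)
    then have "(V + real (Suc N) * J) powr (1/u) \<le> ((V + 2 * J) * real N) powr (1/u)"
      using u V J by (intro powr_mono2) auto
    then have "b * (V + real (Suc N) * J) powr (1/u) \<le> b * ((V + 2 * J) powr (1/u) * real N powr (1/u))"
      using b by (intro mult_left_mono) (auto simp: powr_mult)
    then show "a * real N powr 1 \<le> b * (V + 2 * J) powr (1/u) * real N powr (1/u)"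
      using main[OF N] N by (simp add: mult.assoc)
  qed
  then show False using u by simp
qed

section \<open>Chirped multipliers\<close>

lemma integrable_lborel_tensor:
  fixes f :: "'a::euclidean_space \<Rightarrow> complex" and g :: "'b::euclidean_space \<Rightarrow> complex"
  assumes f: "integrable lborel f" and g: "integrable lborel g"
  shows "integrable lborel (\<lambda>z. f (fst z) * g (snd z))"
    and "(LINT z|lborel. f (fst z) * g (snd z)) = (LINT x|lborel. f x) * (LINT y|lborel. g y)"
proof -
  have [measurable]: "f \<in> borel_measurable borel" "g \<in> borel_measurable borel" using f g by auto
  have "(\<integral>\<^sup>+x. \<integral>\<^sup>+y. norm (f x * g y) \<partial>lborel \<partial>lborel) = (\<integral>\<^sup>+x. norm (f x) \<partial>lborel) * (\<integral>\<^sup>+y. norm (g y) \<partial>lborel)"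
    by (simp add: norm_mult ennreal_mult nn_integral_cmult nn_integral_multc)
  also have "\<dots> < \<infinity>" using f g by (simp add: integrable_iff_bounded ennreal_mult_less_top)
  finally have "integrable (lborel \<Otimes>\<^sub>M lborel) (\<lambda>(x, y). f x * g y)"
    by (intro integrable_lborel_pairI) auto
  then show i: "integrable lborel (\<lambda>z. f (fst z) * g (snd z))"
    by (simp only: lborel_prod case_prod_unfold)
  show "(LINT z|lborel. f (fst z) * g (snd z)) = (LINT x|lborel. f x) * (LINT y|lborel. g y)"
    by (subst lborel_prod_integral[OF i]) simp
qed

lemma norm_powr_of_real: "norm (\<alpha> powr (of_real r :: complex)) = norm \<alpha> powr r"
  by (cases "\<alpha> = 0") (simp_all add: norm_powr_real_powr')

text \<open>The variables \<open>\<sigma> = \<xi>1 + \<xi>2\<close> and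
  \<open>v = \<xi>2 - (1/2) *\<^sub>R \<sigma>\<close> decouple the integral, because the squared
  norms of \<open>\<xi>1\<close> and \<open>\<xi>2\<close> add up to
  \<open>(norm \<sigma>)\<^sup>2 / 2 + 2 * (norm v)\<^sup>2\<close>. The phase in
  \<open>\<xi>1 + \<xi>2\<close> joins the Gaussian in \<open>\<sigma>\<close> as the imaginary part
  of \<open>\<alpha>\<close>, and each variable contributes one Fourier transform.\<close>

lemma chirp_gaussian_integral:
  fixes w :: "('a::euclidean_space) \<times> 'a" and x :: 'a and c \<tau> :: real
  assumes c: "c > 0"
  defines "\<alpha> \<equiv> Complex (c / 2) \<tau>"
  shows "(LINT \<xi>|lborel. cgauss (of_real c) (fst \<xi>) * cgauss (of_real c) (snd \<xi>) * cis (- (pi * \<tau> * (norm (fst \<xi> + snd \<xi>))\<^sup>2))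
      * cis (- 2 * pi * (\<xi> \<bullet> w)) * cis (2 * pi * (x \<bullet> (fst \<xi> + snd \<xi>))))
    = fourier (cgauss \<alpha>) ((1/2) *\<^sub>R (fst w + snd w) - x) * fourier (cgauss (of_real (2 * c))) (snd w - fst w)"
proof -
  define \<Phi> where "\<Phi> \<xi>1 \<xi>2 = cgauss (of_real c) \<xi>1 * cgauss (of_real c) \<xi>2 * cis (- (pi * \<tau> * (norm (\<xi>1 + \<xi>2))\<^sup>2))
      * cis (- 2 * pi * ((\<xi>1, \<xi>2) \<bullet> w)) * cis (2 * pi * (x \<bullet> (\<xi>1 + \<xi>2)))" for \<xi>1 \<xi>2 :: 'a
  have [measurable]: "case_prod \<Phi> \<in> borel_measurable (borel \<Otimes>\<^sub>M borel)"
    unfolding \<Phi>_def by measurable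
  have n\<Phi>: "norm (\<Phi> \<xi>1 \<xi>2) = norm (cgauss (of_real c) \<xi>1) * norm (cgauss (of_real c) \<xi>2)" for \<xi>1 \<xi>2
    by (simp add: \<Phi>_def norm_mult)
  have fin: "(\<integral>\<^sup>+\<xi>. norm (cgauss (of_real c) \<xi>) \<partial>(lborel :: 'a measure)) < \<infinity>"
    using c by (subst nn_integral_cgauss) auto
  have b1: "(\<integral>\<^sup>+\<xi>1. \<integral>\<^sup>+\<xi>2. norm (\<Phi> \<xi>1 \<xi>2) \<partial>lborel \<partial>lborel) < \<infinity>"
    unfolding n\<Phi> using fin by (simp add: ennreal_mult nn_integral_cmult nn_integral_multc ennreal_mult_less_top)
  have i: "integrable lborel (\<lambda>\<xi>. case_prod \<Phi> \<xi>)"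
    using integrable_lborel_pairI[OF _ b1] by (simp add: lborel_prod)
  have "(LINT \<xi>|lborel. cgauss (of_real c) (fst \<xi>) * cgauss (of_real c) (snd \<xi>) * cis (- (pi * \<tau> * (norm (fst \<xi> + snd \<xi>))\<^sup>2))
      * cis (- 2 * pi * (\<xi> \<bullet> w)) * cis (2 * pi * (x \<bullet> (fst \<xi> + snd \<xi>)))) = (LINT \<xi>|lborel. case_prod \<Phi> \<xi>)"
    by (intro Bochner_Integration.integral_cong refl) (simp add: \<Phi>_def split_beta)
  also have "\<dots> = (LINT \<xi>1|lborel. LINT \<xi>2|lborel. \<Phi> \<xi>1 \<xi>2)"
    using lborel_prod_integral[OF i] by simp
  also have "\<dots> = (LINT \<xi>2|lborel. LINT \<xi>1|lborel. \<Phi> \<xi>1 \<xi>2)"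
    by (rule fubini_lborel(1)[OF _ b1]) simp
  also have "\<dots> = (LINT \<xi>2|lborel. LINT \<sigma>|lborel. \<Phi> (\<sigma> - \<xi>2) \<xi>2)"
    by (subst integral_lborel_translate(2)) simp
  also have "\<dots> = (LINT \<sigma>|lborel. LINT \<xi>2|lborel. \<Phi> (\<sigma> - \<xi>2) \<xi>2)"
  proof (rule fubini_lborel(1))
    have "(\<integral>\<^sup>+\<xi>2. \<integral>\<^sup>+\<sigma>. norm (\<Phi> (\<sigma> - \<xi>2) \<xi>2) \<partial>lborel \<partial>lborel) = (\<integral>\<^sup>+\<xi>2. \<integral>\<^sup>+\<sigma>. norm (\<Phi> \<sigma> \<xi>2) \<partial>lborel \<partial>lborel)"
    proof (rule nn_integral_cong)
      fix \<xi>2 :: 'a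
      show "(\<integral>\<^sup>+\<sigma>. norm (\<Phi> (\<sigma> - \<xi>2) \<xi>2) \<partial>lborel) = (\<integral>\<^sup>+\<sigma>. norm (\<Phi> \<sigma> \<xi>2) \<partial>lborel)"
        by (rule nn_integral_lborel_translate(2)[of "\<lambda>\<sigma>. ennreal (norm (\<Phi> \<sigma> \<xi>2))"]) simp
    qed
    also have "\<dots> < \<infinity>" using b1 by (subst nn_integral_lborel_swap) simp_all
    finally show "(\<integral>\<^sup>+\<xi>2. \<integral>\<^sup>+\<sigma>. norm (\<Phi> (\<sigma> - \<xi>2) \<xi>2) \<partial>lborel \<partial>lborel) < \<infinity>" .
  qed measurable
  also have "\<dots> = (LINT \<sigma>|lborel. LINT \<tau>'|lborel. \<Phi> (\<sigma> - (\<tau>' + (1/2) *\<^sub>R \<sigma>)) (\<tau>' + (1/2) *\<^sub>R \<sigma>))"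
  proof (rule Bochner_Integration.integral_cong[OF refl])
    fix \<sigma> :: 'a
    show "(LINT \<xi>2|lborel. \<Phi> (\<sigma> - \<xi>2) \<xi>2) = (LINT \<tau>'|lborel. \<Phi> (\<sigma> - (\<tau>' + (1/2) *\<^sub>R \<sigma>)) (\<tau>' + (1/2) *\<^sub>R \<sigma>))"
      by (rule integral_lborel_translate(1)[of "\<lambda>\<xi>2. \<Phi> (\<sigma> - \<xi>2) \<xi>2", symmetric])
  qed
  also have "\<dots> = (LINT \<sigma>|lborel. LINT \<tau>'|lborel. (cgauss \<alpha> \<sigma> * cis (- 2 * pi * (\<sigma> \<bullet> ((1/2) *\<^sub>R (fst w + snd w) - x))))
       * (cgauss (of_real (2 * c)) \<tau>' * cis (- 2 * pi * (\<tau>' \<bullet> (snd w - fst w)))))"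
  proof (intro Bochner_Integration.integral_cong refl)
    fix \<sigma> v :: 'a
    have h: "\<sigma> - (v + (1/2) *\<^sub>R \<sigma>) = (1/2) *\<^sub>R \<sigma> - v"
    proof -
      have "(1/2) *\<^sub>R \<sigma> + (1/2) *\<^sub>R \<sigma> = \<sigma>" by (simp add: scaleR_left_distrib[symmetric])
      then have "\<sigma> - (v + (1/2) *\<^sub>R \<sigma>) = ((1/2) *\<^sub>R \<sigma> + (1/2) *\<^sub>R \<sigma>) - (v + (1/2) *\<^sub>R \<sigma>)" by (simp only:)
      then show ?thesis by simp
    qed
    have n1: "(norm ((1/2) *\<^sub>R \<sigma> - v))\<^sup>2 + (norm (v + (1/2) *\<^sub>R \<sigma>))\<^sup>2 = (norm \<sigma>)\<^sup>2 / 2 + 2 * (norm v)\<^sup>2"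
      unfolding power2_norm_eq_inner by (simp add: inner_diff_left inner_diff_right inner_add_left inner_add_right inner_commute[of v \<sigma>] field_simps)
    have M1: "cgauss (of_real c) ((1/2) *\<^sub>R \<sigma> - v) * cgauss (of_real c) (v + (1/2) *\<^sub>R \<sigma>)
       = cgauss (of_real (c / 2)) \<sigma> * cgauss (of_real (2 * c)) v"
    proof -
      have "pi * c * (norm ((1/2) *\<^sub>R \<sigma> - v))\<^sup>2 + pi * c * (norm (v + (1/2) *\<^sub>R \<sigma>))\<^sup>2 = pi * c * ((norm \<sigma>)\<^sup>2 / 2 + 2 * (norm v)\<^sup>2)"
        by (simp only: n1[symmetric] distrib_left)
      then show ?thesis unfolding cgauss_of_real of_real_mult[symmetric] of_real_eq_iff mult_exp_exp
        by (simp add: algebra_simps)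
    qed
    have M2: "cgauss \<alpha> \<sigma> = cgauss (of_real (c / 2)) \<sigma> * cis (- (pi * \<tau> * (norm \<sigma>)\<^sup>2))"
    proof -
      have "\<alpha> = of_real (c / 2) + \<i> * of_real \<tau>" by (simp add: \<alpha>_def complex_eq_iff)
      then show ?thesis by (simp only: cgauss_add) (simp add: cgauss_def cis_conv_exp mult_ac)
    qed
    have M3: "cis (- 2 * pi * (((1/2) *\<^sub>R \<sigma> - v, v + (1/2) *\<^sub>R \<sigma>) \<bullet> w)) * cis (2 * pi * (x \<bullet> \<sigma>))
       = cis (- 2 * pi * (\<sigma> \<bullet> ((1/2) *\<^sub>R (fst w + snd w) - x))) * cis (- 2 * pi * (v \<bullet> (snd w - fst w)))"
    proof -
      have "- 2 * pi * (((1/2) *\<^sub>R \<sigma> - v, v + (1/2) *\<^sub>R \<sigma>) \<bullet> w) + 2 * pi * (x \<bullet> \<sigma>)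
         = - 2 * pi * (\<sigma> \<bullet> ((1/2) *\<^sub>R (fst w + snd w) - x)) + - 2 * pi * (v \<bullet> (snd w - fst w))"
        by (cases w) (simp add: inner_diff_left inner_diff_right inner_add_left inner_add_right inner_commute[of x \<sigma>] algebra_simps)
      then show ?thesis by (simp only: cis_mult)
    qed
    have M4: "(1/2) *\<^sub>R \<sigma> - v + (v + (1/2) *\<^sub>R \<sigma>) = \<sigma>" using h by (simp add: algebra_simps)
    show "\<Phi> (\<sigma> - (v + (1/2) *\<^sub>R \<sigma>)) (v + (1/2) *\<^sub>R \<sigma>)
       = (cgauss \<alpha> \<sigma> * cis (- 2 * pi * (\<sigma> \<bullet> ((1/2) *\<^sub>R (fst w + snd w) - x))))
       * (cgauss (of_real (2 * c)) v * cis (- 2 * pi * (v \<bullet> (snd w - fst w))))"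
    proof -
      have "\<Phi> (\<sigma> - (v + (1/2) *\<^sub>R \<sigma>)) (v + (1/2) *\<^sub>R \<sigma>)
        = (cgauss (of_real c) ((1/2) *\<^sub>R \<sigma> - v) * cgauss (of_real c) (v + (1/2) *\<^sub>R \<sigma>)) * cis (- (pi * \<tau> * (norm \<sigma>)\<^sup>2))
          * (cis (- 2 * pi * (((1/2) *\<^sub>R \<sigma> - v, v + (1/2) *\<^sub>R \<sigma>) \<bullet> w)) * cis (2 * pi * (x \<bullet> \<sigma>)))"
        unfolding \<Phi>_def h M4 by (simp only: mult.assoc)
      also have "\<dots> = (cgauss (of_real (c / 2)) \<sigma> * cis (- (pi * \<tau> * (norm \<sigma>)\<^sup>2)) * cis (- 2 * pi * (\<sigma> \<bullet> ((1/2) *\<^sub>R (fst w + snd w) - x))))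
         * (cgauss (of_real (2 * c)) v * cis (- 2 * pi * (v \<bullet> (snd w - fst w))))"
        unfolding M1 M3 by (simp only: mult_ac)
      finally show ?thesis by (simp only: M2)
    qed
  qed
  also have "\<dots> = fourier (cgauss \<alpha>) ((1/2) *\<^sub>R (fst w + snd w) - x) * fourier (cgauss (of_real (2 * c))) (snd w - fst w)"
    unfolding fourier_def by simp
  finally show ?thesis .
qed

section \<open>The quadratic phase and the smoothed chirp\<close>

definition qform :: "real \<Rightarrow> real \<Rightarrow> real \<Rightarrow> ('a::real_inner) \<times> 'a \<Rightarrow> real" where
  "qform c0 c1 c2 \<xi> = c1 * (norm (fst \<xi>))\<^sup>2 + c2 * (norm (snd \<xi>))\<^sup>2 - c0 * (norm (fst \<xi> + snd \<xi>))\<^sup>2"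

text \<open>Half of the gradient of \<open>qform\<close> at \<open>\<eta>\<close>, which represents
  its polar form.\<close>

definition qgrad :: "real \<Rightarrow> real \<Rightarrow> real \<Rightarrow> ('a::real_inner) \<times> 'a \<Rightarrow> 'a \<times> 'a" where
  "qgrad c0 c1 c2 \<eta> = (c1 *\<^sub>R fst \<eta> - c0 *\<^sub>R (fst \<eta> + snd \<eta>), c2 *\<^sub>R snd \<eta> - c0 *\<^sub>R (fst \<eta> + snd \<eta>))"

text \<open>Polarisation. For a chirp of rate \<open>N\<close> and \<open>t = 1 / N\<close> the
  cross term loses its factor \<open>N\<close>: a shift by \<open>(1 / N) *\<^sub>R \<eta>\<close>
  acts as a modulation with the fixed frequency \<open>qgrad c0 c1 c2 \<eta>\<close>, up to a phase
  of order \<open>1 / N\<close>.\<close>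

lemma qform_diff:
  "qform c0 c1 c2 (\<xi> - t *\<^sub>R \<eta>) = qform c0 c1 c2 \<xi> - 2 * t * (\<xi> \<bullet> qgrad c0 c1 c2 \<eta>) + t\<^sup>2 * qform c0 c1 c2 \<eta>"
proof -
  obtain a b c d where "\<xi> = (a, b)" "\<eta> = (c, d)" by fastforce
  then show ?thesis
    unfolding qform_def qgrad_def power2_norm_eq_inner
    by (simp add: inner_diff_left inner_diff_right inner_add_left inner_add_right inner_commute[of c a] inner_commute[of d a]
        inner_commute[of c b] inner_commute[of d b] inner_commute[of b a] inner_commute[of d c] power2_eq_square algebra_simps)
qed

lemma borel_measurable_qform [measurable]: "qform c0 c1 c2 \<in> borel_measurable (borel :: ('a::euclidean_space \<times> 'a) measure)"
  unfolding qform_def[abs_def] by (intro borel_measurable_continuous_onI continuous_intros)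

lemma borel_measurable_qgrad [measurable]: "qgrad c0 c1 c2 \<in> borel_measurable (borel :: ('a::euclidean_space \<times> 'a) measure)"
  unfolding qgrad_def[abs_def] by (intro borel_measurable_continuous_onI continuous_intros)

text \<open>The chirp oscillates at frequencies of order \<open>N\<close>; smoothing it at scale \<open>1 / N\<close> trades the factor
  \<open>jap powr (s / 2)\<close> of the Bessel norm for a bounded quotient of brackets times \<open>N powr s\<close>.\<close>

definition chirp :: "real \<Rightarrow> real \<Rightarrow> real \<Rightarrow> real \<Rightarrow> ('a::euclidean_space) \<times> 'a \<Rightarrow> complex" where
  "chirp c0 c1 c2 N \<xi> = cis (pi * N * qform c0 c1 c2 \<xi>) * cgauss 1 \<xi>"

definition chirp_smooth :: "real \<Rightarrow> real \<Rightarrow> real \<Rightarrow> real \<Rightarrow> real \<Rightarrow> ('a::euclidean_space) \<times> 'a \<Rightarrow> complex" where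
  "chirp_smooth s c0 c1 c2 N \<xi> = (LINT \<eta>|lborel. of_real (bessel_ker s \<eta>) * chirp c0 c1 c2 N (\<xi> - (1 / N) *\<^sub>R \<eta>))"

lemma norm_chirp: "norm (chirp c0 c1 c2 N \<xi>) = norm (cgauss 1 \<xi>)"
  by (simp add: chirp_def norm_mult)

lemma borel_measurable_chirp [measurable]: "chirp c0 c1 c2 N \<in> borel_measurable (borel :: ('a::euclidean_space \<times> 'a) measure)"
  unfolding chirp_def[abs_def] by measurable

lemma integrable_chirp: "integrable lborel (chirp c0 c1 c2 N :: ('a::euclidean_space) \<times> 'a \<Rightarrow> complex)"
  by (rule Bochner_Integration.integrable_bound[OF integrable_cgauss[of 1]]) (auto simp: norm_chirp)

text \<open>On the Fourier side the smoothing contributes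
  \<open>jap (x /\<^sub>R N) powr (- s / 2)\<close>. The bracket bound with
  \<open>b = 1 / N\<^sup>2\<close> and \<open>y = 0\<close> then costs \<open>1 + N powr s\<close>,
  and nothing else depends on \<open>N\<close>, since the chirp has the modulus of a fixed
  Gaussian.\<close>

lemma chirp_smooth_bessel_rep:
  fixes s u :: real
  assumes s: "0 < s" and u: "1 < u"
  obtains C where "C > 0"
    "\<And>c0 c1 c2 N. N \<ge> 1 \<Longrightarrow> \<exists>G. bessel_rep s (chirp_smooth s c0 c1 c2 N :: ('a::euclidean_space) \<times> 'a \<Rightarrow> complex) G \<and>
       (\<integral>\<^sup>+\<xi>. norm (G \<xi>) powr u \<partial>lborel) \<le> ennreal ((C * N powr s) powr u)"
proof -
  let ?E = "TYPE('a \<times> 'a)"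
  obtain C0 :: real and m :: nat where C0: "C0 > 0" and mul: "bracket_bound s u C0 m ?E"
    by (rule bracket_multiplier[OF s u, where 'a="'a \<times> 'a"]) (rule that)
  define B0 where "B0 = u powr (- real DIM('a \<times> 'a) / (2 * u))"
  have B0: "B0 > 0" using u by (simp add: B0_def)
  define C where "C = 2 * C0 * B0"
  have C: "C > 0" using C0 B0 by (simp add: C_def)
  show thesis
  proof (rule that[OF C])
    fix c0 c1 c2 N :: real assume N: "N \<ge> 1"
    let ?f = "chirp c0 c1 c2 N :: 'a \<times> 'a \<Rightarrow> complex"
    let ?F = "chirp_smooth s c0 c1 c2 N :: 'a \<times> 'a \<Rightarrow> complex"
    \<comment> \<open>The L^1-normalised dilate of the Bessel kernel, by which smoothing at scale
      \<open>1 / N\<close> becomes a convolution.\<close>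
    define K where "K \<eta> = complex_of_real (N ^ DIM('a \<times> 'a)) * of_real (bessel_ker s (N *\<^sub>R \<eta>))" for \<eta> :: "'a \<times> 'a"
    have iK: "integrable lborel K"
      unfolding K_def[abs_def] using N integrable_lborel_affine[OF integrable_bessel_ker[OF s, where 'a="'a \<times> 'a"], of N 0]
      by (intro integrable_mult_right) simp
    have fK: "fourier K x = of_real (jap (x /\<^sub>R N) powr (- s / 2))" for x
    proof -
      have "fourier K x = of_real (N ^ DIM('a \<times> 'a)) * fourier (\<lambda>\<eta>. of_real (bessel_ker s (N *\<^sub>R \<eta>))) x"
        unfolding K_def[abs_def] by (rule fourier_cmult)
      also have "\<dots> = of_real (N ^ DIM('a \<times> 'a)) * (of_real (1 / N ^ DIM('a \<times> 'a)) * fourier (\<lambda>\<eta>. of_real (bessel_ker s \<eta>)) (x /\<^sub>R N))"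
        using N by (subst fourier_dilate[where f="\<lambda>\<eta>. of_real (bessel_ker s \<eta>)"]) auto
      also have "\<dots> = fourier (\<lambda>\<eta>. of_real (bessel_ker s \<eta>)) (x /\<^sub>R N)"
        unfolding mult.assoc[symmetric] of_real_mult[symmetric] using N by simp
      finally show ?thesis by (simp only: fourier_bessel_ker[OF s])
    qed
    have F: "?F = convol K ?f"
    proof
      fix \<xi>
      have "convol K ?f \<xi> = \<bar>1 / N\<bar> ^ DIM('a \<times> 'a) *\<^sub>R (LINT \<eta>|lborel. K (0 + (1 / N) *\<^sub>R \<eta>) * ?f (\<xi> - (0 + (1 / N) *\<^sub>R \<eta>)))"
        unfolding convol_def by (rule integral_lborel_affine) (use N in simp)
      also have "\<dots> = (LINT \<eta>|lborel. \<bar>1 / N\<bar> ^ DIM('a \<times> 'a) *\<^sub>R (K (0 + (1 / N) *\<^sub>R \<eta>) * ?f (\<xi> - (0 + (1 / N) *\<^sub>R \<eta>))))"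
        by simp
      also have "\<dots> = ?F \<xi>"
        unfolding chirp_smooth_def
      proof (intro Bochner_Integration.integral_cong refl)
        fix \<eta> :: "'a \<times> 'a"
        have "\<bar>1 / N\<bar> ^ DIM('a \<times> 'a) * N ^ DIM('a \<times> 'a) = 1" using N by (simp add: power_mult_distrib[symmetric])
        then show "\<bar>1 / N\<bar> ^ DIM('a \<times> 'a) *\<^sub>R (K (0 + (1 / N) *\<^sub>R \<eta>) * ?f (\<xi> - (0 + (1 / N) *\<^sub>R \<eta>)))
          = of_real (bessel_ker s \<eta>) * ?f (\<xi> - (1 / N) *\<^sub>R \<eta>)"
          using N unfolding K_def scaleR_conv_of_real by (simp only: mult.assoc[symmetric] of_real_mult[symmetric]) simp
      qed
      finally show "?F \<xi> = convol K ?f \<xi>" ..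
    qed
    have iF: "integrable lborel ?F" unfolding F by (rule integrable_convol[OF iK integrable_chirp])
    have fF: "fourier ?F x = of_real (jap (x /\<^sub>R N) powr (- s / 2)) * fourier ?f x" for x
      unfolding F fourier_convol[OF iK integrable_chirp] fK ..
    have bd: "(\<integral>\<^sup>+\<xi>. norm (?f \<xi>) powr u \<partial>lborel) \<le> ennreal (B0 powr u)"
    proof -
      have "(\<integral>\<^sup>+\<xi>. norm (?f \<xi>) powr u \<partial>lborel) = (\<integral>\<^sup>+\<xi>. ennreal (exp (- (pi * u * (norm \<xi>)\<^sup>2))) \<partial>(lborel :: ('a \<times> 'a) measure))"
        by (intro nn_integral_cong) (simp add: norm_chirp norm_cgauss powr_def mult_ac)
      also have "\<dots> = ennreal (u powr (- real DIM('a \<times> 'a) / 2))" using u by (intro nn_integral_gaussian) simp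
      finally show ?thesis using u by (simp add: B0_def powr_powr)
    qed
    define L where "L = enn2real (\<integral>\<^sup>+\<xi>. norm (?f \<xi>) \<partial>lborel)"
    have L: "(\<integral>\<^sup>+\<xi>. norm (?f \<xi>) \<partial>lborel) \<le> ennreal L" "0 \<le> L"
      using integrable_chirp[of c0 c1 c2 N, where 'a='a] by (auto simp: L_def integrable_iff_bounded)
    have mm: "(\<lambda>(y::'a \<times> 'a, \<xi>). ?f \<xi>) \<in> borel_measurable (borel \<Otimes>\<^sub>M borel)" by measurable
    have N2: "1 / N\<^sup>2 > 0" using N by simp
    obtain H where H: "\<And>y. integrable lborel (H y)"
       "\<And>y. (\<integral>\<^sup>+\<xi>. norm (H y \<xi>) powr u \<partial>lborel) \<le> ennreal ((C0 * (1 + norm y) ^ m * (1 + (1 / N\<^sup>2) powr (- s / 2)) * B0) powr u)"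
       "\<And>y x. fourier (H y) x = of_real ((jap (x + y) / (1 + (1 / N\<^sup>2) * (4 * pi\<^sup>2 * (norm x)\<^sup>2))) powr (s / 2)) * fourier ?f x"
      by (rule bracket_boundE[OF mul N2 mm integrable_chirp bd B0 L]) (rule that)
    show "\<exists>G. bessel_rep s ?F G \<and> (\<integral>\<^sup>+\<xi>. norm (G \<xi>) powr u \<partial>lborel) \<le> ennreal ((C * N powr s) powr u)"
    proof (intro exI[of _ "H 0"] conjI)
      have "fourier (H 0) x = of_real (jap x powr (s / 2)) * fourier ?F x" for x
      proof -
        have j: "1 + (1 / N\<^sup>2) * (4 * pi\<^sup>2 * (norm x)\<^sup>2) = jap (x /\<^sub>R N)"
          using N by (simp add: jap_def power_mult_distrib power_divide field_simps)
        have "(jap x / jap (x /\<^sub>R N)) powr (s / 2) = jap x powr (s / 2) * jap (x /\<^sub>R N) powr (- s / 2)"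
        proof -
          have e: "- s / 2 = - (s / 2)" by simp
          show ?thesis unfolding e powr_minus powr_divide by (rule divide_inverse)
        qed
        then show ?thesis unfolding H(3) j fF by (simp add: mult.assoc)
      qed
      then show "bessel_rep s ?F (H 0)" using H(1) iF by (simp add: bessel_rep_def)
      have Ns: "(1 / N\<^sup>2) powr (- s / 2) = N powr s"
      proof -
        have "(1 / N\<^sup>2) powr (- s / 2) = (N powr 2) powr (s / 2)" using N by (simp add: powr_divide powr_minus)
        then show ?thesis by (simp only: powr_powr) simp
      qed
      have "1 \<le> N powr s" using N s by (simp add: ge_one_powr_ge_zero)
      then have "C0 * (1 + norm (0::'a \<times> 'a)) ^ m * (1 + (1 / N\<^sup>2) powr (- s / 2)) * B0 \<le> C0 * (2 * N powr s) * B0"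
        unfolding Ns using C0 B0 by (intro mult_right_mono mult_left_mono) auto
      also have "\<dots> = C * N powr s" by (simp add: C_def)
      finally have "(C0 * (1 + norm (0::'a \<times> 'a)) ^ m * (1 + (1 / N\<^sup>2) powr (- s / 2)) * B0) powr u \<le> (C * N powr s) powr u"
        using u C0 B0 by (intro powr_mono2) (auto intro!: mult_nonneg_nonneg add_nonneg_nonneg)
      then show "(\<integral>\<^sup>+\<xi>. norm (H 0 \<xi>) powr u \<partial>lborel) \<le> ennreal ((C * N powr s) powr u)"
        using H(2)[of 0] by (meson ennreal_leI order_trans)
    qed
  qed
qed

lemma norm_chirp_smooth_le:
  fixes \<xi> :: "('a::euclidean_space) \<times> 'a"
  assumes s: "0 < s"
  shows "norm (chirp_smooth s c0 c1 c2 N \<xi>) \<le> 1"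
proof -
  have "ennreal (norm (chirp_smooth s c0 c1 c2 N \<xi>)) \<le> (\<integral>\<^sup>+\<eta>. norm (of_real (bessel_ker s \<eta>) * chirp c0 c1 c2 N (\<xi> - (1 / N) *\<^sub>R \<eta>)) \<partial>lborel)"
    unfolding chirp_smooth_def by (rule norm_integral_le_nn_integral)
  also have "\<dots> \<le> (\<integral>\<^sup>+\<eta>. bessel_ker s \<eta> \<partial>(lborel :: ('a \<times> 'a) measure))"
  proof (rule nn_integral_mono, rule ennreal_leI)
    fix \<eta> :: "'a \<times> 'a"
    show "norm (of_real (bessel_ker s \<eta>) * chirp c0 c1 c2 N (\<xi> - (1 / N) *\<^sub>R \<eta>)) \<le> bessel_ker s \<eta>"
      using mult_left_mono[OF norm_cgauss_le_1[of 1 "\<xi> - (1 / N) *\<^sub>R \<eta>"] bessel_ker_nonneg[OF s, of \<eta>]]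
      by (simp add: norm_mult norm_chirp bessel_ker_nonneg[OF s])
  qed
  also have "\<dots> \<le> ennreal 1" by (rule nn_integral_bessel_ker[OF s])
  finally show ?thesis by simp
qed

section \<open>Limits of superpositions of Gaussians\<close>

lemma tendsto_integral_mult:
  fixes \<rho> :: "'w::euclidean_space \<Rightarrow> complex"
  assumes \<rho>: "integrable lborel \<rho>" and [measurable]: "\<And>n. k n \<in> borel_measurable borel"
    and B: "\<And>n \<omega>. norm (k n \<omega>) \<le> B" and lim: "\<And>\<omega>. (\<lambda>n. k n \<omega>) \<longlonglongrightarrow> l \<omega>"
  shows "(\<lambda>n. LINT \<omega>|lborel. \<rho> \<omega> * k n \<omega>) \<longlonglongrightarrow> (LINT \<omega>|lborel. \<rho> \<omega> * l \<omega>)"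
proof (rule integral_dominated_convergence)
  have [measurable]: "\<rho> \<in> borel_measurable borel" using \<rho> by auto
  have [measurable]: "l \<in> borel_measurable borel" by (rule borel_measurable_LIMSEQ_metric[where f=k]) (use lim in auto)
  show "(\<lambda>\<omega>. \<rho> \<omega> * l \<omega>) \<in> borel_measurable lborel" "\<And>n. (\<lambda>\<omega>. \<rho> \<omega> * k n \<omega>) \<in> borel_measurable lborel" by auto
  show "integrable lborel (\<lambda>\<omega>. B * norm (\<rho> \<omega>))" by (intro integrable_mult_right integrable_norm \<rho>)
  show "AE \<omega> in lborel. (\<lambda>n. \<rho> \<omega> * k n \<omega>) \<longlonglongrightarrow> \<rho> \<omega> * l \<omega>" by (intro AE_I2 tendsto_mult_left lim)
  show "AE \<omega> in lborel. norm (\<rho> \<omega> * k n \<omega>) \<le> B * norm (\<rho> \<omega>)" for n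
    using mult_left_mono[OF B[of n] norm_ge_zero[of "\<rho> _"]] by (intro AE_I2) (simp add: norm_mult mult.commute)
qed

lemma isCont_integral_mult:
  fixes \<rho> :: "'w::euclidean_space \<Rightarrow> complex" and z0 :: "'z::metric_space"
  assumes \<rho>: "integrable lborel \<rho>" and k: "\<And>z. k z \<in> borel_measurable borel"
    and B: "\<And>z \<omega>. norm (k z \<omega>) \<le> B" and cont: "\<And>\<omega>. isCont (\<lambda>z. k z \<omega>) z0"
  shows "isCont (\<lambda>z. LINT \<omega>|lborel. \<rho> \<omega> * k z \<omega>) z0"
proof (rule continuous_at_sequentially[THEN iffD2], intro allI impI)
  fix x :: "nat \<Rightarrow> 'z" assume x: "x \<longlonglongrightarrow> z0"
  have "(\<lambda>n. k (x n) \<omega>) \<longlonglongrightarrow> k z0 \<omega>" for \<omega>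
    by (rule isCont_tendsto_compose[OF cont x])
  then show "((\<lambda>z. LINT \<omega>|lborel. \<rho> \<omega> * k z \<omega>) \<circ> x) \<longlonglongrightarrow> (LINT \<omega>|lborel. \<rho> \<omega> * k z0 \<omega>)"
    unfolding o_def by (intro tendsto_integral_mult[OF \<rho> k B])
qed

lemma tendsto_cis: "(f \<longlongrightarrow> a) F \<Longrightarrow> ((\<lambda>x. cis (f x)) \<longlongrightarrow> cis a) F"
  unfolding cis_conv_exp by (intro tendsto_intros)

lemma tendsto_cgauss:
  fixes f :: "'b \<Rightarrow> 'a::real_normed_vector"
  shows "(a \<longlongrightarrow> a0) F \<Longrightarrow> (f \<longlongrightarrow> x) F \<Longrightarrow> ((\<lambda>n. cgauss (a n) (f n)) \<longlongrightarrow> cgauss a0 x) F"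
  unfolding cgauss_def by (intro tendsto_intros)

text \<open>The output on chirped inputs, stripped of its powers of \<open>N\<close>, at a rescaled
  point. The factor \<open>(1 - c0) + c0 * N\<close> is 1 for \<open>c0 = 0\<close> and
  \<open>N\<close> for \<open>c0 = 1\<close>, so one formula serves both cases. In the application
  \<open>W\<close> and \<open>V\<close> are the mean and the difference of the two components of a
  frequency shift.\<close>

definition chirp_amplitude ::
  "('w::euclidean_space \<Rightarrow> complex) \<Rightarrow> ('w \<Rightarrow> real) \<Rightarrow> ('w \<Rightarrow> 'a::euclidean_space) \<Rightarrow> ('w \<Rightarrow> 'a) \<Rightarrow> real \<Rightarrow> real \<Rightarrow> real \<Rightarrow> 'a \<Rightarrow> complex" where
  "chirp_amplitude \<rho> \<theta> W V c c0 N z = (LINT \<omega>|lborel. \<rho> \<omega> * (cis (\<theta> \<omega> / N) *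
     (cgauss (1 / Complex (c / 2) (N * c0)) (W \<omega> - ((1 - c0) + c0 * N) *\<^sub>R z) * cgauss (of_real (1 / (2 * c))) (V \<omega>))))"

text \<open>For \<open>c0 = 0\<close> only the phase \<open>\<theta> \<omega> / N\<close> depends on
  \<open>N\<close>. For \<open>c0 = 1\<close> a Gaussian with parameter of size \<open>1 / N\<close>
  is evaluated at a point of size \<open>N\<close>; expanding the square separates a factor that
  does not depend on \<open>\<omega>\<close>, whose phase the norm discards, while the cross term
  tends to a character of \<open>W \<omega>\<close>.\<close>

lemma chirp_amplitude_limit:
  fixes \<rho> :: "'w::euclidean_space \<Rightarrow> complex" and W V :: "'w \<Rightarrow> 'a::euclidean_space"
  assumes \<rho>: "integrable lborel \<rho>" and \<theta>[measurable]: "\<theta> \<in> borel_measurable borel"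
    and WV[measurable]: "W \<in> borel_measurable borel" "V \<in> borel_measurable borel"
    and c: "c > 0" and c0: "c0 = 0 \<or> c0 = 1"
  obtains h where "\<And>z. (\<lambda>n. norm (chirp_amplitude \<rho> \<theta> W V c c0 (real n) z)) \<longlonglongrightarrow> h z" "isCont h 0"
    "h 0 = norm (LINT \<omega>|lborel. \<rho> \<omega> * (cgauss (of_real (if c0 = 0 then 2 / c else 0)) (W \<omega>) * cgauss (of_real (1 / (2 * c))) (V \<omega>)))"
proof -
  have cV: "norm (cgauss (of_real (1 / (2 * c))) (V \<omega>)) \<le> 1" for \<omega> using c by (intro norm_cgauss_le_1) simp
  have \<theta>0: "(\<lambda>n. cis (\<theta> \<omega> / real n)) \<longlonglongrightarrow> 1" for \<omega>
    using tendsto_cis[OF lim_const_over_n[of "\<theta> \<omega>"]] by simp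
  show thesis
  proof (cases "c0 = 0")
    case True
    define k where "k z \<omega> = cgauss (of_real (2 / c)) (W \<omega> - z) * cgauss (of_real (1 / (2 * c))) (V \<omega>)" for z \<omega>
    have [measurable]: "k z \<in> borel_measurable borel" for z unfolding k_def[abs_def] by measurable
    have k1: "norm (k z \<omega>) \<le> 1" for z \<omega>
    proof -
      have "norm (cgauss (of_real (2 / c)) (W \<omega> - z)) \<le> 1" using c by (intro norm_cgauss_le_1) simp
      then show ?thesis unfolding k_def norm_mult using mult_mono[OF _ cV, of _ 1] by simp
    qed
    have \<alpha>: "1 / Complex (c / 2) 0 = of_real (2 / c)" using c by (simp add: complex_eq_iff Re_divide Im_divide power2_eq_square)
    have e: "chirp_amplitude \<rho> \<theta> W V c c0 (real n) z = (LINT \<omega>|lborel. \<rho> \<omega> * (cis (\<theta> \<omega> / real n) * k z \<omega>))" for n z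
      unfolding chirp_amplitude_def k_def using \<alpha> True by simp
    show thesis
    proof (rule that[of "\<lambda>z. norm (LINT \<omega>|lborel. \<rho> \<omega> * k z \<omega>)"])
      fix z
      have "(\<lambda>n. LINT \<omega>|lborel. \<rho> \<omega> * (cis (\<theta> \<omega> / real n) * k z \<omega>)) \<longlonglongrightarrow> (LINT \<omega>|lborel. \<rho> \<omega> * k z \<omega>)"
      proof (rule tendsto_integral_mult[OF \<rho>])
        show "norm (cis (\<theta> \<omega> / real n) * k z \<omega>) \<le> 1" for n \<omega> by (simp add: norm_mult k1)
        show "(\<lambda>n. cis (\<theta> \<omega> / real n) * k z \<omega>) \<longlonglongrightarrow> k z \<omega>" for \<omega>
          using tendsto_mult_right[OF \<theta>0[of \<omega>], of "k z \<omega>"] by simp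
      qed measurable
      then show "(\<lambda>n. norm (chirp_amplitude \<rho> \<theta> W V c c0 (real n) z)) \<longlonglongrightarrow> norm (LINT \<omega>|lborel. \<rho> \<omega> * k z \<omega>)"
        unfolding e by (rule tendsto_norm)
    next
      show "isCont (\<lambda>z. norm (LINT \<omega>|lborel. \<rho> \<omega> * k z \<omega>)) 0"
      proof (intro continuous_norm isCont_integral_mult[OF \<rho> _ k1])
        show "isCont (\<lambda>z. k z \<omega>) 0" for \<omega>
          unfolding k_def isCont_def by (intro tendsto_mult tendsto_cgauss tendsto_intros)
      qed measurable
    qed (simp add: k_def True)
  next
    case False
    then have c1: "c0 = 1" using c0 by simp
    define \<alpha> where "\<alpha> n = Complex (c / 2) (real n)" for n :: nat
    have \<alpha>0: "\<alpha> n \<noteq> 0" for n using c by (simp add: \<alpha>_def complex_eq_iff)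
    \<comment> \<open>The coefficient of the cross term: \<open>N / (c / 2 + \<i> * N)\<close> tends
      to \<open>- \<i>\<close>, so the cross term becomes purely oscillatory.\<close>
    define g where "g n = of_real (real n) / \<alpha> n" for n
    have g: "g \<longlonglongrightarrow> - \<i>"
    proof (rule Lim_transform_eventually)
      have "(\<lambda>n. 1 / Complex (c / 2 / real n) 1) \<longlonglongrightarrow> 1 / Complex 0 1"
        by (intro tendsto_divide tendsto_Complex lim_const_over_n tendsto_const) (simp add: complex_eq_iff)
      then show "(\<lambda>n. 1 / Complex (c / 2 / real n) 1) \<longlonglongrightarrow> - \<i>" by (simp add: Complex_eq)
      show "\<forall>\<^sub>F n in sequentially. 1 / Complex (c / 2 / real n) 1 = g n"
        using eventually_gt_at_top[of 0]
      proof eventually_elim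
        case (elim n)
        have "\<alpha> n = of_real (real n) * Complex (c / 2 / real n) 1"
          unfolding \<alpha>_def using elim by (intro complex_eqI) auto
        then show ?case using elim by (simp add: g_def)
      qed
    qed
    have inv: "(\<lambda>n. 1 / \<alpha> n) \<longlonglongrightarrow> 0"
    proof (rule Lim_transform_eventually)
      have "(\<lambda>n. g n * of_real (1 / real n)) \<longlonglongrightarrow> - \<i> * of_real 0"
        by (intro tendsto_mult g tendsto_of_real lim_1_over_n)
      then show "(\<lambda>n. g n * of_real (1 / real n)) \<longlonglongrightarrow> 0" by simp
      show "\<forall>\<^sub>F n in sequentially. g n * of_real (1 / real n) = 1 / \<alpha> n"
        using eventually_gt_at_top[of 0] by eventually_elim (simp add: g_def)
    qed
    have Re\<alpha>: "Re (1 / \<alpha> n) * (real n)\<^sup>2 = c / 2 * (norm (g n))\<^sup>2" for n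
    proof -
      have "Re (1 / \<alpha> n) = (c / 2) / (norm (\<alpha> n))\<^sup>2" unfolding cmod_power2 by (simp add: Re_divide \<alpha>_def)
      moreover have "(norm (g n))\<^sup>2 = (real n)\<^sup>2 / (norm (\<alpha> n))\<^sup>2" by (simp add: g_def norm_divide power_divide)
      ultimately show ?thesis by (simp only: times_divide_eq_left times_divide_eq_right)
    qed
    have g1: "norm (g n) \<le> 1" for n
    proof -
      have "norm (\<alpha> n) \<ge> real n" using abs_Im_le_cmod[of "\<alpha> n"] by (simp add: \<alpha>_def)
      then show ?thesis unfolding g_def norm_divide using \<alpha>0[of n] by (simp add: divide_le_eq)
    qed
    define P where "P n z = cgauss (1 / \<alpha> n) (real n *\<^sub>R z)" for n :: nat and z :: 'a
    define E where "E n z \<omega> = exp (of_real (2 * pi * (W \<omega> \<bullet> z)) * g n - of_real (pi * (norm (W \<omega>))\<^sup>2) * (1 / \<alpha> n))" for n :: nat and z \<omega>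
    have [measurable]: "E n z \<in> borel_measurable borel" for n z unfolding E_def[abs_def] by measurable
    have split: "cgauss (1 / \<alpha> n) (W \<omega> - real n *\<^sub>R z) = P n z * E n z \<omega>" for n z \<omega>
    proof -
      have "(norm (W \<omega> - real n *\<^sub>R z))\<^sup>2 = (norm (W \<omega>))\<^sup>2 - 2 * real n * (W \<omega> \<bullet> z) + (norm (real n *\<^sub>R z))\<^sup>2"
        unfolding power2_norm_eq_inner by (simp add: inner_diff_left inner_diff_right inner_commute[of z "W \<omega>"] algebra_simps)
      then have N: "complex_of_real (pi * (norm (W \<omega> - real n *\<^sub>R z))\<^sup>2)
          = of_real (pi * (norm (W \<omega>))\<^sup>2) - of_real (2 * pi * (W \<omega> \<bullet> z)) * of_real (real n) + of_real (pi * (norm (real n *\<^sub>R z))\<^sup>2)"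
        unfolding of_real_mult[symmetric] of_real_diff[symmetric] of_real_add[symmetric] of_real_eq_iff
        by (simp only:) (simp only: algebra_simps)
      define i where "i = 1 / \<alpha> n"
      have g': "g n = of_real (real n) * i" by (simp add: g_def i_def)
      show ?thesis
        unfolding cgauss_def P_def E_def mult_exp_exp g' i_def[symmetric] N by (rule arg_cong[where f=exp], algebra)
    qed
    have nP: "norm (P n z) = exp (- (pi * (c / 2 * (norm (g n))\<^sup>2) * (norm z)\<^sup>2))" for n z
      unfolding P_def norm_cgauss Re\<alpha>[symmetric] by (simp add: power_mult_distrib)
    \<comment> \<open>A bound uniform in \<open>\<omega>\<close>, as dominated convergence needs:
      the product of \<open>P\<close> and \<open>E\<close> is a Gaussian of modulus at most 1, and
      \<open>P\<close> is bounded below because \<open>norm (g n) \<le> 1\<close>.\<close>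
    have nE: "norm (E n z \<omega>) \<le> exp (pi * (c / 2) * (norm z)\<^sup>2)" for n z \<omega>
    proof -
      have "norm (P n z) * norm (E n z \<omega>) \<le> 1"
        unfolding norm_mult[symmetric] split[symmetric] using c by (intro norm_cgauss_le_1) (simp add: \<alpha>_def Re_divide)
      then have "norm (E n z \<omega>) \<le> exp (pi * (c / 2 * (norm (g n))\<^sup>2) * (norm z)\<^sup>2)"
        unfolding nP by (simp add: exp_minus field_simps)
      also have "\<dots> \<le> exp (pi * (c / 2) * (norm z)\<^sup>2)"
      proof -
        have "(norm (g n))\<^sup>2 \<le> 1" using g1[of n] by (simp add: power_le_one)
        then have "c / 2 * (norm (g n))\<^sup>2 \<le> c / 2 * 1" using c by (intro mult_left_mono) auto
        then show ?thesis by (simp add: mult_right_mono mult_left_mono)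
      qed
      finally show ?thesis .
    qed
    define k where "k z \<omega> = cis (- (2 * pi * (W \<omega> \<bullet> z))) * cgauss (of_real (1 / (2 * c))) (V \<omega>)" for z \<omega>
    have [measurable]: "k z \<in> borel_measurable borel" for z unfolding k_def[abs_def] by measurable
    have e: "norm (chirp_amplitude \<rho> \<theta> W V c c0 (real n) z)
       = norm (P n z) * norm (LINT \<omega>|lborel. \<rho> \<omega> * (cis (\<theta> \<omega> / real n) * (E n z \<omega> * cgauss (of_real (1 / (2 * c))) (V \<omega>))))" for n z
    proof -
      have a: "1 / Complex (c / 2) (real n * 1) = 1 / \<alpha> n" "1 - 1 + 1 * real n = real n" by (simp_all add: \<alpha>_def)
      have "chirp_amplitude \<rho> \<theta> W V c c0 (real n) z
        = (LINT \<omega>|lborel. P n z * (\<rho> \<omega> * (cis (\<theta> \<omega> / real n) * (E n z \<omega> * cgauss (of_real (1 / (2 * c))) (V \<omega>)))))"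
        unfolding chirp_amplitude_def c1 a split by (simp only: mult_ac)
      then show ?thesis by (simp add: norm_mult)
    qed
    show thesis
    proof (rule that[of "\<lambda>z. exp (- (pi * (c / 2) * (norm z)\<^sup>2)) * norm (LINT \<omega>|lborel. \<rho> \<omega> * k z \<omega>)"])
      fix z
      have "(\<lambda>n. LINT \<omega>|lborel. \<rho> \<omega> * (cis (\<theta> \<omega> / real n) * (E n z \<omega> * cgauss (of_real (1 / (2 * c))) (V \<omega>)))) \<longlonglongrightarrow> (LINT \<omega>|lborel. \<rho> \<omega> * k z \<omega>)"
      proof (rule tendsto_integral_mult[OF \<rho>])
        show "norm (cis (\<theta> \<omega> / real n) * (E n z \<omega> * cgauss (of_real (1 / (2 * c))) (V \<omega>))) \<le> exp (pi * (c / 2) * (norm z)\<^sup>2)" for n \<omega>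
          unfolding norm_mult norm_cis using mult_mono[OF nE[of n z \<omega>] cV[of \<omega>]] by simp
        fix \<omega>
        have "(\<lambda>n. E n z \<omega>) \<longlonglongrightarrow> exp (of_real (2 * pi * (W \<omega> \<bullet> z)) * - \<i> - of_real (pi * (norm (W \<omega>))\<^sup>2) * 0)"
          unfolding E_def by (intro tendsto_intros g inv)
        then have "(\<lambda>n. E n z \<omega>) \<longlonglongrightarrow> cis (- (2 * pi * (W \<omega> \<bullet> z)))"
          by (simp add: cis_conv_exp mult_ac)
        from tendsto_mult[OF \<theta>0[of \<omega>] tendsto_mult_right[OF this]]
        show "(\<lambda>n. cis (\<theta> \<omega> / real n) * (E n z \<omega> * cgauss (of_real (1 / (2 * c))) (V \<omega>))) \<longlonglongrightarrow> k z \<omega>"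
          by (simp add: k_def)
      qed measurable
      moreover have "(\<lambda>n. norm (P n z)) \<longlonglongrightarrow> exp (- (pi * (c / 2 * (norm (- \<i>))\<^sup>2) * (norm z)\<^sup>2))"
        unfolding nP by (intro tendsto_intros g)
      ultimately show "(\<lambda>n. norm (chirp_amplitude \<rho> \<theta> W V c c0 (real n) z)) \<longlonglongrightarrow> exp (- (pi * (c / 2) * (norm z)\<^sup>2)) * norm (LINT \<omega>|lborel. \<rho> \<omega> * k z \<omega>)"
        unfolding e by (intro tendsto_mult tendsto_norm) auto
    next
      have k1: "norm (k z \<omega>) \<le> 1" for z \<omega> using cV by (simp add: k_def norm_mult)
      show "isCont (\<lambda>z. exp (- (pi * (c / 2) * (norm z)\<^sup>2)) * norm (LINT \<omega>|lborel. \<rho> \<omega> * k z \<omega>)) 0"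
      proof (intro continuous_mult continuous_norm isCont_integral_mult[OF \<rho> _ k1])
        show "isCont (\<lambda>z. k z \<omega>) 0" for \<omega>
          unfolding k_def isCont_def by (intro tendsto_mult tendsto_cis tendsto_intros)
        show "isCont (\<lambda>z::'a. exp (- (pi * (c / 2) * (norm z)\<^sup>2))) 0" by (intro continuous_intros)
      qed measurable
    qed (simp add: k_def c1 cgauss_def)
  qed
qed

text \<open>As \<open>c\<close> grows the Gaussians flatten to 1 and the integral tends to the total
  mass of \<open>\<rho>\<close>, so some large \<open>c\<close> works. The bound
  \<open>c \<ge> 2\<close> makes \<open>c / 2 \<ge> 1\<close>, which the comparison of
  \<open>Complex (c / 2) (N * c0)\<close> with \<open>N powr c0\<close> requires.\<close>

lemma chirp_amplitude_limit_nonzero: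
  fixes \<rho> :: "'w::euclidean_space \<Rightarrow> complex" and W V :: "'w \<Rightarrow> 'a::euclidean_space" and c0 :: real
  assumes \<rho>: "integrable lborel \<rho>" and [measurable]: "W \<in> borel_measurable borel" "V \<in> borel_measurable borel"
    and nz: "(LINT \<omega>|lborel. \<rho> \<omega>) \<noteq> 0"
  obtains c where "c \<ge> 2"
    "(LINT \<omega>|lborel. \<rho> \<omega> * (cgauss (of_real (if c0 = 0 then 2 / c else 0)) (W \<omega>) * cgauss (of_real (1 / (2 * c))) (V \<omega>))) \<noteq> 0"
proof -
  define a where "a n = (if c0 = 0 then 2 / (real n + 2) else 0)" for n :: nat
  define b where "b n = 1 / (2 * (real n + 2))" for n :: nat
  have "(\<lambda>n. inverse (real (n + 2))) \<longlonglongrightarrow> 0" by (rule LIMSEQ_ignore_initial_segment[OF lim_inverse_n])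
  then have i: "(\<lambda>n. inverse (real n + 2)) \<longlonglongrightarrow> 0" unfolding of_nat_add of_nat_numeral .
  have a: "a \<longlonglongrightarrow> 0"
  proof (cases "c0 = 0")
    case True
    then have "a = (\<lambda>n. 2 * inverse (real n + 2))" by (simp add: a_def fun_eq_iff divide_inverse)
    then show ?thesis using tendsto_mult_left[OF i, of 2] by simp
  next
    case False
    then have "a = (\<lambda>n. 0)" by (simp add: a_def fun_eq_iff)
    then show ?thesis by simp
  qed
  have "b = (\<lambda>n. (1/2) * inverse (real n + 2))" by (intro ext) (simp add: b_def field_simps)
  then have b: "b \<longlonglongrightarrow> 0" using tendsto_mult_left[OF i, of "1/2"] by simp
  have "(\<lambda>n. LINT \<omega>|lborel. \<rho> \<omega> * (cgauss (of_real (a n)) (W \<omega>) * cgauss (of_real (b n)) (V \<omega>))) \<longlonglongrightarrow> (LINT \<omega>|lborel. \<rho> \<omega> * 1)"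
  proof (rule tendsto_integral_mult[OF \<rho>])
    show "norm (cgauss (of_real (a n)) (W \<omega>) * cgauss (of_real (b n)) (V \<omega>)) \<le> 1" for n \<omega>
    proof -
      have "norm (cgauss (of_real (a n)) (W \<omega>)) \<le> 1" "norm (cgauss (of_real (b n)) (V \<omega>)) \<le> 1"
        by (intro norm_cgauss_le_1; simp add: a_def b_def)+
      then show ?thesis by (simp add: norm_mult mult_le_one)
    qed
    show "(\<lambda>n. cgauss (of_real (a n)) (W \<omega>) * cgauss (of_real (b n)) (V \<omega>)) \<longlonglongrightarrow> 1" for \<omega>
      using tendsto_mult[OF tendsto_cgauss[OF tendsto_of_real[OF a] tendsto_const[of "W \<omega>"]]
         tendsto_cgauss[OF tendsto_of_real[OF b] tendsto_const[of "V \<omega>"]]] by (simp add: cgauss_def)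
  qed measurable
  then have "(\<lambda>n. LINT \<omega>|lborel. \<rho> \<omega> * (cgauss (of_real (a n)) (W \<omega>) * cgauss (of_real (b n)) (V \<omega>))) \<longlonglongrightarrow> (LINT \<omega>|lborel. \<rho> \<omega>)"
    by simp
  from tendsto_imp_eventually_ne[OF this nz]
  obtain n where "(LINT \<omega>|lborel. \<rho> \<omega> * (cgauss (of_real (a n)) (W \<omega>) * cgauss (of_real (b n)) (V \<omega>))) \<noteq> 0"
    by (meson eventually_happens' sequentially_bot)
  then show thesis by (intro that[of "real n + 2"]) (auto simp: a_def b_def)
qed

lemma nn_integral_powr_pos:
  fixes h :: "'a::euclidean_space \<Rightarrow> real"
  assumes h: "isCont h 0" "h 0 > 0" and p: "p > 0"
  obtains \<delta> where "\<delta> > 0" "ennreal \<delta> \<le> (\<integral>\<^sup>+x. h x powr p \<partial>lborel)"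
proof -
  have "eventually (\<lambda>x. h x > h 0 / 2) (at 0)"
    using h by (intro order_tendstoD(1)[where y="h 0"]) (auto simp: isCont_def)
  then obtain r where r: "r > 0" "\<And>x. x \<noteq> 0 \<Longrightarrow> dist x 0 < r \<Longrightarrow> h x > h 0 / 2"
    unfolding eventually_at by blast
  have le: "h x \<ge> h 0 / 2" if "x \<in> ball 0 r" for x using r(2)[of x] that h by (cases "x = 0") auto
  obtain V where V: "emeasure lborel (ball (0::'a) r) = ennreal V" "V > 0"
  proof (cases "emeasure lborel (ball (0::'a) r)")
    case (real V)
    have "V \<noteq> 0"
    proof
      assume "V = 0"
      then have "negligible (ball (0::'a) r)" using real
        by (intro negligible_iff_null_sets[THEN iffD2] null_sets_completionI) auto
      then show False using open_not_negligible[of "ball (0::'a) r"] r by simp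
    qed
    then show ?thesis using real that by auto
  next
    case top then show ?thesis using emeasure_lborel_ball_finite[of "0::'a" r] by simp
  qed
  show thesis
  proof (rule that)
    show "(h 0 / 2) powr p * V > 0" using h V by simp
    have "ennreal ((h 0 / 2) powr p * V) = ennreal ((h 0 / 2) powr p) * emeasure lborel (ball (0::'a) r)"
      using V by (simp add: ennreal_mult)
    also have "\<dots> = (\<integral>\<^sup>+x. ennreal ((h 0 / 2) powr p) * indicator (ball (0::'a) r) x \<partial>lborel)"
      by (subst nn_integral_cmult_indicator) auto
    also have "\<dots> \<le> (\<integral>\<^sup>+x. h x powr p \<partial>lborel)"
      using le h p by (intro nn_integral_mono) (auto split: split_indicator intro!: ennreal_leI powr_mono2)
    finally show "ennreal ((h 0 / 2) powr p * V) \<le> (\<integral>\<^sup>+x. h x powr p \<partial>lborel)" .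
  qed
qed

section \<open>Expansion of the chirped multiplier into characters\<close>

text \<open>Expanding every factor of the multiplier but one Gaussian and one chirp as a superposition of
  characters, indexed by \<open>(\<eta>, y, v)\<close>: \<open>\<eta>\<close> for the Bessel kernel, \<open>y\<close> for \<open>\<Theta>\<close>, \<open>v\<close> for the Gaussian cutoff.\<close>

definition chirp_density :: "real \<Rightarrow> ('b \<Rightarrow> complex) \<Rightarrow> 'b \<Rightarrow> ('b::euclidean_space) \<times> ('b \<times> 'b) \<Rightarrow> complex" where
  "chirp_density s \<Theta> \<zeta> \<omega> = of_real (bessel_ker s (fst \<omega>)) *
     ((\<Theta> (fst (snd \<omega>)) * cis (- 2 * pi * (fst (snd \<omega>) \<bullet> \<zeta>))) * cgauss 1 (snd (snd \<omega>)))"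

text \<open>The part of the phase that does not involve \<open>\<xi>\<close>; it enters divided by
  \<open>N\<close> and disappears in the limit.\<close>

definition chirp_phase :: "real \<Rightarrow> real \<Rightarrow> real \<Rightarrow> (('a::euclidean_space) \<times> 'a) \<times> (('a \<times> 'a) \<times> ('a \<times> 'a)) \<Rightarrow> real" where
  "chirp_phase c0 c1 c2 \<omega> = pi * qform c0 c1 c2 (fst \<omega>) + 2 * pi * (snd (snd \<omega>) \<bullet> fst \<omega>)"

text \<open>The total frequency of the character in \<open>\<xi>\<close>. It is independent of
  \<open>N\<close>, since a shift of the chirp by \<open>(1 / N) *\<^sub>R \<eta>\<close> produces
  the frequency \<open>qgrad c0 c1 c2 \<eta>\<close>.\<close>

definition chirp_shift :: "real \<Rightarrow> real \<Rightarrow> real \<Rightarrow> (('a::euclidean_space) \<times> 'a) \<times> (('a \<times> 'a) \<times> ('a \<times> 'a)) \<Rightarrow> 'a \<times> 'a" where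
  "chirp_shift c0 c1 c2 \<omega> = qgrad c0 c1 c2 (fst \<omega>) + fst (snd \<omega>) + snd (snd \<omega>)"

lemma borel_measurable_chirp_phase [measurable]: "chirp_phase c0 c1 c2 \<in> borel_measurable borel"
  unfolding chirp_phase_def[abs_def] qform_def by (intro borel_measurable_continuous_onI continuous_intros)

lemma borel_measurable_chirp_shift [measurable]: "chirp_shift c0 c1 c2 \<in> borel_measurable borel"
  unfolding chirp_shift_def[abs_def] qgrad_def by (intro borel_measurable_continuous_onI continuous_intros)

lemma chirp_density:
  fixes \<Theta> :: "'b::euclidean_space \<Rightarrow> complex"
  assumes s: "0 < s" and \<Theta>: "integrable lborel \<Theta>"
  shows "integrable lborel (chirp_density s \<Theta> \<zeta>)"
    and "(LINT \<omega>|lborel. chirp_density s \<Theta> \<zeta> \<omega>) = fourier \<Theta> \<zeta>"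
proof -
  have i1: "integrable lborel (\<lambda>y. \<Theta> y * cis (- 2 * pi * (y \<bullet> \<zeta>)))" by (rule integrable_cis_mult[OF \<Theta>]) measurable
  have i2: "integrable lborel (cgauss 1 :: 'b \<Rightarrow> complex)" by (rule integrable_cgauss) simp
  have i3: "integrable lborel (\<lambda>\<eta>::'b. complex_of_real (bessel_ker s \<eta>))" by (rule integrable_bessel_ker[OF s])
  show "integrable lborel (chirp_density s \<Theta> \<zeta>)"
    unfolding chirp_density_def[abs_def]
    by (rule integrable_lborel_tensor(1)[OF i3 integrable_lborel_tensor(1)[OF i1 i2]])
  have "(LINT \<omega>|lborel. chirp_density s \<Theta> \<zeta> \<omega>) = (LINT \<eta>|lborel. complex_of_real (bessel_ker s (\<eta>::'b))) * ((LINT y|lborel. \<Theta> y * cis (- 2 * pi * (y \<bullet> \<zeta>))) * (LINT v|lborel. cgauss 1 (v::'b)))"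
    unfolding chirp_density_def[abs_def]
    unfolding integrable_lborel_tensor(2)[OF i3 integrable_lborel_tensor(1)[OF i1 i2]] integrable_lborel_tensor(2)[OF i1 i2] ..
  moreover have "(LINT \<eta>|lborel. complex_of_real (bessel_ker s (\<eta>::'b))) = 1"
    using fourier_bessel_ker[OF s, of "0::'b"] by (simp add: fourier_def jap_def)
  moreover have "(LINT v|lborel. cgauss 1 (v::'b)) = 1"
    using integral_cgauss_of_real[of 1, where 'a='b] by simp
  ultimately show "(LINT \<omega>|lborel. chirp_density s \<Theta> \<zeta> \<omega>) = fourier \<Theta> \<zeta>" by (simp add: fourier_def)
qed

text \<open>By \<open>qform_diff\<close> the shifted chirp is the chirp at \<open>\<xi>\<close>
  times a character and a constant phase. The Gaussian cutoff, being its own transform, and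
  \<open>fourier \<Theta>\<close> are superpositions of characters as well. Hence a single quadratic
  phase can be taken out of the integral.\<close>

lemma chirp_smooth_expansion:
  fixes \<Theta> :: "('a::euclidean_space) \<times> 'a \<Rightarrow> complex"
  assumes s: "0 < s" and \<Theta>: "integrable lborel \<Theta>" and N: "N > 0"
  shows "chirp_smooth s c0 c1 c2 N \<xi> * fourier \<Theta> (\<xi> + \<zeta>) = cis (pi * N * qform c0 c1 c2 \<xi>) *
    (LINT \<omega>|lborel. chirp_density s \<Theta> \<zeta> \<omega> * (cis (chirp_phase c0 c1 c2 \<omega> / N) * cis (- 2 * pi * (\<xi> \<bullet> chirp_shift c0 c1 c2 \<omega>))))"
proof -
  have i0: "integrable lborel (\<lambda>\<omega>. chirp_density s \<Theta> \<zeta> \<omega> * (cis (chirp_phase c0 c1 c2 \<omega> / N) * cis (- 2 * pi * (\<xi> \<bullet> chirp_shift c0 c1 c2 \<omega>))))"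
    unfolding mult.assoc[symmetric] by (intro integrable_cis_mult chirp_density s \<Theta>) measurable
  have i1: "integrable lborel (\<lambda>y. \<Theta> y * cis (- 2 * pi * (y \<bullet> (\<xi> + \<zeta>))))" by (rule integrable_cis_mult[OF \<Theta>]) measurable
  have i2: "integrable lborel (\<lambda>v. cgauss 1 v * cis (- 2 * pi * (v \<bullet> (\<xi> - (1 / N) *\<^sub>R \<eta>))))" for \<eta> :: "'a \<times> 'a"
    by (rule integrable_cis_mult[OF integrable_cgauss]) simp_all
  have pt: "cis (pi * N * qform c0 c1 c2 \<xi>) * (chirp_density s \<Theta> \<zeta> (\<eta>, z) * (cis (chirp_phase c0 c1 c2 (\<eta>, z) / N) * cis (- 2 * pi * (\<xi> \<bullet> chirp_shift c0 c1 c2 (\<eta>, z)))))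
    = (of_real (bessel_ker s \<eta>) * cis (pi * N * qform c0 c1 c2 (\<xi> - (1 / N) *\<^sub>R \<eta>))) *
      ((\<Theta> (fst z) * cis (- 2 * pi * (fst z \<bullet> (\<xi> + \<zeta>)))) * (cgauss 1 (snd z) * cis (- 2 * pi * (snd z \<bullet> (\<xi> - (1 / N) *\<^sub>R \<eta>)))))" for \<eta> z
  proof -
    obtain y v where z: "z = (y, v)" by (cases z)
    have "pi * N * qform c0 c1 c2 \<xi> + (chirp_phase c0 c1 c2 (\<eta>, z) / N + (- 2 * pi * (\<xi> \<bullet> chirp_shift c0 c1 c2 (\<eta>, z)))) + - 2 * pi * (y \<bullet> \<zeta>)
       = pi * N * qform c0 c1 c2 (\<xi> - (1 / N) *\<^sub>R \<eta>) + - 2 * pi * (y \<bullet> (\<xi> + \<zeta>)) + - 2 * pi * (v \<bullet> (\<xi> - (1 / N) *\<^sub>R \<eta>))"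
      unfolding qform_diff z chirp_phase_def chirp_shift_def using N
      by (simp add: inner_add_right inner_diff_right inner_commute[of \<xi> y] inner_commute[of \<xi> v] field_simps power2_eq_square)
    from arg_cong[where f=cis, OF this]
    have e: "cis (pi * N * qform c0 c1 c2 \<xi>) * (cis (chirp_phase c0 c1 c2 (\<eta>, z) / N) * cis (- 2 * pi * (\<xi> \<bullet> chirp_shift c0 c1 c2 (\<eta>, z)))) * cis (- 2 * pi * (y \<bullet> \<zeta>))
       = cis (pi * N * qform c0 c1 c2 (\<xi> - (1 / N) *\<^sub>R \<eta>)) * cis (- 2 * pi * (y \<bullet> (\<xi> + \<zeta>))) * cis (- 2 * pi * (v \<bullet> (\<xi> - (1 / N) *\<^sub>R \<eta>)))"
      by (simp only: cis_mult)
    have "cis (pi * N * qform c0 c1 c2 \<xi>) * (chirp_density s \<Theta> \<zeta> (\<eta>, z) * (cis (chirp_phase c0 c1 c2 (\<eta>, z) / N) * cis (- 2 * pi * (\<xi> \<bullet> chirp_shift c0 c1 c2 (\<eta>, z)))))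
      = (of_real (bessel_ker s \<eta>) * \<Theta> y * cgauss 1 v) * (cis (pi * N * qform c0 c1 c2 \<xi>) * (cis (chirp_phase c0 c1 c2 (\<eta>, z) / N) * cis (- 2 * pi * (\<xi> \<bullet> chirp_shift c0 c1 c2 (\<eta>, z)))) * cis (- 2 * pi * (y \<bullet> \<zeta>)))"
      unfolding chirp_density_def z fst_conv snd_conv by (simp only: mult_ac)
    also have "\<dots> = (of_real (bessel_ker s \<eta>) * cis (pi * N * qform c0 c1 c2 (\<xi> - (1 / N) *\<^sub>R \<eta>))) *
      ((\<Theta> (fst z) * cis (- 2 * pi * (fst z \<bullet> (\<xi> + \<zeta>)))) * (cgauss 1 (snd z) * cis (- 2 * pi * (snd z \<bullet> (\<xi> - (1 / N) *\<^sub>R \<eta>)))))"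
      unfolding e unfolding z fst_conv snd_conv by (simp only: mult_ac)
    finally show ?thesis .
  qed
  have "cis (pi * N * qform c0 c1 c2 \<xi>) * (LINT \<omega>|lborel. chirp_density s \<Theta> \<zeta> \<omega> * (cis (chirp_phase c0 c1 c2 \<omega> / N) * cis (- 2 * pi * (\<xi> \<bullet> chirp_shift c0 c1 c2 \<omega>))))
    = (LINT \<eta>|lborel. LINT z|lborel. cis (pi * N * qform c0 c1 c2 \<xi>) * (chirp_density s \<Theta> \<zeta> (\<eta>, z) * (cis (chirp_phase c0 c1 c2 (\<eta>, z) / N) * cis (- 2 * pi * (\<xi> \<bullet> chirp_shift c0 c1 c2 (\<eta>, z))))))"
    unfolding lborel_prod_integral[OF i0] by simp
  also have "\<dots> = (LINT \<eta>|lborel. (of_real (bessel_ker s \<eta>) * chirp c0 c1 c2 N (\<xi> - (1 / N) *\<^sub>R \<eta>)) * fourier \<Theta> (\<xi> + \<zeta>))"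
  proof (rule Bochner_Integration.integral_cong[OF refl])
    fix \<eta> :: "'a \<times> 'a"
    have g: "fourier (cgauss 1) w = cgauss 1 w" for w :: "'a \<times> 'a" using fourier_cgauss_of_real[of 1 w] by simp
    show "(LINT z|lborel. cis (pi * N * qform c0 c1 c2 \<xi>) * (chirp_density s \<Theta> \<zeta> (\<eta>, z) * (cis (chirp_phase c0 c1 c2 (\<eta>, z) / N) * cis (- 2 * pi * (\<xi> \<bullet> chirp_shift c0 c1 c2 (\<eta>, z))))))
      = (of_real (bessel_ker s \<eta>) * chirp c0 c1 c2 N (\<xi> - (1 / N) *\<^sub>R \<eta>)) * fourier \<Theta> (\<xi> + \<zeta>)"
      unfolding pt integral_mult_right_zero integrable_lborel_tensor(2)[OF i1 i2] fourier_def[symmetric] g chirp_def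
      by (simp only: mult_ac)
  qed
  also have "\<dots> = chirp_smooth s c0 c1 c2 N \<xi> * fourier \<Theta> (\<xi> + \<zeta>)"
    unfolding chirp_smooth_def by (rule integral_mult_left_zero)
  finally show ?thesis ..
qed

text \<open>The imaginary parts of the two input Gaussians cancel the \<open>c1\<close> and
  \<open>c2\<close> terms of the phase. Only the term in \<open>fst \<xi> + snd \<xi>\<close>
  survives, so for each character the integral in \<open>\<xi>\<close> is the explicit one of
  \<open>chirp_gaussian_integral\<close>.\<close>

lemma chirp_Tm_expansion:
  fixes \<Theta> :: "('a::euclidean_space) \<times> 'a \<Rightarrow> complex"
  assumes s: "0 < s" and \<Theta>: "integrable lborel \<Theta>" and N: "N > 0" and c: "c > 0"
  shows "(LINT \<xi>|lborel. cgauss (Complex c (N * c1)) (fst \<xi>) * cgauss (Complex c (N * c2)) (snd \<xi>) *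
      (chirp_smooth s c0 c1 c2 N \<xi> * fourier \<Theta> (\<xi> + \<zeta>)) * cis (2 * pi * (x \<bullet> (fst \<xi> + snd \<xi>))))
    = (LINT \<omega>|lborel. chirp_density s \<Theta> \<zeta> \<omega> * (cis (chirp_phase c0 c1 c2 \<omega> / N) *
        (fourier (cgauss (Complex (c / 2) (N * c0))) ((1/2) *\<^sub>R (fst (chirp_shift c0 c1 c2 \<omega>) + snd (chirp_shift c0 c1 c2 \<omega>)) - x)
         * fourier (cgauss (of_real (2 * c))) (snd (chirp_shift c0 c1 c2 \<omega>) - fst (chirp_shift c0 c1 c2 \<omega>)))))"
proof -
  define J where "J \<xi> w = cgauss (of_real c) (fst \<xi>) * cgauss (of_real c) (snd \<xi>) * cis (- (pi * (N * c0) * (norm (fst \<xi> + snd \<xi>))\<^sup>2))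
      * cis (- 2 * pi * (\<xi> \<bullet> w)) * cis (2 * pi * (x \<bullet> (fst \<xi> + snd \<xi>)))" for \<xi> w :: "'a \<times> 'a"
  note [measurable] = borel_measurable_fst_snd
  have [measurable]: "case_prod J \<in> borel_measurable (borel \<Otimes>\<^sub>M borel)" unfolding J_def[abs_def] by measurable
  have [measurable]: "chirp_density s \<Theta> \<zeta> \<in> borel_measurable borel" using chirp_density(1)[OF s \<Theta>] by auto
  define \<Psi> where "\<Psi> \<xi> \<omega> = chirp_density s \<Theta> \<zeta> \<omega> * (cis (chirp_phase c0 c1 c2 \<omega> / N) * J \<xi> (chirp_shift c0 c1 c2 \<omega>))" for \<xi> \<omega>
  have n\<Psi>: "norm (\<Psi> \<xi> \<omega>) = norm (cgauss (of_real c) \<xi>) * norm (chirp_density s \<Theta> \<zeta> \<omega>)" for \<xi> \<omega>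
    by (cases \<xi>) (simp add: \<Psi>_def J_def norm_mult cgauss_Pair)
  have m\<Psi>: "case_prod \<Psi> \<in> borel_measurable (borel \<Otimes>\<^sub>M borel)" unfolding \<Psi>_def[abs_def] by measurable
  have "(\<integral>\<^sup>+\<xi>. \<integral>\<^sup>+\<omega>. norm (\<Psi> \<xi> \<omega>) \<partial>lborel \<partial>lborel)
     = (\<integral>\<^sup>+\<xi>. norm (cgauss (of_real c) \<xi>) \<partial>(lborel :: ('a \<times> 'a) measure)) * (\<integral>\<^sup>+\<omega>. norm (chirp_density s \<Theta> \<zeta> \<omega>) \<partial>lborel)"
    unfolding n\<Psi> by (simp add: ennreal_mult nn_integral_cmult nn_integral_multc)
  also have "\<dots> < \<infinity>"
  proof -
    have "integrable lborel (cgauss (of_real c) :: 'a \<times> 'a \<Rightarrow> complex)" using c by (intro integrable_cgauss) simp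
    then show ?thesis using chirp_density(1)[OF s \<Theta>, of \<zeta>] by (simp add: integrable_iff_bounded ennreal_mult_less_top)
  qed
  finally have b\<Psi>: "(\<integral>\<^sup>+\<xi>. \<integral>\<^sup>+\<omega>. norm (\<Psi> \<xi> \<omega>) \<partial>lborel \<partial>lborel) < \<infinity>" .
  have "(LINT \<xi>|lborel. cgauss (Complex c (N * c1)) (fst \<xi>) * cgauss (Complex c (N * c2)) (snd \<xi>) *
      (chirp_smooth s c0 c1 c2 N \<xi> * fourier \<Theta> (\<xi> + \<zeta>)) * cis (2 * pi * (x \<bullet> (fst \<xi> + snd \<xi>)))) = (LINT \<xi>|lborel. LINT \<omega>|lborel. \<Psi> \<xi> \<omega>)"
  proof (rule Bochner_Integration.integral_cong[OF refl])
    fix \<xi> :: "'a \<times> 'a"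
    define S where "S = (LINT \<omega>|lborel. chirp_density s \<Theta> \<zeta> \<omega> * (cis (chirp_phase c0 c1 c2 \<omega> / N) * cis (- 2 * pi * (\<xi> \<bullet> chirp_shift c0 c1 c2 \<omega>))))"
    define A where "A = cgauss (of_real c) (fst \<xi>) * cgauss (of_real c) (snd \<xi>) * cis (- (pi * (N * c0) * (norm (fst \<xi> + snd \<xi>))\<^sup>2)) * cis (2 * pi * (x \<bullet> (fst \<xi> + snd \<xi>)))"
    have C: "cgauss (Complex c t) y = cgauss (of_real c) y * cis (- (pi * t * (norm y)\<^sup>2))" for t and y :: 'a
    proof -
      have "Complex c t = of_real c + \<i> * of_real t" by (simp add: complex_eq_iff)
      then show ?thesis by (simp only: cgauss_add) (simp add: cgauss_def cis_conv_exp mult_ac)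
    qed
    have "- (pi * (N * c1) * (norm (fst \<xi>))\<^sup>2) + - (pi * (N * c2) * (norm (snd \<xi>))\<^sup>2) + pi * N * qform c0 c1 c2 \<xi> = - (pi * (N * c0) * (norm (fst \<xi> + snd \<xi>))\<^sup>2)"
      by (simp add: qform_def algebra_simps)
    from arg_cong[where f=cis, OF this]
    have e: "cis (- (pi * (N * c1) * (norm (fst \<xi>))\<^sup>2)) * cis (- (pi * (N * c2) * (norm (snd \<xi>))\<^sup>2)) * cis (pi * N * qform c0 c1 c2 \<xi>) = cis (- (pi * (N * c0) * (norm (fst \<xi> + snd \<xi>))\<^sup>2))"
      by (simp only: cis_mult)
    have "cgauss (Complex c (N * c1)) (fst \<xi>) * cgauss (Complex c (N * c2)) (snd \<xi>) *
      (chirp_smooth s c0 c1 c2 N \<xi> * fourier \<Theta> (\<xi> + \<zeta>)) * cis (2 * pi * (x \<bullet> (fst \<xi> + snd \<xi>))) = A * S"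
      unfolding chirp_smooth_expansion[OF s \<Theta> N] S_def[symmetric] C A_def e[symmetric] by (simp only: mult_ac)
    also have "\<dots> = (LINT \<omega>|lborel. A * (chirp_density s \<Theta> \<zeta> \<omega> * (cis (chirp_phase c0 c1 c2 \<omega> / N) * cis (- 2 * pi * (\<xi> \<bullet> chirp_shift c0 c1 c2 \<omega>)))))"
      unfolding S_def by simp
    also have "\<dots> = (LINT \<omega>|lborel. \<Psi> \<xi> \<omega>)"
      by (intro Bochner_Integration.integral_cong refl) (simp only: \<Psi>_def J_def A_def mult_ac)
    finally show "cgauss (Complex c (N * c1)) (fst \<xi>) * cgauss (Complex c (N * c2)) (snd \<xi>) *
      (chirp_smooth s c0 c1 c2 N \<xi> * fourier \<Theta> (\<xi> + \<zeta>)) * cis (2 * pi * (x \<bullet> (fst \<xi> + snd \<xi>))) = (LINT \<omega>|lborel. \<Psi> \<xi> \<omega>)" .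
  qed
  also have "\<dots> = (LINT \<omega>|lborel. LINT \<xi>|lborel. \<Psi> \<xi> \<omega>)" by (rule fubini_lborel(1)[OF m\<Psi> b\<Psi>])
  also have "\<dots> = (LINT \<omega>|lborel. chirp_density s \<Theta> \<zeta> \<omega> * (cis (chirp_phase c0 c1 c2 \<omega> / N) * (LINT \<xi>|lborel. J \<xi> (chirp_shift c0 c1 c2 \<omega>))))"
    unfolding \<Psi>_def by simp
  finally show ?thesis unfolding J_def chirp_gaussian_integral[OF c] .
qed

section \<open>Counting powers of N on both sides of the bound\<close>

lemma nn_integral_powr_scale:
  fixes g :: "'a::euclidean_space \<Rightarrow> real"
  assumes [measurable]: "g \<in> borel_measurable borel" and g: "\<And>x. 0 \<le> g x"
    and \<kappa>: "\<kappa> > 0" and a: "a > 0" and p: "p > 0" and Q: "Q \<ge> 0"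
    and le: "(\<integral>\<^sup>+x. (\<kappa> * g ((1 / a) *\<^sub>R x)) powr p \<partial>lborel) \<le> ennreal (Q powr p)"
  shows "(\<integral>\<^sup>+z. g z powr p \<partial>lborel) \<le> ennreal ((Q * (1 / \<kappa>) * a powr (- real DIM('a) / p)) powr p)"
proof -
  have "(\<integral>\<^sup>+z. g z powr p \<partial>lborel) = ennreal (\<bar>1 / a\<bar> ^ DIM('a)) * (\<integral>\<^sup>+x. ennreal (g (0 + (1 / a) *\<^sub>R x) powr p) \<partial>lborel)"
    by (rule nn_integral_lborel_affine) (use a in simp_all)
  also have "(\<integral>\<^sup>+x. ennreal (g (0 + (1 / a) *\<^sub>R x) powr p) \<partial>lborel)
    = (\<integral>\<^sup>+x. ennreal ((1 / \<kappa>) powr p) * ennreal ((\<kappa> * g ((1 / a) *\<^sub>R x)) powr p) \<partial>lborel)"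
    by (intro nn_integral_cong) (use \<kappa> g in \<open>simp add: ennreal_mult[symmetric] powr_mult[symmetric]\<close>)
  also have "\<dots> = ennreal ((1 / \<kappa>) powr p) * (\<integral>\<^sup>+x. ennreal ((\<kappa> * g ((1 / a) *\<^sub>R x)) powr p) \<partial>lborel)"
    by (rule nn_integral_cmult) measurable
  also have "ennreal (\<bar>1 / a\<bar> ^ DIM('a)) * \<dots> \<le> ennreal (\<bar>1 / a\<bar> ^ DIM('a)) * (ennreal ((1 / \<kappa>) powr p) * ennreal (Q powr p))"
    by (intro mult_left_mono le) auto
  also have "\<dots> = ennreal (\<bar>1 / a\<bar> ^ DIM('a) * ((1 / \<kappa>) powr p * Q powr p))"
    by (simp add: ennreal_mult)
  also have "\<bar>1 / a\<bar> ^ DIM('a) = (a powr (- real DIM('a) / p)) powr p"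
  proof -
    have "(a powr (- real DIM('a) / p)) powr p = a powr (- real DIM('a))" using p by (simp add: powr_powr)
    also have "\<dots> = \<bar>1 / a\<bar> ^ DIM('a)" using a by (simp add: powr_minus powr_realpow power_inverse divide_inverse)
    finally show ?thesis ..
  qed
  also have "(a powr (- real DIM('a) / p)) powr p * ((1 / \<kappa>) powr p * Q powr p) = (Q * (1 / \<kappa>) * a powr (- real DIM('a) / p)) powr p"
    by (simp only: powr_mult mult_ac)
  finally show ?thesis .
qed

lemma powr_comparable:
  fixes X c N t \<gamma> :: real
  assumes c: "c \<ge> 0" and N: "N \<ge> 1" and X: "N powr t \<le> X" "X \<le> (c + 1) * N powr t"
  shows "X powr \<gamma> \<le> (c + 1) powr \<bar>\<gamma>\<bar> * N powr (t * \<gamma>)"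
proof (cases "\<gamma> \<ge> 0")
  case True
  have "X powr \<gamma> \<le> ((c + 1) * N powr t) powr \<gamma>" using X N True by (intro powr_mono2) (auto intro: order_trans[rotated])
  then show ?thesis using True c by (simp add: powr_mult powr_powr)
next
  case False
  have "X powr \<gamma> \<le> (N powr t) powr \<gamma>" using X N False by (intro powr_mono2') auto
  also have "\<dots> = 1 * N powr (t * \<gamma>)" by (simp add: powr_powr)
  also have "\<dots> \<le> (c + 1) powr \<bar>\<gamma>\<bar> * N powr (t * \<gamma>)"
    using c by (intro mult_right_mono ge_one_powr_ge_zero) auto
  finally show ?thesis .
qed

lemma norm_Complex_comparable:
  fixes c b N t :: real
  assumes b: "1 \<le> b" "b \<le> c" and N: "N \<ge> 1" and t: "t = 0 \<or> t = 1"
  shows "N powr t \<le> norm (Complex b (N * t))" "norm (Complex b (N * t)) \<le> (c + 1) * N powr t"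
proof -
  have "N \<le> norm (Complex b N)" "b \<le> norm (Complex b 0)"
    using abs_Im_le_cmod[of "Complex b N"] abs_Re_le_cmod[of "Complex b 0"] by auto
  then show "N powr t \<le> norm (Complex b (N * t))" using t b N by auto
  have "norm (Complex b (N * t)) \<le> \<bar>b\<bar> + \<bar>N * t\<bar>" using cmod_le[of "Complex b (N * t)"] by simp
  also have "\<dots> \<le> (c + 1) * N powr t"
  proof (cases "t = 0")
    case True then show ?thesis using b N by simp
  next
    case False
    have "b * 1 \<le> c * N" using b N by (intro mult_mono) auto
    then show ?thesis using False t b N by (simp add: algebra_simps)
  qed
  finally show "norm (Complex b (N * t)) \<le> (c + 1) * N powr t" .
qed

text \<open>Recentring the frequency variable at \<open>\<zeta>\<close> gives a unimodular factor,
  which the norm removes. The prefactor collects four normalisations of Gaussian transforms: those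
  of the two inputs, and those of the sum and difference variables of the output.\<close>

lemma Tm_chirp_smooth:
  fixes \<Theta> :: "(real^'n) \<times> (real^'n) \<Rightarrow> complex" and \<zeta> :: "(real^'n) \<times> (real^'n)"
    and c c0 c1 c2 N s :: real and z :: "real^'n"
  assumes s: "0 < s" and \<Theta>: "integrable lborel \<Theta>" and N: "N > 0" and c: "c > 0"
  defines "m \<equiv> \<lambda>\<xi>. chirp_smooth s c0 c1 c2 N (\<xi> - \<zeta>) * fourier \<Theta> \<xi>"
  defines "d \<equiv> real CARD('n)"
  shows "norm (Tm m (gmod (fst \<zeta>) (1 / Complex c (N * c1))) (gmod (snd \<zeta>) (1 / Complex c (N * c2))) (((1 - c0) + c0 * N) *\<^sub>R z))
    = (norm (Complex c (N * c1)) powr (d / 2) * norm (Complex c (N * c2)) powr (d / 2)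
       * norm (Complex (c / 2) (N * c0)) powr (- d / 2) * (2 * c) powr (- d / 2)) *
      norm (chirp_amplitude (chirp_density s \<Theta> \<zeta>) (chirp_phase c0 c1 c2)
        (\<lambda>\<omega>. (1/2) *\<^sub>R (fst (chirp_shift c0 c1 c2 \<omega>) + snd (chirp_shift c0 c1 c2 \<omega>)))
        (\<lambda>\<omega>. snd (chirp_shift c0 c1 c2 \<omega>) - fst (chirp_shift c0 c1 c2 \<omega>)) c c0 N z)"
proof -
  define x where "x = ((1 - c0) + c0 * N) *\<^sub>R z"
  define \<alpha>1 where "\<alpha>1 = Complex c (N * c1)"
  define \<alpha>2 where "\<alpha>2 = Complex c (N * c2)"
  define \<alpha> where "\<alpha> = Complex (c / 2) (N * c0)"
  define w where "w = (chirp_shift c0 c1 c2 :: ((real^'n) \<times> (real^'n)) \<times> (((real^'n) \<times> (real^'n)) \<times> ((real^'n) \<times> (real^'n))) \<Rightarrow> (real^'n) \<times> (real^'n))"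
  have nz: "\<alpha>1 \<noteq> 0" "\<alpha>2 \<noteq> 0" using c by (simp_all add: \<alpha>1_def \<alpha>2_def complex_eq_iff)
  have Re: "Re (1 / \<alpha>1) > 0" "Re (1 / \<alpha>2) > 0" "Re \<alpha> > 0"
    using c by (simp_all add: \<alpha>1_def \<alpha>2_def \<alpha>_def Re_divide add_pos_nonneg)
  define I where "I = (LINT \<xi>|lborel. cgauss \<alpha>1 (fst \<xi>) * cgauss \<alpha>2 (snd \<xi>) * (chirp_smooth s c0 c1 c2 N \<xi> * fourier \<Theta> (\<xi> + \<zeta>)) * cis (2 * pi * (x \<bullet> (fst \<xi> + snd \<xi>))))"
  define L where "L = (LINT \<xi>|lborel. cgauss (1 / (1 / \<alpha>1)) (fst \<xi> - fst \<zeta>) * cgauss (1 / (1 / \<alpha>2)) (snd \<xi> - snd \<zeta>) * m \<xi> * cis (2 * pi * (x \<bullet> (fst \<xi> + snd \<xi>))))"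
  have L: "L = cis (2 * pi * (x \<bullet> (fst \<zeta> + snd \<zeta>))) * I"
  proof -
    have "L = (LINT \<xi>|lborel. cgauss (1 / (1 / \<alpha>1)) (fst (\<xi> + \<zeta>) - fst \<zeta>) * cgauss (1 / (1 / \<alpha>2)) (snd (\<xi> + \<zeta>) - snd \<zeta>) * m (\<xi> + \<zeta>) * cis (2 * pi * (x \<bullet> (fst (\<xi> + \<zeta>) + snd (\<xi> + \<zeta>)))))"
      unfolding L_def by (rule integral_lborel_translate(1)[symmetric])
    also have "\<dots> = (LINT \<xi>|lborel. cis (2 * pi * (x \<bullet> (fst \<zeta> + snd \<zeta>))) * (cgauss \<alpha>1 (fst \<xi>) * cgauss \<alpha>2 (snd \<xi>) * (chirp_smooth s c0 c1 c2 N \<xi> * fourier \<Theta> (\<xi> + \<zeta>)) * cis (2 * pi * (x \<bullet> (fst \<xi> + snd \<xi>)))))"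
    proof (intro Bochner_Integration.integral_cong refl)
      fix \<xi> :: "(real^'n) \<times> (real^'n)"
      have e: "cis (2 * pi * (x \<bullet> (fst (\<xi> + \<zeta>) + snd (\<xi> + \<zeta>)))) = cis (2 * pi * (x \<bullet> (fst \<zeta> + snd \<zeta>))) * cis (2 * pi * (x \<bullet> (fst \<xi> + snd \<xi>)))"
        unfolding cis_mult by (simp add: inner_add_right algebra_simps)
      have f: "fst (\<xi> + \<zeta>) - fst \<zeta> = fst \<xi>" "snd (\<xi> + \<zeta>) - snd \<zeta> = snd \<xi>" "\<xi> + \<zeta> - \<zeta> = \<xi>" "1 / (1 / \<alpha>1) = \<alpha>1" "1 / (1 / \<alpha>2) = \<alpha>2" by simp_all
      show "cgauss (1 / (1 / \<alpha>1)) (fst (\<xi> + \<zeta>) - fst \<zeta>) * cgauss (1 / (1 / \<alpha>2)) (snd (\<xi> + \<zeta>) - snd \<zeta>) * m (\<xi> + \<zeta>) * cis (2 * pi * (x \<bullet> (fst (\<xi> + \<zeta>) + snd (\<xi> + \<zeta>))))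
        = cis (2 * pi * (x \<bullet> (fst \<zeta> + snd \<zeta>))) * (cgauss \<alpha>1 (fst \<xi>) * cgauss \<alpha>2 (snd \<xi>) * (chirp_smooth s c0 c1 c2 N \<xi> * fourier \<Theta> (\<xi> + \<zeta>)) * cis (2 * pi * (x \<bullet> (fst \<xi> + snd \<xi>))))"
        unfolding e f m_def by (simp only: mult_ac)
    qed
    also have "\<dots> = cis (2 * pi * (x \<bullet> (fst \<zeta> + snd \<zeta>))) * I" unfolding I_def by (rule integral_mult_right_zero)
    finally show ?thesis .
  qed
  define A where "A = chirp_amplitude (chirp_density s \<Theta> \<zeta>) (chirp_phase c0 c1 c2)
        (\<lambda>\<omega>. (1/2) *\<^sub>R (fst (w \<omega>) + snd (w \<omega>))) (\<lambda>\<omega>. snd (w \<omega>) - fst (w \<omega>)) c c0 N z"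
  have I: "I = (\<alpha> powr of_real (- d / 2) * of_real ((2 * c) powr (- d / 2))) * A"
  proof -
    have "I = (LINT \<omega>|lborel. chirp_density s \<Theta> \<zeta> \<omega> * (cis (chirp_phase c0 c1 c2 \<omega> / N) *
        (fourier (cgauss \<alpha>) ((1/2) *\<^sub>R (fst (w \<omega>) + snd (w \<omega>)) - x) * fourier (cgauss (of_real (2 * c))) (snd (w \<omega>) - fst (w \<omega>)))))"
      unfolding I_def \<alpha>1_def \<alpha>2_def \<alpha>_def w_def by (rule chirp_Tm_expansion[OF s \<Theta> N c])
    also have "\<dots> = (LINT \<omega>|lborel. (\<alpha> powr of_real (- d / 2) * of_real ((2 * c) powr (- d / 2))) * (chirp_density s \<Theta> \<zeta> \<omega> * (cis (chirp_phase c0 c1 c2 \<omega> / N) *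
        (cgauss (1 / \<alpha>) ((1/2) *\<^sub>R (fst (w \<omega>) + snd (w \<omega>)) - x) * cgauss (of_real (1 / (2 * c))) (snd (w \<omega>) - fst (w \<omega>))))))"
    proof -
      have f1: "fourier (cgauss \<alpha>) y = \<alpha> powr of_real (- d / 2) * cgauss (1 / \<alpha>) y" for y :: "real^'n"
        using fourier_cgauss[OF Re(3), of y] by (simp add: d_def)
      have f2: "fourier (cgauss (of_real (2 * c))) y = of_real ((2 * c) powr (- d / 2)) * cgauss (of_real (1 / (2 * c))) y" for y :: "real^'n"
        using fourier_cgauss_of_real[of "2 * c" y] c by (simp add: d_def)
      show ?thesis unfolding f1 f2 by (simp only: mult_ac)
    qed
    also have "\<dots> = (\<alpha> powr of_real (- d / 2) * of_real ((2 * c) powr (- d / 2))) * A"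
      unfolding A_def chirp_amplitude_def \<alpha>_def[symmetric] x_def[symmetric] by (rule integral_mult_right_zero)
    finally show ?thesis .
  qed
  have inv: "norm ((1 / b) powr of_real (- d / 2)) = norm b powr (d / 2)" for b :: complex
  proof -
    have e: "- d / 2 = - (d / 2)" by simp
    show ?thesis unfolding norm_powr_of_real norm_divide norm_one powr_divide e powr_minus by simp
  qed
  have "norm (Tm m (gmod (fst \<zeta>) (1 / \<alpha>1)) (gmod (snd \<zeta>) (1 / \<alpha>2)) x)
     = norm ((1 / \<alpha>1) powr of_real (- d / 2)) * norm ((1 / \<alpha>2) powr of_real (- d / 2)) * norm L"
    unfolding Tm_gmod_eq[OF Re(1,2)] L_def d_def by (simp only: norm_mult)
  also have "norm L = norm \<alpha> powr (- d / 2) * (2 * c) powr (- d / 2) * norm A"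
    unfolding L I norm_mult norm_cis norm_powr_of_real by simp
  finally show ?thesis unfolding inv x_def A_def w_def \<alpha>1_def \<alpha>2_def \<alpha>_def by (simp only: mult_ac)
qed

text \<open>For \<open>c1 = 1\<close> the real part of \<open>1 / Complex c N\<close> is of order
  \<open>N powr (- 2)\<close>, so the first input is spread over \<open>|x| \<le> N\<close> and its
  norm has order \<open>N powr (d / p1)\<close>, against the amplitude \<open>N powr (d / 2)\<close>
  of its transform; likewise for the second input. Setting \<open>ci = 0\<close> removes the
  corresponding term, which gives all eight combinations at once.\<close>

theorem Hoermander_bound_imp_s_ge:
  fixes \<Theta> :: "(real^'n) \<times> (real^'n) \<Rightarrow> complex"
  assumes Theta: "schwartz \<Theta>"
    and supp: "\<And>\<xi>. fourier \<Theta> \<xi> \<noteq> 0 \<Longrightarrow> 1/2 \<le> norm \<xi> \<and> norm \<xi> \<le> 2"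
    and p: "p > 0" "p1 > 0" "p2 > 0" and u: "1 < u" and s: "0 < s"
    and bound: "Hoermander_bound \<Theta> u s p p1 p2"
    and c012: "c0 = 0 \<or> c0 = 1" "c1 = 0 \<or> c1 = 1" "c2 = 0 \<or> c2 = 1"
  shows "c0 * (1 / p - 1/2) + c1 * (1/2 - 1 / p1) + c2 * (1/2 - 1 / p2) \<le> s / real CARD('n)"
proof -
  define d where "d = real CARD('n)"
  have d: "d > 0" by (simp add: d_def)
  have \<Theta>: "integrable lborel \<Theta>" by (rule integrable_schwartz[OF Theta])
  have u0: "u > 0" using u by simp
  obtain \<zeta> where \<zeta>: "fourier \<Theta> \<zeta> \<noteq> 0" by (rule fourier_Theta_nonzero[OF p u0 bound])
  obtain C where C: "C > 0" and TC: "\<And>F G B f1 f2 K1 K2. bessel_rep s F G \<Longrightarrow> 0 < B \<Longrightarrow>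
       (\<integral>\<^sup>+\<xi>. norm (G \<xi>) powr u \<partial>lborel) \<le> ennreal (B powr u) \<Longrightarrow> bounded (range F) \<Longrightarrow>
       schwartz f1 \<Longrightarrow> schwartz f2 \<Longrightarrow> Lp_norm p1 f1 \<le> ennreal K1 \<Longrightarrow> Lp_norm p2 f2 \<le> ennreal K2 \<Longrightarrow>
       0 \<le> K1 \<Longrightarrow> 0 \<le> K2 \<Longrightarrow>
       (\<integral>\<^sup>+x. norm (Tm (\<lambda>\<xi>. F \<xi> * fourier \<Theta> \<xi>) f1 f2 x) powr p \<partial>lborel) \<le> ennreal ((C * B * K1 * K2) powr p)"
    by (rule Tm_localized_bound[OF Theta supp s u p(1) bound]) (assumption, rule that)
  obtain C' where C': "C' > 0" and rep: "\<And>c0 c1 c2 N. N \<ge> 1 \<Longrightarrow> \<exists>G. bessel_rep s (chirp_smooth s c0 c1 c2 N :: (real^'n) \<times> (real^'n) \<Rightarrow> complex) G \<and>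
       (\<integral>\<^sup>+\<xi>. norm (G \<xi>) powr u \<partial>lborel) \<le> ennreal ((C' * N powr s) powr u)"
    by (rule chirp_smooth_bessel_rep[OF s u, where 'a="real^'n"]) (rule that)
  define \<rho> where "\<rho> = chirp_density s \<Theta> \<zeta>"
  define \<theta> where "\<theta> = (chirp_phase c0 c1 c2 :: ((real^'n) \<times> (real^'n)) \<times> (((real^'n) \<times> (real^'n)) \<times> ((real^'n) \<times> (real^'n))) \<Rightarrow> real)"
  define W where "W \<omega> = (1/2) *\<^sub>R (fst (chirp_shift c0 c1 c2 \<omega>) + snd (chirp_shift c0 c1 c2 \<omega>) :: real^'n)" for \<omega>
  define V where "V \<omega> = snd (chirp_shift c0 c1 c2 \<omega>) - fst (chirp_shift c0 c1 c2 \<omega>)" for \<omega> :: "((real^'n) \<times> (real^'n)) \<times> (((real^'n) \<times> (real^'n)) \<times> ((real^'n) \<times> (real^'n)))"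
  have \<rho>: "integrable lborel \<rho>" unfolding \<rho>_def by (rule chirp_density(1)[OF s \<Theta>])
  have \<rho>nz: "(LINT \<omega>|lborel. \<rho> \<omega>) \<noteq> 0" unfolding \<rho>_def chirp_density(2)[OF s \<Theta>] by (rule \<zeta>)
  note [measurable] = borel_measurable_fst_snd
  have [measurable]: "\<rho> \<in> borel_measurable borel" using \<rho> by auto
  have \<theta>: "\<theta> \<in> borel_measurable borel" unfolding \<theta>_def by measurable
  have W: "W \<in> borel_measurable borel" unfolding W_def[abs_def] by measurable
  have V: "V \<in> borel_measurable borel" unfolding V_def[abs_def] by measurable
  note [measurable] = \<theta> W V
  \<comment> \<open>The width \<open>c\<close> is fixed before \<open>N\<close> and ensures that the
    limit profile \<open>h\<close> does not vanish at 0.\<close>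
  obtain c where c: "c \<ge> 2" and nz: "(LINT \<omega>|lborel. \<rho> \<omega> * (cgauss (of_real (if c0 = 0 then 2 / c else 0)) (W \<omega>) * cgauss (of_real (1 / (2 * c))) (V \<omega>))) \<noteq> 0"
    by (rule chirp_amplitude_limit_nonzero[OF \<rho> W V \<rho>nz])
  have c0: "c > 0" using c by simp
  define T where "T N z = norm (chirp_amplitude \<rho> \<theta> W V c c0 N z)" for N z
  have T0: "0 \<le> T N z" for N z by (simp add: T_def)
  have Tm[measurable]: "T N \<in> borel_measurable borel" for N
    unfolding T_def[abs_def] chirp_amplitude_def by measurable
  obtain h where h: "\<And>z. (\<lambda>n. T (real n) z) \<longlonglongrightarrow> h z" "isCont h 0" and h0: "h 0 = norm (LINT \<omega>|lborel. \<rho> \<omega> * (cgauss (of_real (if c0 = 0 then 2 / c else 0)) (W \<omega>) * cgauss (of_real (1 / (2 * c))) (V \<omega>)))"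
    by (rule chirp_amplitude_limit[OF \<rho> \<theta> W V c0 c012(1), folded T_def]) (rule that)
  have "h 0 > 0" using nz by (simp add: h0)
  then obtain \<delta> where \<delta>: "\<delta> > 0" "ennreal \<delta> \<le> (\<integral>\<^sup>+x. h x powr p \<partial>lborel)"
    by (rule nn_integral_powr_pos[OF h(2) _ p(1)])
  define \<gamma>1 where "\<gamma>1 = d / p1 - d / 2"
  define \<gamma>2 where "\<gamma>2 = d / p2 - d / 2"
  \<comment> \<open>The net power of \<open>N\<close> in the upper bound: \<open>s\<close> from the
    multiplier, \<open>\<gamma>1\<close> and \<open>\<gamma>2\<close> from chirped inputs, and
    \<open>d / 2 - d / p\<close> from an output spread over radius \<open>N\<close>. The claim
    amounts to \<open>e \<ge> 0\<close>.\<close>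
  define e where "e = s + c0 * (d / 2 - d / p) + c1 * \<gamma>1 + c2 * \<gamma>2"
  define k1 where "k1 = (p1 * c) powr (- d / (2 * p1))"
  define k2 where "k2 = (p2 * c) powr (- d / (2 * p2))"
  define D where "D = C * C' * k1 * k2 * (2 * c) powr (d / 2) * ((c + 1) powr \<bar>\<gamma>1\<bar> * (c + 1) powr \<bar>\<gamma>2\<bar> * (c + 1) powr \<bar>d / 2\<bar>)"
  have kpos: "k1 > 0" "k2 > 0" using p c by (auto simp: k1_def k2_def)
  have upper: "(\<integral>\<^sup>+z. T N z powr p \<partial>lborel) \<le> ennreal ((D * N powr e) powr p)" if N: "N \<ge> 1" for N
  proof -
    define n1 where "n1 = norm (Complex c (N * c1))"
    define n2 where "n2 = norm (Complex c (N * c2))"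
    define n0 where "n0 = norm (Complex (c / 2) (N * c0))"
    define a where "a = (1 - c0) + c0 * N"
    have a: "a = N powr c0" "a > 0" using c012(1) N by (auto simp: a_def)
    have n1: "N powr c1 \<le> n1" "n1 \<le> (c + 1) * N powr c1"
      unfolding n1_def using c N by (auto intro!: norm_Complex_comparable c012)
    have n2: "N powr c2 \<le> n2" "n2 \<le> (c + 1) * N powr c2"
      unfolding n2_def using c N by (auto intro!: norm_Complex_comparable c012)
    have n0: "N powr c0 \<le> n0" "n0 \<le> (c + 1) * N powr c0"
      unfolding n0_def using c N by (auto intro!: norm_Complex_comparable c012)
    have N0: "N powr t > 0" for t using N by simp
    have npos: "n1 > 0" "n2 > 0" "n0 > 0" using n1(1) n2(1) n0(1) N0 less_le_trans by blast+
    obtain G where G: "bessel_rep s (chirp_smooth s c0 c1 c2 N :: (real^'n) \<times> (real^'n) \<Rightarrow> complex) G"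
       "(\<integral>\<^sup>+\<xi>. norm (G \<xi>) powr u \<partial>lborel) \<le> ennreal ((C' * N powr s) powr u)" using rep[OF N] by blast
    have Gm: "G \<in> borel_measurable borel" using G(1) by (auto simp: bessel_rep_def)
    have G2: "(\<integral>\<^sup>+\<xi>. norm (G (\<xi> - \<zeta>)) powr u \<partial>lborel) \<le> ennreal ((C' * N powr s) powr u)"
      using nn_integral_lborel_translate(2)[of "\<lambda>\<xi>. ennreal (norm (G \<xi>) powr u)" \<zeta>] Gm G(2) by simp
    define f1 where "f1 = (gmod (fst \<zeta>) (1 / Complex c (N * c1)) :: real^'n \<Rightarrow> complex)"
    define f2 where "f2 = (gmod (snd \<zeta>) (1 / Complex c (N * c2)) :: real^'n \<Rightarrow> complex)"
    have Re: "Re (1 / Complex c t) = c / (norm (Complex c t))\<^sup>2" for t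
      unfolding cmod_power2 by (simp add: Re_divide)
    have Re0: "Re (1 / Complex c t) > 0" for t
      unfolding Re using c by (simp add: complex_eq_iff)
    have K: "(q * Re (1 / Complex c t)) powr (- d / (2 * q)) = (q * c) powr (- d / (2 * q)) * norm (Complex c t) powr (d / q)" if q: "q > 0" for q t
    proof -
      define m where "m = norm (Complex c t)"
      have m: "m > 0" unfolding m_def using c by (simp add: complex_eq_iff)
      have "q * Re (1 / Complex c t) = (q * c) * m powr (- 2)"
        unfolding Re m_def[symmetric] using m by (simp add: powr_minus powr_numeral divide_inverse)
      then have "(q * Re (1 / Complex c t)) powr (- d / (2 * q)) = (q * c) powr (- d / (2 * q)) * (m powr (- 2)) powr (- d / (2 * q))"
        by (simp only: powr_mult)
      also have "(m powr (- 2)) powr (- d / (2 * q)) = m powr (d / q)" by (simp add: powr_powr)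
      finally show ?thesis by (simp only: m_def)
    qed
    have L1: "Lp_norm p1 f1 \<le> ennreal (k1 * n1 powr (d / p1))"
      using Lp_norm_gmod[OF Re0[of "N * c1"] p(2), of "fst \<zeta>"] unfolding f1_def k1_def n1_def K[OF p(2), symmetric] by (simp add: d_def)
    have L2: "Lp_norm p2 f2 \<le> ennreal (k2 * n2 powr (d / p2))"
      using Lp_norm_gmod[OF Re0[of "N * c2"] p(3), of "snd \<zeta>"] unfolding f2_def k2_def n2_def K[OF p(3), symmetric] by (simp add: d_def)
    define Q where "Q = C * (C' * N powr s) * (k1 * n1 powr (d / p1)) * (k2 * n2 powr (d / p2))"
    have Q: "Q \<ge> 0" using C C' kpos by (simp add: Q_def)
    define \<kappa> where "\<kappa> = n1 powr (d / 2) * n2 powr (d / 2) * n0 powr (- d / 2) * (2 * c) powr (- d / 2)"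
    have \<kappa>: "\<kappa> > 0" using npos c by (simp add: \<kappa>_def)
    have B: "C' * N powr s > 0" using C' N by simp
    have "(\<integral>\<^sup>+x. norm (Tm (\<lambda>\<xi>. chirp_smooth s c0 c1 c2 N (\<xi> - \<zeta>) * fourier \<Theta> \<xi>) f1 f2 x) powr p \<partial>lborel) \<le> ennreal (Q powr p)"
      unfolding Q_def
    proof (rule TC[OF bessel_rep_translate[OF G(1)] B G2 _ _ _ L1 L2])
      show "bounded (range (\<lambda>\<xi>. chirp_smooth s c0 c1 c2 N (\<xi> - \<zeta>)))"
        by (rule boundedI[of _ 1]) (use norm_chirp_smooth_le[OF s] in blast)
      show "schwartz f1" "schwartz f2" unfolding f1_def f2_def by (intro schwartz_gmod Re0)+
    qed (use kpos in simp_all)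
    moreover have "norm (Tm (\<lambda>\<xi>. chirp_smooth s c0 c1 c2 N (\<xi> - \<zeta>) * fourier \<Theta> \<xi>) f1 f2 x) = \<kappa> * T N ((1 / a) *\<^sub>R x)" for x
    proof -
      have "a *\<^sub>R ((1 / a) *\<^sub>R x) = x" using a(2) by simp
      then show ?thesis
        using Tm_chirp_smooth[OF s \<Theta> _ c0, of N c0 c1 c2 \<zeta> "(1 / a) *\<^sub>R x"] N
        unfolding a_def[symmetric] f1_def[symmetric] f2_def[symmetric] n1_def[symmetric] n2_def[symmetric] n0_def[symmetric]
          d_def[symmetric] \<kappa>_def[symmetric] \<rho>_def[symmetric] \<theta>_def[symmetric] T_def W_def V_def by simp
    qed
    ultimately have "(\<integral>\<^sup>+x. (\<kappa> * T N ((1 / a) *\<^sub>R x)) powr p \<partial>lborel) \<le> ennreal (Q powr p)" by simp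
    then have "(\<integral>\<^sup>+z. T N z powr p \<partial>lborel) \<le> ennreal ((Q * (1 / \<kappa>) * a powr (- real DIM(real^'n) / p)) powr p)"
      by (rule nn_integral_powr_scale[OF Tm T0 \<kappa> a(2) p(1) Q])
    also have "\<dots> \<le> ennreal ((D * N powr e) powr p)"
    proof (intro ennreal_leI powr_mono2)
      have inv: "1 / n1 powr (d / 2) = n1 powr (- d / 2)" "1 / n2 powr (d / 2) = n2 powr (- d / 2)"
        "1 / n0 powr (- d / 2) = n0 powr (d / 2)" "1 / (2 * c) powr (- d / 2) = (2 * c) powr (d / 2)"
        by (simp_all add: powr_minus_divide[symmetric])
      have "1 / \<kappa> = (1 / n1 powr (d / 2)) * (1 / n2 powr (d / 2)) * (1 / n0 powr (- d / 2)) * (1 / (2 * c) powr (- d / 2))"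
        unfolding \<kappa>_def by simp
      then have k: "1 / \<kappa> = n1 powr (- d / 2) * n2 powr (- d / 2) * n0 powr (d / 2) * (2 * c) powr (d / 2)" by (simp only: inv)
      have g: "n1 powr \<gamma>1 = n1 powr (d / p1) * n1 powr (- d / 2)" "n2 powr \<gamma>2 = n2 powr (d / p2) * n2 powr (- d / 2)"
        by (simp_all add: powr_add[symmetric] \<gamma>1_def \<gamma>2_def)
      have "Q * (1 / \<kappa>) * a powr (- real DIM(real^'n) / p)
         = (C * C' * k1 * k2 * (2 * c) powr (d / 2) * N powr s * a powr (- d / p)) * (n1 powr \<gamma>1 * n2 powr \<gamma>2 * n0 powr (d / 2))"
        unfolding Q_def k g by (simp add: d_def mult_ac)
      also have "\<dots> \<le> (C * C' * k1 * k2 * (2 * c) powr (d / 2) * N powr s * a powr (- d / p)) *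
         ((c + 1) powr \<bar>\<gamma>1\<bar> * N powr (c1 * \<gamma>1) * ((c + 1) powr \<bar>\<gamma>2\<bar> * N powr (c2 * \<gamma>2)) * ((c + 1) powr \<bar>d / 2\<bar> * N powr (c0 * (d / 2))))"
        using powr_comparable[OF _ N n1, of \<gamma>1] powr_comparable[OF _ N n2, of \<gamma>2] powr_comparable[OF _ N n0, of "d / 2"] c C C' kpos
        by (intro mult_left_mono mult_mono) auto
      also have "\<dots> = D * (N powr s * N powr (- c0 * d / p) * N powr (c1 * \<gamma>1) * N powr (c2 * \<gamma>2) * N powr (c0 * (d / 2)))"
        unfolding D_def a(1) powr_powr by (simp add: mult_ac)
      also have "N powr s * N powr (- c0 * d / p) * N powr (c1 * \<gamma>1) * N powr (c2 * \<gamma>2) * N powr (c0 * (d / 2)) = N powr e"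
        unfolding powr_add[symmetric] e_def by (simp add: algebra_simps)
      finally show "Q * (1 / \<kappa>) * a powr (- real DIM(real^'n) / p) \<le> D * N powr e" .
    qed (use p Q \<kappa> in auto)
    finally show ?thesis .
  qed
  have D: "D > 0" using C C' kpos c by (simp add: D_def)
  \<comment> \<open>A negative \<open>e\<close> would send the upper bounds to 0, whereas the
    integral of \<open>h x powr p\<close> is at least \<open>\<delta>\<close>. Fatou is applied to
    the tail starting at \<open>M\<close>, all of whose members obey the bound for \<open>M\<close>
    because \<open>e < 0\<close>.\<close>
  have "e \<ge> 0"
  proof (rule ccontr)
    assume "\<not> e \<ge> 0"
    then have e: "e < 0" by simp
    have "0 \<le> e * p"
    proof (rule growth_exponent_le[OF \<delta>(1), of 1 0 "D powr p" "e * p"])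
      fix M :: nat assume M: "M \<ge> 1"
      have "(\<integral>\<^sup>+x. h x powr p \<partial>lborel) \<le> ennreal ((D * real M powr e) powr p)"
      proof (rule fatou_powr[OF p(1), of "\<lambda>n. T (real (n + M))"])
        show "(\<lambda>n. T (real (n + M)) x) \<longlonglongrightarrow> h x" for x by (rule LIMSEQ_ignore_initial_segment[OF h(1)])
        show "(\<integral>\<^sup>+x. T (real (n + M)) x powr p \<partial>lborel) \<le> ennreal ((D * real M powr e) powr p)" for n
        proof -
          have "real (n + M) powr e \<le> real M powr e" using e M by (intro powr_mono2') auto
          then have "D * real (n + M) powr e \<le> D * real M powr e" using D by (intro mult_left_mono) auto
          then have le: "(D * real (n + M) powr e) powr p \<le> (D * real M powr e) powr p"
            using D p(1) by (intro powr_mono2) auto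
          have "real (n + M) \<ge> 1" using M by simp
          from order_trans[OF upper[OF this] ennreal_leI[OF le]] show ?thesis .
        qed
      qed (auto simp: T0)
      with \<delta>(2) have "ennreal \<delta> \<le> ennreal ((D * real M powr e) powr p)" by (rule order_trans)
      then have "\<delta> \<le> (D * real M powr e) powr p" by simp
      then show "\<delta> * real M powr 0 \<le> D powr p * real M powr (e * p)" using M D by (simp add: powr_mult powr_powr)
    qed
    then show False using e p mult_neg_pos[of e p] by simp
  qed
  then have "d * (c0 * (1 / p - 1/2) + c1 * (1/2 - 1 / p1) + c2 * (1/2 - 1 / p2)) \<le> s"
    by (simp add: e_def \<gamma>1_def \<gamma>2_def algebra_simps)
  then show ?thesis using d by (simp add: d_def[symmetric] field_simps)
qed

section \<open>The condition \<open>s / n > 1 / p - 1 / u'\<close>\<close>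

lemma nn_integral_lborel_shear:
  fixes A B :: "'a::euclidean_space \<Rightarrow> ennreal"
  assumes [measurable]: "A \<in> borel_measurable borel" "B \<in> borel_measurable borel"
  shows "(\<integral>\<^sup>+\<xi>. A (fst \<xi> + snd \<xi>) * B (snd \<xi>) \<partial>lborel) = (\<integral>\<^sup>+x. A x \<partial>lborel) * (\<integral>\<^sup>+y. B y \<partial>lborel)"
proof -
  note [measurable] = borel_measurable_fst_snd
  have "(\<integral>\<^sup>+\<xi>. A (fst \<xi> + snd \<xi>) * B (snd \<xi>) \<partial>lborel) = (\<integral>\<^sup>+x. \<integral>\<^sup>+y. A (x + y) * B y \<partial>lborel \<partial>lborel)"
    by (subst nn_integral_lborel_fst) simp_all
  also have "\<dots> = (\<integral>\<^sup>+y. \<integral>\<^sup>+x. A (x + y) * B y \<partial>lborel \<partial>lborel)"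
    by (rule nn_integral_lborel_swap) measurable
  also have "\<dots> = (\<integral>\<^sup>+y. (\<integral>\<^sup>+x. A x \<partial>lborel) * B y \<partial>lborel)"
    by (intro nn_integral_cong) (simp add: nn_integral_multc nn_integral_lborel_translate(1)[of A])
  also have "\<dots> = (\<integral>\<^sup>+x. A x \<partial>lborel) * (\<integral>\<^sup>+y. B y \<partial>lborel)" by (simp add: nn_integral_cmult)
  finally show ?thesis .
qed

text \<open>The measure-preserving change to the variables \<open>fst \<xi> + snd \<xi>\<close> and
  \<open>snd \<xi>\<close> has the dual variables \<open>fst x\<close> and
  \<open>snd x - fst x\<close>. On the diagonal the second one vanishes, so there only the transform
  of \<open>P\<close> produces decay.\<close>

lemma
  fixes P Q :: "'a::euclidean_space \<Rightarrow> complex"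
  assumes P: "integrable lborel P" and Q: "integrable lborel Q"
  shows integrable_shear: "integrable lborel (\<lambda>\<xi>. P (fst \<xi> + snd \<xi>) * Q (snd \<xi>))"
    and fourier_shear: "fourier (\<lambda>\<xi>. P (fst \<xi> + snd \<xi>) * Q (snd \<xi>)) x = fourier P (fst x) * fourier Q (snd x - fst x)"
proof -
  note [measurable] = borel_measurable_fst_snd
  have [measurable]: "P \<in> borel_measurable borel" "Q \<in> borel_measurable borel" using P Q by auto
  define h where "h \<xi> = P (fst \<xi> + snd \<xi>) * Q (snd \<xi>)" for \<xi>
  have [measurable]: "h \<in> borel_measurable borel" unfolding h_def[abs_def] by measurable
  have "(\<integral>\<^sup>+\<xi>. norm (h \<xi>) \<partial>lborel) = (\<integral>\<^sup>+x. norm (P x) \<partial>lborel) * (\<integral>\<^sup>+y. norm (Q y) \<partial>lborel)"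
    unfolding h_def norm_mult ennreal_mult[OF norm_ge_zero norm_ge_zero]
    by (rule nn_integral_lborel_shear) measurable
  also have "\<dots> < \<infinity>" using P Q by (simp add: integrable_iff_bounded ennreal_mult_less_top)
  finally have h: "integrable lborel h" by (intro integrableI_bounded) auto
  then show "integrable lborel (\<lambda>\<xi>. P (fst \<xi> + snd \<xi>) * Q (snd \<xi>))" by (simp add: h_def[abs_def])
  define k where "k y z = h (y, z) * cis (- 2 * pi * ((y, z) \<bullet> x))" for y z
  have i: "integrable lborel (\<lambda>\<xi>. h \<xi> * cis (- 2 * pi * (\<xi> \<bullet> x)))" by (rule integrable_cis_mult[OF h]) measurable
  have m: "case_prod k \<in> borel_measurable (borel \<Otimes>\<^sub>M borel)" unfolding k_def[abs_def] by measurable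
  have "(\<integral>\<^sup>+y. \<integral>\<^sup>+z. norm (k y z) \<partial>lborel \<partial>lborel) = (\<integral>\<^sup>+\<xi>. norm (h \<xi>) \<partial>lborel)"
    unfolding k_def norm_mult norm_cis by (subst nn_integral_lborel_fst) simp_all
  also have "\<dots> < \<infinity>" using h by (simp add: integrable_iff_bounded)
  finally have b: "(\<integral>\<^sup>+y. \<integral>\<^sup>+z. norm (k y z) \<partial>lborel \<partial>lborel) < \<infinity>" .
  have "fourier h x = (LINT y|lborel. LINT z|lborel. k y z)"
    unfolding fourier_def lborel_prod_integral[OF i] k_def ..
  also have "\<dots> = (LINT z|lborel. LINT y|lborel. k y z)" by (rule fubini_lborel(1)[OF m b])
  also have "\<dots> = (LINT z|lborel. fourier P (fst x) * (Q z * cis (- 2 * pi * (z \<bullet> (snd x - fst x)))))"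
  proof (rule Bochner_Integration.integral_cong[OF refl])
    fix z
    have "(LINT y|lborel. k y z) = (LINT y|lborel. k (y - z) z)" by (rule integral_lborel_translate(2)[symmetric])
    also have "\<dots> = (LINT y|lborel. (P y * cis (- 2 * pi * (y \<bullet> fst x))) * (Q z * cis (- 2 * pi * (z \<bullet> (snd x - fst x)))))"
    proof (rule Bochner_Integration.integral_cong[OF refl])
      fix y
      have "- 2 * pi * ((y - z, z) \<bullet> x) = - 2 * pi * (y \<bullet> fst x) + - 2 * pi * (z \<bullet> (snd x - fst x))"
        by (cases x) (simp add: inner_diff_left inner_diff_right algebra_simps)
      then have "cis (- 2 * pi * ((y - z, z) \<bullet> x)) = cis (- 2 * pi * (y \<bullet> fst x)) * cis (- 2 * pi * (z \<bullet> (snd x - fst x)))"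
        by (simp only: cis_mult)
      then show "k (y - z) z = (P y * cis (- 2 * pi * (y \<bullet> fst x))) * (Q z * cis (- 2 * pi * (z \<bullet> (snd x - fst x))))"
        unfolding k_def h_def by simp
    qed
    also have "\<dots> = fourier P (fst x) * (Q z * cis (- 2 * pi * (z \<bullet> (snd x - fst x))))"
      unfolding fourier_def by (rule integral_mult_left_zero)
    finally show "(LINT y|lborel. k y z) = fourier P (fst x) * (Q z * cis (- 2 * pi * (z \<bullet> (snd x - fst x))))" .
  qed
  also have "\<dots> = fourier P (fst x) * fourier Q (snd x - fst x)"
    unfolding fourier_def[of Q] by (rule integral_mult_right_zero)
  finally show "fourier (\<lambda>\<xi>. P (fst \<xi> + snd \<xi>) * Q (snd \<xi>)) x = fourier P (fst x) * fourier Q (snd x - fst x)"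
    by (simp add: h_def[abs_def])
qed

text \<open>The Bessel kernel of order \<open>b\<close> with every heat time delayed by
  \<open>\<delta>\<close>: this smooths the singularity at 0 and cuts the transform off beyond
  \<open>|x| = \<delta> powr (- 1/2)\<close>. The absolute value keeps the heat time positive for
  negative \<open>t\<close>, where the weight \<open>gker\<close> vanishes.\<close>

definition bessel_heat :: "real \<Rightarrow> real \<Rightarrow> 'a::euclidean_space \<Rightarrow> complex" where
  "bessel_heat b \<delta> \<xi> = (LINT t|lborel. complex_of_real ((1 / Gamma (b / 2)) * (gker (b / 2) t * exp (- t)) * heat (\<bar>t\<bar> + \<delta>) \<xi>))"

lemma
  fixes x \<xi> :: "'a::euclidean_space"
  assumes b: "b > 0" and \<delta>: "\<delta> > 0"
  shows integrable_bessel_heat: "integrable lborel (bessel_heat b \<delta> :: 'a \<Rightarrow> complex)"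
    and fourier_bessel_heat: "fourier (bessel_heat b \<delta>) x = of_real (jap x powr (- b / 2) * exp (- (\<delta> * (4 * pi\<^sup>2 * (norm x)\<^sup>2))))"
    and norm_bessel_heat_le: "norm (bessel_heat b \<delta> \<xi>) \<le> (4 * pi * \<delta>) powr (- real DIM('a) / 2)"
proof -
  define r where "r t = (1 / Gamma (b / 2)) * (gker (b / 2) t * exp (- t))" for t
  have G: "Gamma (b / 2) > 0" using b by simp
  have r0: "r t \<ge> 0" for t unfolding r_def using G by (intro mult_nonneg_nonneg) auto
  have [measurable]: "r \<in> borel_measurable borel" unfolding r_def[abs_def] by measurable
  have "(\<integral>\<^sup>+t. ennreal (r t) \<partial>lborel) = (\<integral>\<^sup>+t. ennreal (1 / Gamma (b / 2)) * ennreal (gker (b / 2) t * exp (- (t * 1))) \<partial>lborel)"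
    unfolding r_def using G by (intro nn_integral_cong) (simp add: ennreal_mult[symmetric] less_imp_le)
  also have "\<dots> = ennreal (1 / Gamma (b / 2)) * ennreal (Gamma (b / 2) * 1 powr (- (b / 2)))"
    using b by (subst nn_integral_cmult, simp, subst nn_integral_gker_exp) auto
  also have "\<dots> = ennreal 1" using G by (simp add: ennreal_mult[symmetric] less_imp_le)
  finally have r1: "(\<integral>\<^sup>+t. ennreal (r t) \<partial>lborel) = ennreal 1" .
  have tp: "\<bar>t\<bar> + \<delta> > 0" for t using \<delta> by simp
  have m: "(\<lambda>(t, \<xi>). complex_of_real (r t * heat (\<bar>t\<bar> + \<delta>) (\<xi>::'a))) \<in> borel_measurable (borel \<Otimes>\<^sub>M borel)" by measurable
  have "(\<integral>\<^sup>+t. \<integral>\<^sup>+\<xi>. norm (complex_of_real (r t * heat (\<bar>t\<bar> + \<delta>) (\<xi>::'a))) \<partial>lborel \<partial>lborel) = (\<integral>\<^sup>+t. ennreal (r t) \<partial>lborel)"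
  proof (rule nn_integral_cong)
    fix t
    have "(\<integral>\<^sup>+\<xi>. norm (complex_of_real (r t * heat (\<bar>t\<bar> + \<delta>) (\<xi>::'a))) \<partial>lborel) = (\<integral>\<^sup>+\<xi>. ennreal (r t) * ennreal (heat (\<bar>t\<bar> + \<delta>) (\<xi>::'a)) \<partial>lborel)"
      unfolding norm_of_real by (intro nn_integral_cong) (simp add: ennreal_mult[symmetric] r0 abs_mult)
    also have "\<dots> = ennreal (r t)" by (simp add: nn_integral_cmult nn_integral_heat[OF tp])
    finally show "(\<integral>\<^sup>+\<xi>. norm (complex_of_real (r t * heat (\<bar>t\<bar> + \<delta>) (\<xi>::'a))) \<partial>lborel) = ennreal (r t)" .
  qed
  then have bd: "(\<integral>\<^sup>+t. \<integral>\<^sup>+\<xi>. norm (complex_of_real (r t * heat (\<bar>t\<bar> + \<delta>) (\<xi>::'a))) \<partial>lborel \<partial>lborel) \<le> ennreal 1" by (simp add: r1)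
  have e: "bessel_heat b \<delta> = (\<lambda>\<xi>::'a. LINT t|lborel. complex_of_real (r t * heat (\<bar>t\<bar> + \<delta>) \<xi>))"
    by (rule ext) (simp add: bessel_heat_def r_def)
  note mix = fourier_mix[OF m bd]
  show "integrable lborel (bessel_heat b \<delta> :: 'a \<Rightarrow> complex)" unfolding e by (rule mix(1))
  define A where "A = exp (- (\<delta> * (4 * pi\<^sup>2 * (norm x)\<^sup>2)))"
  have "fourier (bessel_heat b \<delta>) x = (LINT t|lborel. fourier (\<lambda>\<xi>. complex_of_real (r t * heat (\<bar>t\<bar> + \<delta>) \<xi>)) x)"
    unfolding e by (rule mix(3))
  also have "\<dots> = (LINT t|lborel. complex_of_real ((1 / Gamma (b / 2) * A) * (gker (b / 2) t * exp (- (t * jap x)))))"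
  proof (rule Bochner_Integration.integral_cong[OF refl])
    fix t
    have "fourier (\<lambda>\<xi>. complex_of_real (r t * heat (\<bar>t\<bar> + \<delta>) \<xi>)) x = of_real (r t * exp (- ((\<bar>t\<bar> + \<delta>) * (4 * pi\<^sup>2 * (norm x)\<^sup>2))))"
      unfolding of_real_mult fourier_cmult fourier_heat[OF tp] ..
    also have "r t * exp (- ((\<bar>t\<bar> + \<delta>) * (4 * pi\<^sup>2 * (norm x)\<^sup>2))) = (1 / Gamma (b / 2) * A) * (gker (b / 2) t * exp (- (t * jap x)))"
    proof (cases "t > 0")
      case True
      then have "exp (- t) * exp (- ((\<bar>t\<bar> + \<delta>) * (4 * pi\<^sup>2 * (norm x)\<^sup>2))) = A * exp (- (t * jap x))"
        unfolding A_def mult_exp_exp jap_def by (simp add: algebra_simps)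
      then show ?thesis unfolding r_def by simp
    qed (simp add: r_def gker_def)
    finally show "fourier (\<lambda>\<xi>. complex_of_real (r t * heat (\<bar>t\<bar> + \<delta>) \<xi>)) x = complex_of_real ((1 / Gamma (b / 2) * A) * (gker (b / 2) t * exp (- (t * jap x))))" .
  qed
  also have "\<dots> = of_real ((1 / Gamma (b / 2) * A) * (LINT t|lborel. gker (b / 2) t * exp (- (t * jap x))))"
    unfolding integral_complex_of_real by simp
  also have "(LINT t|lborel. gker (b / 2) t * exp (- (t * jap x))) = Gamma (b / 2) * jap x powr (- (b / 2))"
  proof -
    have "(\<integral>\<^sup>+t. ennreal (gker (b / 2) t * exp (- (t * jap x))) \<partial>lborel) = ennreal (Gamma (b / 2) * jap x powr (- (b / 2)))"
      by (rule nn_integral_gker_exp) (use b in simp_all)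
    then show ?thesis using G by (subst integral_eq_nn_integral) (auto simp: less_imp_le)
  qed
  finally show "fourier (bessel_heat b \<delta>) x = of_real (jap x powr (- b / 2) * exp (- (\<delta> * (4 * pi\<^sup>2 * (norm x)\<^sup>2))))"
    using G by (simp add: A_def)
  have h: "heat (\<bar>t\<bar> + \<delta>) \<xi> \<le> (4 * pi * \<delta>) powr (- real DIM('a) / 2)" for t
  proof -
    have "(4 * pi * (\<bar>t\<bar> + \<delta>)) powr (- real DIM('a) / 2) \<le> (4 * pi * \<delta>) powr (- real DIM('a) / 2)"
      using \<delta> by (intro powr_mono2') auto
    moreover have "exp (- ((norm \<xi>)\<^sup>2 / (4 * (\<bar>t\<bar> + \<delta>)))) \<le> 1" using \<delta> by simp
    ultimately show ?thesis unfolding heat_def using mult_mono[of "(4 * pi * (\<bar>t\<bar> + \<delta>)) powr (- real DIM('a) / 2)" "(4 * pi * \<delta>) powr (- real DIM('a) / 2)" "exp (- ((norm \<xi>)\<^sup>2 / (4 * (\<bar>t\<bar> + \<delta>))))" 1] by simp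
  qed
  have "ennreal (norm (bessel_heat b \<delta> \<xi>)) \<le> (\<integral>\<^sup>+t. norm (complex_of_real (r t * heat (\<bar>t\<bar> + \<delta>) \<xi>)) \<partial>lborel)"
    unfolding e by (rule norm_integral_le_nn_integral)
  also have "\<dots> \<le> (\<integral>\<^sup>+t. ennreal ((4 * pi * \<delta>) powr (- real DIM('a) / 2)) * ennreal (r t) \<partial>lborel)"
    unfolding norm_of_real
  proof (rule nn_integral_mono)
    fix t :: real
    show "ennreal \<bar>r t * heat (\<bar>t\<bar> + \<delta>) \<xi>\<bar> \<le> ennreal ((4 * pi * \<delta>) powr (- real DIM('a) / 2)) * ennreal (r t)"
      using mult_left_mono[OF h[of t] r0[of t]] r0[of t] by (simp add: ennreal_mult[symmetric] abs_mult mult.commute ennreal_leI)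
  qed
  also have "\<dots> = ennreal ((4 * pi * \<delta>) powr (- real DIM('a) / 2))" by (simp add: nn_integral_cmult r1)
  finally show "norm (bessel_heat b \<delta> \<xi>) \<le> (4 * pi * \<delta>) powr (- real DIM('a) / 2)" by simp
qed

text \<open>The exponent is dictated by scaling, as \<open>heat \<tau>\<close> has mass 1 at scale
  \<open>sqrt \<tau>\<close>; constants at most 1 are dropped, using \<open>4 * pi \<ge> 1\<close>
  and \<open>u > 1\<close>. Against the Gamma weight \<open>t powr (b / 2 - 1)\<close> with
  \<open>b = d - d / u\<close> this bound leaves \<open>1 / t\<close>, the source of a
  logarithm.\<close>

lemma heat_powr_integral:
  fixes u \<tau> :: real
  assumes u: "1 < u" and \<tau>: "\<tau> > 0"
  shows "(\<integral>\<^sup>+\<xi>. heat \<tau> \<xi> powr u \<partial>(lborel :: 'a::euclidean_space measure)) \<le> ennreal ((\<tau> powr (- (real DIM('a) - real DIM('a) / u) / 2)) powr u)"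
proof -
  define d where "d = real DIM('a)"
  have d: "d > 0" by (simp add: d_def)
  define T where "T = 4 * pi * \<tau>"
  have "4 * pi \<ge> 1" using pi_gt3 by linarith
  then have T: "T > 0" "\<tau> \<le> T" using \<tau> mult_right_mono[of 1 "4 * pi" \<tau>] by (simp_all add: T_def)
  have "(\<integral>\<^sup>+\<xi>. heat \<tau> \<xi> powr u \<partial>(lborel :: 'a measure)) = (\<integral>\<^sup>+\<xi>. ennreal (T powr (- d * u / 2)) * ennreal (exp (- (pi * (u / T) * (norm \<xi>)\<^sup>2))) \<partial>(lborel :: 'a measure))"
  proof (rule nn_integral_cong)
    fix \<xi> :: 'a
    have "exp (- ((norm \<xi>)\<^sup>2 / (4 * \<tau>))) powr u = exp (- (pi * (u / T) * (norm \<xi>)\<^sup>2))"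
      using \<tau> by (simp add: powr_def T_def field_simps)
    then show "ennreal (heat \<tau> \<xi> powr u) = ennreal (T powr (- d * u / 2)) * ennreal (exp (- (pi * (u / T) * (norm \<xi>)\<^sup>2)))"
      unfolding heat_def d_def[symmetric] T_def[symmetric] by (simp add: powr_mult powr_powr ennreal_mult[symmetric])
  qed
  also have "\<dots> = ennreal (T powr (- d * u / 2)) * ennreal ((u / T) powr (- d / 2))"
  proof -
    have "(\<integral>\<^sup>+\<xi>. ennreal (exp (- (pi * (u / T) * (norm \<xi>)\<^sup>2))) \<partial>(lborel :: 'a measure)) = ennreal ((u / T) powr (- d / 2))"
      unfolding d_def by (rule nn_integral_gaussian) (use u T in simp)
    then show ?thesis by (subst nn_integral_cmult) simp_all
  qed
  also have "\<dots> = ennreal (T powr (- d * u / 2) * (u / T) powr (- d / 2))" by (simp add: ennreal_mult)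
  also have "\<dots> \<le> ennreal ((\<tau> powr (- (d - d / u) / 2)) powr u)"
  proof (rule ennreal_leI)
    have "(u / T) powr (- d / 2) = u powr (- d / 2) * T powr (d / 2)"
      unfolding powr_divide using powr_minus_divide[of T "d / 2"] by simp
    also have "\<dots> \<le> 1 * T powr (d / 2)"
    proof (rule mult_right_mono)
      have "u powr (- d / 2) \<le> u powr 0" using u d by (intro powr_mono) auto
      then show "u powr (- d / 2) \<le> 1" using u by simp
    qed simp
    finally have "T powr (- d * u / 2) * (u / T) powr (- d / 2) \<le> T powr (- d * u / 2) * T powr (d / 2)" by (simp add: mult_left_mono)
    also have "\<dots> = T powr (- (d - d / u) / 2 * u)" proof -
      define A where "A = d - d / u"
      have "A * u = d * u - d" using u by (simp add: A_def left_diff_distrib)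
      then have "- d * u / 2 + d / 2 = - A / 2 * u" by (simp add: field_simps)
      then have "- d * u / 2 + d / 2 = - (d - d / u) / 2 * u" by (simp only: A_def)
      then show ?thesis unfolding powr_add[symmetric] by (simp only:)
    qed
    also have "\<dots> \<le> \<tau> powr (- (d - d / u) / 2 * u)"
    proof (rule powr_mono2'[OF _ \<tau> T(2)])
      have "d / u \<le> d" using d u by (simp add: divide_le_eq)
      then show "- (d - d / u) / 2 * u \<le> 0" using u by (intro mult_nonpos_nonneg) auto
    qed
    finally show "T powr (- d * u / 2) * (u / T) powr (- d / 2) \<le> (\<tau> powr (- (d - d / u) / 2)) powr u" by (simp add: powr_powr)
  qed
  finally show ?thesis by (simp only: d_def)
qed

text \<open>The bound is linear in \<open>N = log (1 / \<delta>) / log 4\<close>: interpolate \<open>(t + \<delta>) powr (- b / 2)\<close> between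
  \<open>t powr (- b / 2)\<close> and \<open>\<delta> powr (- b / 2)\<close> with parameter of order \<open>1 / N\<close>.\<close>

lemma bessel_heat_powr_integral:
  fixes u b :: real
  assumes u: "1 < u" and b: "b = real DIM('a::euclidean_space) - real DIM('a) / u"
  obtains C where "C > 0" "\<And>N::nat. N \<ge> 1 \<Longrightarrow>
    (\<integral>\<^sup>+\<xi>. norm (bessel_heat b (1 / 4 ^ N) (\<xi>::'a)) powr u \<partial>lborel) \<le> ennreal ((C * real N) powr u)"
proof -
  have b0: "b > 0" unfolding b using u by (simp add: divide_less_eq)
  have G: "Gamma (b / 2) > 0" using b0 by simp
  have "continuous_on {1..1 + b / 2} (Gamma :: real \<Rightarrow> real)"
    by (intro continuous_on_Gamma) (auto elim!: nonpos_Ints_cases)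
  \<comment> \<open>\<open>Gamma (\<theta> + 1)\<close> is evaluated on a compact interval, so
    \<open>Gamma \<theta>\<close>, its quotient by \<open>\<theta>\<close>, is of order
    \<open>1 / \<theta>\<close>.\<close>
  then obtain M where M: "\<And>t. t \<in> {1..1 + b / 2} \<Longrightarrow> Gamma t \<le> M"
    using continuous_attains_sup[of "{1..1 + b / 2}" "Gamma :: real \<Rightarrow> real"] b0 by (metis atLeastAtMost_iff compact_Icc empty_iff le_add_same_cancel1 less_eq_real_def half_gt_zero order_refl)
  have M1: "M > 0" using M[of 1] b0 by simp
  define C where "C = (1 / Gamma (b / 2)) * (M * (2 / b)) * 4 powr (b / 2)"
  have C: "C > 0" using G M1 b0 by (simp add: C_def)
  show thesis
  proof (rule that[OF C])
    fix N :: nat assume N: "N \<ge> 1"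
    define \<delta> where "\<delta> = (1 / 4 ^ N :: real)"
    have \<delta>: "\<delta> > 0" by (simp add: \<delta>_def)
    \<comment> \<open>With this choice \<open>\<delta> powr (- \<theta>)\<close> is the constant
      \<open>4 powr (b / 2)\<close>, while \<open>Gamma \<theta>\<close> is of order
      \<open>N\<close>.\<close>
    define \<theta> where "\<theta> = b / (2 * real N)"
    have "b / 2 * 1 \<le> b / 2 * real N" using N b0 by (intro mult_left_mono) auto
    then have \<theta>: "\<theta> > 0" "\<theta> \<le> b / 2" using N b0 by (simp_all add: \<theta>_def field_simps)
    have \<delta>\<theta>: "\<delta> powr (- \<theta>) = 4 powr (b / 2)"
    proof -
      have "\<delta> = 4 powr (- real N)" by (simp add: \<delta>_def powr_minus powr_realpow divide_inverse)
      then show ?thesis using N by (simp add: powr_powr \<theta>_def)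
    qed
    have G\<theta>: "Gamma \<theta> \<le> M * (2 / b) * real N"
    proof -
      have "\<theta> \<notin> \<int>\<^sub>\<le>\<^sub>0" using \<theta>(1) by (auto elim!: nonpos_Ints_cases)
      then have "\<theta> * Gamma \<theta> = Gamma (\<theta> + 1)" by (simp add: Gamma_plus1)
      also have "\<dots> \<le> M" using \<theta> by (intro M) auto
      finally have "Gamma \<theta> \<le> M / \<theta>" using \<theta>(1) by (simp add: pos_le_divide_eq mult.commute)
      also have "M / \<theta> = M * (2 / b) * real N" by (simp add: \<theta>_def)
      finally show ?thesis .
    qed
    define r where "r t = (1 / Gamma (b / 2)) * (gker (b / 2) t * exp (- t))" for t
    have r0: "r t \<ge> 0" for t unfolding r_def using G by (intro mult_nonneg_nonneg) auto
    have [measurable]: "r \<in> borel_measurable borel" unfolding r_def[abs_def] by measurable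
    have tp: "\<bar>t\<bar> + \<delta> > 0" for t using \<delta> by simp
    define \<beta> where "\<beta> t = (\<bar>t\<bar> + \<delta>) powr (- b / 2)" for t
    have "(\<integral>\<^sup>+\<xi>. norm (LINT t|lborel. complex_of_real (r t * heat (\<bar>t\<bar> + \<delta>) (\<xi>::'a))) powr u \<partial>lborel) \<le> ennreal ((C * real N) powr u)"
    proof (rule minkowski_powr_integral[OF u, where \<rho>=r and b=\<beta> and g="\<lambda>t \<xi>. heat (\<bar>t\<bar> + \<delta>) \<xi>"])
      show "\<beta> \<in> borel_measurable borel" unfolding \<beta>_def[abs_def] by measurable
      show "(\<lambda>(t, \<xi>). heat (\<bar>t\<bar> + \<delta>) (\<xi>::'a)) \<in> borel_measurable (borel \<Otimes>\<^sub>M borel)" by measurable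
      show "0 < \<beta> t" for t using tp[of t] by (simp add: \<beta>_def)
      show "norm (complex_of_real (r t * heat (\<bar>t\<bar> + \<delta>) (\<xi>::'a))) \<le> r t * heat (\<bar>t\<bar> + \<delta>) \<xi>" for t \<xi>
        unfolding norm_of_real by (simp add: abs_mult r0)
      show "(\<integral>\<^sup>+\<xi>. heat (\<bar>t\<bar> + \<delta>) (\<xi>::'a) powr u \<partial>lborel) \<le> ennreal (\<beta> t powr u)" for t
        using heat_powr_integral[OF u tp[of t], where 'a='a] by (simp only: \<beta>_def b)
      show "0 \<le> C * real N" using C by simp
      have "(\<integral>\<^sup>+t. ennreal (r t * \<beta> t) \<partial>lborel) \<le> (\<integral>\<^sup>+t. ennreal ((1 / Gamma (b / 2)) * \<delta> powr (- \<theta>)) * ennreal (gker \<theta> t * exp (- (t * 1))) \<partial>lborel)"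
      proof (rule nn_integral_mono)
        fix t :: real
        show "ennreal (r t * \<beta> t) \<le> ennreal ((1 / Gamma (b / 2)) * \<delta> powr (- \<theta>)) * ennreal (gker \<theta> t * exp (- (t * 1)))"
        proof (cases "t > 0")
          case False then show ?thesis by (simp add: r_def gker_def)
        next
          case True
          have "(t + \<delta>) powr (- b / 2) = (t + \<delta>) powr (- (b / 2 - \<theta>)) * (t + \<delta>) powr (- \<theta>)"
            unfolding powr_add[symmetric] by simp
          also have "\<dots> \<le> t powr (- (b / 2 - \<theta>)) * \<delta> powr (- \<theta>)"
            using True \<theta> \<delta> by (intro mult_mono powr_mono2') auto
          finally have le: "t powr (b / 2 - 1) * (t + \<delta>) powr (- b / 2) \<le> t powr (b / 2 - 1) * (t powr (- (b / 2 - \<theta>)) * \<delta> powr (- \<theta>))"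
            by (rule mult_left_mono) simp
          have eq: "t powr (b / 2 - 1) * (t powr (- (b / 2 - \<theta>)) * \<delta> powr (- \<theta>)) = t powr (\<theta> - 1) * \<delta> powr (- \<theta>)"
          proof -
            have "t powr (b / 2 - 1) * t powr (- (b / 2 - \<theta>)) = t powr (\<theta> - 1)" unfolding powr_add[symmetric] by simp
            then show ?thesis by (simp only: mult.assoc[symmetric])
          qed
          have "r t * \<beta> t = (1 / Gamma (b / 2) * exp (- t)) * (t powr (b / 2 - 1) * (t + \<delta>) powr (- b / 2))"
            using True by (simp add: r_def \<beta>_def gker_def)
          also have "\<dots> \<le> (1 / Gamma (b / 2) * exp (- t)) * (t powr (\<theta> - 1) * \<delta> powr (- \<theta>))"
            using le unfolding eq by (rule mult_left_mono) (use G in simp)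
          also have "\<dots> = ((1 / Gamma (b / 2)) * \<delta> powr (- \<theta>)) * (gker \<theta> t * exp (- (t * 1)))"
            using True by (simp add: gker_def)
          finally have "ennreal (r t * \<beta> t) \<le> ennreal (((1 / Gamma (b / 2)) * \<delta> powr (- \<theta>)) * (gker \<theta> t * exp (- (t * 1))))" by (rule ennreal_leI)
          also have "\<dots> = ennreal ((1 / Gamma (b / 2)) * \<delta> powr (- \<theta>)) * ennreal (gker \<theta> t * exp (- (t * 1)))"
            by (rule ennreal_mult) (use G in auto)
          finally show ?thesis .
        qed
      qed
      also have "\<dots> = ennreal ((1 / Gamma (b / 2)) * \<delta> powr (- \<theta>)) * ennreal (Gamma \<theta> * 1 powr (- \<theta>))"
        using \<theta> by (subst nn_integral_cmult, simp, subst nn_integral_gker_exp) auto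
      also have "\<dots> = ennreal ((1 / Gamma (b / 2)) * \<delta> powr (- \<theta>) * Gamma \<theta>)"
        using G \<theta>(1) by (subst ennreal_mult[symmetric]) (auto simp: less_imp_le)
      also have "\<dots> \<le> ennreal (C * real N)"
      proof (rule ennreal_leI)
        have "(1 / Gamma (b / 2)) * \<delta> powr (- \<theta>) * Gamma \<theta> \<le> (1 / Gamma (b / 2)) * \<delta> powr (- \<theta>) * (M * (2 / b) * real N)"
          using G by (intro mult_left_mono G\<theta>) auto
        then show "(1 / Gamma (b / 2)) * \<delta> powr (- \<theta>) * Gamma \<theta> \<le> C * real N" unfolding \<delta>\<theta> C_def by (simp only: mult_ac)
      qed
      finally show "(\<integral>\<^sup>+t. ennreal (r t * \<beta> t) \<partial>lborel) \<le> ennreal (C * real N)" .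
    qed (simp_all add: r0)
    then show "(\<integral>\<^sup>+\<xi>. norm (bessel_heat b (1 / 4 ^ N) (\<xi>::'a)) powr u \<partial>lborel) \<le> ennreal ((C * real N) powr u)"
      unfolding bessel_heat_def \<delta>_def[symmetric] r_def .
  qed
qed

section \<open>Translates of the Fourier weight along the diagonal\<close>

lemma jap_le_mult: "jap x \<le> 2 * jap (x - z) * jap z"
proof -
  define a where "a = norm (x - z)"
  define c where "c = norm z"
  have "norm x \<le> a + c" unfolding a_def c_def using norm_triangle_ineq[of "x - z" z] by simp
  then have "(norm x)\<^sup>2 \<le> (a + c)\<^sup>2" by (rule power_mono) simp
  also have "\<dots> \<le> 2 * a\<^sup>2 + 2 * c\<^sup>2" using sum_squares_ge_zero[of "a - c" 0] by (simp add: power2_eq_square algebra_simps)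
  finally have "4 * pi\<^sup>2 * (norm x)\<^sup>2 \<le> 4 * pi\<^sup>2 * (2 * a\<^sup>2 + 2 * c\<^sup>2)" by (rule mult_left_mono) simp
  moreover have "0 \<le> 2 * (4 * pi\<^sup>2 * a\<^sup>2) * (4 * pi\<^sup>2 * c\<^sup>2)" by simp
  moreover have "2 * (1 + 4 * pi\<^sup>2 * a\<^sup>2) * (1 + 4 * pi\<^sup>2 * c\<^sup>2) = 2 + 4 * pi\<^sup>2 * (2 * a\<^sup>2 + 2 * c\<^sup>2) + 2 * (4 * pi\<^sup>2 * a\<^sup>2) * (4 * pi\<^sup>2 * c\<^sup>2)"
    by (simp add: algebra_simps)
  ultimately show ?thesis unfolding jap_def a_def[symmetric] c_def[symmetric] by linarith
qed

lemma jap_quotient_tendsto: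
  fixes X :: "nat \<Rightarrow> 'a::real_inner"
  assumes X: "filterlim (\<lambda>k. norm (X k)) at_top sequentially"
  shows "(\<lambda>k. jap (X k) / jap (X k - z)) \<longlonglongrightarrow> 1"
proof -
  define Y where "Y k = X k - z" for k
  have "filterlim (\<lambda>k. - norm z + norm (X k)) at_top sequentially"
    by (rule filterlim_tendsto_add_at_top[OF tendsto_const X])
  then have Y: "filterlim (\<lambda>k. norm (Y k)) at_top sequentially"
  proof (rule filterlim_at_top_mono)
    show "\<forall>\<^sub>F k in sequentially. - norm z + norm (X k) \<le> norm (Y k)"
      unfolding Y_def using norm_triangle_ineq2[of "X _" z] by (intro always_eventually) (simp add: algebra_simps)
  qed
  have iY: "(\<lambda>k. 1 / norm (Y k)) \<longlonglongrightarrow> 0"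
    by (rule tendsto_divide_0[OF tendsto_const filterlim_at_top_imp_at_infinity[OF Y]])
  have "(\<lambda>k. 2 * norm z * (1 / norm (Y k)) + (norm z)\<^sup>2 * (1 / norm (Y k))\<^sup>2) \<longlonglongrightarrow> 2 * norm z * 0 + (norm z)\<^sup>2 * 0\<^sup>2"
    by (intro tendsto_intros iY)
  then have lim: "(\<lambda>k. 2 * norm z * (1 / norm (Y k)) + (norm z)\<^sup>2 * (1 / norm (Y k))\<^sup>2) \<longlonglongrightarrow> 0" by simp
  have "(\<lambda>k. jap (X k) / jap (Y k) - 1) \<longlonglongrightarrow> 0"
  proof (rule Lim_null_comparison[OF _ lim])
    have "\<forall>\<^sub>F k in sequentially. norm (Y k) \<ge> 1" using Y by (simp add: filterlim_at_top)
    then show "\<forall>\<^sub>F k in sequentially. norm (jap (X k) / jap (Y k) - 1) \<le> 2 * norm z * (1 / norm (Y k)) + (norm z)\<^sup>2 * (1 / norm (Y k))\<^sup>2"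
    proof eventually_elim
      case (elim k)
      define y where "y = norm (Y k)"
      have y: "y > 0" using elim unfolding y_def by linarith
      have "X k = Y k + z" by (simp add: Y_def)
      then have eqX: "(norm (X k))\<^sup>2 - y\<^sup>2 = 2 * (Y k \<bullet> z) + (norm z)\<^sup>2"
        unfolding y_def power2_norm_eq_inner by (simp add: inner_add_left inner_add_right inner_commute[of z "Y k"])
      have "\<bar>Y k \<bullet> z\<bar> \<le> y * norm z" unfolding y_def by (rule Cauchy_Schwarz_ineq2)
      then have cs: "Y k \<bullet> z \<le> y * norm z" "- (Y k \<bullet> z) \<le> y * norm z" by (simp_all add: abs_le_iff)
      have "\<bar>(norm (X k))\<^sup>2 - y\<^sup>2\<bar> \<le> 2 * (y * norm z) + (norm z)\<^sup>2"
        by (rule abs_leI) (use eqX cs zero_le_power2[of "norm z"] in linarith)+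
      then have "4 * pi\<^sup>2 * \<bar>(norm (X k))\<^sup>2 - y\<^sup>2\<bar> \<le> 4 * pi\<^sup>2 * (2 * (y * norm z) + (norm z)\<^sup>2)" by (rule mult_left_mono) simp
      moreover have "\<bar>jap (X k) - jap (Y k)\<bar> = 4 * pi\<^sup>2 * \<bar>(norm (X k))\<^sup>2 - y\<^sup>2\<bar>"
      proof -
        have "jap (X k) - jap (Y k) = 4 * pi\<^sup>2 * ((norm (X k))\<^sup>2 - y\<^sup>2)" by (simp add: jap_def y_def right_diff_distrib)
        then show ?thesis by (simp add: abs_mult)
      qed
      ultimately have num: "\<bar>jap (X k) - jap (Y k)\<bar> \<le> 4 * pi\<^sup>2 * (2 * (y * norm z) + (norm z)\<^sup>2)" by simp
      have den: "4 * pi\<^sup>2 * y\<^sup>2 \<le> jap (Y k)" "4 * pi\<^sup>2 * y\<^sup>2 > 0" using y by (simp_all add: jap_def y_def)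
      have "norm (jap (X k) / jap (Y k) - 1) = \<bar>jap (X k) - jap (Y k)\<bar> / jap (Y k)"
      proof -
        have "jap (X k) / jap (Y k) - 1 = (jap (X k) - jap (Y k)) / jap (Y k)" by (simp add: diff_divide_distrib)
        then show ?thesis by simp
      qed
      also have "\<dots> \<le> (4 * pi\<^sup>2 * (2 * (y * norm z) + (norm z)\<^sup>2)) / (4 * pi\<^sup>2 * y\<^sup>2)"
        by (rule frac_le[OF _ num den(2) den(1)]) (use y in \<open>intro mult_nonneg_nonneg add_nonneg_nonneg; simp\<close>)
      also have "\<dots> = (2 * (y * norm z) + (norm z)\<^sup>2) / y\<^sup>2"
      proof -
        have "4 * pi\<^sup>2 \<noteq> 0" by simp
        then show ?thesis by (rule nonzero_mult_divide_mult_cancel_left)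
      qed
      also have "\<dots> = 2 * norm z * (1 / y) + (norm z)\<^sup>2 * (1 / y)\<^sup>2"
        using y by (simp add: field_simps power2_eq_square)
      finally show ?case unfolding y_def .
    qed
  qed
  from tendsto_add[OF this tendsto_const[of 1]] show ?thesis by (simp add: Y_def)
qed

text \<open>The Fourier transform of the second test multiplier, apart from a Gaussian in
  \<open>snd y - fst y\<close>: the first factor is that of the Bessel kernel in both variables, the
  others come from \<open>bessel_heat\<close> in the sum variable, whose dual variable is
  \<open>fst y\<close>.\<close>

definition diag_weight :: "real \<Rightarrow> real \<Rightarrow> real \<Rightarrow> ('a::euclidean_space) \<times> 'a \<Rightarrow> real" where
  "diag_weight s b \<delta> y = jap y powr (- s / 2) * jap (fst y) powr (- b / 2) * exp (- (\<delta> * (4 * pi\<^sup>2 * (norm (fst y))\<^sup>2)))"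

lemma diag_weight_pos: "diag_weight s b \<delta> y > 0"
  by (simp add: diag_weight_def)

lemma borel_measurable_diag_weight [measurable]: "diag_weight s b \<delta> \<in> borel_measurable borel"
proof -
  note [measurable] = borel_measurable_fst_snd
  show ?thesis unfolding diag_weight_def[abs_def] by measurable
qed

lemma diag_weight_quotient:
  fixes x :: "'a::euclidean_space" and z :: "'a \<times> 'a"
  shows "diag_weight s b \<delta> (z - (x, x)) / diag_weight s b \<delta> (x, x)
    = (jap (x, x) / jap ((x, x) - z)) powr (s / 2) * (jap x / jap (x - fst z)) powr (b / 2)
      * exp (4 * pi\<^sup>2 * (\<delta> * ((norm x)\<^sup>2 - (norm (x - fst z))\<^sup>2)))"
proof -
  have j: "jap (z - (x, x)) = jap ((x, x) - z)" "jap (fst z - x) = jap (x - fst z)" "norm (fst z - x) = norm (x - fst z)"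
    by (simp_all add: jap_def norm_minus_commute)
  have p: "A powr (- c / 2) / B powr (- c / 2) = (B / A) powr (c / 2)" for A B c :: real
    using powr_minus_divide[of A "c / 2"] powr_minus_divide[of B "c / 2"] by (simp add: powr_divide)
  have e: "exp (- (\<delta> * (4 * pi\<^sup>2 * A))) / exp (- (\<delta> * (4 * pi\<^sup>2 * B))) = exp (4 * pi\<^sup>2 * (\<delta> * (B - A)))" for A B :: real
    unfolding exp_diff[symmetric] by (simp add: algebra_simps)
  have "diag_weight s b \<delta> (z - (x, x)) / diag_weight s b \<delta> (x, x)
    = (jap ((x, x) - z) powr (- s / 2) / jap (x, x) powr (- s / 2)) * (jap (x - fst z) powr (- b / 2) / jap x powr (- b / 2))
      * (exp (- (\<delta> * (4 * pi\<^sup>2 * (norm (x - fst z))\<^sup>2))) / exp (- (\<delta> * (4 * pi\<^sup>2 * (norm x)\<^sup>2))))"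
    unfolding diag_weight_def fst_diff fst_conv j by (simp only: times_divide_times_eq)
  then show ?thesis unfolding p e .
qed

text \<open>Against an integrable density with enough decay, the weight translated to a far point of the
  diagonal behaves like a constant, uniformly in \<open>\<delta>\<close> as long as \<open>\<delta> |x|\<^sup>2 \<le> 1\<close>.\<close>

lemma diag_weight_average:
  fixes \<rho> :: "('a::euclidean_space) \<times> 'a \<Rightarrow> complex"
  assumes s: "s > 0" and b: "b > 0" and [measurable]: "\<rho> \<in> borel_measurable borel"
    and \<rho>: "integrable lborel (\<lambda>z. (1 + norm z) ^ nat \<lceil>s + b\<rceil> * norm (\<rho> z))"
    and \<kappa>: "(LINT z|lborel. \<rho> z) \<noteq> 0"
  obtains R where "R \<ge> 1" "\<And>\<delta> x. 0 \<le> \<delta> \<Longrightarrow> R \<le> norm x \<Longrightarrow> \<delta> * (norm x)\<^sup>2 \<le> 1 \<Longrightarrow>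
    norm (LINT z|lborel. \<rho> z) / 2 * diag_weight s b \<delta> (x, x) \<le> norm (LINT z|lborel. \<rho> z * of_real (diag_weight s b \<delta> (z - (x, x))))"
proof (rule ccontr)
  assume "\<not> thesis"
  note n = this
  define \<kappa> where "\<kappa> = norm (LINT z|lborel. \<rho> z)"
  \<comment> \<open>\<open>Q k \<delta> x\<close> states that \<open>(\<delta>, x)\<close> violates
    the estimate with \<open>norm x\<close> at least \<open>k + 1\<close>. Violations for every
    \<open>k\<close> give a sequence along which the quotients of weights tend to 1; the normalised
    integrals then tend to the total mass, contradicting the factor \<open>1/2\<close>.\<close>
  define Q where "Q k \<delta> x \<longleftrightarrow> 0 \<le> \<delta> \<and> real k + 1 \<le> norm x \<and> \<delta> * (norm x)\<^sup>2 \<le> 1 \<and>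
     norm (LINT z|lborel. \<rho> z * of_real (diag_weight s b \<delta> (z - (x, x)))) < \<kappa> / 2 * diag_weight s b \<delta> (x, x)" for k :: nat and \<delta> :: real and x :: 'a
  have "\<exists>p. Q k (fst p) (snd p)" for k
  proof (rule ccontr)
    assume c: "\<not> ?thesis"
    have c': "\<not> Q k \<delta> x" for \<delta> x
    proof
      assume "Q k \<delta> x"
      then have "\<exists>p. Q k (fst p) (snd p)" by (intro exI[of _ "(\<delta>, x)"]) simp
      with c show False by contradiction
    qed
    have thesis
    proof (rule that)
      show "real k + 1 \<ge> 1" by simp
      fix \<delta> and x :: 'a assume "0 \<le> \<delta>" "real k + 1 \<le> norm x" "\<delta> * (norm x)\<^sup>2 \<le> 1"
      with c'[of \<delta> x] have "\<not> norm (LINT z|lborel. \<rho> z * of_real (diag_weight s b \<delta> (z - (x, x)))) < \<kappa> / 2 * diag_weight s b \<delta> (x, x)"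
        unfolding Q_def by blast
      then show "norm (LINT z|lborel. \<rho> z) / 2 * diag_weight s b \<delta> (x, x) \<le> norm (LINT z|lborel. \<rho> z * of_real (diag_weight s b \<delta> (z - (x, x))))"
        unfolding \<kappa>_def by (rule leI)
    qed
    with n show False by contradiction
  qed
  then have "\<forall>k. \<exists>p. Q k (fst p) (snd p)" ..
  from choice[OF this] obtain P where P: "\<And>k. Q k (fst (P k)) (snd (P k))" by blast
  define \<delta> where "\<delta> k = fst (P k)" for k
  define x where "x k = snd (P k)" for k
  have Qk: "Q k (\<delta> k) (x k)" for k using P[of k] by (simp only: \<delta>_def x_def)
  have \<delta>0: "0 \<le> \<delta> k" for k using Qk[of k] unfolding Q_def by (rule conjunct1)
  have xk: "real k + 1 \<le> norm (x k)" for k using Qk[of k] unfolding Q_def by (elim conjE)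
  have \<delta>x: "\<delta> k * (norm (x k))\<^sup>2 \<le> 1" for k using Qk[of k] unfolding Q_def by (elim conjE)
  have small: "norm (LINT z|lborel. \<rho> z * of_real (diag_weight s b (\<delta> k) (z - (x k, x k)))) < \<kappa> / 2 * diag_weight s b (\<delta> k) (x k, x k)" for k
    using Qk[of k] unfolding Q_def by (elim conjE)
  define m where "m = nat \<lceil>s + b\<rceil>"
  define E where "E k z = \<delta> k * ((norm (x k))\<^sup>2 - (norm (x k - fst z))\<^sup>2)" for k and z :: "'a \<times> 'a"
  define q where "q k z = diag_weight s b (\<delta> k) (z - (x k, x k)) / diag_weight s b (\<delta> k) (x k, x k)" for k z
  have q: "q k z = (jap (x k, x k) / jap ((x k, x k) - z)) powr (s / 2) * (jap (x k) / jap (x k - fst z)) powr (b / 2) * exp (4 * pi\<^sup>2 * E k z)" for k z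
    unfolding q_def E_def by (rule diag_weight_quotient)
  have q0: "0 \<le> q k z" for k z unfolding q_def using diag_weight_pos less_imp_le by (intro divide_nonneg_nonneg) blast+
  define K where "K = (2 * (1 + 2 * pi)\<^sup>2) powr ((s + b) / 2) * exp (4 * pi\<^sup>2)"
  have qle: "q k z \<le> K * (1 + norm z) ^ m" for k z
  proof -
    define A where "A = 2 * (1 + 2 * pi)\<^sup>2 * (1 + norm z)\<^sup>2"
    have A: "A > 0" unfolding A_def by (intro mult_pos_pos zero_less_power) (auto simp: add_pos_nonneg pi_gt_zero)
    have jz: "2 * jap z \<le> A"
    proof -
      have "jap z \<le> (1 + 2 * pi * norm z)\<^sup>2" unfolding jap_def by (simp add: power2_eq_square algebra_simps)
      also have "\<dots> \<le> ((1 + 2 * pi) * (1 + norm z))\<^sup>2" by (intro power_mono) (auto simp: algebra_simps)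
      finally show ?thesis by (simp add: A_def power_mult_distrib)
    qed
    have jf: "jap (fst z) \<le> jap z" unfolding jap_def using norm_fst_le[of "fst z" "snd z"] by (simp add: power_mono mult_left_mono)
    \<comment> \<open>Peetre's inequality bounds both quotients of brackets by polynomials in
      \<open>z\<close>, independently of \<open>x k\<close>. Together with the exponential,
      controlled by \<open>\<delta> k * (norm (x k))\<^sup>2 \<le> 1\<close>, this gives the weight
      that is integrable against \<open>\<rho>\<close>.\<close>
    have "jap (x k, x k) / jap ((x k, x k) - z) \<le> 2 * jap z" using jap_le_mult[of "(x k, x k)" z] by (simp add: divide_le_eq mult_ac)
    then have 1: "(jap (x k, x k) / jap ((x k, x k) - z)) powr (s / 2) \<le> A powr (s / 2)" using jz s by (intro powr_mono2) auto
    have "jap (x k) / jap (x k - fst z) \<le> 2 * jap (fst z)" using jap_le_mult[of "x k" "fst z"] by (simp add: divide_le_eq mult_ac)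
    then have 2: "(jap (x k) / jap (x k - fst z)) powr (b / 2) \<le> A powr (b / 2)" using jz jf b by (intro powr_mono2) auto
    have "E k z \<le> \<delta> k * (norm (x k))\<^sup>2" unfolding E_def using \<delta>0[of k] by (intro mult_left_mono) auto
    then have "E k z \<le> 1" using \<delta>x[of k] by simp
    then have 3: "exp (4 * pi\<^sup>2 * E k z) \<le> exp (4 * pi\<^sup>2)" by simp
    have "q k z \<le> A powr (s / 2) * A powr (b / 2) * exp (4 * pi\<^sup>2)" unfolding q by (intro mult_mono 1 2 3) auto
    also have "A powr (s / 2) * A powr (b / 2) = A powr ((s + b) / 2)" by (simp add: powr_add[symmetric] add_divide_distrib)
    also have "A powr ((s + b) / 2) = (2 * (1 + 2 * pi)\<^sup>2) powr ((s + b) / 2) * ((1 + norm z)\<^sup>2) powr ((s + b) / 2)" unfolding A_def by (rule powr_mult)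
    also have "((1 + norm z)\<^sup>2) powr ((s + b) / 2) = (1 + norm z) powr (s + b)"
    proof -
      have "(1 + norm z)\<^sup>2 = (1 + norm z) powr 2" by (simp add: add_pos_nonneg)
      moreover have "2 * ((s + b) / 2) = s + b" by (simp add: field_simps)
      ultimately show ?thesis by (simp only: powr_powr)
    qed
    also have "(2 * (1 + 2 * pi)\<^sup>2) powr ((s + b) / 2) * (1 + norm z) powr (s + b) * exp (4 * pi\<^sup>2) = K * (1 + norm z) powr (s + b)"
      by (simp add: K_def mult_ac)
    also have "\<dots> \<le> K * (1 + norm z) powr (real m)"
    proof (intro mult_left_mono powr_mono)
      show "s + b \<le> real m" unfolding m_def by (rule real_nat_ceiling_ge)
    qed (auto simp: K_def)
    also have "(1 + norm z) powr (real m) = (1 + norm z) ^ m" by (rule powr_realpow) (simp add: add_pos_nonneg)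
    finally show ?thesis .
  qed
  have xinf: "filterlim (\<lambda>k. norm (x k)) at_top sequentially"
  proof (rule filterlim_at_top_mono[OF filterlim_real_sequentially], intro always_eventually allI)
    show "real k \<le> norm (x k)" for k using xk[of k] by linarith
  qed
  have xxinf: "filterlim (\<lambda>k. norm (x k, x k)) at_top sequentially"
    by (rule filterlim_at_top_mono[OF xinf], intro always_eventually allI norm_fst_le)
  have ix: "(\<lambda>k. 1 / norm (x k)) \<longlonglongrightarrow> 0"
    by (rule tendsto_divide_0[OF tendsto_const filterlim_at_top_imp_at_infinity[OF xinf]])
  \<comment> \<open>The difference of the squared norms is of order \<open>norm (x k)\<close> for
    fixed \<open>z\<close>, and \<open>\<delta> k\<close> is at most the inverse square of
    \<open>norm (x k)\<close>. This makes the estimate uniform in \<open>\<delta>\<close>.\<close>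
  have Elim: "(\<lambda>k. E k z) \<longlonglongrightarrow> 0" for z
  proof (rule Lim_null_comparison)
    have "(\<lambda>k. 2 * norm (fst z) * (1 / norm (x k)) + (norm (fst z))\<^sup>2 * (1 / norm (x k))\<^sup>2) \<longlonglongrightarrow> 2 * norm (fst z) * 0 + (norm (fst z))\<^sup>2 * 0\<^sup>2"
      by (intro tendsto_intros ix)
    then show "(\<lambda>k. 2 * norm (fst z) * (1 / norm (x k)) + (norm (fst z))\<^sup>2 * (1 / norm (x k))\<^sup>2) \<longlonglongrightarrow> 0" by simp
    show "\<forall>\<^sub>F k in sequentially. norm (E k z) \<le> 2 * norm (fst z) * (1 / norm (x k)) + (norm (fst z))\<^sup>2 * (1 / norm (x k))\<^sup>2"
    proof (rule always_eventually, rule allI)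
      fix k
      define r where "r = norm (x k)"
      have r: "r > 0" using xk[of k] unfolding r_def by linarith
      have eqr: "r\<^sup>2 - (norm (x k - fst z))\<^sup>2 = 2 * (x k \<bullet> fst z) - (norm (fst z))\<^sup>2"
        unfolding r_def power2_norm_eq_inner by (simp add: inner_diff_left inner_diff_right inner_commute[of "fst z" "x k"])
      have "\<bar>x k \<bullet> fst z\<bar> \<le> r * norm (fst z)" unfolding r_def by (rule Cauchy_Schwarz_ineq2)
      then have cs: "x k \<bullet> fst z \<le> r * norm (fst z)" "- (x k \<bullet> fst z) \<le> r * norm (fst z)" by (simp_all add: abs_le_iff)
      have "\<bar>r\<^sup>2 - (norm (x k - fst z))\<^sup>2\<bar> \<le> 2 * (r * norm (fst z)) + (norm (fst z))\<^sup>2"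
        by (rule abs_leI) (use eqr cs zero_le_power2[of "norm (fst z)"] in linarith)+
      moreover have "\<delta> k \<le> 1 / r\<^sup>2" using \<delta>x[of k] r by (simp add: r_def[symmetric] pos_le_divide_eq)
      ultimately have "\<delta> k * \<bar>r\<^sup>2 - (norm (x k - fst z))\<^sup>2\<bar> \<le> (1 / r\<^sup>2) * (2 * (r * norm (fst z)) + (norm (fst z))\<^sup>2)"
        using \<delta>0[of k] by (intro mult_mono) auto
      also have "\<dots> = 2 * norm (fst z) * (1 / r) + (norm (fst z))\<^sup>2 * (1 / r)\<^sup>2" using r by (simp add: field_simps power2_eq_square)
      finally show "norm (E k z) \<le> 2 * norm (fst z) * (1 / norm (x k)) + (norm (fst z))\<^sup>2 * (1 / norm (x k))\<^sup>2"
        using \<delta>0[of k] by (simp add: E_def r_def abs_mult)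
    qed
  qed
  have qlim: "(\<lambda>k. q k z) \<longlonglongrightarrow> 1" for z
  proof -
    have "(\<lambda>k. q k z) \<longlonglongrightarrow> 1 powr (s / 2) * 1 powr (b / 2) * exp (4 * pi\<^sup>2 * 0)"
      unfolding q by (intro tendsto_mult tendsto_powr tendsto_exp tendsto_const Elim jap_quotient_tendsto xinf xxinf) simp_all
    then show ?thesis by simp
  qed
  \<comment> \<open>The polynomial weight is moved into the density, so that the remaining factor is
    bounded by \<open>K\<close> and \<open>tendsto_integral_mult\<close> applies.\<close>
  define \<rho>' where "\<rho>' z = of_real ((1 + norm z) ^ m) * \<rho> z" for z
  have [measurable]: "q k \<in> borel_measurable borel" for k unfolding q_def[abs_def] by measurable
  have \<rho>': "integrable lborel \<rho>'"
  proof (rule Bochner_Integration.integrable_bound[OF \<rho>])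
    show "\<rho>' \<in> borel_measurable lborel" unfolding \<rho>'_def[abs_def] by measurable
    show "AE z in lborel. norm (\<rho>' z) \<le> norm ((1 + norm z) ^ nat \<lceil>s + b\<rceil> * norm (\<rho> z))"
      by (intro AE_I2) (simp add: \<rho>'_def m_def norm_mult abs_mult del: of_real_power)
  qed
  have wpos: "(1 + norm z) ^ m > 0" for z :: "'a \<times> 'a" by (simp add: add_pos_nonneg)
  have L: "(\<lambda>k. LINT z|lborel. \<rho>' z * of_real (q k z / (1 + norm z) ^ m)) \<longlonglongrightarrow> (LINT z|lborel. \<rho>' z * of_real (1 / (1 + norm z) ^ m))"
  proof (rule tendsto_integral_mult[OF \<rho>'])
    show "norm (complex_of_real (q k z / (1 + norm z) ^ m)) \<le> K" for k z
    proof -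
      have "\<bar>q k z / (1 + norm z) ^ m\<bar> = q k z / (1 + norm z) ^ m"
        by (rule abs_of_nonneg) (rule divide_nonneg_nonneg[OF q0 less_imp_le[OF wpos]])
      also have "\<dots> \<le> K" unfolding pos_divide_le_eq[OF wpos] by (rule qle)
      finally show ?thesis by (simp only: norm_of_real)
    qed
    show "(\<lambda>k. complex_of_real (q k z / (1 + norm z) ^ m)) \<longlonglongrightarrow> of_real (1 / (1 + norm z) ^ m)" for z
      by (intro tendsto_of_real tendsto_divide qlim tendsto_const) (metis less_irrefl wpos)
  qed measurable
  have g: "(of_real a * r) * of_real (t / a) = r * of_real t" if "a \<noteq> 0" for a t :: real and r :: complex
    using that by simp
  have e: "\<rho>' z * of_real (t / (1 + norm z) ^ m) = \<rho> z * of_real t" for t z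
    unfolding \<rho>'_def by (rule g) (metis less_irrefl wpos)
  have "(\<lambda>k. LINT z|lborel. \<rho> z * of_real (q k z)) \<longlonglongrightarrow> (LINT z|lborel. \<rho> z)"
    using L unfolding e by simp
  then have "(\<lambda>k. norm (LINT z|lborel. \<rho> z * of_real (q k z))) \<longlonglongrightarrow> \<kappa>" unfolding \<kappa>_def by (rule tendsto_norm)
  moreover have "norm (LINT z|lborel. \<rho> z * of_real (q k z)) \<le> \<kappa> / 2" for k
  proof -
    define w where "w = diag_weight s b (\<delta> k) (x k, x k)"
    have w: "w > 0" unfolding w_def by (rule diag_weight_pos)
    have "(LINT z|lborel. \<rho> z * of_real (q k z)) = (LINT z|lborel. \<rho> z * of_real (diag_weight s b (\<delta> k) (z - (x k, x k))) * of_real (1 / w))"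
      unfolding q_def w_def by (intro Bochner_Integration.integral_cong refl) simp
    also have "\<dots> = (LINT z|lborel. \<rho> z * of_real (diag_weight s b (\<delta> k) (z - (x k, x k)))) * of_real (1 / w)"
      by (rule integral_mult_left_zero)
    finally have "norm (LINT z|lborel. \<rho> z * of_real (q k z)) = norm (LINT z|lborel. \<rho> z * of_real (diag_weight s b (\<delta> k) (z - (x k, x k)))) / w"
      using w by (simp add: norm_mult norm_divide)
    then show ?thesis using small[of k] w by (simp add: w_def[symmetric] divide_le_eq)
  qed
  ultimately have "\<kappa> \<le> \<kappa> / 2" by (intro LIMSEQ_le_const2) auto
  then show False using \<kappa> by (simp add: \<kappa>_def)
qed

text \<open>Where \<open>\<delta> * (norm x)\<^sup>2 \<le> 1\<close> the exponential is bounded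
  below and the pure power \<open>- (s + b)\<close> remains. The number
  \<open>8 * pi\<^sup>2\<close> reflects that \<open>(x, x)\<close> has squared norm
  \<open>2 * (norm x)\<^sup>2\<close>.\<close>

lemma diag_weight_ge:
  fixes x :: "'a::euclidean_space"
  assumes s: "s > 0" and b: "b > 0" and x: "1 \<le> norm x" and \<delta>: "\<delta> * (norm x)\<^sup>2 \<le> 1"
  shows "exp (- (4 * pi\<^sup>2)) * (1 + 8 * pi\<^sup>2) powr (- (s + b) / 2) * norm x powr (- (s + b)) \<le> diag_weight s b \<delta> (x, x)"
proof -
  define A where "A = (1 + 8 * pi\<^sup>2) * (norm x)\<^sup>2"
  have x2: "1 \<le> (norm x)\<^sup>2" using x by simp
  have n: "(norm (x, x))\<^sup>2 = 2 * (norm x)\<^sup>2" by (simp add: norm_Pair)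
  have 1: "jap (x, x) \<le> A" unfolding jap_def n A_def using x2 by (simp add: algebra_simps)
  have 2: "jap x \<le> A" unfolding jap_def A_def using x2 by (simp add: algebra_simps add_increasing2)
  have "exp (- (4 * pi\<^sup>2)) * (1 + 8 * pi\<^sup>2) powr (- (s + b) / 2) * norm x powr (- (s + b)) = A powr (- s / 2) * A powr (- b / 2) * exp (- (4 * pi\<^sup>2))"
  proof -
    have "(norm x)\<^sup>2 = norm x powr 2" using x by simp
    moreover have "2 * (- (s + b) / 2) = - (s + b)" by (simp add: field_simps)
    ultimately have "((norm x)\<^sup>2) powr (- (s + b) / 2) = norm x powr (- (s + b))" by (simp only: powr_powr)
    then have AA: "A powr (- (s + b) / 2) = (1 + 8 * pi\<^sup>2) powr (- (s + b) / 2) * norm x powr (- (s + b))"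
      unfolding A_def powr_mult by (simp only:)
    have A12: "A powr (- s / 2) * A powr (- b / 2) = A powr (- (s + b) / 2)" unfolding powr_add[symmetric] by (simp add: field_simps)
    show ?thesis unfolding A12 AA by (simp only: mult_ac)
  qed
  also have "\<dots> \<le> diag_weight s b \<delta> (x, x)"
    unfolding diag_weight_def fst_conv
  proof (intro mult_mono)
    show "A powr (- s / 2) \<le> jap (x, x) powr (- s / 2)" using 1 s by (intro powr_mono2') auto
    show "A powr (- b / 2) \<le> jap x powr (- b / 2)" using 2 b by (intro powr_mono2') auto
    have "4 * pi\<^sup>2 * (\<delta> * (norm x)\<^sup>2) \<le> 4 * pi\<^sup>2 * 1" by (intro mult_left_mono \<delta>) simp
    then show "exp (- (4 * pi\<^sup>2)) \<le> exp (- (\<delta> * (4 * pi\<^sup>2 * (norm x)\<^sup>2)))" by (simp add: mult_ac)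
  qed auto
  finally show ?thesis .
qed

text \<open>The weight is submultiplicative, by
  \<open>1 + norm z \<le> (1 + norm y) * (1 + norm (z - y))\<close>, so it distributes over the two
  factors of the convolution.\<close>

lemma integrable_convol_weight:
  fixes f g :: "'a::euclidean_space \<Rightarrow> complex"
  assumes f: "integrable lborel f" and g: "integrable lborel g"
    and wf: "integrable lborel (\<lambda>y. (1 + norm y) ^ m * norm (f y))"
    and wg: "integrable lborel (\<lambda>y. (1 + norm y) ^ m * norm (g y))"
  shows "integrable lborel (\<lambda>z. (1 + norm z) ^ m * norm (convol f g z))"
proof (rule integrableI_bounded)
  have [measurable]: "f \<in> borel_measurable borel" "g \<in> borel_measurable borel" "convol f g \<in> borel_measurable borel"
    using f g integrable_convol[OF f g] by auto
  define w where "w z = (1 + norm z) ^ m" for z :: 'a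
  have w0: "0 \<le> w z" for z by (simp add: w_def)
  have [measurable]: "w \<in> borel_measurable borel" unfolding w_def[abs_def] by measurable
  have ww: "w z \<le> w y * w (z - y)" for z y
  proof -
    have "norm z \<le> norm y + norm (z - y)" using norm_triangle_ineq[of y "z - y"] by simp
    moreover have "0 \<le> norm y * norm (z - y)" by simp
    ultimately have "1 + norm z \<le> (1 + norm y) * (1 + norm (z - y))"
      unfolding distrib_left distrib_right by linarith
    then have "(1 + norm z) ^ m \<le> ((1 + norm y) * (1 + norm (z - y))) ^ m" by (rule power_mono) simp
    then show ?thesis by (simp only: w_def power_mult_distrib)
  qed
  define A where "A y = ennreal (w y * norm (f y))" for y
  define B where "B y = ennreal (w y * norm (g y))" for y
  have [measurable]: "A \<in> borel_measurable borel" "B \<in> borel_measurable borel" unfolding A_def[abs_def] B_def[abs_def] by measurable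
  have fin: "(\<integral>\<^sup>+y. A y \<partial>lborel) < \<infinity>" "(\<integral>\<^sup>+y. B y \<partial>lborel) < \<infinity>"
    using wf wg by (simp_all add: integrable_iff_bounded A_def B_def w_def abs_mult)
  have "(\<integral>\<^sup>+z. norm (w z * norm (convol f g z)) \<partial>lborel) \<le> (\<integral>\<^sup>+z. \<integral>\<^sup>+y. A y * B (z - y) \<partial>lborel \<partial>lborel)"
  proof (rule nn_integral_mono)
    fix z
    have "ennreal (norm (w z * norm (convol f g z))) = ennreal (w z) * ennreal (norm (convol f g z))"
      by (simp add: ennreal_mult[symmetric] w0 abs_mult)
    also have "\<dots> \<le> ennreal (w z) * (\<integral>\<^sup>+y. norm (f y * g (z - y)) \<partial>lborel)"
      unfolding convol_def by (intro mult_left_mono norm_integral_le_nn_integral) simp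
    also have "\<dots> = (\<integral>\<^sup>+y. ennreal (w z) * norm (f y * g (z - y)) \<partial>lborel)" by (rule nn_integral_cmult[symmetric]) measurable
    also have "\<dots> \<le> (\<integral>\<^sup>+y. A y * B (z - y) \<partial>lborel)"
    proof (rule nn_integral_mono)
      fix y
      have "w z * norm (f y * g (z - y)) \<le> (w y * w (z - y)) * norm (f y * g (z - y))" by (rule mult_right_mono[OF ww]) simp
      also have "\<dots> = (w y * norm (f y)) * (w (z - y) * norm (g (z - y)))" by (simp add: norm_mult)
      finally show "ennreal (w z) * norm (f y * g (z - y)) \<le> A y * B (z - y)"
        unfolding A_def B_def by (simp add: ennreal_mult[symmetric] w0 ennreal_leI)
    qed
    finally show "ennreal (norm (w z * norm (convol f g z))) \<le> (\<integral>\<^sup>+y. A y * B (z - y) \<partial>lborel)" .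
  qed
  also have "\<dots> = (\<integral>\<^sup>+y. \<integral>\<^sup>+z. A y * B (z - y) \<partial>lborel \<partial>lborel)" by (rule nn_integral_lborel_swap) measurable
  also have "\<dots> = (\<integral>\<^sup>+y. A y * (\<integral>\<^sup>+z. B z \<partial>lborel) \<partial>lborel)"
    by (intro nn_integral_cong) (simp add: nn_integral_cmult nn_integral_lborel_translate(2)[of B])
  also have "\<dots> < \<infinity>" using fin by (simp add: nn_integral_multc ennreal_mult_less_top)
  finally show "(\<integral>\<^sup>+z. ennreal (norm ((1 + norm z) ^ m * norm (convol f g z))) \<partial>lborel) < \<infinity>" by (simp only: w_def)
  show "(\<lambda>z. (1 + norm z) ^ m * norm (convol f g z)) \<in> borel_measurable lborel" by measurable
qed

text \<open>The transforms of the inputs multiply to a Gaussian on the product space, and with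
  \<open>fourier \<Theta>\<close> to the transform of \<open>convol \<Theta> (cgauss 1)\<close>; the
  character in \<open>x\<close> translates this function along the diagonal. The multiplication
  formula then moves the transform onto \<open>F\<close>, so the output averages
  \<open>fourier F\<close> near \<open>- (x, x)\<close>.\<close>

lemma norm_Tm_gaussian:
  fixes F \<Theta> :: "(real^'n) \<times> (real^'n) \<Rightarrow> complex"
  assumes F: "integrable lborel F" and \<Theta>: "integrable lborel \<Theta>"
  shows "norm (Tm (\<lambda>\<xi>. F (\<xi> - \<zeta>) * fourier \<Theta> \<xi>) (gmod 0 1) (gmod 0 1) x)
    = norm (LINT z|lborel. cis (- 2 * pi * (z \<bullet> \<zeta>)) * convol \<Theta> (cgauss 1) z * fourier F (z - (x, x)))"
proof -
  have i1: "integrable lborel (cgauss 1 :: (real^'n) \<times> (real^'n) \<Rightarrow> complex)" by (rule integrable_cgauss) simp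
  define W where "W = convol \<Theta> (cgauss 1)"
  have W: "integrable lborel W" unfolding W_def by (rule integrable_convol[OF \<Theta> i1])
  have fW: "fourier W \<xi> = fourier \<Theta> \<xi> * cgauss 1 \<xi>" for \<xi>
    unfolding W_def fourier_convol[OF \<Theta> i1] using fourier_cgauss_of_real[of 1 \<xi>] by simp
  define V where "V z = W (z - (- (x, x)))" for z
  have V: "integrable lborel V" unfolding V_def using W by (simp add: integrable_lborel_translate del: diff_minus_eq_add)
  have F': "integrable lborel (\<lambda>\<xi>. F (\<xi> - \<zeta>))" using F by (simp add: integrable_lborel_translate)
  have fV: "fourier V \<xi> = cis (2 * pi * (x \<bullet> (fst \<xi> + snd \<xi>))) * (fourier \<Theta> \<xi> * cgauss 1 \<xi>)" for \<xi>
  proof -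
    have "- 2 * pi * ((- (x, x)) \<bullet> \<xi>) = 2 * pi * (x \<bullet> (fst \<xi> + snd \<xi>))" by (cases \<xi>) (simp add: inner_add_right algebra_simps)
    then show ?thesis unfolding V_def[abs_def] fourier_translate fW by (simp only:)
  qed
  have o: "(1::complex) powr w = 1" for w by simp
  have "Tm (\<lambda>\<xi>. F (\<xi> - \<zeta>) * fourier \<Theta> \<xi>) (gmod 0 1) (gmod 0 1) x
     = (1 powr (of_real (- real CARD('n) / 2)) * 1 powr (of_real (- real CARD('n) / 2)))
      * (LINT \<xi>|lborel. cgauss (1 / 1) (fst \<xi> - 0) * cgauss (1 / 1) (snd \<xi> - 0) * (F (\<xi> - \<zeta>) * fourier \<Theta> \<xi>) * cis (2 * pi * (x \<bullet> (fst \<xi> + snd \<xi>))))"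
    by (rule Tm_gmod_eq) simp_all
  also have "\<dots> = (LINT \<xi>|lborel. F (\<xi> - \<zeta>) * fourier V \<xi>)"
    unfolding o mult_1_left
  proof (rule Bochner_Integration.integral_cong[OF refl])
    fix \<xi> :: "(real^'n) \<times> (real^'n)"
    have "cgauss 1 \<xi> = cgauss 1 (fst \<xi>) * cgauss 1 (snd \<xi>)" using cgauss_Pair[of 1 "fst \<xi>" "snd \<xi>"] by simp
    then show "cgauss (1 / 1) (fst \<xi> - 0) * cgauss (1 / 1) (snd \<xi> - 0) * (F (\<xi> - \<zeta>) * fourier \<Theta> \<xi>) * cis (2 * pi * (x \<bullet> (fst \<xi> + snd \<xi>)))
       = F (\<xi> - \<zeta>) * fourier V \<xi>"
      unfolding fV diff_zero div_by_1 by (simp only: mult_ac)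
  qed
  also have "\<dots> = (LINT z|lborel. fourier (\<lambda>\<xi>. F (\<xi> - \<zeta>)) z * V z)" by (rule fourier_multiplication_formula[OF F' V])
  also have "\<dots> = (LINT z|lborel. fourier (\<lambda>\<xi>. F (\<xi> - \<zeta>)) (z - (x, x)) * V (z - (x, x)))"
    by (rule integral_lborel_translate(2)[symmetric])
  also have "\<dots> = (LINT z|lborel. cis (2 * pi * (\<zeta> \<bullet> (x, x))) * (cis (- 2 * pi * (z \<bullet> \<zeta>)) * W z * fourier F (z - (x, x))))"
  proof (rule Bochner_Integration.integral_cong[OF refl])
    fix z :: "(real^'n) \<times> (real^'n)"
    have "- 2 * pi * (\<zeta> \<bullet> (z - (x, x))) = 2 * pi * (\<zeta> \<bullet> (x, x)) + - 2 * pi * (z \<bullet> \<zeta>)"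
      by (simp add: inner_diff_right inner_commute[of z \<zeta>] algebra_simps)
    then have "cis (- 2 * pi * (\<zeta> \<bullet> (z - (x, x)))) = cis (2 * pi * (\<zeta> \<bullet> (x, x))) * cis (- 2 * pi * (z \<bullet> \<zeta>))" by (simp only: cis_mult)
    moreover have "V (z - (x, x)) = W z" unfolding V_def diff_minus_eq_add diff_add_cancel ..
    ultimately show "fourier (\<lambda>\<xi>. F (\<xi> - \<zeta>)) (z - (x, x)) * V (z - (x, x))
       = cis (2 * pi * (\<zeta> \<bullet> (x, x))) * (cis (- 2 * pi * (z \<bullet> \<zeta>)) * W z * fourier F (z - (x, x)))"
      unfolding fourier_translate by (simp only: mult_ac)
  qed
  also have "\<dots> = cis (2 * pi * (\<zeta> \<bullet> (x, x))) * (LINT z|lborel. cis (- 2 * pi * (z \<bullet> \<zeta>)) * W z * fourier F (z - (x, x)))"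
    by (rule integral_mult_right_zero)
  finally show ?thesis by (simp add: norm_mult W_def)
qed

theorem Hoermander_bound_imp_s_gt_dual:
  fixes \<Theta> :: "(real^'n) \<times> (real^'n) \<Rightarrow> complex"
  assumes Theta: "schwartz \<Theta>"
    and supp: "\<And>\<xi>. fourier \<Theta> \<xi> \<noteq> 0 \<Longrightarrow> 1/2 \<le> norm \<xi> \<and> norm \<xi> \<le> 2"
    and p: "p > 0" "p1 > 0" "p2 > 0" and u: "1 < u" and s: "0 < s"
    and bound: "Hoermander_bound \<Theta> u s p p1 p2"
    and gt: "2 / u < s / real CARD('n)"
  shows "1 / p - (1 - 1 / u) < s / real CARD('n)"
proof (rule ccontr)
  define d where "d = real CARD('n)"
  have d: "d > 0" by (simp add: d_def)
  assume "\<not> 1 / p - (1 - 1 / u) < s / real CARD('n)"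
  then have le: "s / d \<le> 1 / p - (1 - 1 / u)" by (simp add: d_def)
  have u0: "u > 0" using u by simp
  define b where "b = d - d / u"
  have b: "b > 0" unfolding b_def using u d by (simp add: divide_less_eq)
  \<comment> \<open>The negated conclusion in the form used below: an output of size
    \<open>norm x powr (- (s + b))\<close> decays no faster than the critical power
    \<open>norm x powr (- d / p)\<close>.\<close>
  have sb: "s + b \<le> d / p"
  proof -
    have "d * (s / d) \<le> d * (1 / p - (1 - 1 / u))" by (rule mult_left_mono[OF le]) (use d in simp)
    then show ?thesis using d by (simp add: b_def algebra_simps)
  qed
  \<comment> \<open>Here the first strict inequality enters:
    \<open>1 / p \<ge> s / d + 1 - 1 / u\<close>, and \<open>s / d > 2 / u\<close> makes the right
    side exceed 1.\<close>
  have plt: "p < 1"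
  proof -
    have "1 / u > 0" "2 / u = 2 * (1 / u)" using u0 by simp_all
    then have "1 / p > 1" using le gt unfolding d_def[symmetric] by linarith
    then show ?thesis using p by (simp add: field_simps)
  qed
  have \<Theta>: "integrable lborel \<Theta>" by (rule integrable_schwartz[OF Theta])
  obtain \<zeta> where \<zeta>: "fourier \<Theta> \<zeta> \<noteq> 0" by (rule fourier_Theta_nonzero[OF p u0 bound])
  obtain C where C: "C > 0" and TC: "\<And>F G B f1 f2 K1 K2. bessel_rep s F G \<Longrightarrow> 0 < B \<Longrightarrow>
       (\<integral>\<^sup>+\<xi>. norm (G \<xi>) powr u \<partial>lborel) \<le> ennreal (B powr u) \<Longrightarrow> bounded (range F) \<Longrightarrow>
       schwartz f1 \<Longrightarrow> schwartz f2 \<Longrightarrow> Lp_norm p1 f1 \<le> ennreal K1 \<Longrightarrow> Lp_norm p2 f2 \<le> ennreal K2 \<Longrightarrow>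
       0 \<le> K1 \<Longrightarrow> 0 \<le> K2 \<Longrightarrow>
       (\<integral>\<^sup>+x. norm (Tm (\<lambda>\<xi>. F \<xi> * fourier \<Theta> \<xi>) f1 f2 x) powr p \<partial>lborel) \<le> ennreal ((C * B * K1 * K2) powr p)"
    by (rule Tm_localized_bound[OF Theta supp s u p(1) bound]) (assumption, rule that)
  note [measurable] = borel_measurable_fst_snd
  have i1: "integrable lborel (cgauss 1 :: (real^'n) \<times> (real^'n) \<Rightarrow> complex)" by (rule integrable_cgauss) simp
  define W where "W = convol \<Theta> (cgauss 1)"
  have W: "integrable lborel W" unfolding W_def by (rule integrable_convol[OF \<Theta> i1])
  have [measurable]: "W \<in> borel_measurable borel" using W by auto
  define \<rho>0 where "\<rho>0 z = W z * cis (- 2 * pi * (z \<bullet> \<zeta>))" for z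
  have \<rho>0: "integrable lborel \<rho>0" unfolding \<rho>0_def by (rule integrable_cis_mult[OF W]) measurable
  have [measurable]: "\<rho>0 \<in> borel_measurable borel" using \<rho>0 by auto
  have "(LINT z|lborel. \<rho>0 z) = fourier W \<zeta>" by (simp add: \<rho>0_def fourier_def)
  also have "\<dots> = fourier \<Theta> \<zeta> * cgauss 1 \<zeta>"
    unfolding W_def fourier_convol[OF \<Theta> i1] using fourier_cgauss_of_real[of 1 \<zeta>] by simp
  finally have \<rho>0nz: "(LINT z|lborel. \<rho>0 z) \<noteq> 0" using \<zeta> by (simp add: cgauss_def)
  \<comment> \<open>The Gaussian cutoff in \<open>snd \<xi>\<close> multiplies the density by a
    Gaussian in \<open>snd z - fst z\<close>. This tends to 1 with its parameter tending to 0, so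
    some \<open>r > 0\<close> keeps the integral nonzero.\<close>
  have "(\<lambda>k. LINT z|lborel. \<rho>0 z * cgauss (of_real (inverse (real (Suc k)))) (snd z - fst z)) \<longlonglongrightarrow> (LINT z|lborel. \<rho>0 z * 1)"
  proof (rule tendsto_integral_mult[OF \<rho>0])
    show "norm (cgauss (of_real (inverse (real (Suc k)))) (snd z - fst z)) \<le> 1" for k and z :: "(real^'n) \<times> (real^'n)"
      by (rule norm_cgauss_le_1) simp
    fix z :: "(real^'n) \<times> (real^'n)"
    have "(\<lambda>k. cgauss (complex_of_real (inverse (real (Suc k)))) (snd z - fst z)) \<longlonglongrightarrow> cgauss (of_real 0) (snd z - fst z)"
      by (intro tendsto_cgauss tendsto_of_real LIMSEQ_inverse_real_of_nat tendsto_const)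
    then show "(\<lambda>k. cgauss (complex_of_real (inverse (real (Suc k)))) (snd z - fst z)) \<longlonglongrightarrow> 1" by (simp add: cgauss_def)
  qed measurable
  then have "(\<lambda>k. LINT z|lborel. \<rho>0 z * cgauss (of_real (inverse (real (Suc k)))) (snd z - fst z)) \<longlonglongrightarrow> (LINT z|lborel. \<rho>0 z)" by simp
  from tendsto_imp_eventually_ne[OF this \<rho>0nz]
  obtain k where "(LINT z|lborel. \<rho>0 z * cgauss (of_real (inverse (real (Suc k)))) (snd z - fst z)) \<noteq> 0"
    by (meson eventually_happens' sequentially_bot)
  then obtain r where r: "r > 0" and nz: "(LINT z|lborel. \<rho>0 z * cgauss (of_real r) (snd z - fst z)) \<noteq> 0"
    by (intro that[of "inverse (real (Suc k))"]) auto
  define \<rho> where "\<rho> z = \<rho>0 z * cgauss (of_real r) (snd z - fst z)" for z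
  have m\<rho>[measurable]: "\<rho> \<in> borel_measurable borel" unfolding \<rho>_def[abs_def] by measurable
  define m where "m = nat \<lceil>s + b\<rceil>"
  have wW: "integrable lborel (\<lambda>z. (1 + norm z) ^ m * norm (W z))"
  proof -
    have g: "cgauss 1 = (gmod 0 1 :: (real^'n) \<times> (real^'n) \<Rightarrow> complex)" by (simp add: gmod_def fun_eq_iff)
    have sg: "schwartz (gmod 0 1 :: (real^'n) \<times> (real^'n) \<Rightarrow> complex)" by (rule schwartz_gmod) simp
    show ?thesis unfolding W_def
      by (rule integrable_convol_weight[OF \<Theta> i1 integrable_schwartz_weight[OF Theta]]) (use integrable_schwartz_weight[OF sg, of m] in \<open>simp only: g\<close>)
  qed
  have w\<rho>: "integrable lborel (\<lambda>z. (1 + norm z) ^ nat \<lceil>s + b\<rceil> * norm (\<rho> z))"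
    unfolding m_def[symmetric]
  proof (rule Bochner_Integration.integrable_bound[OF wW])
    show "AE z in lborel. norm ((1 + norm z) ^ m * norm (\<rho> z)) \<le> norm ((1 + norm z) ^ m * norm (W z))"
    proof (rule AE_I2)
      fix z :: "(real^'n) \<times> (real^'n)"
      have "norm (cgauss (of_real r) (snd z - fst z)) \<le> 1" using r by (intro norm_cgauss_le_1) simp
      then have "norm (W z) * norm (cgauss (of_real r) (snd z - fst z)) \<le> norm (W z) * 1" by (rule mult_left_mono) simp
      then have "norm (\<rho> z) \<le> norm (W z)" by (simp add: \<rho>_def \<rho>0_def norm_mult)
      then have "(1 + norm z) ^ m * norm (\<rho> z) \<le> (1 + norm z) ^ m * norm (W z)" by (rule mult_left_mono) simp
      then show "norm ((1 + norm z) ^ m * norm (\<rho> z)) \<le> norm ((1 + norm z) ^ m * norm (W z))" by (simp add: abs_mult)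
    qed
  qed measurable
  have nz\<rho>: "(LINT z|lborel. \<rho> z) \<noteq> 0" using nz by (simp add: \<rho>_def)
  obtain R where R: "R \<ge> 1" "\<And>\<delta> x. 0 \<le> \<delta> \<Longrightarrow> R \<le> norm x \<Longrightarrow> \<delta> * (norm x)\<^sup>2 \<le> 1 \<Longrightarrow>
    norm (LINT z|lborel. \<rho> z) / 2 * diag_weight s b \<delta> (x, x) \<le> norm (LINT z|lborel. \<rho> z * of_real (diag_weight s b \<delta> (z - (x, x))))"
    by (rule diag_weight_average[OF s b m\<rho> w\<rho> nz\<rho>]) (rule that)
  \<comment> \<open>The pointwise lower bound holds only beyond radius \<open>R\<close>; the first
    \<open>k0\<close> dyadic shells are given up.\<close>
  obtain k0 :: nat where k0: "R < 2 ^ k0" using real_arch_pow[of 2 R] by auto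
  define Q where "Q = (cgauss (of_real (1 / r)) :: real^'n \<Rightarrow> complex)"
  have Q: "integrable lborel Q" unfolding Q_def by (rule integrable_cgauss) (use r in simp)
  have [measurable]: "Q \<in> borel_measurable borel" using Q by auto
  define cQ where "cQ = (1 / r) powr (- d / 2)"
  have cQ: "cQ > 0" using r by (simp add: cQ_def)
  have fQ: "fourier Q y = of_real cQ * cgauss (of_real r) y" for y
    using fourier_cgauss_of_real[of "1 / r" y] r by (simp add: Q_def cQ_def d_def)
  define kQ where "kQ = (u / r) powr (- d / (2 * u))"
  have kQ: "kQ > 0" using u r by (simp add: kQ_def)
  have Qu: "(\<integral>\<^sup>+y. norm (Q y) powr u \<partial>lborel) = ennreal (kQ powr u)"
  proof -
    have "(\<integral>\<^sup>+y. norm (Q y) powr u \<partial>lborel) = (\<integral>\<^sup>+y. ennreal (exp (- (pi * (u / r) * (norm y)\<^sup>2))) \<partial>(lborel :: (real^'n) measure))"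
      unfolding Q_def norm_cgauss by (intro nn_integral_cong) (simp add: powr_def mult_ac)
    also have "\<dots> = ennreal ((u / r) powr (- d / 2))"
    proof -
      have "u / r > 0" using u r by simp
      from nn_integral_gaussian[OF this, where 'a="real^'n"] show ?thesis by (simp add: d_def)
    qed
    also have "(u / r) powr (- d / 2) = kQ powr u" unfolding kQ_def powr_powr using u by simp
    finally show ?thesis .
  qed
  have b_eq: "b = real DIM(real^'n) - real DIM(real^'n) / u" by (simp add: b_def d_def)
  obtain C1 where C1: "C1 > 0" "\<And>N::nat. N \<ge> 1 \<Longrightarrow>
    (\<integral>\<^sup>+\<xi>. norm (bessel_heat b (1 / 4 ^ N) (\<xi>::real^'n)) powr u \<partial>lborel) \<le> ennreal ((C1 * real N) powr u)"
    by (rule bessel_heat_powr_integral[OF u b_eq]) (rule that)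
  obtain J where J: "J > 0" "\<And>N::nat. annulus_mass 1 (2 ^ N) TYPE(real^'n) = ennreal (real N * J)"
    by (rule annulus_mass_dyadic[where 'a="real^'n"]) (rule that)
  define c1 where "c1 = exp (- (4 * pi\<^sup>2)) * (1 + 8 * pi\<^sup>2) powr (- (s + b) / 2)"
  have pp: "1 + 8 * pi\<^sup>2 > 0" by (simp add: add_pos_nonneg)
  have c1: "c1 > 0" unfolding c1_def using pp by simp
  define c2 where "c2 = cQ * (norm (LINT z|lborel. \<rho> z) / 2) * c1"
  have c2: "c2 > 0" using cQ c1 nz\<rho> by (simp add: c2_def)
  define K1 where "K1 = p1 powr (- d / (2 * p1))"
  define K2 where "K2 = p2 powr (- d / (2 * p2))"
  have L1: "Lp_norm p1 (gmod 0 1 :: real^'n \<Rightarrow> complex) \<le> ennreal K1"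
    using Lp_norm_gmod[of 1 p1 "0::real^'n"] p by (simp add: K1_def d_def)
  have L2: "Lp_norm p2 (gmod 0 1 :: real^'n \<Rightarrow> complex) \<le> ennreal K2"
    using Lp_norm_gmod[of 1 p2 "0::real^'n"] p by (simp add: K2_def d_def)
  have K0: "0 \<le> K1" "0 \<le> K2" by (simp_all add: K1_def K2_def)
  define C3 where "C3 = C * (C1 * kQ) * K1 * K2"
  have C3: "0 \<le> C3" using C C1 kQ K0 by (simp add: C3_def)
  have sg: "schwartz (gmod 0 1 :: real^'n \<Rightarrow> complex)" by (rule schwartz_gmod) simp
  have main: "c2 powr p * J / 2 * real N powr 1 \<le> C3 powr p * real N powr p" if N: "N \<ge> 2 * k0 + 1" for N :: nat
  proof -
    have N1: "N \<ge> 1" using N by simp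
    \<comment> \<open>This places the cutoff of the transform at radius \<open>2 ^ N\<close>, the
      outer edge of the last shell used.\<close>
    define \<delta> where "\<delta> = (1 / 4 ^ N :: real)"
    have \<delta>: "\<delta> > 0" by (simp add: \<delta>_def)
    define P where "P = (bessel_heat b \<delta> :: real^'n \<Rightarrow> complex)"
    have P: "integrable lborel P" unfolding P_def by (rule integrable_bessel_heat[OF b \<delta>])
    have [measurable]: "P \<in> borel_measurable borel" using P by auto
    \<comment> \<open>Concentrated along \<open>fst \<xi> + snd \<xi> = 0\<close>, with a fixed
      Gaussian in the complementary variable to make it integrable. On the diagonal the transform of
      \<open>Q\<close> is evaluated at 0, so it causes no decay there.\<close>
    define g where "g \<xi> = P (fst \<xi> + snd \<xi>) * Q (snd \<xi>)" for \<xi>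
    have g: "integrable lborel g" unfolding g_def by (rule integrable_shear[OF P Q])
    have fg: "fourier g y = fourier P (fst y) * fourier Q (snd y - fst y)" for y unfolding g_def by (rule fourier_shear[OF P Q])
    have gb: "norm (g \<xi>) \<le> (4 * pi * \<delta>) powr (- d / 2) * 1" for \<xi>
      unfolding g_def norm_mult
    proof (rule mult_mono)
      show "norm (P (fst \<xi> + snd \<xi>)) \<le> (4 * pi * \<delta>) powr (- d / 2)"
        using norm_bessel_heat_le[OF b \<delta>, of "fst \<xi> + snd \<xi>"] by (simp add: P_def d_def)
      show "norm (Q (snd \<xi>)) \<le> 1" unfolding Q_def by (rule norm_cgauss_le_1) (use r in simp)
    qed simp_all
    define F where "F = convol (\<lambda>\<xi>. of_real (bessel_ker s \<xi>)) g"
    have rep: "bessel_rep s F g" unfolding F_def by (rule bessel_rep_convol[OF s g])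
    have iF: "integrable lborel F" using rep by (simp add: bessel_rep_def)
    have Fb: "norm (F \<xi>) \<le> (4 * pi * \<delta>) powr (- d / 2) * 1" for \<xi> unfolding F_def by (rule norm_convol_bessel_le[OF s gb])
    have fF: "fourier F y = of_real (diag_weight s b \<delta> y * cQ) * cgauss (of_real r) (snd y - fst y)" for y
    proof -
      have "fourier F y = of_real (jap y powr (- s / 2)) * fourier g y"
        unfolding F_def fourier_convol[OF integrable_bessel_ker[OF s] g] fourier_bessel_ker[OF s] ..
      then show ?thesis unfolding fg fQ P_def fourier_bessel_heat[OF b \<delta>] diag_weight_def by simp
    qed
    have "(\<integral>\<^sup>+\<xi>. norm (g (\<xi> - \<zeta>)) powr u \<partial>lborel) = (\<integral>\<^sup>+\<xi>. norm (g \<xi>) powr u \<partial>lborel)"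
      by (rule nn_integral_lborel_translate(2)[of "\<lambda>\<xi>. ennreal (norm (g \<xi>) powr u)" \<zeta>]) (use g in auto)
    also have "\<dots> = (\<integral>\<^sup>+\<xi>. ennreal (norm (P (fst \<xi> + snd \<xi>)) powr u) * ennreal (norm (Q (snd \<xi>)) powr u) \<partial>lborel)"
      unfolding g_def norm_mult by (intro nn_integral_cong) (simp add: powr_mult ennreal_mult[symmetric])
    also have "\<dots> = (\<integral>\<^sup>+x. ennreal (norm (P x) powr u) \<partial>lborel) * (\<integral>\<^sup>+y. ennreal (norm (Q y) powr u) \<partial>lborel)"
      by (rule nn_integral_lborel_shear) measurable
    also have "\<dots> \<le> ennreal ((C1 * real N) powr u) * ennreal (kQ powr u)"
      unfolding Qu P_def \<delta>_def by (intro mult_right_mono C1(2)[OF N1]) simp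
    also have "\<dots> = ennreal ((C1 * kQ * real N) powr u)"
      by (simp add: ennreal_mult[symmetric] powr_mult mult_ac)
    finally have LG: "(\<integral>\<^sup>+\<xi>. norm (g (\<xi> - \<zeta>)) powr u \<partial>lborel) \<le> ennreal ((C1 * kQ * real N) powr u)" .
    have B: "C1 * kQ * real N > 0" using C1 kQ N1 by simp
    have upper: "(\<integral>\<^sup>+x. norm (Tm (\<lambda>\<xi>. F (\<xi> - \<zeta>) * fourier \<Theta> \<xi>) (gmod 0 1) (gmod 0 1) x) powr p \<partial>lborel)
        \<le> ennreal ((C * (C1 * kQ * real N) * K1 * K2) powr p)"
    proof (rule TC[OF bessel_rep_translate[OF rep] B LG _ sg sg L1 L2 K0])
      show "bounded (range (\<lambda>\<xi>. F (\<xi> - \<zeta>)))"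
        by (rule boundedI[of _ "(4 * pi * \<delta>) powr (- d / 2) * 1"]) (use Fb in blast)
    qed
    have low: "c2 * norm x powr (- d / p) \<le> norm (Tm (\<lambda>\<xi>. F (\<xi> - \<zeta>) * fourier \<Theta> \<xi>) (gmod 0 1) (gmod 0 1) x)"
      if x: "2 ^ k0 < norm x" "norm x \<le> 2 ^ N" for x
    proof -
      have xR: "R \<le> norm x" and x1: "1 \<le> norm x" using x k0 R(1) by linarith+
      have \<delta>x: "\<delta> * (norm x)\<^sup>2 \<le> 1"
      proof -
        have "(norm x)\<^sup>2 \<le> (2 ^ N)\<^sup>2" using x by (intro power_mono) auto
        also have "(2 ^ N)\<^sup>2 = ((2::real)\<^sup>2) ^ N" by (metis power_mult mult.commute)
        also have "\<dots> = 4 ^ N" by simp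
        finally show ?thesis by (simp add: \<delta>_def divide_le_eq)
      qed
      have pt: "cis (- 2 * pi * (z \<bullet> \<zeta>)) * convol \<Theta> (cgauss 1) z * fourier F (z - (x, x)) = of_real cQ * (\<rho> z * of_real (diag_weight s b \<delta> (z - (x, x))))" for z
      proof -
        have e: "snd (z - (x, x)) - fst (z - (x, x)) = snd z - fst z" by simp
        show ?thesis unfolding fF e \<rho>_def \<rho>0_def W_def of_real_mult by (simp only: mult_ac)
      qed
      have T: "norm (Tm (\<lambda>\<xi>. F (\<xi> - \<zeta>) * fourier \<Theta> \<xi>) (gmod 0 1) (gmod 0 1) x) = cQ * norm (LINT z|lborel. \<rho> z * of_real (diag_weight s b \<delta> (z - (x, x))))"
        unfolding norm_Tm_gaussian[OF iF \<Theta>] pt integral_mult_right_zero norm_mult using cQ by simp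
      have "cQ * (norm (LINT z|lborel. \<rho> z) / 2 * (c1 * norm x powr (- d / p))) \<le> cQ * norm (LINT z|lborel. \<rho> z * of_real (diag_weight s b \<delta> (z - (x, x))))"
      proof (rule mult_left_mono)
        have "- d / p \<le> - (s + b)" using sb by simp
        then have "norm x powr (- d / p) \<le> norm x powr (- (s + b))" by (rule powr_mono) (rule x1)
        then have "c1 * norm x powr (- d / p) \<le> c1 * norm x powr (- (s + b))" using c1 by simp
        also have "\<dots> \<le> diag_weight s b \<delta> (x, x)" unfolding c1_def by (rule diag_weight_ge[OF s b x1 \<delta>x])
        finally have "norm (LINT z|lborel. \<rho> z) / 2 * (c1 * norm x powr (- d / p)) \<le> norm (LINT z|lborel. \<rho> z) / 2 * diag_weight s b \<delta> (x, x)"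
          by (rule mult_left_mono) simp
        also have "\<dots> \<le> norm (LINT z|lborel. \<rho> z * of_real (diag_weight s b \<delta> (z - (x, x))))"
          by (rule R(2)[OF less_imp_le[OF \<delta>] xR \<delta>x])
        finally show "norm (LINT z|lborel. \<rho> z) / 2 * (c1 * norm x powr (- d / p)) \<le> norm (LINT z|lborel. \<rho> z * of_real (diag_weight s b \<delta> (z - (x, x))))" .
      qed (use cQ in simp)
      then show ?thesis unfolding T c2_def mult.assoc .
    qed
    have "ennreal (c2 powr p * (real (N - k0) * J)) = ennreal (c2 powr p) * annulus_mass (2 ^ k0) (2 ^ N) TYPE(real^'n)"
    proof -
      have "(2::real) ^ N = 2 ^ k0 * 2 ^ (N - k0)" using N by (simp add: power_add[symmetric])
      then have "annulus_mass (2 ^ k0) (2 ^ N) TYPE(real^'n) = annulus_mass (2 ^ k0 * 1) (2 ^ k0 * 2 ^ (N - k0)) TYPE(real^'n)" by (simp only: mult_1_right)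
      also have "\<dots> = annulus_mass 1 (2 ^ (N - k0)) TYPE(real^'n)" by (rule annulus_mass_scale) simp
      also have "\<dots> = ennreal (real (N - k0) * J)" by (rule J(2))
      finally show ?thesis using J(1) by (simp add: ennreal_mult[symmetric])
    qed
    also have "\<dots> = (\<integral>\<^sup>+x. ennreal (c2 powr p) * ennreal (indicator {2 ^ k0<..2 ^ N} (norm x) * norm x powr (- d)) \<partial>(lborel :: (real^'n) measure))"
    proof -
      have "annulus_mass (2 ^ k0) (2 ^ N) TYPE(real^'n) = (\<integral>\<^sup>+x. ennreal (indicator {2 ^ k0<..2 ^ N} (norm x) * norm x powr (- d)) \<partial>(lborel :: (real^'n) measure))"
        by (simp add: annulus_mass_def d_def)
      then show ?thesis by (simp add: nn_integral_cmult)
    qed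
    also have "\<dots> \<le> (\<integral>\<^sup>+x. norm (Tm (\<lambda>\<xi>. F (\<xi> - \<zeta>) * fourier \<Theta> \<xi>) (gmod 0 1) (gmod 0 1) x) powr p \<partial>lborel)"
    proof (rule nn_integral_mono)
      fix x :: "real^'n"
      show "ennreal (c2 powr p) * ennreal (indicator {2 ^ k0<..2 ^ N} (norm x) * norm x powr (- d)) \<le> ennreal (norm (Tm (\<lambda>\<xi>. F (\<xi> - \<zeta>) * fourier \<Theta> \<xi>) (gmod 0 1) (gmod 0 1) x) powr p)"
      proof (cases "2 ^ k0 < norm x \<and> norm x \<le> 2 ^ N")
        case False
        then show ?thesis by (auto split: split_indicator)
      next
        case True
        have "(c2 * norm x powr (- d / p)) powr p = c2 powr p * norm x powr (- d)"
          using p by (simp add: powr_mult powr_powr)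
        moreover have "(c2 * norm x powr (- d / p)) powr p \<le> norm (Tm (\<lambda>\<xi>. F (\<xi> - \<zeta>) * fourier \<Theta> \<xi>) (gmod 0 1) (gmod 0 1) x) powr p"
          using low[of x] True c2 p by (intro powr_mono2) auto
        ultimately show ?thesis using True by (simp add: ennreal_mult[symmetric] ennreal_leI)
      qed
    qed
    also note upper
    finally have "c2 powr p * (real (N - k0) * J) \<le> (C * (C1 * kQ * real N) * K1 * K2) powr p" by simp
    also have "C * (C1 * kQ * real N) * K1 * K2 = C3 * real N" by (simp add: C3_def)
    also have "(C3 * real N) powr p = C3 powr p * real N powr p" by (rule powr_mult)
    finally have fin: "c2 powr p * (real (N - k0) * J) \<le> C3 powr p * real N powr p" .
    \<comment> \<open>The assumption \<open>N \<ge> 2 * k0 + 1\<close> leaves at least half of the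
      shells.\<close>
    have "real N / 2 \<le> real (N - k0)" using N by linarith
    then have "c2 powr p * (real N / 2 * J) \<le> c2 powr p * (real (N - k0) * J)" using J(1) by (intro mult_left_mono mult_right_mono) auto
    with fin have "c2 powr p * (real N / 2 * J) \<le> C3 powr p * real N powr p" by (rule order_trans[rotated])
    then show ?thesis by (simp add: mult_ac)
  qed
  \<comment> \<open>The integral of the \<open>p\<close>-th power of the output is at least linear
    in \<open>N\<close> by the shells, and at most of order \<open>N powr p\<close> by the norm of
    \<open>g\<close>.\<close>
  have "1 \<le> p"
  proof (rule growth_exponent_le[of "c2 powr p * J / 2" "2 * k0 + 1" 1 "C3 powr p" p])
    show "0 < c2 powr p * J / 2" using c2 J(1) by simp
  qed (rule main)
  then show False using plt by simp
qed

section \<open>The necessary conditions\<close>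

theorem theorem6p9:
  fixes \<Theta> :: "(real^'n) \<times> (real^'n) \<Rightarrow> complex"
    and p p1 p2 u s :: real
  assumes Theta: "schwartz \<Theta>"
    and Theta_supp: "\<And>\<xi>. fourier \<Theta> \<xi> \<noteq> 0 \<Longrightarrow> 1/2 \<le> norm \<xi> \<and> norm \<xi> \<le> 2"
    and p1: "1 < p1" and p2: "1 < p2"
    and p: "1 / p = 1 / p1 + 1 / p2"
    and u: "1 < u"
    and s: "0 < s"
    and bound: "\<exists>C::real. \<forall>m. m \<in> borel_measurable lborel \<and> bounded (range m) \<and> Aus \<Theta> u s m < \<infinity> \<longrightarrow>
                  (\<forall>f1 f2. schwartz f1 \<and> schwartz f2 \<longrightarrow>
                     Lp_norm p (Tm m f1 f2) \<le> ennreal C * Aus \<Theta> u s m * Lp_norm p1 f1 * Lp_norm p2 f2)"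
  shows "s / real CARD('n) > max (2 / u) (1 / p - (1 - 1 / u))
       \<and> s / real CARD('n) \<ge> max (1/2 - (1 - 1 / p)) 0
                + (max (1/2 - 1 / p1) 0 + max (1/2 - 1 / p2) 0)"
proof -
  define n where "n = real CARD('n)"
  have pos: "p1 > 0" "p2 > 0" using p1 p2 by auto
  have "1 / p > 0" unfolding p using pos by (intro add_pos_pos) auto
  then have p0: "p > 0" by simp
  have H: "Hoermander_bound \<Theta> u s p p1 p2" unfolding Hoermander_bound_def by (rule bound)
  have 1: "2 / u < s / n"
    unfolding n_def by (rule Hoermander_bound_imp_s_gt_two_div_u[OF Theta Theta_supp s u p0 pos p H])
  have 2: "1 / p - (1 - 1 / u) < s / n"
    unfolding n_def by (rule Hoermander_bound_imp_s_gt_dual[OF Theta Theta_supp p0 pos u s H 1[unfolded n_def]])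
  \<comment> \<open>Each of the three coefficients is switched on exactly when its term is positive,
    so that \<open>c a * a = max a 0\<close> and one application of the family of inequalities
    yields the sum of the three maxima.\<close>
  define c where "c a = (if a > 0 then 1 else 0 :: real)" for a :: real
  have c: "c a = 0 \<or> c a = 1" "c a * a = max a 0" for a by (auto simp: c_def max_def)
  have "c (1 / p - 1/2) * (1 / p - 1/2) + c (1/2 - 1 / p1) * (1/2 - 1 / p1) + c (1/2 - 1 / p2) * (1/2 - 1 / p2) \<le> s / n"
    unfolding n_def by (rule Hoermander_bound_imp_s_ge[OF Theta Theta_supp p0 pos u s H c(1) c(1) c(1)])
  then have "max (1 / p - 1/2) 0 + max (1/2 - 1 / p1) 0 + max (1/2 - 1 / p2) 0 \<le> s / n" unfolding c(2) .
  moreover have "1/2 - (1 - 1 / p) = 1 / p - 1/2" by simp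
  ultimately have 3: "max (1/2 - (1 - 1 / p)) 0 + (max (1/2 - 1 / p1) 0 + max (1/2 - 1 / p2) 0) \<le> s / n" by (simp only: add.assoc)
  show ?thesis using 1 2 3 unfolding n_def[symmetric] by simp
qed

end
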